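(* Let $F$ be an algebraically closed field of characteristic $0$, let $H$ be an associative algebra with $1$ over $F$, and let $A$ be a finite dimensional non-nilpotent associative algebra over $F$ with a generalized $H$-action. Suppose that the Jacobson radical $J:=J(A)$ is an $H$-submodule of $A$. Let $$A/J = B_1 \oplus \ldots \oplus B_q$$ (direct sum of $H$-invariant ideals), where the $B_i$ are $H$-simple algebras, and let $\varkappa \colon A/J \to A$ be any homomorphism of algebras (not necessarily $H$-linear) such that $\pi\varkappa = \mathrm{id}_{A/J}$, where $\pi \colon A \to A/J$ is the natural projection. Put $A^+:=A+F\cdot 1$ and let $d$ be the maximum of $$\dim\left( B_{i_1}\oplus B_{i_2} \oplus \ldots \oplus B_{i_r}\right)$$ over all $r \geqslant 1$ and all pairwise distinct indices $i_1,\ldots,i_r\in\{1,\ldots,q\}$ such that $$(H\varkappa(B_{i_1}))\,A^+ \,(H\varkappa(B_{i_2}))\, A^+ \ldots (H\varkappa(B_{i_{r-1}}))\, A^+\,(H\varkappa(B_{i_r}))\ne 0.$$ Then there exist constants $C_1, C_2 > 0$, $r_1, r_2 \in \mathbb R$ such that $$C_1 n^{r_1} d^n \leqslant c^{H}_n(A) \leqslant C_2 n^{r_2} d^n\quad\text{for all }n \in \mathbb N.$$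
   Context: Algebras are not assumed to have a unit unless stated; $\mathbb N=\{1,2,3,\ldots\}$. Generalized $H$-action: an associative algebra $A$ over $F$ is an algebra with a generalized $H$-action if it is endowed with a (unital) algebra homomorphism $H \to \mathrm{End}_F(A)$ such that for every $h \in H$ there exist $k\in \mathbb N$ and $h'_i, h''_i, h'''_i, h''''_i \in H$, $1\leqslant i \leqslant k$, with $h(ab)=\sum_{i=1}^k\bigl((h'_i a)(h''_i b) + (h'''_i b)(h''''_i a)\bigr)$ for all $a,b \in A$. If $J$ is an $H$-invariant ideal, $A/J$ carries the induced generalized $H$-action. An algebra $B$ with a generalized $H$-action is $H$-simple if $B^2\neq 0$ and $B$ has no $H$-invariant two-sided ideals other than $0$ and $B$. $H$-polynomials: choose a basis $(\gamma_\beta)_{\beta \in \Lambda}$ of $H$ and let $F \langle X | H \rangle$ be the free associative algebra over $F$ with free generators $x_i^{\gamma_\beta}$, $\beta \in \Lambda$, $i \in \mathbb N$. For $h= \sum_{\beta} \alpha_\beta \gamma_\beta$ (finite sum, $\alpha_\beta\in F$) put $x_i^h := \sum_{\beta} \alpha_\beta x_i^{\gamma_\beta}$, and $x_i:=x_i^1$, $X=\{x_1,x_2,\ldots\}$. Any map $\psi\colon X\to A$ extends uniquely to an algebra homomorphism $\bar\psi\colon F\langle X|H\rangle\to A$ with $\bar\psi(x_i^h)=h\psi(x_i)$. An element $f\in F\langle X|H\rangle$ is an $H$-identity of $A$ if $\bar\psi(f)=0$ for all $\psi$; $\mathrm{Id}^H(A)$ is the set of all $H$-identities of $A$. Let $P^H_n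 = \langle x^{h_1}_{\sigma(1)} x^{h_2}_{\sigma(2)}\ldots x^{h_n}_{\sigma(n)} \mid h_i \in H, \sigma\in S_n \rangle_F$ and $c^H_n(A):=\dim\left(P^H_n/(P^H_n \cap \mathrm{Id}^H(A))\right)$ (the $n$th $H$-codimension). These do not depend on the choice of the basis of $H$. Notation: for a subspace $V\subseteq A$, $HV$ is the $F$-linear span of all $hv$, $h\in H$, $v\in V$; products of subspaces are $F$-linear spans of products of elements. $A^+=A+F\cdot 1$ is $A$ with a unit adjoined. *)

theory Defs
  imports Complex_Main "HOL-Library.Poly_Mapping" "HOL-Computational_Algebra.Polynomial"
    "HOL-Combinatorics.Permutations"
begin

section \<open>The Jacobson radical and the quotient by it\<close>

definition left_ideal :: "'a::ring set \<Rightarrow> bool" where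
  "left_ideal L \<longleftrightarrow>
     0 \<in> L \<and> (\<forall>x\<in>L. \<forall>y\<in>L. x - y \<in> L) \<and> (\<forall>a. \<forall>x\<in>L. a * x \<in> L)"

definition modular_maximal_left_ideal :: "'a::ring set \<Rightarrow> bool" where
  "modular_maximal_left_ideal L \<longleftrightarrow>
     left_ideal L \<and> L \<noteq> UNIV
     \<and> (\<forall>M. left_ideal M \<and> L \<subseteq> M \<longrightarrow> M = L \<or> M = UNIV)
     \<and> (\<exists>e. \<forall>x. x - x * e \<in> L)"

text \<open>
  The Jacobson radical of a ring that need not have a unit. It is the whole ring if there are no
  modular maximal left ideals. For an algebra over a field, requiring the left ideals to be
  subspaces would change nothing: modular maximal left ideals are automatically subspaces.
\<close>

definition jacobson_radical :: "'a::ring set" where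
  "jacobson_radical = \<Inter> {L. modular_maximal_left_ideal L}"

lemma left_ideal_0: "left_ideal L \<Longrightarrow> 0 \<in> L"
  and left_ideal_diff: "left_ideal L \<Longrightarrow> x \<in> L \<Longrightarrow> y \<in> L \<Longrightarrow> x - y \<in> L"
  and left_ideal_mult: "left_ideal L \<Longrightarrow> x \<in> L \<Longrightarrow> a * x \<in> L"
  by (auto simp: left_ideal_def)

lemma left_ideal_uminus: "left_ideal L \<Longrightarrow> x \<in> L \<Longrightarrow> - x \<in> L"
  using left_ideal_diff[of L 0 x] left_ideal_0[of L] by simp

lemma left_ideal_add: "left_ideal L \<Longrightarrow> x \<in> L \<Longrightarrow> y \<in> L \<Longrightarrow> x + y \<in> L"
  using left_ideal_diff[of L x "- y"] left_ideal_uminus[of L y] by simp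

lemma left_ideal_jacobson_radical: "left_ideal (jacobson_radical :: 'a::ring set)"
proof -
  have "left_ideal L" if "modular_maximal_left_ideal L" for L :: "'a set"
    using that by (simp add: modular_maximal_left_ideal_def)
  then show ?thesis
    unfolding left_ideal_def[of "jacobson_radical :: 'a set"] unfolding jacobson_radical_def
    by (auto intro: left_ideal_0 left_ideal_diff left_ideal_mult)
qed

lemma modular_maximal_left_ideal_colon:
  assumes L: "modular_maximal_left_ideal L" and r: "\<not> (\<forall>y. y * r \<in> L)"
  shows "modular_maximal_left_ideal {y. y * r \<in> L}"
proof -
  have li: "left_ideal L"
    and max: "\<And>M. left_ideal M \<Longrightarrow> L \<subseteq> M \<Longrightarrow> M = L \<or> M = UNIV"
    using L by (auto simp: modular_maximal_left_ideal_def)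
  have gen: "{m * r + l | m l. m \<in> M \<and> l \<in> L} = UNIV"
    if M: "left_ideal M" and m: "m \<in> M" "m * r \<notin> L" for M m
  proof -
    let ?N = "{m * r + l | m l. m \<in> M \<and> l \<in> L}"
    have "left_ideal ?N"
      unfolding left_ideal_def
    proof (intro conjI ballI allI)
      show "0 \<in> ?N"
        using left_ideal_0[OF M] left_ideal_0[OF li] by force
    next
      fix x y assume "x \<in> ?N" "y \<in> ?N"
      then obtain m l m' l' where "x = m * r + l" "y = m' * r + l'"
        "m \<in> M" "m' \<in> M" "l \<in> L" "l' \<in> L" by blast
      then have "x - y = (m - m') * r + (l - l')" "m - m' \<in> M" "l - l' \<in> L"
        using left_ideal_diff[OF M] left_ideal_diff[OF li] by (auto simp: algebra_simps)
      then show "x - y \<in> ?N" by blast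
    next
      fix a x assume "x \<in> ?N"
      then obtain m l where "x = m * r + l" "m \<in> M" "l \<in> L" by blast
      then have "a * x = (a * m) * r + a * l" "a * m \<in> M" "a * l \<in> L"
        using left_ideal_mult[OF M] left_ideal_mult[OF li] by (auto simp: algebra_simps)
      then show "a * x \<in> ?N" by blast
    qed
    moreover have "L \<subseteq> ?N"
      using left_ideal_0[OF M] by force
    moreover have "m * r \<in> ?N"
      using m left_ideal_0[OF li] by force
    ultimately show ?thesis
      using max m(2) by blast
  qed
  let ?K = "{y. y * r \<in> L}"
  have "left_ideal ?K"
    unfolding left_ideal_def
    using left_ideal_0[OF li] left_ideal_diff[OF li] left_ideal_mult[OF li]
    by (auto simp: algebra_simps)
  moreover have "?K \<noteq> UNIV"
    using r by auto
  moreover have "M = ?K \<or> M = UNIV" if M: "left_ideal M" "?K \<subseteq> M" for M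
  proof (cases "M \<subseteq> ?K")
    case False
    then obtain m where m: "m \<in> M" "m * r \<notin> L" by blast
    have "y \<in> M" for y
    proof -
      obtain m' l where y: "y * r = m' * r + l" "m' \<in> M" "l \<in> L"
        using gen[OF M(1) m] by (blast dest: equalityD2)
      then have "(y - m') * r \<in> L" by (simp add: algebra_simps)
      then have "(y - m') + m' \<in> M"
        using M y left_ideal_add[OF M(1)] by blast
      then show "y \<in> M" by simp
    qed
    then show ?thesis by auto
  qed (use M in auto)
  moreover have "\<exists>e. \<forall>x. x - x * e \<in> ?K"
  proof -
    have "left_ideal UNIV" by (simp add: left_ideal_def)
    then obtain e l where el: "r = e * r + l" "l \<in> L"
      using gen[of UNIV] r by blast
    then have "r - e * r \<in> L" by (metis add_diff_cancel_left')
    then have "x * (r - e * r) \<in> L" for x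
      using left_ideal_mult[OF li] by blast
    then show ?thesis
      by (auto simp: algebra_simps intro!: exI[of _ e])
  qed
  ultimately show ?thesis
    unfolding modular_maximal_left_ideal_def by blast
qed

lemma jacobson_radical_right:
  assumes "x \<in> jacobson_radical"
  shows "x * r \<in> jacobson_radical"
  unfolding jacobson_radical_def
proof (rule InterI, clarify)
  fix L :: "'a set" assume L: "modular_maximal_left_ideal L"
  show "x * r \<in> L"
    using modular_maximal_left_ideal_colon[OF L, of r] assms
    unfolding jacobson_radical_def by blast
qed

definition jrad_rel :: "'a::ring \<Rightarrow> 'a \<Rightarrow> bool" where
  "jrad_rel x y \<longleftrightarrow> x - y \<in> jacobson_radical"

lemma equivp_jrad_rel: "equivp (jrad_rel :: 'a::ring \<Rightarrow> _)"
proof (rule equivpI)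
  note J = left_ideal_jacobson_radical
  show "reflp (jrad_rel :: 'a \<Rightarrow> _)"
    by (auto simp: reflp_def jrad_rel_def left_ideal_0[OF J])
  show "symp (jrad_rel :: 'a \<Rightarrow> _)"
  proof (rule sympI)
    fix x y :: 'a
    assume "jrad_rel x y"
    then have "- (x - y) \<in> jacobson_radical"
      unfolding jrad_rel_def by (rule left_ideal_uminus[OF J])
    then show "jrad_rel y x" by (simp add: jrad_rel_def)
  qed
  show "transp (jrad_rel :: 'a \<Rightarrow> _)"
  proof (rule transpI)
    fix x y z :: 'a
    assume "jrad_rel x y" "jrad_rel y z"
    then have "(x - y) + (y - z) \<in> jacobson_radical"
      unfolding jrad_rel_def by (rule left_ideal_add[OF J])
    then show "jrad_rel x z" by (simp add: jrad_rel_def)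
  qed
qed

text \<open>The ring \<open>A/J(A)\<close>, where \<open>A\<close> is the type \<^typ>\<open>'a\<close>.\<close>

quotient_type (overloaded) 'a mod_jrad = "'a::ring" / jrad_rel
  by (rule equivp_jrad_rel)

text \<open>The natural projection from \<open>A\<close> onto \<open>A/J(A)\<close>.\<close>

abbreviation jrad_proj :: "'a::ring \<Rightarrow> 'a mod_jrad" where
  "jrad_proj \<equiv> abs_mod_jrad"

instantiation mod_jrad :: (ring) ring
begin

lift_definition zero_mod_jrad :: "'a mod_jrad" is 0 .

lift_definition plus_mod_jrad :: "'a mod_jrad \<Rightarrow> 'a mod_jrad \<Rightarrow> 'a mod_jrad" is "(+)"
proof -
  fix x x' y y' :: 'a
  assume "jrad_rel x x'" "jrad_rel y y'"
  then have "(x - x') + (y - y') \<in> jacobson_radical"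
    unfolding jrad_rel_def by (rule left_ideal_add[OF left_ideal_jacobson_radical])
  then show "jrad_rel (x + y) (x' + y')" by (simp add: jrad_rel_def algebra_simps)
qed

lift_definition minus_mod_jrad :: "'a mod_jrad \<Rightarrow> 'a mod_jrad \<Rightarrow> 'a mod_jrad" is "(-)"
proof -
  fix x x' y y' :: 'a
  assume "jrad_rel x x'" "jrad_rel y y'"
  then have "(x - x') - (y - y') \<in> jacobson_radical"
    unfolding jrad_rel_def by (rule left_ideal_diff[OF left_ideal_jacobson_radical])
  then show "jrad_rel (x - y) (x' - y')" by (simp add: jrad_rel_def algebra_simps)
qed

lift_definition uminus_mod_jrad :: "'a mod_jrad \<Rightarrow> 'a mod_jrad" is uminus
proof -
  fix x x' :: 'a
  assume "jrad_rel x x'"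
  then have "- (x - x') \<in> jacobson_radical"
    unfolding jrad_rel_def by (rule left_ideal_uminus[OF left_ideal_jacobson_radical])
  then show "jrad_rel (- x) (- x')" by (simp only: jrad_rel_def minus_diff_minus)
qed

lift_definition times_mod_jrad :: "'a mod_jrad \<Rightarrow> 'a mod_jrad \<Rightarrow> 'a mod_jrad" is "(*)"
proof -
  fix x x' y y' :: 'a
  assume "jrad_rel x x'" "jrad_rel y y'"
  then have "x - x' \<in> jacobson_radical" "y - y' \<in> jacobson_radical"
    by (simp_all only: jrad_rel_def)
  then have "(x - x') * y \<in> jacobson_radical" "x' * (y - y') \<in> jacobson_radical"
    by (simp_all only: jacobson_radical_right left_ideal_mult[OF left_ideal_jacobson_radical])
  then have "(x - x') * y + x' * (y - y') \<in> jacobson_radical"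
    by (rule left_ideal_add[OF left_ideal_jacobson_radical])
  then show "jrad_rel (x * y) (x' * y')" by (simp add: jrad_rel_def algebra_simps)
qed

instance
proof
  fix a b c :: "'a mod_jrad"
  note r = equivp_reflp[OF equivp_jrad_rel]
  show "a * b * c = a * (b * c)" by transfer (simp add: mult.assoc r)
  show "a + b + c = a + (b + c)" by transfer (simp add: add.assoc r)
  show "a + b = b + a" by transfer (simp add: add.commute r)
  show "0 + a = a" by transfer (simp add: r)
  show "- a + a = 0" by transfer (simp add: r)
  show "a - b = a + - b" by transfer (simp add: r)
  show "(a + b) * c = a * c + b * c" by transfer (simp add: distrib_right r)
  show "a * (b + c) = a * b + a * c" by transfer (simp add: distrib_left r)
qed

end

text \<open>
  The maps induced on \<open>A/J\<close> by scalar multiplication and by the operators of \<open>H\<close>, computed on a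
  representative. The choice is irrelevant as soon as \<open>J\<close> is stable under these maps; for scalars
  this always holds.
\<close>

definition mod_jrad_scale :: "('f \<Rightarrow> 'a::ring \<Rightarrow> 'a) \<Rightarrow> 'f \<Rightarrow> 'a mod_jrad \<Rightarrow> 'a mod_jrad" where
  "mod_jrad_scale sA c x = jrad_proj (sA c (rep_mod_jrad x))"

definition mod_jrad_act :: "('h \<Rightarrow> 'a::ring \<Rightarrow> 'a) \<Rightarrow> 'h \<Rightarrow> 'a mod_jrad \<Rightarrow> 'a mod_jrad" where
  "mod_jrad_act act h x = jrad_proj (act h (rep_mod_jrad x))"


section \<open>Algebras with a generalized $H$-action\<close>

locale assoc_algebra = vector_space scale
  for scale :: "'f::field \<Rightarrow> 'a::ring \<Rightarrow> 'a" +
  assumes scale_mult_left: "scale c x * y = scale c (x * y)"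
    and scale_mult_right: "x * scale c y = scale c (x * y)"

locale generalized_H_action =
  A: assoc_algebra sA + H: assoc_algebra sH
  for sA :: "'f::field \<Rightarrow> 'a::ring \<Rightarrow> 'a"
    and sH :: "'f \<Rightarrow> 'h::ring_1 \<Rightarrow> 'h" +
  fixes act :: "'h \<Rightarrow> 'a \<Rightarrow> 'a"
  assumes act_add_right: "act h (a + b) = act h a + act h b"
    and act_scale_right: "act h (sA c a) = sA c (act h a)"
    and act_add_left: "act (h + h') a = act h a + act h' a"
    and act_scale_left: "act (sH c h) a = sA c (act h a)"
    and act_mult: "act (h * h') a = act h (act h' a)"
    and act_one: "act 1 a = a"
    and act_product: "\<exists>k\<ge>1. \<exists>h1 h2 h3 h4 :: nat \<Rightarrow> 'h. \<forall>a b.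
      act h (a * b) = (\<Sum>i=1..k. act (h1 i) a * act (h2 i) b + act (h3 i) b * act (h4 i) a)"

definition H_invariant_ideal ::
  "('f::field \<Rightarrow> 'b::ring \<Rightarrow> 'b) \<Rightarrow> ('h \<Rightarrow> 'b \<Rightarrow> 'b) \<Rightarrow> 'b set \<Rightarrow> 'b set \<Rightarrow> bool" where
  "H_invariant_ideal s act B I \<longleftrightarrow>
     I \<subseteq> B \<and> module.subspace s I
     \<and> (\<forall>x\<in>I. \<forall>b\<in>B. b * x \<in> I \<and> x * b \<in> I)
     \<and> (\<forall>h. \<forall>x\<in>I. act h x \<in> I)"

definition H_simple ::
  "('f::field \<Rightarrow> 'b::ring \<Rightarrow> 'b) \<Rightarrow> ('h \<Rightarrow> 'b \<Rightarrow> 'b) \<Rightarrow> 'b set \<Rightarrow> bool" where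
  "H_simple s act B \<longleftrightarrow>
     (\<exists>x\<in>B. \<exists>y\<in>B. x * y \<noteq> 0) \<and> (\<forall>I. H_invariant_ideal s act B I \<longrightarrow> I = {0} \<or> I = B)"

definition direct_sum :: "'i set \<Rightarrow> ('i \<Rightarrow> 'b::comm_monoid_add set) \<Rightarrow> bool" where
  "direct_sum S B \<longleftrightarrow> (\<forall>x. \<exists>!b. b \<in> (\<Pi>\<^sub>E i\<in>S. B i) \<and> x = (\<Sum>i\<in>S. b i))"

definition algebra_hom ::
  "('f \<Rightarrow> 'b::ring \<Rightarrow> 'b) \<Rightarrow> ('f \<Rightarrow> 'a::ring \<Rightarrow> 'a) \<Rightarrow> ('b \<Rightarrow> 'a) \<Rightarrow> bool" where
  "algebra_hom s1 s2 f \<longleftrightarrow>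
     (\<forall>x y. f (x + y) = f x + f y) \<and> (\<forall>x y. f (x * y) = f x * f y)
     \<and> (\<forall>c x. f (s1 c x) = s2 c (f x))"

text \<open>Products of nonempty lists; there is no unit to serve as the empty product.\<close>

fun nonempty_prod :: "'a::semigroup_mult list \<Rightarrow> 'a" where
  "nonempty_prod [x] = x"
| "nonempty_prod (x # y # xs) = x * nonempty_prod (y # xs)"

definition nilpotent_ring :: "'a::ring itself \<Rightarrow> bool" where
  "nilpotent_ring _ \<longleftrightarrow> (\<exists>n\<ge>1. \<forall>xs::'a list. length xs = n \<longrightarrow> nonempty_prod xs = 0)"

definition H_span ::
  "('f::field \<Rightarrow> 'a::ring \<Rightarrow> 'a) \<Rightarrow> ('h \<Rightarrow> 'a \<Rightarrow> 'a) \<Rightarrow> 'a set \<Rightarrow> 'a set" where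
  "H_span sA act V = module.span sA {act h v | h v. v \<in> V}"

definition subspace_prod ::
  "('f::field \<Rightarrow> 'a::ring \<Rightarrow> 'a) \<Rightarrow> 'a set \<Rightarrow> 'a set \<Rightarrow> 'a set" where
  "subspace_prod sA V W = module.span sA {v * w | v w. v \<in> V \<and> w \<in> W}"

text \<open>
  The subspace \<open>V A\<^sup>+\<close> of \<open>A\<close>: a general element of \<open>A\<^sup>+\<close> is \<open>a + c1\<close>, and \<open>v (a + c1) = va + cv\<close>.
\<close>

definition prod_unitization ::
  "('f::field \<Rightarrow> 'a::ring \<Rightarrow> 'a) \<Rightarrow> 'a set \<Rightarrow> 'a set" where
  "prod_unitization sA V = module.span sA {v * a + sA c v | v a c. v \<in> V}"

text \<open>\<open>V\<^sub>1 A\<^sup>+ V\<^sub>2 A\<^sup>+ \<dots> A\<^sup>+ V\<^sub>r\<close>\<close>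

fun unitization_chain ::
  "('f::field \<Rightarrow> 'a::ring \<Rightarrow> 'a) \<Rightarrow> 'a set list \<Rightarrow> 'a set" where
  "unitization_chain sA [V] = V"
| "unitization_chain sA (V # W # Vs) =
     subspace_prod sA (prod_unitization sA V) (unitization_chain sA (W # Vs))"


section \<open>$H$-polynomials and $H$-codimensions\<close>

datatype 'a free_word = Word (letters: "'a list")

instantiation free_word :: (type) monoid_add
begin

definition zero_free_word :: "'a free_word" where
  "0 = Word []"

definition plus_free_word :: "'a free_word \<Rightarrow> 'a free_word \<Rightarrow> 'a free_word" where
  "u + v = Word (letters u @ letters v)"

instance
  by standard (auto simp: zero_free_word_def plus_free_word_def)

end

text \<open>
  By the library's convolution product, this type is the free associative algebra with unit on
  symbols \<open>(i, \<gamma>)\<close>, standing for \<open>x\<^sub>i\<^sup>\<gamma>\<close>.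
\<close>

type_synonym ('h, 'f) hpoly = "(nat \<times> 'h) free_word \<Rightarrow>\<^sub>0 'f"

definition hpoly_scale :: "'f::field \<Rightarrow> ('h, 'f) hpoly \<Rightarrow> ('h, 'f) hpoly" where
  "hpoly_scale c f = Poly_Mapping.map ((*) c) f"

text \<open>
  The algebra \<open>F\<langle>X|H\<rangle>\<close> without unit, built from a basis \<open>\<Gamma>\<close> of \<open>H\<close>.
\<close>

definition hpolys :: "'h set \<Rightarrow> ('h, 'f::field) hpoly set" where
  "hpolys \<Gamma> = {f. \<forall>w \<in> Poly_Mapping.keys f. w \<noteq> 0 \<and> set (letters w) \<subseteq> {1..} \<times> \<Gamma>}"

text \<open>The element \<open>x\<^sub>i\<^sup>h\<close> for arbitrary \<open>h\<close>, through the coordinates of \<open>h\<close> in the basis.\<close>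

definition hvar ::
  "('f::field \<Rightarrow> 'h::ring_1 \<Rightarrow> 'h) \<Rightarrow> 'h set \<Rightarrow> nat \<Rightarrow> 'h \<Rightarrow> ('h, 'f) hpoly" where
  "hvar sH \<Gamma> i h =
     (\<Sum>\<gamma> | module.representation sH \<Gamma> h \<gamma> \<noteq> 0.
        hpoly_scale (module.representation sH \<Gamma> h \<gamma>) (Poly_Mapping.single (Word [(i, \<gamma>)]) 1))"

text \<open>The value of an element of \<open>F\<langle>X|H\<rangle>\<close> under the homomorphism extending \<open>\<psi>\<close>.\<close>

definition hpoly_eval ::
  "('f::field \<Rightarrow> 'a::ring \<Rightarrow> 'a) \<Rightarrow> ('h \<Rightarrow> 'a \<Rightarrow> 'a) \<Rightarrow> (nat \<Rightarrow> 'a) \<Rightarrow> ('h, 'f) hpoly \<Rightarrow> 'a" where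
  "hpoly_eval sA act \<psi> f =
     (\<Sum>w \<in> Poly_Mapping.keys f.
        sA (Poly_Mapping.lookup f w)
          (nonempty_prod (map (\<lambda>(i, \<gamma>). act \<gamma> (\<psi> i)) (letters w))))"

definition H_identities ::
  "('f::field \<Rightarrow> 'a::ring \<Rightarrow> 'a) \<Rightarrow> ('h \<Rightarrow> 'a \<Rightarrow> 'a) \<Rightarrow> 'h set \<Rightarrow> ('h, 'f) hpoly set" where
  "H_identities sA act \<Gamma> = {f \<in> hpolys \<Gamma>. \<forall>\<psi>. hpoly_eval sA act \<psi> f = 0}"

definition multilinear_hpolys ::
  "('f::field \<Rightarrow> 'h::ring_1 \<Rightarrow> 'h) \<Rightarrow> 'h set \<Rightarrow> nat \<Rightarrow> ('h, 'f) hpoly set" where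
  "multilinear_hpolys sH \<Gamma> n =
     module.span hpoly_scale
       {prod_list (map (\<lambda>j. hvar sH \<Gamma> (\<sigma> j) (h j)) [1..<n+1]) | \<sigma> h. \<sigma> permutes {1..n}}"

text \<open>
  \<open>S\<close> is a set of representatives of a basis of the quotient space \<open>V/W\<close>, for subspaces
  \<open>W \<subseteq> V\<close>.
\<close>

definition quotient_basis ::
  "('f::field \<Rightarrow> 'v::ab_group_add \<Rightarrow> 'v) \<Rightarrow> 'v set \<Rightarrow> 'v set \<Rightarrow> 'v set \<Rightarrow> bool" where
  "quotient_basis s V W S \<longleftrightarrow>
     S \<subseteq> V
     \<and> (\<forall>T c. finite T \<and> T \<subseteq> S \<and> (\<Sum>v\<in>T. s (c v) v) \<in> W \<longrightarrow> (\<forall>v\<in>T. c v = 0))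
     \<and> (\<forall>v\<in>V. \<exists>T c. finite T \<and> T \<subseteq> S \<and> v - (\<Sum>u\<in>T. s (c u) u) \<in> W)"

text \<open>As for \<^const>\<open>vector_space.dim\<close>, the value is 0 if the dimension is infinite.\<close>

definition quotient_dim ::
  "('f::field \<Rightarrow> 'v::ab_group_add \<Rightarrow> 'v) \<Rightarrow> 'v set \<Rightarrow> 'v set \<Rightarrow> nat" where
  "quotient_dim s V W = card (SOME S. quotient_basis s V W S)"

definition H_codim ::
  "('f::field \<Rightarrow> 'a::ring \<Rightarrow> 'a) \<Rightarrow> ('f \<Rightarrow> 'h::ring_1 \<Rightarrow> 'h) \<Rightarrow> ('h \<Rightarrow> 'a \<Rightarrow> 'a) \<Rightarrow> 'h set \<Rightarrow> nat \<Rightarrow> nat"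
where
  "H_codim sA sH act \<Gamma> n =
     quotient_dim hpoly_scale (multilinear_hpolys sH \<Gamma> n)
       (multilinear_hpolys sH \<Gamma> n \<inter> H_identities sA act \<Gamma>)"

end

theory Submission
  imports Defs "HOL-Library.Function_Algebras" "HOL-Library.Multiset" "Jordan_Normal_Form.Determinant"
begin

text \<open>
  Modulo \<open>H\<close>-identities, multilinear \<open>H\<close>-polynomials are multilinear functions on \<open>A\<close>, hence they are
  determined by their values on tuples of elements of a basis adapted to \<open>J\<close> and the \<open>\<kappa>(B\<^sub>i)\<close>. A
  monomial can be nonzero on such a tuple only if boundedly many entries lie in \<open>J\<close> and the blocks of
  the others form a nonzero chain. There are at most \<open>C n\<^sup>p d\<^sup>n\<close> such tuples, which gives the upper
  bound.

  For the lower bound, density in an \<open>H\<close>-simple block \<open>B\<^sub>i\<close> of dimension \<open>m\<close> provides multilinear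
  functions whose values are multiples of a fixed element by products of determinants of the trace
  form, each on two columns of \<open>m\<close> variables. Take a nonzero product with a factor in every
  \<open>H\<kappa>(B\<^sub>i)\<close> of an optimal chain in which the number of radical factors is maximal, and replace one
  factor of each block by such a function. By maximality, the errors caused by \<open>\<kappa>\<close> not being
  \<open>H\<close>-linear vanish, so the product of the determinants survives. Distribute the variables to the
  columns according to ballot words in \<open>d\<close> letters, each occurring \<open>2s\<close> times. The resulting functions
  are triangular with respect to the evaluations at the words of basis elements, so they are linearly
  independent. The number of ballot words is \<open>d\<^sup>n\<close> up to a polynomial factor.
\<close>

section \<open>Products and powers\<close>

text \<open>The obstacle is that \<open>\<kappa>\<close> need not be \<open>H\<close>-linear. A
  function built over A/J lifts to A, but on values of \<open>\<kappa>\<close> the lift is right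
  only up to terms with an additional radical factor. Maximality of the number of radical factors
  kills such a term only if it still contains a factor from every block. Therefore each inserted
  function carries at least \<open>nil_index\<close> constants from its \<open>W i\<close>; they
  cannot all turn into radical factors of a nonzero product. The number of these constants must not
  grow with the degree. Hence arbitrarily many columns are not produced by multiplying many
  functions, but by letting derivations, which replace x by uvx, act on one fixed alternating
  function: each application yields a trace and leaves the constants alone. The trace form also
  vanishes on foreign blocks, so the determinants tell the blocks apart. In the codimension the
  constants count as \<open>N\<close> additional variables with values in a basis, which costs a
  factor \<open>card E ^ N\<close>. Ballot words encode the standard tableaux with \<open>d\<close>
  equal rows.\<close>

lemma nonempty_prod_Cons: "xs \<noteq> [] \<Longrightarrow> nonempty_prod (x # xs) = x * nonempty_prod xs"
  by (cases xs) auto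

lemma nonempty_prod_append:
  "xs \<noteq> [] \<Longrightarrow> ys \<noteq> [] \<Longrightarrow> nonempty_prod (xs @ ys) = nonempty_prod xs * nonempty_prod ys"
proof (induction xs)
  case (Cons x xs)
  then show ?case
    by (cases "xs = []") (auto simp: nonempty_prod_Cons mult.assoc)
qed simp

lemma nonempty_prod_concat:
  "xss \<noteq> [] \<Longrightarrow> \<forall>xs\<in>set xss. xs \<noteq> [] \<Longrightarrow>
     nonempty_prod (concat xss) = nonempty_prod (map nonempty_prod xss)"
proof (induction xss)
  case (Cons xs xss)
  show ?case
  proof (cases "xss = []")
    case False
    then have "concat xss \<noteq> []"
      using Cons.prems by (cases xss) auto
    then show ?thesis
      using Cons False by (simp add: nonempty_prod_append nonempty_prod_Cons)
  qed simp
qed simp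

lemma nonempty_prod_0:
  fixes xs :: "'a::ring list"
  shows "0 \<in> set xs \<Longrightarrow> nonempty_prod xs = 0"
proof (induction xs)
  case (Cons x xs)
  then show ?case
    by (cases "xs = []") (auto simp: nonempty_prod_Cons)
qed simp

text \<open>\<open>pw x n\<close> is \<open>x\<^sup>n\<^sup>+\<^sup>1\<close>, since there need not be a unit.\<close>

fun pw :: "'a::semigroup_mult \<Rightarrow> nat \<Rightarrow> 'a" where
  "pw x 0 = x"
| "pw x (Suc n) = x * pw x n"

lemma pw_mult: "pw x m * pw x n = pw x (Suc (m + n))"
  by (induction m) (auto simp: mult.assoc)

section \<open>The Jacobson radical of a finite-dimensional algebra\<close>

lemma jacobson_radical_left: "x \<in> jacobson_radical \<Longrightarrow> a * x \<in> jacobson_radical"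
  by (rule left_ideal_mult[OF left_ideal_jacobson_radical])

lemma jacobson_radical_add:
  "x \<in> jacobson_radical \<Longrightarrow> y \<in> jacobson_radical \<Longrightarrow> x + y \<in> jacobson_radical"
  by (rule left_ideal_add[OF left_ideal_jacobson_radical])

lemma jacobson_radical_0: "0 \<in> jacobson_radical"
  by (rule left_ideal_0[OF left_ideal_jacobson_radical])

text \<open>Modulo a modular maximal left ideal \<open>L\<close> not containing \<open>I\<close>, the right unit is represented by
  some \<open>i \<in> I\<close>, and then so is every power of \<open>i\<close>.\<close>

lemma nil_left_ideal_subset_jacobson_radical:
  fixes I :: "'a::ring set"
  assumes I: "left_ideal I" and nil: "\<And>x. x \<in> I \<Longrightarrow> \<exists>n. pw x n \<in> jacobson_radical"
  shows "I \<subseteq> jacobson_radical"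
  unfolding jacobson_radical_def
proof (rule Inter_greatest, clarify)
  fix L :: "'a set" and x assume L: "modular_maximal_left_ideal L" and x: "x \<in> I"
  then have li: "left_ideal L" and "L \<noteq> UNIV"
    and max: "\<And>M. left_ideal M \<Longrightarrow> L \<subseteq> M \<Longrightarrow> M = L \<or> M = UNIV"
    by (auto simp: modular_maximal_left_ideal_def)
  obtain e where e: "\<And>x. x - x * e \<in> L"
    using L by (auto simp: modular_maximal_left_ideal_def)
  let ?M = "{l + i | l i. l \<in> L \<and> i \<in> I}"
  have M: "left_ideal ?M"
    unfolding left_ideal_def
  proof (intro conjI ballI allI)
    show "0 \<in> ?M"
      using left_ideal_0[OF I] left_ideal_0[OF li] by force
  next
    fix x y assume "x \<in> ?M" "y \<in> ?M"
    then obtain l i l' i' where "x = l + i" "y = l' + i'" "l \<in> L" "l' \<in> L" "i \<in> I" "i' \<in> I"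
      by blast
    then have "x - y = (l - l') + (i - i')" "l - l' \<in> L" "i - i' \<in> I"
      using left_ideal_diff[OF I] left_ideal_diff[OF li] by auto
    then show "x - y \<in> ?M" by blast
  next
    fix a x assume "x \<in> ?M"
    then obtain l i where "x = l + i" "l \<in> L" "i \<in> I" by blast
    then have "a * x = a * l + a * i" "a * l \<in> L" "a * i \<in> I"
      using left_ideal_mult[OF I] left_ideal_mult[OF li] by (auto simp: algebra_simps)
    then show "a * x \<in> ?M" by blast
  qed
  have sub: "L \<subseteq> ?M" "I \<subseteq> ?M"
    using left_ideal_0[OF I] left_ideal_0[OF li] by force+
  show "x \<in> L"
  proof (cases "?M = L")
    case True
    then show ?thesis using sub x by blast
  next
    case False
    then have "?M = UNIV" using max[OF M sub(1)] by blast
    then obtain l i where li': "e = l + i" "l \<in> L" "i \<in> I" by blast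
    have step: "y - y * i \<in> L" for y
    proof -
      have "y - y * i = (y - y * e) + y * l" using li' by (simp add: algebra_simps)
      moreover have "(y - y * e) + y * l \<in> L"
        by (rule left_ideal_add[OF li e left_ideal_mult[OF li li'(2)]])
      ultimately show ?thesis by (simp only:)
    qed
    have pw: "y - y * pw i n \<in> L" for y n
    proof (induction n arbitrary: y)
      case (Suc n)
      have "(y - y * i) + (y * i - y * i * pw i n) \<in> L"
        by (rule left_ideal_add[OF li step Suc])
      moreover have "(y - y * i) + (y * i - y * i * pw i n) = y - y * pw i (Suc n)"
        by (simp add: algebra_simps)
      ultimately show ?case by (simp only:)
    qed (simp add: step)
    obtain n where "pw i n \<in> jacobson_radical" using nil li' by blast
    then have "pw i n \<in> L" using L by (auto simp: jacobson_radical_def)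
    then have "y \<in> L" for y
      using left_ideal_add[OF li pw[of y n] left_ideal_mult[OF li, of "pw i n" y]] by simp
    then show ?thesis by blast
  qed
qed

text \<open>Left ideals are not subspaces by definition, and there is no unit through which scalars
  could act. But L + cL is a left ideal above a modular maximal \<open>L\<close>; if it were
  everything, a right unit e = l + c i modulo \<open>L\<close> would give y = (y - y e) + y l + (c
  y) i in \<open>L\<close> for every y.\<close>

lemma (in assoc_algebra) jacobson_radical_scale:
  assumes "x \<in> jacobson_radical"
  shows "scale c x \<in> jacobson_radical"
  unfolding jacobson_radical_def
proof (rule InterI, clarify)
  fix L :: "'a set" assume L: "modular_maximal_left_ideal L"
  then have li: "left_ideal L" and ne: "L \<noteq> UNIV"
    and max: "\<And>M. left_ideal M \<Longrightarrow> L \<subseteq> M \<Longrightarrow> M = L \<or> M = UNIV"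
    by (auto simp: modular_maximal_left_ideal_def)
  obtain e where e: "\<And>x. x - x * e \<in> L"
    using L by (auto simp: modular_maximal_left_ideal_def)
  have x: "x \<in> L" using assms L by (auto simp: jacobson_radical_def)
  let ?M = "{l + scale c i | l i. l \<in> L \<and> i \<in> L}"
  have M: "left_ideal ?M"
    unfolding left_ideal_def
  proof (intro conjI ballI allI)
    show "0 \<in> ?M"
      using left_ideal_0[OF li] by force
  next
    fix x y assume "x \<in> ?M" "y \<in> ?M"
    then obtain l i l' i' where "x = l + scale c i" "y = l' + scale c i'"
      "l \<in> L" "l' \<in> L" "i \<in> L" "i' \<in> L"
      by blast
    then have "x - y = (l - l') + scale c (i - i')" "l - l' \<in> L" "i - i' \<in> L"
      using left_ideal_diff[OF li] by (auto simp: algebra_simps)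
    then show "x - y \<in> ?M" by blast
  next
    fix a x assume "x \<in> ?M"
    then obtain l i where "x = l + scale c i" "l \<in> L" "i \<in> L" by blast
    then have "a * x = a * l + scale c (a * i)" "a * l \<in> L" "a * i \<in> L"
      using left_ideal_mult[OF li] by (auto simp: algebra_simps scale_mult_right)
    then show "a * x \<in> ?M" by blast
  qed
  have sub: "L \<subseteq> ?M"
    using left_ideal_0[OF li] by force
  have "?M \<noteq> UNIV"
  proof
    assume "?M = UNIV"
    then obtain l i where li': "e = l + scale c i" "l \<in> L" "i \<in> L" by blast
    have "y \<in> L" for y
    proof -
      have "y = (y - y * e) + (y * l + scale c y * i)"
        using li' by (simp add: algebra_simps scale_mult_left scale_mult_right)
      then show ?thesis
        using e[of y] left_ideal_mult[OF li li'(2)] left_ideal_mult[OF li li'(3)] left_ideal_add[OF li]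
        by metis
    qed
    then show False using ne by blast
  qed
  then have "?M = L" using max[OF M sub] by blast
  moreover have "scale c x \<in> ?M"
    using left_ideal_0[OF li] x by force
  ultimately show "scale c x \<in> L" by blast
qed

lemma (in assoc_algebra) subspace_jacobson_radical: "subspace jacobson_radical"
  by (auto simp: subspace_def jacobson_radical_scale jacobson_radical_add jacobson_radical_0)

section \<open>Nilpotency of the radical of a finite-dimensional algebra\<close>

locale fd_algebra = assoc_algebra scale for scale :: "'f::field \<Rightarrow> 'a::ring \<Rightarrow> 'a" +
  assumes fin_dim: "\<exists>S. finite S \<and> span S = UNIV"
begin

lemma fd_basis: obtains E where "finite E" "independent E" "span E = UNIV"
proof -
  obtain S where S: "finite S" "span S = UNIV" using fin_dim by blast
  obtain E where "E \<subseteq> S" "independent E" "S \<subseteq> span E"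
    using maximal_independent_subset[of S] by blast
  moreover then have "span E = UNIV" using S by (metis span_mono span_span top.extremum_uniqueI)
  ultimately show ?thesis using that S finite_subset by blast
qed

lemma fd_independent: "independent T \<Longrightarrow> finite T"
  by (metis fin_dim independent_span_bound top_greatest)

lemma fd_dim_mono:
  assumes "S \<subseteq> T" shows "dim S \<le> dim T"
proof -
  obtain E where "finite E" "independent E" "span E = UNIV" by (rule fd_basis)
  then interpret finite_dimensional_vector_space scale E by unfold_locales auto
  show ?thesis using assms by (rule dim_subset)
qed

lemma fd_dim_equal:
  assumes "subspace S" "subspace T" "S \<subseteq> T" "dim T \<le> dim S" shows "S = T"
proof -
  obtain E where "finite E" "independent E" "span E = UNIV" by (rule fd_basis)
  then interpret finite_dimensional_vector_space scale E by unfold_locales auto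
  show ?thesis using assms by (rule subspace_dim_equal)
qed

text \<open>The spans of the tails decrease, so one of least dimension coincides with the next. This
  provides a linear relation, solved for its lowest term, among the powers of an element and later
  among the iterates of an operator.\<close>

lemma exists_in_later_span:
  fixes f :: "nat \<Rightarrow> 'a"
  shows "\<exists>a. f a \<in> span {f n | n. n > a}"
proof -
  let ?S = "\<lambda>a. span {f n | n. n \<ge> a}"
  obtain a where a: "\<And>b. dim (?S a) \<le> dim (?S b)"
    using ex_has_least_nat[of "\<lambda>_. True" 0 "\<lambda>a. dim (?S a)"] by blast
  have "?S (Suc a) = ?S a"
  proof (rule fd_dim_equal)
    show "?S (Suc a) \<subseteq> ?S a" by (rule span_mono) auto
  qed (use a in auto)
  moreover have "f a \<in> ?S a" by (rule span_base) auto
  ultimately show ?thesis by (auto simp: Suc_le_eq)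
qed

text \<open>A relation that expresses \<open>pw x a\<close> by higher powers gives \<open>y\<close>
  in the span of the powers with \<open>pw x a * y = pw x a\<close>. Then \<open>y\<close> is a
  right unit for the span \<open>I a\<close> of all powers from \<open>pw x a\<close> on. Since
  \<open>pw y a\<close> itself lies in \<open>I a\<close>, multiplying it by powers of
  \<open>y\<close> does not change it, so it is idempotent.\<close>

lemma idempotent_of_non_nilpotent:
  assumes nn: "\<And>n. pw x n \<noteq> 0"
  obtains e where "e \<in> span (range (pw x))" "e * e = e" "e \<noteq> 0"
proof -
  define I where "I a = span {pw x n | n. n \<ge> a}" for a
  obtain a where a: "pw x a \<in> span {pw x n | n. n > a}"
    using exists_in_later_span[of "pw x"] by blast
  have "\<exists>y\<in>I 0. z = pw x a * y" if "z \<in> span {pw x n | n. n > a}" for z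
    using that
  proof (induction rule: span_induct_alt)
    case base
    show ?case by (rule bexI[of _ 0]) (auto simp: I_def span_zero)
  next
    case (step c u z)
    then obtain n y where n: "u = pw x n" "n > a" and y: "y \<in> I 0" "z = pw x a * y" by blast
    have "pw x n = pw x a * pw x (n - a - 1)"
      using n by (simp add: pw_mult)
    then have "scale c u + z = pw x a * (scale c (pw x (n - a - 1)) + y)"
      using n y by (simp add: scale_mult_right distrib_left)
    moreover have "pw x (n - a - 1) \<in> I 0" unfolding I_def by (rule span_base) auto
    then have "scale c (pw x (n - a - 1)) + y \<in> I 0"
      using y(1) unfolding I_def by (intro span_add span_scale)
    ultimately show ?case by blast
  qed
  from this[OF a] obtain y where y: "y \<in> I 0" "pw x a * y = pw x a" by auto
  have fix_y: "z * y = z" if "z \<in> I a" for z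
    using that unfolding I_def
  proof (induction rule: span_induct_alt)
    case (step c u z)
    then obtain n where n: "u = pw x n" "n \<ge> a" by blast
    have "pw x n * y = pw x n"
    proof (cases "n = a")
      case False
      then have "pw x n = pw x (n - a - 1) * pw x a" using n by (simp add: pw_mult)
      then show ?thesis using y by (simp add: mult.assoc)
    qed (use y in auto)
    then show ?case using step n by (simp add: distrib_right scale_mult_left)
  qed simp
  have I_mult: "u * v \<in> I (Suc (b + c))" if "u \<in> I b" "v \<in> I c" for u v b c
    using that(1) unfolding I_def
  proof (induction rule: span_induct_alt)
    case (step d w z)
    then obtain n where n: "w = pw x n" "n \<ge> b" by blast
    have "w * v \<in> span {pw x n | n. n \<ge> Suc (b + c)}"
      using that(2) unfolding I_def
    proof (induction rule: span_induct_alt)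
      case (step d' w' z')
      then obtain n' where n': "w' = pw x n'" "n' \<ge> c" by blast
      have "w * w' \<in> span {pw x n | n. n \<ge> Suc (b + c)}"
        using n n' by (intro span_base) (auto simp: pw_mult intro!: exI[of _ "Suc (n + n')"])
      then show ?case using step by (simp add: distrib_left scale_mult_right span_add span_scale)
    qed (simp add: span_zero)
    then show ?case using step by (simp add: distrib_right scale_mult_left span_add span_scale)
  qed (simp add: span_zero)
  have pwy: "pw y m \<in> I m" for m
    by (induction m) (use y I_mult[of y 0] in auto)
  have pw_fix: "z * pw y n = z" if "z \<in> I a" for z n
    by (induction n) (use fix_y[OF that] in \<open>auto simp: mult.assoc[symmetric]\<close>)
  have xa: "pw x a \<in> I a" unfolding I_def by (rule span_base) auto
  have "pw y a \<in> span (range (pw x))"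
    using pwy[of a] unfolding I_def by (rule set_rev_mp) (rule span_mono, auto)
  moreover have "pw y a * pw y a = pw y a" using pw_fix pwy by blast
  moreover have "pw y a \<noteq> 0" using pw_fix[OF xa, of a] nn[of a] by auto
  ultimately show ?thesis by (rule that)
qed

text \<open>A non-nilpotent \<open>x\<close> would produce an idempotent \<open>e\<close> in the
  radical. By Zorn's lemma some left ideal \<open>M\<close> is maximal among those that contain all
  z with z e = 0 but not \<open>e\<close>. It is modular with right unit \<open>e\<close>, because
  (y - y e) e = 0, and a larger left ideal contains \<open>e\<close>, hence every y. So
  \<open>e\<close> would have to lie in \<open>M\<close>.\<close>

lemma jacobson_radical_nil:
  fixes x :: 'a
  assumes x: "x \<in> jacobson_radical"
  shows "\<exists>n. pw x n = 0"
proof (rule ccontr)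
  assume "\<not> ?thesis"
  then obtain e where e: "e \<in> span (range (pw x))" "e * e = e" "e \<noteq> 0"
    using idempotent_of_non_nilpotent by metis
  have "pw x n \<in> jacobson_radical" for n
    by (induction n) (auto simp: x jacobson_radical_left)
  then have eJ: "e \<in> jacobson_radical"
    using e(1) span_minimal[OF _ subspace_jacobson_radical] by blast
  let ?A = "{M. left_ideal M \<and> (\<forall>z. z * e = 0 \<longrightarrow> z \<in> M) \<and> e \<notin> M}"
  have "{z. z * e = 0} \<in> ?A"
    using e by (auto simp: left_ideal_def algebra_simps)
  then have ne: "?A \<noteq> {}" by blast
  have "\<Union>C \<in> ?A" if C: "C \<noteq> {}" "subset.chain ?A C" for C
  proof -
    have mem: "M \<in> ?A" if "M \<in> C" for M using that C(2) by (auto simp: subset.chain_def)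
    have "left_ideal (\<Union>C)"
      unfolding left_ideal_def
    proof (intro conjI ballI allI)
      show "0 \<in> \<Union>C" using C mem left_ideal_0 by blast
      fix u v assume "u \<in> \<Union>C" "v \<in> \<Union>C"
      then obtain M N where MN: "u \<in> M" "v \<in> N" "M \<in> C" "N \<in> C" by blast
      then have "M \<subseteq> N \<or> N \<subseteq> M" using C(2) by (auto simp: subset_chain_def)
      then show "u - v \<in> \<Union>C" using MN mem left_ideal_diff by blast
    next
      fix a u assume "u \<in> \<Union>C"
      then show "a * u \<in> \<Union>C" using mem left_ideal_mult by blast
    qed
    then show ?thesis using C mem by blast
  qed
  then have "\<exists>M\<in>?A. \<forall>N\<in>?A. M \<subseteq> N \<longrightarrow> N = M"
    by (intro subset_Zorn_nonempty[OF ne])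
  then obtain M where M: "M \<in> ?A" and max: "\<And>N. N \<in> ?A \<Longrightarrow> M \<subseteq> N \<Longrightarrow> N = M"
    by (elim bexE) simp
  have mod: "y - y * e \<in> M" for y
    using M e(2) by (auto simp: algebra_simps)
  have "modular_maximal_left_ideal M"
    unfolding modular_maximal_left_ideal_def
  proof (intro conjI allI impI)
    fix N assume N: "left_ideal N \<and> M \<subseteq> N"
    show "N = M \<or> N = UNIV"
    proof (cases "e \<in> N")
      case True
      have "y \<in> N" for y
      proof -
        have "y - y * e \<in> N" "y * e \<in> N" using N mod[of y] True left_ideal_mult by auto
        then have "(y - y * e) + y * e \<in> N" using N left_ideal_add by blast
        then show ?thesis by simp
      qed
      then show ?thesis by blast
    next
      case False
      then show ?thesis using max[of N] N M by blast
    qed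
  qed (use M mod in auto)
  then show False using eJ M by (auto simp: jacobson_radical_def)
qed

text \<open>Nakayama's argument. The spans \<open>K m\<close> of products of m + 1 radical elements
  become stationary at some \<open>K a\<close>, so that J K a = K a. If this is nonzero, a maximal
  proper left submodule \<open>M\<close> and an element \<open>k\<close> outside it give K a = M +
  Fk + Ak, hence k = m + j k with m in \<open>M\<close> and j in J. Iteration yields k - j^n k in
  \<open>M\<close>, and j is nilpotent.\<close>

lemma jacobson_radical_nilpotent:
  "\<exists>p\<ge>1. \<forall>xs :: 'a list. length xs = p \<longrightarrow> set xs \<subseteq> jacobson_radical \<longrightarrow> nonempty_prod xs = 0"
proof -
  let ?J = "jacobson_radical :: 'a set"
  define K where "K m = span {nonempty_prod xs | xs. length xs = Suc m \<and> set xs \<subseteq> ?J}" for m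
  obtain a where a: "\<And>b. dim (K a) \<le> dim (K b)"
    using ex_has_least_nat[of "\<lambda>_. True" 0 "\<lambda>a. dim (K a)"] by blast
  have dec: "K (Suc m) \<subseteq> K m" for m
    unfolding K_def
  proof (rule span_mono, clarify)
    fix xs :: "'a list" assume "length xs = Suc (Suc m)" "set xs \<subseteq> ?J"
    then obtain x y ys where xs: "xs = x # y # ys" "x \<in> ?J" "y \<in> ?J" "set ys \<subseteq> ?J" "length ys = m"
      by (auto simp: length_Suc_conv)
    then have "nonempty_prod xs = nonempty_prod ((x * y) # ys)"
      by (cases ys) (auto simp: mult.assoc)
    then show "\<exists>zs. nonempty_prod xs = nonempty_prod zs \<and> length zs = Suc m \<and> set zs \<subseteq> ?J"
      using xs by (intro exI[of _ "(x * y) # ys"]) (auto intro: jacobson_radical_left)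
  qed
  have Keq: "K (Suc a) = K a"
    by (rule fd_dim_equal) (use a dec in \<open>auto simp: K_def\<close>)
  have KJ: "K (Suc a) = span {j * x | j x. j \<in> ?J \<and> x \<in> K a}"
  proof
    have "{nonempty_prod xs | xs. length xs = Suc (Suc a) \<and> set xs \<subseteq> ?J}
       \<subseteq> {j * x | j x. j \<in> ?J \<and> x \<in> K a}"
    proof clarify
      fix xs :: "'a list" assume "length xs = Suc (Suc a)" "set xs \<subseteq> ?J"
      then obtain x ys where xs: "xs = x # ys" "x \<in> ?J" "set ys \<subseteq> ?J" "length ys = Suc a"
        by (auto simp: length_Suc_conv)
      moreover then have "nonempty_prod ys \<in> K a" unfolding K_def by (intro span_base) auto
      moreover have "nonempty_prod xs = x * nonempty_prod ys"
        using xs by (auto intro: nonempty_prod_Cons)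
      ultimately show "\<exists>j x. nonempty_prod xs = j * x \<and> j \<in> ?J \<and> x \<in> K a" by blast
    qed
    then show "K (Suc a) \<subseteq> span {j * x | j x. j \<in> ?J \<and> x \<in> K a}"
      unfolding K_def[of "Suc a"] by (rule span_mono)
    have "j * x \<in> K (Suc a)" if j: "j \<in> ?J" and x: "x \<in> K a" for j x
      using x unfolding K_def
    proof (induction rule: span_induct_alt)
      case (step c u z)
      then obtain xs where xs: "u = nonempty_prod xs" "length xs = Suc a" "set xs \<subseteq> ?J" by blast
      have "j * u = nonempty_prod (j # xs)"
        using xs by (cases xs) auto
      then have "j * u \<in> span {nonempty_prod xs | xs. length xs = Suc (Suc a) \<and> set xs \<subseteq> ?J}"
        using xs j by (intro span_base) (auto intro!: exI[of _ "j # xs"])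
      then show ?case using step by (simp add: distrib_left scale_mult_right span_add span_scale)
    qed (simp add: span_zero)
    then show "span {j * x | j x. j \<in> ?J \<and> x \<in> K a} \<subseteq> K (Suc a)"
      by (intro span_minimal) (auto simp: K_def)
  qed
  have subK: "subspace (K a)" by (simp add: K_def)
  have left_K: "b * x \<in> K a" if "x \<in> K a" for b x
    using that unfolding K_def
  proof (induction rule: span_induct_alt)
    case (step c u z)
    then obtain x xs where xs: "u = nonempty_prod (x # xs)" "length xs = a" "set (x # xs) \<subseteq> ?J"
      by (auto simp: length_Suc_conv)
    have "b * u = nonempty_prod ((b * x) # xs)"
      using xs by (cases xs) (auto simp: mult.assoc)
    then have "b * u \<in> span {nonempty_prod xs | xs. length xs = Suc a \<and> set xs \<subseteq> ?J}"
      using xs by (intro span_base) (auto intro!: exI[of _ "(b * x) # xs"] jacobson_radical_left)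
    then show ?case using step by (simp add: distrib_left scale_mult_right span_add span_scale)
  qed (simp add: span_zero)
  have K0: "K a \<subseteq> {0}"
  proof (rule ccontr)
    assume nz: "\<not> K a \<subseteq> {0}"
    let ?P = "\<lambda>M. subspace M \<and> M \<subseteq> K a \<and> M \<noteq> K a \<and> (\<forall>b. \<forall>x\<in>M. b * x \<in> M)"
    have "?P {0}" using nz subK by (auto simp: subspace_def)
    moreover have "\<forall>M. ?P M \<longrightarrow> dim M < Suc (dim (K a))"
      using fd_dim_mono by (simp add: less_Suc_eq_le)
    ultimately obtain M where M: "?P M" and max: "\<And>N. ?P N \<Longrightarrow> dim N \<le> dim M"
      using ex_has_greatest_nat[of ?P "{0}" dim "Suc (dim (K a))"] by blast
    then obtain k where k: "k \<in> K a" "k \<notin> M" by blast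
    have sM: "subspace M" using M by blast
    let ?N = "{m + (scale c k + b * k) | m c b. m \<in> M}"
    have sN: "subspace ?N"
    proof (rule subspaceI)
      show "0 \<in> ?N" using subspace_0[OF sM] by (force intro!: exI[of _ 0])
    next
      fix x y assume "x \<in> ?N" "y \<in> ?N"
      then obtain m c b m' c' b' where "x = m + (scale c k + b * k)" "y = m' + (scale c' k + b' * k)"
        "m \<in> M" "m' \<in> M" by blast
      then have "x + y = (m + m') + (scale (c + c') k + (b + b') * k)" "m + m' \<in> M"
        using subspace_add[OF sM] by (auto simp: algebra_simps)
      then show "x + y \<in> ?N" by blast
    next
      fix d x assume "x \<in> ?N"
      then obtain m c b where "x = m + (scale c k + b * k)" "m \<in> M" by blast
      then have "scale d x = scale d m + (scale (d * c) k + scale d b * k)" "scale d m \<in> M"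
        using subspace_scale[OF sM] by (auto simp: algebra_simps scale_mult_left)
      then show "scale d x \<in> ?N" by blast
    qed
    have leftN: "d * x \<in> ?N" if "x \<in> ?N" for d x
    proof -
      from that obtain m c b where "x = m + (scale c k + b * k)" "m \<in> M" by blast
      then have "d * x = d * m + (scale 0 k + (scale c d + d * b) * k)" "d * m \<in> M"
        using M by (auto simp: algebra_simps scale_mult_left scale_mult_right)
      then show ?thesis by blast
    qed
    have MN: "M \<subseteq> ?N"
    proof
      fix m assume "m \<in> M"
      moreover have "m = m + (scale 0 k + 0 * k)" by simp
      ultimately show "m \<in> ?N" by blast
    qed
    have kN: "k \<in> ?N"
    proof -
      have "k = 0 + (scale 1 k + 0 * k)" by simp
      then show ?thesis using subspace_0[OF sM] by blast
    qed
    have NK: "?N \<subseteq> K a"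
      using M k left_K subspace_add[OF subK] subspace_scale[OF subK] by auto
    have "?N = K a"
    proof (rule ccontr)
      assume "?N \<noteq> K a"
      then have "?P ?N" using sN NK leftN by blast
      then have "M = ?N" using fd_dim_equal[OF sM sN MN] max by blast
      then show False using k kN by blast
    qed
    then have dec_K: "\<exists>m\<in>M. \<exists>c b. x = m + (scale c k + b * k)" if "x \<in> K a" for x
      using that by blast
    have "\<exists>m\<in>M. \<exists>j\<in>?J. x = m + j * k" if "x \<in> span {j * x | j x. j \<in> ?J \<and> x \<in> K a}" for x
      using that
    proof (induction rule: span_induct_alt)
      case base
      show ?case using subspace_0[OF sM] jacobson_radical_0 by (intro bexI[of _ 0]) auto
    next
      case (step d u z)
      then obtain m j where mj: "m \<in> M" "j \<in> ?J" "z = m + j * k" by blast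
      obtain j' x where j': "u = j' * x" "j' \<in> ?J" "x \<in> K a" using step by blast
      then obtain m' c b where m': "x = m' + (scale c k + b * k)" "m' \<in> M" using dec_K by blast
      have "scale d u + z = (scale d (j' * m') + m) + (scale d (scale c j' + j' * b) + j) * k"
        using j' m' mj by (simp add: algebra_simps scale_mult_left scale_mult_right)
      moreover have "scale d (j' * m') + m \<in> M"
        using M m' mj by (intro subspace_add[OF sM] subspace_scale[OF sM]) auto
      moreover have "scale d (scale c j' + j' * b) + j \<in> ?J"
        using j' mj by (intro jacobson_radical_add jacobson_radical_scale jacobson_radical_right)
      ultimately show ?case by blast
    qed
    then obtain m j where mj: "m \<in> M" "j \<in> ?J" "k = m + j * k"
      using k Keq KJ by blast
    have "k - pw j n * k \<in> M" for n
    proof (induction n)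
      case 0
      have "k - pw j 0 * k = m" using mj(3) by (simp add: algebra_simps)
      then show ?case using mj by simp
    next
      case (Suc n)
      have "k - pw j (Suc n) * k = m + j * (k - pw j n * k)"
        using mj(3) by (simp add: algebra_simps)
      then show ?case using Suc mj M subspace_add[OF sM] by auto
    qed
    moreover obtain n where "pw j n = 0" using jacobson_radical_nil mj by blast
    ultimately have "k \<in> M" by (metis diff_zero mult_zero_left)
    then show False using k by blast
  qed
  have "nonempty_prod xs = 0" if "length xs = Suc a" "set xs \<subseteq> ?J" for xs :: "'a list"
  proof -
    have "nonempty_prod xs \<in> K a" unfolding K_def using that by (intro span_base) auto
    then show ?thesis using K0 by blast
  qed
  then show ?thesis by (intro exI[of _ "Suc a"]) auto
qed

text \<open>A factor outside the radical is absorbed by the next radical factor on its right, and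
  the factors after the last radical one by that one.\<close>

lemma exists_nonempty_prod_jacobson_radical:
  fixes ys :: "'a list"
  assumes "filter (\<lambda>y. y \<in> jacobson_radical) ys \<noteq> []"
  shows "\<exists>js. length js = length (filter (\<lambda>y. y \<in> jacobson_radical) ys)
           \<and> set js \<subseteq> jacobson_radical \<and> nonempty_prod ys = nonempty_prod js"
  using assms
proof (induction ys)
  case (Cons y ys)
  let ?f = "filter (\<lambda>y. y \<in> jacobson_radical)"
  show ?case
  proof (cases "?f ys = []")
    case True
    then have y: "y \<in> jacobson_radical" using Cons.prems by (auto split: if_splits)
    have "nonempty_prod (y # ys) \<in> jacobson_radical"
      using y by (cases "ys = []") (auto simp: nonempty_prod_Cons jacobson_radical_right)
    then show ?thesis using True y by (intro exI[of _ "[nonempty_prod (y # ys)]"]) auto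
  next
    case False
    then obtain js where js: "length js = length (?f ys)" "set js \<subseteq> jacobson_radical"
      "nonempty_prod ys = nonempty_prod js" using Cons.IH by blast
    then have ne: "js \<noteq> []" "ys \<noteq> []" using False by auto
    show ?thesis
    proof (cases "y \<in> jacobson_radical")
      case True
      then show ?thesis
        using js ne by (intro exI[of _ "y # js"]) (auto simp: nonempty_prod_Cons)
    next
      case yJ: False
      obtain j js' where "js = j # js'" using ne by (cases js) auto
      moreover have "y * nonempty_prod (j # js') = nonempty_prod ((y * j) # js')"
        by (cases js') (auto simp: mult.assoc)
      ultimately show ?thesis
        using js ne yJ by (intro exI[of _ "(y * j) # js'"])
          (auto simp: nonempty_prod_Cons jacobson_radical_left)
    qed
  qed
qed simp

lemma jacobson_radical_factors:
  obtains p :: nat where "p \<ge> 1"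
    "\<And>ys :: 'a list. length (filter (\<lambda>y. y \<in> jacobson_radical) ys) \<ge> p \<Longrightarrow> nonempty_prod ys = 0"
proof -
  obtain p where p: "p \<ge> 1"
    and nil: "\<And>xs :: 'a list. length xs = p \<Longrightarrow> set xs \<subseteq> jacobson_radical \<Longrightarrow> nonempty_prod xs = 0"
    using jacobson_radical_nilpotent by blast
  show ?thesis
  proof (rule that[OF p])
    fix ys :: "'a list" assume ys: "length (filter (\<lambda>y. y \<in> jacobson_radical) ys) \<ge> p"
    then have "filter (\<lambda>y. y \<in> jacobson_radical) ys \<noteq> []" using p by auto
    then obtain js where js: "length js \<ge> p" "set js \<subseteq> jacobson_radical"
      "nonempty_prod ys = nonempty_prod js"
      using exists_nonempty_prod_jacobson_radical ys by metis
    have take: "nonempty_prod (take p js) = 0"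
      using js by (intro nil) (auto dest: in_set_takeD)
    have "nonempty_prod js = 0"
    proof (cases "drop p js = []")
      case False
      moreover have "take p js \<noteq> []" using js p by auto
      ultimately have "nonempty_prod (take p js @ drop p js) = 0"
        using take by (subst nonempty_prod_append) auto
      then show ?thesis by simp
    qed (use take in simp)
    then show "nonempty_prod ys = 0" using js by simp
  qed
qed

end

section \<open>The quotient by the radical\<close>

lemma jrad_proj_eq_iff: "jrad_proj x = jrad_proj y \<longleftrightarrow> x - y \<in> jacobson_radical"
  by (simp add: mod_jrad.abs_eq_iff jrad_rel_def)

lemma jrad_proj_rep [simp]: "jrad_proj (rep_mod_jrad y) = y"
  by (rule Quotient3_abs_rep[OF Quotient3_mod_jrad])

lemma jrad_proj_surj: obtains x where "y = jrad_proj x"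
  by (metis jrad_proj_rep)

lemma jrad_proj_add: "jrad_proj (x + y) = jrad_proj x + jrad_proj y"
  by (simp add: plus_mod_jrad.abs_eq)

lemma jrad_proj_mult: "jrad_proj (x * y) = jrad_proj x * jrad_proj y"
  by (simp add: times_mod_jrad.abs_eq)

lemma jrad_proj_0: "jrad_proj 0 = 0"
  by (simp add: zero_mod_jrad_def)

lemma jrad_proj_eq_0_iff: "jrad_proj x = 0 \<longleftrightarrow> x \<in> jacobson_radical"
  using jrad_proj_eq_iff[of x 0] by (simp add: jrad_proj_0)

lemma jrad_proj_sum: "jrad_proj (sum f S) = (\<Sum>i\<in>S. jrad_proj (f i))"
  by (induction S rule: infinite_finite_induct) (auto simp: jrad_proj_0 jrad_proj_add)

lemma jrad_proj_pw: "jrad_proj (pw x n) = pw (jrad_proj x) n"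
  by (induction n) (auto simp: jrad_proj_mult)

text \<open>Semisimplicity of A/J in the form needed for the trace form: the preimage of
  \<open>I\<close> is a left ideal that is nil modulo the radical, hence contained in it.\<close>

lemma nil_left_ideal_mod_jrad:
  fixes I :: "'a::ring mod_jrad set"
  assumes I: "left_ideal I" and nil: "\<And>x. x \<in> I \<Longrightarrow> \<exists>n. pw x n = 0"
  shows "I \<subseteq> {0}"
proof -
  have "left_ideal {x. jrad_proj x \<in> I}"
    unfolding left_ideal_def
  proof (intro conjI ballI allI)
    show "0 \<in> {x. jrad_proj x \<in> I}" using left_ideal_0[OF I] by (simp add: jrad_proj_0)
    fix x y :: 'a assume "x \<in> {x. jrad_proj x \<in> I}" "y \<in> {x. jrad_proj x \<in> I}"
    then have "jrad_proj x - jrad_proj y \<in> I" using left_ideal_diff[OF I] by simp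
    then show "x - y \<in> {x. jrad_proj x \<in> I}" by (simp add: minus_mod_jrad.abs_eq)
  next
    fix a x :: 'a assume "x \<in> {x. jrad_proj x \<in> I}"
    then show "a * x \<in> {x. jrad_proj x \<in> I}" using left_ideal_mult[OF I] by (simp add: jrad_proj_mult)
  qed
  moreover have "\<exists>n. pw x n \<in> jacobson_radical" if "x \<in> {x. jrad_proj x \<in> I}" for x
    using nil[of "jrad_proj x"] that by (simp add: jrad_proj_pw[symmetric] jrad_proj_eq_0_iff)
  ultimately have sub: "{x. jrad_proj x \<in> I} \<subseteq> jacobson_radical"
    by (rule nil_left_ideal_subset_jacobson_radical)
  show ?thesis
  proof
    fix y assume "y \<in> I"
    moreover obtain x where "y = jrad_proj x" by (rule jrad_proj_surj)
    ultimately show "y \<in> {0}" using sub by (auto simp: jrad_proj_eq_0_iff)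
  qed
qed

lemma (in assoc_algebra) jrad_proj_scale: "jrad_proj (scale c x) = mod_jrad_scale scale c (jrad_proj x)"
proof -
  have "x - rep_mod_jrad (jrad_proj x) \<in> jacobson_radical"
    by (simp add: jrad_proj_eq_iff[symmetric])
  then have "scale c x - scale c (rep_mod_jrad (jrad_proj x)) \<in> jacobson_radical"
    using jacobson_radical_scale by (simp add: scale_right_diff_distrib[symmetric])
  then show ?thesis by (simp add: mod_jrad_scale_def jrad_proj_eq_iff)
qed

locale fd_H_action = generalized_H_action sA sH act
  for sA :: "'f::field \<Rightarrow> 'a::ring \<Rightarrow> 'a" and sH :: "'f \<Rightarrow> 'h::ring_1 \<Rightarrow> 'h" and act +
  assumes fin_dim: "\<exists>S. finite S \<and> A.span S = UNIV"

sublocale fd_H_action \<subseteq> A: fd_algebra sA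
  by unfold_locales (rule fin_dim)

lemma (in generalized_H_action) act_0: "act h 0 = 0"
  using act_add_right[of h 0 0] by simp

lemma (in generalized_H_action) act_diff: "act h (x - y) = act h x - act h y"
  using act_add_right[of h "x - y" y] by (simp add: algebra_simps)

locale fd_H_radical = fd_H_action sA sH act
  for sA :: "'f::field \<Rightarrow> 'a::ring \<Rightarrow> 'a" and sH :: "'f \<Rightarrow> 'h::ring_1 \<Rightarrow> 'h" and act +
  assumes radical_inv: "x \<in> jacobson_radical \<Longrightarrow> act h x \<in> jacobson_radical"
begin

lemma jrad_proj_act: "jrad_proj (act h x) = mod_jrad_act act h (jrad_proj x)"
proof -
  have "x - rep_mod_jrad (jrad_proj x) \<in> jacobson_radical"
    by (simp add: jrad_proj_eq_iff[symmetric])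
  then have "act h x - act h (rep_mod_jrad (jrad_proj x)) \<in> jacobson_radical"
    using radical_inv by (simp add: act_diff[symmetric])
  then show ?thesis by (simp add: mod_jrad_act_def jrad_proj_eq_iff)
qed

lemmas jrad_proj_hom = jrad_proj_add jrad_proj_mult jrad_proj_0 A.jrad_proj_scale jrad_proj_act

lemma generalized_H_action_mod_jrad:
  "generalized_H_action (mod_jrad_scale sA) sH (mod_jrad_act act)"
proof
  fix a b :: 'f and x y :: "'a mod_jrad" and h h' :: 'h
  obtain x' y' where xy: "x = jrad_proj x'" "y = jrad_proj y'" by (metis jrad_proj_rep)
  show "mod_jrad_scale sA a (x + y) = mod_jrad_scale sA a x + mod_jrad_scale sA a y"
    and "mod_jrad_scale sA (a + b) x = mod_jrad_scale sA a x + mod_jrad_scale sA b x"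
    and "mod_jrad_scale sA a (mod_jrad_scale sA b x) = mod_jrad_scale sA (a * b) x"
    and "mod_jrad_scale sA 1 x = x"
    and "mod_jrad_scale sA a x * y = mod_jrad_scale sA a (x * y)"
    and "x * mod_jrad_scale sA a y = mod_jrad_scale sA a (x * y)"
    unfolding xy by (simp_all add: jrad_proj_hom[symmetric] A.scale_right_distrib
        A.scale_left_distrib A.scale_mult_left A.scale_mult_right)
  show "mod_jrad_act act h (x + y) = mod_jrad_act act h x + mod_jrad_act act h y"
    and "mod_jrad_act act h (mod_jrad_scale sA a x) = mod_jrad_scale sA a (mod_jrad_act act h x)"
    and "mod_jrad_act act (h + h') x = mod_jrad_act act h x + mod_jrad_act act h' x"
    and "mod_jrad_act act (sH a h) x = mod_jrad_scale sA a (mod_jrad_act act h x)"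
    and "mod_jrad_act act (h * h') x = mod_jrad_act act h (mod_jrad_act act h' x)"
    and "mod_jrad_act act 1 x = x"
    unfolding xy by (simp_all add: jrad_proj_hom[symmetric] act_add_right act_scale_right
        act_add_left act_scale_left act_mult act_one)
  obtain k and h1 h2 h3 h4 :: "nat \<Rightarrow> 'h" where k: "k \<ge> 1"
    and eq: "\<And>a b. act h (a * b) = (\<Sum>i=1..k. act (h1 i) a * act (h2 i) b + act (h3 i) b * act (h4 i) a)"
    using act_product[of h] by blast
  have "mod_jrad_act act h (a * b) = (\<Sum>i=1..k. mod_jrad_act act (h1 i) a * mod_jrad_act act (h2 i) b
      + mod_jrad_act act (h3 i) b * mod_jrad_act act (h4 i) a)" for a b
  proof -
    obtain a' b' where ab: "a = jrad_proj a'" "b = jrad_proj b'" by (metis jrad_proj_rep)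
    show ?thesis
      unfolding ab by (simp add: jrad_proj_hom[symmetric] jrad_proj_sum[symmetric] eq)
  qed
  then show "\<exists>k\<ge>1. \<exists>h1 h2 h3 h4 :: nat \<Rightarrow> 'h. \<forall>a b. mod_jrad_act act h (a * b)
     = (\<Sum>i=1..k. mod_jrad_act act (h1 i) a * mod_jrad_act act (h2 i) b
          + mod_jrad_act act (h3 i) b * mod_jrad_act act (h4 i) a)"
    using k by (intro exI[of _ k] conjI exI[of _ h1] exI[of _ h2] exI[of _ h3] exI[of _ h4] allI)
qed

sublocale Q: generalized_H_action "mod_jrad_scale sA" sH "mod_jrad_act act"
  by (rule generalized_H_action_mod_jrad)

lemma jrad_proj_in_span: "x \<in> A.span S \<Longrightarrow> jrad_proj x \<in> Q.A.span (jrad_proj ` S)"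
proof (induction rule: A.span_induct_alt)
  case (step c u z)
  have "mod_jrad_scale sA c (jrad_proj u) + jrad_proj z \<in> Q.A.span (jrad_proj ` S)"
    by (rule Q.A.span_add[OF Q.A.span_scale[OF Q.A.span_base]]) (use step in auto)
  then show ?case by (simp add: jrad_proj_hom)
qed (auto simp: jrad_proj_0 Q.A.span_zero)

sublocale Q: fd_H_action "mod_jrad_scale sA" sH "mod_jrad_act act"
proof
  obtain S where S: "finite S" "A.span S = UNIV" using fin_dim by blast
  have "y \<in> Q.A.span (jrad_proj ` S)" for y
    using jrad_proj_in_span S(2) by (metis UNIV_I jrad_proj_rep)
  then show "\<exists>S. finite S \<and> Q.A.span S = UNIV"
    using S by (intro exI[of _ "jrad_proj ` S"]) auto
qed

end

section \<open>Direct sums of ideals\<close>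

lemma direct_sum_eq_0:
  fixes b :: "'i \<Rightarrow> 'b::comm_monoid_add"
  assumes ds: "direct_sum S B" and b: "\<And>i. i \<in> S \<Longrightarrow> b i \<in> B i"
    and z: "\<And>i. i \<in> S \<Longrightarrow> 0 \<in> B i" and sum: "(\<Sum>i\<in>S. b i) = 0" and i: "i \<in> S"
  shows "b i = 0"
proof -
  let ?f = "restrict b S" and ?g = "restrict (\<lambda>_. 0) S :: 'i \<Rightarrow> 'b"
  have "\<exists>!f. f \<in> (\<Pi>\<^sub>E i\<in>S. B i) \<and> 0 = (\<Sum>i\<in>S. f i)"
    using ds unfolding direct_sum_def by blast
  moreover have "?f \<in> (\<Pi>\<^sub>E i\<in>S. B i)" "0 = (\<Sum>i\<in>S. ?f i)"
    "?g \<in> (\<Pi>\<^sub>E i\<in>S. B i)" "0 = (\<Sum>i\<in>S. ?g i)"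
    using b z sum by auto
  ultimately have "?f = ?g" by blast
  then have "?f i = ?g i" by simp
  then show ?thesis using i by simp
qed

lemma direct_sum_Int:
  fixes B :: "'i \<Rightarrow> 'b::ab_group_add set"
  assumes ds: "direct_sum S B" and fin: "finite S"
    and z: "\<And>i. i \<in> S \<Longrightarrow> 0 \<in> B i" and "\<And>x i. i \<in> S \<Longrightarrow> x \<in> B i \<Longrightarrow> - x \<in> B i"
    and "i \<in> S" "j \<in> S" "i \<noteq> j" "x \<in> B i" "x \<in> B j"
  shows "x = 0"
proof -
  let ?b = "\<lambda>l. if l = i then x else if l = j then - x else 0"
  have "(\<Sum>l\<in>S. ?b l) = (\<Sum>l\<in>{i, j}. ?b l)"
    using assms by (intro sum.mono_neutral_right) auto
  also have "\<dots> = 0" using \<open>i \<noteq> j\<close> by simp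
  finally have "?b i = 0"
    using assms by (intro direct_sum_eq_0[OF ds, of ?b i]) auto
  then show ?thesis by simp
qed

lemma (in vector_space) direct_sum_independent:
  assumes ds: "direct_sum S B" and fin: "finite S" and sub: "\<And>i. i \<in> S \<Longrightarrow> subspace (B i)"
    and E: "\<And>i. i \<in> S \<Longrightarrow> finite (E i)" "\<And>i. i \<in> S \<Longrightarrow> independent (E i)"
      "\<And>i. i \<in> S \<Longrightarrow> span (E i) = B i"
  shows "disjoint_family_on E S" and "independent (\<Union>i\<in>S. E i)"
proof -
  have EB: "v \<in> B i" if "i \<in> S" "v \<in> E i" for v i
    using E(3)[OF that(1)] span_base[OF that(2)] by simp
  show dis: "disjoint_family_on E S"
    unfolding disjoint_family_on_def
  proof (intro ballI impI)
    fix i j assume ij: "i \<in> S" "j \<in> S" "i \<noteq> j"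
    have "False" if "v \<in> E i" "v \<in> E j" for v
    proof -
      have "v = 0"
        using ij that EB sub by (intro direct_sum_Int[OF ds fin _ _ ij]) (auto simp: subspace_0 subspace_neg)
      then show False using E(2)[OF ij(1)] that dependent_zero by blast
    qed
    then show "E i \<inter> E j = {}" by blast
  qed
  show "independent (\<Union>i\<in>S. E i)"
  proof
    have finU: "finite (\<Union>i\<in>S. E i)" using fin E by auto
    assume "dependent (\<Union>i\<in>S. E i)"
    then obtain u v where v: "v \<in> (\<Union>i\<in>S. E i)" "u v \<noteq> 0" and z: "(\<Sum>v\<in>(\<Union>i\<in>S. E i). scale (u v) v) = 0"
      using dependent_finite[OF finU] by blast
    have "(\<Sum>v\<in>(\<Union>i\<in>S. E i). scale (u v) v) = (\<Sum>i\<in>S. \<Sum>v\<in>E i. scale (u v) v)"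
      using dis E fin by (intro sum.UNION_disjoint) (auto simp: disjoint_family_on_def)
    then have "(\<Sum>i\<in>S. \<Sum>v\<in>E i. scale (u v) v) = 0" using z by simp
    then have z': "(\<Sum>v\<in>E i. scale (u v) v) = 0" if "i \<in> S" for i
      using that EB sub by (intro direct_sum_eq_0[OF ds, of "\<lambda>i. \<Sum>v\<in>E i. scale (u v) v" i])
        (auto simp: subspace_0 intro!: subspace_sum subspace_scale)
    from v obtain i where i: "i \<in> S" "v \<in> E i" by blast
    then have "dependent (E i)"
      using z'[OF i(1)] v dependent_finite[OF E(1)[OF i(1)]] by blast
    then show False using E(2)[OF i(1)] by blast
  qed
qed

section \<open>Multilinear $H$-functions\<close>

lemma (in assoc_algebra) nonempty_prod_scale:
  "xs \<noteq> [] \<Longrightarrow> nonempty_prod (map (\<lambda>x. scale (c x) (f x)) xs)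
     = scale (prod_list (map c xs)) (nonempty_prod (map f xs))"
proof (induction xs)
  case (Cons x xs)
  then show ?case
    by (cases "xs = []") (simp_all add: nonempty_prod_Cons scale_mult_left scale_mult_right mult.commute)
qed simp

lemma (in assoc_algebra) subset_span_prods:
  assumes Y: "Y \<subseteq> span {a * b | a b. a \<in> Y \<and> b \<in> Y}" and y: "y \<in> Y"
  shows "y \<in> span {nonempty_prod ws | ws. length ws = Suc n \<and> set ws \<subseteq> Y}"
  using y
proof (induction n arbitrary: y)
  case 0
  then show ?case by (intro span_base) (auto intro!: exI[of _ "[y]"])
next
  case (Suc n)
  have step: "a * b \<in> span {nonempty_prod ws | ws. length ws = Suc (Suc n) \<and> set ws \<subseteq> Y}"
    if a: "a \<in> Y" and b: "b \<in> Y" for a b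
    using Suc.IH[OF b]
  proof (induction rule: span_induct_alt)
    case (step c u z)
    then obtain ws where ws: "u = nonempty_prod ws" "length ws = Suc n" "set ws \<subseteq> Y" by blast
    have "a * u \<in> span {nonempty_prod ws | ws. length ws = Suc (Suc n) \<and> set ws \<subseteq> Y}"
      using ws a nonempty_prod_Cons[of ws a]
      by (intro span_base) (cases ws, auto intro!: exI[of _ "a # ws"])
    then show ?case using step by (simp add: distrib_left scale_mult_right span_add span_scale)
  qed (simp add: span_zero)
  have "y \<in> span {a * b | a b. a \<in> Y \<and> b \<in> Y}" using Suc.prems Y by blast
  also have "\<dots> \<subseteq> span {nonempty_prod ws | ws. length ws = Suc (Suc n) \<and> set ws \<subseteq> Y}"
    by (rule span_minimal) (use step in auto)
  finally show ?case .
qed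

lemma (in vector_space) span_nonzero:
  fixes g :: "'b \<Rightarrow> 'c::ab_group_add"
  assumes add: "\<And>x y. g (x + y) = g x + g y" and scale: "\<And>c x. g x = 0 \<Longrightarrow> g (scale c x) = 0"
    and x: "x \<in> span S" and nz: "g x \<noteq> 0"
  obtains s where "s \<in> S" "g s \<noteq> 0"
proof (rule ccontr)
  assume "\<not> thesis"
  then have S: "g s = 0" if "s \<in> S" for s using that \<open>\<And>s. s \<in> S \<Longrightarrow> g s \<noteq> 0 \<Longrightarrow> thesis\<close> by blast
  have "g 0 = 0" using add[of 0 0] by simp
  then have "subspace {x. g x = 0}" by (auto simp: subspace_def add scale)
  then have "span S \<subseteq> {x. g x = 0}" using S by (intro span_minimal) auto
  then show False using x nz by blast
qed

text \<open>\<open>us\<close> collects the factors that have already been replaced. The product is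
  linear in each position, so if all generators of the span gave zero there, the given factor would
  too.\<close>

lemma (in assoc_algebra) exists_nonzero_expansion:
  assumes "list_all2 (\<lambda>y S. y \<in> span S) ys Ss" and "nonempty_prod (us @ ys) \<noteq> 0"
  shows "\<exists>zs. list_all2 (\<in>) zs Ss \<and> nonempty_prod (us @ zs) \<noteq> 0"
  using assms
proof (induction arbitrary: us rule: list_all2_induct)
  case (Cons y ys S Ss)
  let ?g = "\<lambda>v. nonempty_prod (us @ v # ys)"
  have g_add: "?g (v + w) = ?g v + ?g w" for v w
    by (cases "us = []"; cases "ys = []")
      (auto simp: nonempty_prod_append nonempty_prod_Cons distrib_left distrib_right)
  have g_scale: "?g (scale c v) = scale c (?g v)" for c v
    by (cases "us = []"; cases "ys = []")
      (auto simp: nonempty_prod_append nonempty_prod_Cons scale_mult_left scale_mult_right)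
  obtain s where s: "s \<in> S" "?g s \<noteq> 0"
    using span_nonzero[of ?g y S] g_add g_scale Cons by auto
  then have "nonempty_prod ((us @ [s]) @ ys) \<noteq> 0" by simp
  then obtain zs where "list_all2 (\<in>) zs Ss" "nonempty_prod ((us @ [s]) @ zs) \<noteq> 0"
    using Cons.IH by blast
  then show ?case using s by (intro exI[of _ "s # zs"]) auto
qed auto

context generalized_H_action
begin

text \<open>\<open>hfun Y V N f\<close>: \<open>f\<close> is the evaluation of a linear combination of products in which each
  variable occurs with the multiplicity given by \<open>V\<close>, each time under some operator of \<open>H\<close>, and
  in which \<open>N\<close> constants from \<open>Y\<close> are inserted.\<close>

inductive hfun :: "'a set \<Rightarrow> 'v multiset \<Rightarrow> nat \<Rightarrow> (('v \<Rightarrow> 'a) \<Rightarrow> 'a) \<Rightarrow> bool" for Y where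
  hfun_var: "hfun Y {#v#} 0 (\<lambda>\<psi>. \<psi> v)"
| hfun_const: "a \<in> Y \<Longrightarrow> hfun Y {#} (Suc 0) (\<lambda>\<psi>. a)"
| hfun_act: "hfun Y V N f \<Longrightarrow> hfun Y V N (\<lambda>\<psi>. act h (f \<psi>))"
| hfun_mult: "hfun Y V N f \<Longrightarrow> hfun Y V' N' f' \<Longrightarrow> hfun Y (V + V') (N + N') (\<lambda>\<psi>. f \<psi> * f' \<psi>)"
| hfun_zero: "hfun Y V N (\<lambda>\<psi>. 0)"
| hfun_add: "hfun Y V N f \<Longrightarrow> hfun Y V N f' \<Longrightarrow> hfun Y V N (\<lambda>\<psi>. f \<psi> + f' \<psi>)"
| hfun_scale: "hfun Y V N f \<Longrightarrow> hfun Y V N (\<lambda>\<psi>. sA c (f \<psi>))"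

lemma hfun_sum: "(\<And>i. i \<in> S \<Longrightarrow> hfun Y V N (f i)) \<Longrightarrow> hfun Y V N (\<lambda>\<psi>. \<Sum>i\<in>S. f i \<psi>)"
  by (induction S rule: infinite_finite_induct) (auto intro: hfun_zero hfun_add)

lemma hfun_mono: "hfun Y V N f \<Longrightarrow> Y \<subseteq> Y' \<Longrightarrow> hfun Y' V N f"
  by (induction rule: hfun.induct) (auto intro: hfun.intros)

lemma hfun_subst:
  assumes "hfun Y V N f" and "\<And>v. v \<in># V \<Longrightarrow> hfun Y (T v) (M v) (g v)"
  shows "hfun Y (\<Sum>v\<in>#V. T v) (N + (\<Sum>v\<in>#V. M v)) (\<lambda>\<psi>. f (\<lambda>v. g v \<psi>))"
  using assms
proof (induction rule: hfun.induct)
  case (hfun_mult V N f V' N' f')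
  have "hfun Y ((\<Sum>v\<in>#V. T v) + (\<Sum>v\<in>#V'. T v))
      ((N + (\<Sum>v\<in>#V. M v)) + (N' + (\<Sum>v\<in>#V'. M v))) (\<lambda>\<psi>. f (\<lambda>v. g v \<psi>) * f' (\<lambda>v. g v \<psi>))"
    by (rule hfun.hfun_mult) (use hfun_mult in auto)
  then show ?case by (simp add: ac_simps)
qed (auto intro: hfun.intros)

lemma hfun_rename:
  assumes "hfun Y V N f"
  shows "hfun Y (image_mset r V) N (\<lambda>\<psi>. f (\<lambda>v. \<psi> (r v)))"
proof -
  have "(\<Sum>v\<in>#V. {#r v#}) = image_mset r V" by (induction V) auto
  then show ?thesis
    using hfun_subst[OF assms, of "\<lambda>v. {#r v#}" "\<lambda>_. 0" "\<lambda>v \<psi>. \<psi> (r v)"] by (simp add: hfun_var)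
qed

lemma hfun_prod:
  assumes "\<And>i. i < Suc n \<Longrightarrow> hfun Y (V i) (N i) (f i)"
  shows "hfun Y (\<Sum>i<Suc n. V i) (\<Sum>i<Suc n. N i) (\<lambda>\<psi>. nonempty_prod (map (\<lambda>i. f i \<psi>) [0..<Suc n]))"
  using assms
proof (induction n)
  case (Suc n)
  have "hfun Y ((\<Sum>i<Suc n. V i) + V (Suc n)) ((\<Sum>i<Suc n. N i) + N (Suc n))
     (\<lambda>\<psi>. nonempty_prod (map (\<lambda>i. f i \<psi>) [0..<Suc n]) * f (Suc n) \<psi>)"
    by (rule hfun_mult) (use Suc in auto)
  moreover have "nonempty_prod (map (\<lambda>i. f i \<psi>) [0..<Suc n]) * f (Suc n) \<psi>
      = nonempty_prod (map (\<lambda>i. f i \<psi>) [0..<Suc (Suc n)])" for \<psi>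
    using nonempty_prod_append[of "map (\<lambda>i. f i \<psi>) [0..<Suc n]" "[f (Suc n) \<psi>]"] by simp
  ultimately show ?case by simp
qed simp

lemma hfun_cong: "hfun Y V N f \<Longrightarrow> (\<And>v. v \<in># V \<Longrightarrow> \<psi> v = \<psi>' v) \<Longrightarrow> f \<psi> = f \<psi>'"
proof (induction rule: hfun.induct)
  case (hfun_mult V N f V' N' f')
  then have "f \<psi> = f \<psi>'" "f' \<psi> = f' \<psi>'" by auto
  then show ?case by simp
qed auto

lemma hfun_fun_upd: "hfun Y V N f \<Longrightarrow> v \<notin># V \<Longrightarrow> f (\<psi>(v := x)) = f \<psi>"
  by (rule hfun_cong[where f = f and V = V]) auto

lemma hfun_linear:
  "hfun Y V N f \<Longrightarrow> count V v = 1 \<Longrightarrow> f (\<psi>(v := x + y)) = f (\<psi>(v := x)) + f (\<psi>(v := y))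
     \<and> f (\<psi>(v := sA c x)) = sA c (f (\<psi>(v := x)))"
proof (induction rule: hfun.induct)
  case (hfun_mult V N f V' N' f')
  then consider "count V v = 1" "v \<notin># V'" | "v \<notin># V" "count V' v = 1"
    by (auto simp: not_in_iff add_is_1)
  then show ?case
  proof cases
    case 1
    have "f' (\<psi>(v := z)) = f' \<psi>" for z by (rule hfun_fun_upd[OF hfun_mult.hyps(2) 1(2)])
    then show ?thesis
      using hfun_mult.IH(1)[OF 1(1)] by (simp add: distrib_right A.scale_mult_left del: fun_upd_apply)
  next
    case 2
    have "f (\<psi>(v := z)) = f \<psi>" for z by (rule hfun_fun_upd[OF hfun_mult.hyps(1) 2(1)])
    then show ?thesis
      using hfun_mult.IH(2)[OF 2(2)] by (simp add: distrib_left A.scale_mult_right del: fun_upd_apply)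
  qed
qed (auto simp: act_add_right act_scale_right A.scale_right_distrib A.scale_left_commute split: if_splits)

lemma hfun_in_ideal:
  assumes I: "H_invariant_ideal sA act UNIV I" and "Y \<subseteq> I"
  shows "hfun Y V N f \<Longrightarrow> N \<ge> 1 \<Longrightarrow> f \<psi> \<in> I"
proof (induction rule: hfun.induct)
  case (hfun_mult V N f V' N' f')
  then show ?case using I by (cases "N \<ge> 1") (auto simp: H_invariant_ideal_def)
qed (use I \<open>Y \<subseteq> I\<close> in \<open>auto simp: H_invariant_ideal_def A.subspace_def\<close>)

text \<open>One constant is written as a combination of products of two constants, which raises the
  count by one without changing the function. Functions with different numbers of constants can thus
  be brought to the same number and added.\<close>

lemma hfun_pad_Suc:
  assumes Y: "Y \<subseteq> A.span {a * b | a b. a \<in> Y \<and> b \<in> Y}"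
  shows "hfun Y V N f \<Longrightarrow> N \<ge> 1 \<Longrightarrow> hfun Y V (Suc N) f"
proof (induction rule: hfun.induct)
  case (hfun_const a)
  have "a \<in> A.span {a * b | a b. a \<in> Y \<and> b \<in> Y}" using hfun_const Y by blast
  then show ?case
  proof (induction rule: A.span_induct_alt)
    case (step c u z)
    then obtain a b where "u = a * b" "a \<in> Y" "b \<in> Y" by blast
    then have "hfun Y ({#} + {#}) (Suc 0 + Suc 0) (\<lambda>_. u)"
      using hfun.hfun_mult[OF hfun.hfun_const hfun.hfun_const] by blast
    then have "hfun Y {#} (Suc (Suc 0)) (\<lambda>_. u)" by simp
    then show ?case using step by (intro hfun_add hfun_scale) auto
  qed (rule hfun_zero)
next
  case (hfun_mult V N f V' N' f')
  show ?case
  proof (cases "N \<ge> 1")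
    case True
    then have "hfun Y (V + V') (Suc N + N') (\<lambda>\<psi>. f \<psi> * f' \<psi>)"
      using hfun_mult by (intro hfun.hfun_mult) auto
    then show ?thesis by simp
  next
    case False
    then have "hfun Y (V + V') (N + Suc N') (\<lambda>\<psi>. f \<psi> * f' \<psi>)"
      using hfun_mult by (intro hfun.hfun_mult) auto
    then show ?thesis by simp
  qed
qed (auto intro: hfun.intros)

lemma hfun_pad:
  assumes Y: "Y \<subseteq> A.span {a * b | a b. a \<in> Y \<and> b \<in> Y}" and f: "hfun Y V N f" "N \<ge> 1" "N \<le> N'"
  shows "hfun Y V N' f"
  using f(3)
proof (induction rule: dec_induct)
  case (step n)
  then show ?case using f(2) by (intro hfun_pad_Suc[OF Y]) auto
qed (rule f(1))

text \<open>The product rule may also interchange the two factors, so the first factor can end up on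
  either side of the others. Their number is preserved, and this is what counts when powers of the
  radical are compared.\<close>

lemma act_prod_span:
  assumes W: "\<And>h w. w \<in> W \<Longrightarrow> act h w \<in> W"
  shows "ws \<noteq> [] \<Longrightarrow> set ws \<subseteq> W \<Longrightarrow>
    act h (nonempty_prod ws) \<in> A.span {nonempty_prod zs | zs. length zs = length ws \<and> set zs \<subseteq> W}"
proof (induction ws arbitrary: h)
  case (Cons w ws)
  show ?case
  proof (cases "ws = []")
    case True
    then show ?thesis
      using Cons W by (intro A.span_base) (auto intro!: exI[of _ "[act h w]"])
  next
    case False
    let ?S = "A.span {nonempty_prod zs | zs. length zs = length (w # ws) \<and> set zs \<subseteq> W}"
    obtain k and h1 h2 h3 h4 :: "nat \<Rightarrow> 'h" where
      eq: "\<And>a b. act h (a * b) = (\<Sum>i=1..k. act (h1 i) a * act (h2 i) b + act (h3 i) b * act (h4 i) a)"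
      using act_product[of h] by blast
    have left: "x * y \<in> ?S" if x: "x \<in> W"
      and y: "y \<in> A.span {nonempty_prod zs | zs. length zs = length ws \<and> set zs \<subseteq> W}" for x y
      using y
    proof (induction rule: A.span_induct_alt)
      case (step c u z)
      then obtain zs where zs: "u = nonempty_prod zs" "length zs = length ws" "set zs \<subseteq> W" by blast
      have "zs \<noteq> []" using zs False by auto
      then have "x * u = nonempty_prod (x # zs)"
        using zs nonempty_prod_Cons[of zs x] by simp
      then have "x * u \<in> ?S" using zs x by (intro A.span_base) (auto intro!: exI[of _ "x # zs"])
      then show ?case
        using step by (simp add: distrib_left A.scale_mult_right A.span_add A.span_scale)
    qed (simp add: A.span_zero)
    have right: "y * x \<in> ?S" if x: "x \<in> W"
      and y: "y \<in> A.span {nonempty_prod zs | zs. length zs = length ws \<and> set zs \<subseteq> W}" for x y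
      using y
    proof (induction rule: A.span_induct_alt)
      case (step c u z)
      then obtain zs where zs: "u = nonempty_prod zs" "length zs = length ws" "set zs \<subseteq> W" by blast
      have "zs \<noteq> []" using zs False by auto
      then have "u * x = nonempty_prod (zs @ [x])"
        using zs nonempty_prod_append[of zs "[x]"] by simp
      then have "u * x \<in> ?S" using zs x by (intro A.span_base) (auto intro!: exI[of _ "zs @ [x]"])
      then show ?case
        using step by (simp add: distrib_right A.scale_mult_left A.span_add A.span_scale)
    qed (simp add: A.span_zero)
    have "act h (w * nonempty_prod ws) \<in> ?S"
      unfolding eq
      by (intro A.span_sum A.span_add left right) (use Cons False W in auto)
    then show ?thesis using False by (simp add: nonempty_prod_Cons)
  qed
qed simp

end

section \<open>Density for $H$-simple algebras\<close>

text \<open>The ambient algebra stands for A/J. \<open>semisimple\<close> is the property of A/J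
  from which the nondegeneracy of the trace form is derived.\<close>

locale H_simple_block = fd_H_action sA sH act
  for sA :: "'f::{alg_closed_field, field_char_0} \<Rightarrow> 'a::ring \<Rightarrow> 'a"
    and sH :: "'f \<Rightarrow> 'h::ring_1 \<Rightarrow> 'h" and act +
  fixes B :: "'a set" and m :: nat and e :: "nat \<Rightarrow> 'a"
  assumes ideal: "H_invariant_ideal sA act UNIV B"
    and simple: "H_simple sA act B"
    and inj_e: "inj_on e {..<m}"
    and indep_e: "A.independent (e ` {..<m})"
    and span_e: "A.span (e ` {..<m}) = B"
    and semisimple: "left_ideal (I :: 'a set) \<Longrightarrow> (\<And>x. x \<in> I \<Longrightarrow> \<exists>n. pw x n = 0) \<Longrightarrow> I \<subseteq> {0}"
begin

lemma subspace_B: "A.subspace B"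
  and B_mult: "x \<in> B \<Longrightarrow> a * x \<in> B" "x \<in> B \<Longrightarrow> x * a \<in> B"
  and B_act: "x \<in> B \<Longrightarrow> act h x \<in> B"
  using ideal by (auto simp: H_invariant_ideal_def)

lemma B_0: "0 \<in> B" and B_add: "x \<in> B \<Longrightarrow> y \<in> B \<Longrightarrow> x + y \<in> B"
  and B_scale: "x \<in> B \<Longrightarrow> sA c x \<in> B" and B_diff: "x \<in> B \<Longrightarrow> y \<in> B \<Longrightarrow> x - y \<in> B"
  and B_sum: "(\<And>i. i \<in> S \<Longrightarrow> f i \<in> B) \<Longrightarrow> sum f S \<in> B"
  using subspace_B by (auto simp: A.subspace_0 A.subspace_add A.subspace_scale A.subspace_diff A.subspace_sum)

lemma B_prod_nonzero: obtains x y where "x \<in> B" "y \<in> B" "x * y \<noteq> 0"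
  using simple by (auto simp: H_simple_def)

lemma B_ideal_cases:
  assumes "K \<subseteq> B" "A.subspace K" "\<And>x b. x \<in> K \<Longrightarrow> b \<in> B \<Longrightarrow> b * x \<in> K"
    "\<And>x b. x \<in> K \<Longrightarrow> b \<in> B \<Longrightarrow> x * b \<in> K" "\<And>x h. x \<in> K \<Longrightarrow> act h x \<in> K"
  shows "K = {0} \<or> K = B"
  using simple assms by (auto simp: H_simple_def H_invariant_ideal_def)

text \<open>By the product rule the span of the products is again an \<open>H\<close>-invariant
  ideal, and it is not zero. It follows that constants from \<open>B\<close> can be padded.\<close>

lemma B_subset_span_products: "B \<subseteq> A.span {a * b | a b. a \<in> B \<and> b \<in> B}"
proof -
  let ?K = "A.span {a * b | a b. a \<in> B \<and> b \<in> B}"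
  have sub: "?K \<subseteq> B" by (intro A.span_minimal subspace_B) (auto intro: B_mult)
  have act_K: "act h x \<in> ?K" if "x \<in> ?K" for h x
    using that
  proof (induction rule: A.span_induct_alt)
    case (step c u z)
    then obtain a b where u: "u = a * b" "a \<in> B" "b \<in> B" by blast
    obtain k and h1 h2 h3 h4 :: "nat \<Rightarrow> 'h" where
      eq: "\<And>a b. act h (a * b) = (\<Sum>i=1..k. act (h1 i) a * act (h2 i) b + act (h3 i) b * act (h4 i) a)"
      using act_product[of h] by blast
    have "act h u \<in> ?K"
      unfolding u eq by (intro A.span_sum A.span_add A.span_base) (use u B_act in blast)+
    then show ?case
      using step by (simp add: act_add_right act_scale_right A.span_add A.span_scale)
  qed (simp add: act_0 A.span_zero)
  have "?K = {0} \<or> ?K = B"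
    by (rule B_ideal_cases) (use sub B_mult act_K in \<open>auto intro!: A.span_base\<close>)
  moreover obtain x y where xy: "x \<in> B" "y \<in> B" "x * y \<noteq> 0" by (rule B_prod_nonzero)
  then have "x * y \<in> ?K" by (intro A.span_base) auto
  ultimately show ?thesis using xy by auto
qed

lemma exists_nonzero_prod:
  "\<exists>ws. length ws = Suc n \<and> set ws \<subseteq> B \<and> nonempty_prod ws \<noteq> 0"
proof (rule ccontr)
  assume "\<not> ?thesis"
  then have "{nonempty_prod ws | ws. length ws = Suc n \<and> set ws \<subseteq> B} \<subseteq> {0}" by blast
  then have "A.span {nonempty_prod ws | ws. length ws = Suc n \<and> set ws \<subseteq> B} \<subseteq> {0}"
    by (rule A.span_minimal) (auto simp: A.subspace_def)
  moreover obtain x y where "x \<in> B" "x * y \<noteq> 0" by (rule B_prod_nonzero)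
  ultimately show False using A.subset_span_prods[OF B_subset_span_products, of x n] by auto
qed

lemma hfun_in_B: "hfun B V N f \<Longrightarrow> N \<ge> 1 \<Longrightarrow> f \<psi> \<in> B"
  by (rule hfun_in_ideal[OF ideal]) auto

lemmas hfun_pad_B = hfun_pad[OF B_subset_span_products]

text \<open>These operators take the part of the algebra generated by \<open>H\<close> and the
  multiplications by elements of \<open>B\<close>, with \<open>B\<close> as its module. Requiring a
  constant forces the values into the ideal \<open>B\<close>, even for arguments outside it, and
  makes padding possible.\<close>

definition ops :: "('a \<Rightarrow> 'a) set" where
  "ops = {T. \<exists>N\<ge>1. hfun B {#()#} N (\<lambda>\<psi>. T (\<psi> ()))}"

lemma ops_linear:
  assumes "T \<in> ops"
  shows "T (x + y) = T x + T y" "T (sA c x) = sA c (T x)"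
proof -
  obtain N where N: "hfun B {#()#} N (\<lambda>\<psi>. T (\<psi> ()))" using assms by (auto simp: ops_def)
  show "T (x + y) = T x + T y" "T (sA c x) = sA c (T x)"
    using hfun_linear[OF N, of "()" "\<lambda>_. 0"] by auto
qed

lemma ops_in_B: "T \<in> ops \<Longrightarrow> T x \<in> B"
  unfolding ops_def using hfun_in_B[of _ _ _ "\<lambda>_. x"] by fastforce

lemma ops_0: "(\<lambda>_. 0) \<in> ops"
  unfolding ops_def by (auto intro: hfun_zero)

lemma ops_add:
  assumes "S \<in> ops" "T \<in> ops" shows "(\<lambda>x. S x + T x) \<in> ops"
proof -
  obtain N M where N: "hfun B {#()#} N (\<lambda>\<psi>. S (\<psi> ()))" "N \<ge> 1"
    and M: "hfun B {#()#} M (\<lambda>\<psi>. T (\<psi> ()))" "M \<ge> 1"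
    using assms by (auto simp: ops_def)
  have "hfun B {#()#} (max N M) (\<lambda>\<psi>. S (\<psi> ()) + T (\<psi> ()))"
    by (intro hfun_add hfun_pad_B[OF N] hfun_pad_B[OF M]) auto
  then show ?thesis using N by (auto simp: ops_def intro!: exI[of _ "max N M"])
qed

lemma ops_scale: "T \<in> ops \<Longrightarrow> (\<lambda>x. sA c (T x)) \<in> ops"
  unfolding ops_def by (auto intro: hfun_scale)

lemma ops_sum: "(\<And>i. i \<in> I \<Longrightarrow> T i \<in> ops) \<Longrightarrow> (\<lambda>x. \<Sum>i\<in>I. T i x) \<in> ops"
  by (induction I rule: infinite_finite_induct) (auto intro: ops_0 ops_add)

lemma ops_diff: "S \<in> ops \<Longrightarrow> T \<in> ops \<Longrightarrow> (\<lambda>x. S x - T x) \<in> ops"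
  using ops_add[OF _ ops_scale[of T "- 1"], of S] by simp

lemma ops_hfun_comp:
  assumes T: "T \<in> ops" and S: "hfun B {#()#} M (\<lambda>\<psi>. S (\<psi> ()))"
  shows "(\<lambda>x. T (S x)) \<in> ops"
proof -
  obtain N where N: "hfun B {#()#} N (\<lambda>\<psi>. T (\<psi> ()))" "N \<ge> 1" using T by (auto simp: ops_def)
  have "hfun B {#()#} (N + M) (\<lambda>\<psi>. T (S (\<psi> ())))"
    using hfun_subst[OF N(1), of "\<lambda>_. {#()#}" "\<lambda>_. M" "\<lambda>_ \<psi>. S (\<psi> ())"] S by simp
  then show ?thesis using N(2) by (auto simp: ops_def intro!: exI[of _ "N + M"])
qed

lemma hfun_ops_comp:
  assumes T: "T \<in> ops" and S: "hfun B {#()#} M (\<lambda>\<psi>. S (\<psi> ()))"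
  shows "(\<lambda>x. S (T x)) \<in> ops"
proof -
  obtain N where N: "hfun B {#()#} N (\<lambda>\<psi>. T (\<psi> ()))" "N \<ge> 1" using T by (auto simp: ops_def)
  have "hfun B {#()#} (M + N) (\<lambda>\<psi>. S (T (\<psi> ())))"
    using hfun_subst[OF S, of "\<lambda>_. {#()#}" "\<lambda>_. N" "\<lambda>_ \<psi>. T (\<psi> ())"] N by simp
  then show ?thesis using N(2) by (auto simp: ops_def intro!: exI[of _ "M + N"])
qed

lemma hfun_left: "b \<in> B \<Longrightarrow> hfun B {#()#} 1 (\<lambda>\<psi>. b * \<psi> ())"
  and hfun_right: "b \<in> B \<Longrightarrow> hfun B {#()#} 1 (\<lambda>\<psi>. \<psi> () * b)"
  and hfun_unit_act: "hfun B {#()#} 0 (\<lambda>\<psi>. act h (\<psi> ()))"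
  using hfun_mult[OF hfun_const[of b B] hfun_var[of B "()"]]
    hfun_mult[OF hfun_var[of B "()"] hfun_const[of b B]]
  by (simp_all add: hfun_act hfun_var)

lemma ops_comp: "S \<in> ops \<Longrightarrow> T \<in> ops \<Longrightarrow> (\<lambda>x. S (T x)) \<in> ops"
  unfolding ops_def[of] using ops_hfun_comp[of S _ T] by (auto simp: ops_def)

lemma ops_annihilated:
  assumes v: "v \<in> B" and "\<And>T. T \<in> ops \<Longrightarrow> T v = 0"
  shows "v = 0"
proof -
  let ?K = "{v \<in> B. \<forall>T\<in>ops. T v = 0}"
  have "?K = {0} \<or> ?K = B"
  proof (rule B_ideal_cases)
    show "A.subspace ?K"
      using B_0 B_add B_scale ops_linear(2)[of _ 0 0] by (auto simp: A.subspace_def ops_linear)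
    fix x b assume "x \<in> ?K" "b \<in> B"
    then show "b * x \<in> ?K" "x * b \<in> ?K"
      using ops_hfun_comp[OF _ hfun_left] ops_hfun_comp[OF _ hfun_right] by (auto intro: B_mult)
  next
    fix x h assume "x \<in> ?K"
    then show "act h x \<in> ?K" using ops_hfun_comp[OF _ hfun_unit_act] by (auto intro: B_act)
  qed auto
  moreover obtain x y where xy: "x \<in> B" "y \<in> B" "x * y \<noteq> 0" by (rule B_prod_nonzero)
  have "(\<lambda>y. x * y) \<in> ops" using hfun_left[OF xy(1)] by (auto simp: ops_def)
  then have "y \<notin> ?K" using xy by auto
  ultimately show ?thesis using xy assms by blast
qed

text \<open>The orbit of \<open>v\<close> is an \<open>H\<close>-invariant ideal. As the identity is
  not among the operators by construction, the orbit might a priori be zero; this is what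
  \<open>ops_annihilated\<close> excludes.\<close>

lemma ops_irreducible:
  assumes v: "v \<in> B" "v \<noteq> 0" and w: "w \<in> B"
  obtains T where "T \<in> ops" "T v = w"
proof -
  let ?K = "{T v | T. T \<in> ops}"
  have "?K = {0} \<or> ?K = B"
  proof (rule B_ideal_cases)
    show "?K \<subseteq> B" using ops_in_B by blast
    show "A.subspace ?K"
    proof (rule A.subspaceI)
      show "0 \<in> ?K" using ops_0 by force
    next
      fix x y assume "x \<in> ?K" "y \<in> ?K"
      then obtain S T where "S \<in> ops" "T \<in> ops" "x = S v" "y = T v" by blast
      then show "x + y \<in> ?K" using ops_add[of S T] by force
    next
      fix c x assume "x \<in> ?K"
      then obtain S where "S \<in> ops" "x = S v" by blast
      then show "sA c x \<in> ?K" using ops_scale[of S c] by force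
    qed
    fix x b assume "x \<in> ?K" and b: "b \<in> B"
    then obtain S where "S \<in> ops" "x = S v" by blast
    then show "b * x \<in> ?K" "x * b \<in> ?K"
      using hfun_ops_comp[of S, OF _ hfun_left[OF b]] hfun_ops_comp[of S, OF _ hfun_right[OF b]] by force+
  next
    fix x h assume "x \<in> ?K"
    then obtain S where "S \<in> ops" "x = S v" by blast
    then show "act h x \<in> ?K" using hfun_ops_comp[of S, OF _ hfun_unit_act[of h]] by force
  qed
  moreover have "?K \<noteq> {0}" using ops_annihilated[OF v(1)] v(2) by blast
  ultimately have "w \<in> ?K" using w by blast
  then show ?thesis using that by blast
qed

section \<open>Schur's lemma and the density theorem\<close>

lemma exists_eigenvector:
  fixes D :: "'a \<Rightarrow> 'a"
  assumes D_B: "\<And>x. x \<in> B \<Longrightarrow> D x \<in> B"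
    and D_add: "\<And>x y. x \<in> B \<Longrightarrow> y \<in> B \<Longrightarrow> D (x + y) = D x + D y"
    and D_scale: "\<And>c x. x \<in> B \<Longrightarrow> D (sA c x) = sA c (D x)"
  obtains c y where "y \<in> B" "y \<noteq> 0" "D y = sA c y"
proof -
  obtain x y where "x \<in> B" "x * y \<noteq> 0" by (rule B_prod_nonzero)
  then obtain x0 where x0: "x0 \<in> B" "x0 \<noteq> 0" by force
  have D_0: "D 0 = 0" using D_scale[OF B_0, of 0] by simp
  define ev where "ev p x = fold_coeffs (\<lambda>a y. sA a x + D y) p 0" for p x
  have ev_0: "ev 0 x = 0" for x by (simp add: ev_def)
  have ev_pCons: "ev (pCons a p) x = sA a x + D (ev p x)" for a p x
    by (cases "p = 0 \<and> a = 0") (auto simp: ev_def D_0)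
  have ev_B: "ev p x \<in> B" if "x \<in> B" for p x
    by (induction p) (auto simp: ev_0 ev_pCons that B_0 intro!: B_add B_scale D_B)
  have ev_add: "ev (p + q) x = ev p x + ev q x" if "x \<in> B" for p q x
    by (induction p q rule: poly_induct2)
      (auto simp: ev_0 ev_pCons that D_add ev_B A.scale_left_distrib algebra_simps)
  have ev_smult: "ev (Polynomial.smult c p) x = sA c (ev p x)" if "x \<in> B" for c p x
    by (induction p) (auto simp: ev_0 ev_pCons that D_scale ev_B A.scale_right_distrib)
  \<comment> \<open>A linear factor is split off, p = (X - z) q: either q(D) x = 0 with smaller
    degree, or q(D) x is an eigenvector.\<close>
  have root: "\<exists>c y. y \<in> B \<and> y \<noteq> 0 \<and> D y = sA c y" if "p \<noteq> 0" "x \<in> B" "x \<noteq> 0" "ev p x = 0" for p x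
    using that
  proof (induction "degree p" arbitrary: p rule: less_induct)
    case less
    show ?case
    proof (cases "degree p = 0")
      case True
      then obtain a where "p = [:a:]" by (rule degree_eq_zeroE)
      then show ?thesis using less by (auto simp: ev_pCons ev_0 D_0)
    next
      case False
      then obtain z where "poly p z = 0" using alg_closed_imp_poly_has_root[of p] by auto
      then obtain q where q: "p = [:- z, 1:] * q" unfolding poly_eq_0_iff_dvd by (auto elim: dvdE)
      then have "q \<noteq> 0" using less by auto
      then have deg: "degree q < degree p" unfolding q by (subst degree_mult_eq) auto
      have "p = Polynomial.smult (- z) q + pCons 0 q" unfolding q by simp
      then have "ev p x = sA (- z) (ev q x) + D (ev q x)"
        using less by (simp only: ev_add ev_smult ev_pCons) simp
      then have D: "D (ev q x) = sA z (ev q x)" using less by (simp add: eq_neg_iff_add_eq_0 add.commute)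
      show ?thesis
      proof (cases "ev q x = 0")
        case True
        then show ?thesis using less.hyps[OF deg] \<open>q \<noteq> 0\<close> less.prems by blast
      next
        case False
        then show ?thesis using D ev_B less by blast
      qed
    qed
  qed
  obtain a where a: "(D ^^ a) x0 \<in> A.span {(D ^^ n) x0 | n. n > a}"
    using A.exists_in_later_span[of "\<lambda>n. (D ^^ n) x0"] by blast
  have ev_monom: "ev (Polynomial.monom 1 n) x0 = (D ^^ n) x0" for n
    by (induction n) (auto simp: monom_0 monom_Suc ev_pCons ev_0 D_0)
  have "\<exists>q. (\<forall>i\<le>a. coeff q i = 0) \<and> z = ev q x0" if "z \<in> A.span {(D ^^ n) x0 | n. n > a}" for z
    using that
  proof (induction rule: A.span_induct_alt)
    case base
    show ?case by (intro exI[of _ 0]) (auto simp: ev_0)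
  next
    case (step c u z)
    then obtain n q where "u = (D ^^ n) x0" "n > a" "\<forall>i\<le>a. coeff q i = 0" "z = ev q x0" by blast
    then show ?case
      using x0 by (intro exI[of _ "Polynomial.smult c (Polynomial.monom 1 n) + q"]) (auto simp: ev_add ev_smult ev_monom)
  qed
  from this[OF a] obtain q where q: "\<forall>i\<le>a. coeff q i = 0" "(D ^^ a) x0 = ev q x0" by blast
  \<comment> \<open>\<open>q\<close> involves only powers above \<open>a\<close>, so the coefficient
    of \<open>?p\<close> at \<open>a\<close> is 1.\<close>
  let ?p = "Polynomial.monom 1 a + Polynomial.smult (- 1) q"
  have "coeff ?p a = 1" using q by simp
  then have "?p \<noteq> 0" by (metis coeff_0 zero_neq_one)
  moreover have "ev ?p x0 = 0" using x0 q by (simp only: ev_add ev_smult ev_monom) simp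
  ultimately show ?thesis using root[of ?p x0] x0 that by blast
qed

lemma schur:
  fixes D :: "'a \<Rightarrow> 'a"
  assumes D_B: "\<And>x. x \<in> B \<Longrightarrow> D x \<in> B"
    and D_add: "\<And>x y. x \<in> B \<Longrightarrow> y \<in> B \<Longrightarrow> D (x + y) = D x + D y"
    and D_scale: "\<And>c x. x \<in> B \<Longrightarrow> D (sA c x) = sA c (D x)"
    and D_ops: "\<And>T x. T \<in> ops \<Longrightarrow> x \<in> B \<Longrightarrow> D (T x) = T (D x)"
  obtains c where "\<And>x. x \<in> B \<Longrightarrow> D x = sA c x"
proof -
  obtain c y where y: "y \<in> B" "y \<noteq> 0" "D y = sA c y"
    using exists_eigenvector[OF D_B D_add D_scale] by blast
  have "D x = sA c x" if x: "x \<in> B" for x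
  proof -
    obtain T where T: "T \<in> ops" "T y = x" using ops_irreducible[OF y(1,2) x] .
    show ?thesis using D_ops[OF T(1) y(1)] y ops_linear[OF T(1)] T by simp
  qed
  then show ?thesis using that by blast
qed

text \<open>Jacobson's density theorem, with scalars as the commuting operators by Schur's lemma. If
  every operator that kills \<open>V\<close> also killed \<open>v0\<close>, then T v0 would be
  determined by the values of T on \<open>V\<close>. So \<open>R v w v0\<close> would depend on
  \<open>w\<close> by a map commuting with all operators, a scalar \<open>c v\<close>, and
  \<open>v0 - (\<Sum>v\<in>V. sA (c v) v)\<close> would be annihilated by all operators, contrary to
  independence.\<close>

lemma density:
  assumes "finite V" "A.independent V" "V \<subseteq> B"
  shows "\<forall>v\<in>V. \<forall>w\<in>B. \<exists>T\<in>ops. T v = w \<and> (\<forall>u\<in>V - {v}. T u = 0)"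
  using assms
proof (induction V rule: finite_induct)
  case (insert v0 V)
  have indep: "A.independent V" using insert.prems(1) by (rule A.independent_mono) auto
  have v0: "v0 \<notin> A.span V" "v0 \<in> B" and VB: "V \<subseteq> B"
    using insert.prems insert.hyps by (auto simp: A.independent_insert)
  have IH: "\<exists>T\<in>ops. T v = w \<and> (\<forall>u\<in>V - {v}. T u = 0)" if "v \<in> V" "w \<in> B" for v w
    using insert.IH indep VB that by blast
  have "\<exists>T\<in>ops. (\<forall>u\<in>V. T u = 0) \<and> T v0 \<noteq> 0"
  proof (rule ccontr)
    assume "\<not> ?thesis"
    then have kill: "T v0 = 0" if "T \<in> ops" "\<forall>u\<in>V. T u = 0" for T using that by blast
    have uniq: "S v0 = T v0" if "S \<in> ops" "T \<in> ops" "\<forall>u\<in>V. S u = T u" for S T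
      using kill[OF ops_diff[OF that(1,2)]] that(3) by simp
    define R where "R v w = (SOME T. T \<in> ops \<and> T v = w \<and> (\<forall>u\<in>V - {v}. T u = 0))" for v w
    have R: "R v w \<in> ops" "R v w v = w" "\<And>u. u \<in> V - {v} \<Longrightarrow> R v w u = 0"
      if "v \<in> V" "w \<in> B" for v w
      using someI_ex[of "\<lambda>T. T \<in> ops \<and> T v = w \<and> (\<forall>u\<in>V - {v}. T u = 0)"] IH[OF that]
      unfolding R_def by blast+
    have "\<exists>c. \<forall>w\<in>B. R v w v0 = sA c w" if v: "v \<in> V" for v
    proof -
      have radd: "R v (x + y) v0 = R v x v0 + R v y v0" if "x \<in> B" "y \<in> B" for x y
      proof (rule uniq[of "R v (x + y)" "\<lambda>z. R v x z + R v y z"])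
        show "\<forall>u\<in>V. R v (x + y) u = R v x u + R v y u"
        proof
          fix u assume "u \<in> V"
          then show "R v (x + y) u = R v x u + R v y u"
            using R[OF v] that B_add by (cases "u = v") auto
        qed
      qed (use R(1)[OF v] that B_add ops_add in auto)
      have rscale: "R v (sA c x) v0 = sA c (R v x v0)" if "x \<in> B" for x c
      proof (rule uniq[of "R v (sA c x)" "\<lambda>z. sA c (R v x z)"])
        show "\<forall>u\<in>V. R v (sA c x) u = sA c (R v x u)"
        proof
          fix u assume "u \<in> V"
          then show "R v (sA c x) u = sA c (R v x u)"
            using R[OF v] that B_scale by (cases "u = v") auto
        qed
      qed (use R(1)[OF v] that B_scale ops_scale in auto)
      have rops: "R v (T x) v0 = T (R v x v0)" if "T \<in> ops" "x \<in> B" for T x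
      proof (rule uniq[of "R v (T x)" "\<lambda>z. T (R v x z)"])
        have T0: "T 0 = 0" using ops_linear(2)[OF that(1), of 0 0] by simp
        show "\<forall>u\<in>V. R v (T x) u = T (R v x u)"
        proof
          fix u assume "u \<in> V"
          then show "R v (T x) u = T (R v x u)"
            using R[OF v] that ops_in_B T0 by (cases "u = v") auto
        qed
      qed (use R(1)[OF v] that ops_in_B ops_comp in auto)
      show ?thesis
      proof (rule schur[of "\<lambda>w. R v w v0"])
        fix c assume "\<And>x. x \<in> B \<Longrightarrow> R v x v0 = sA c x"
        then show ?thesis by blast
      qed (simp_all add: radd rscale rops ops_in_B R(1)[OF v])
    qed
    then obtain c where c: "\<And>v w. v \<in> V \<Longrightarrow> w \<in> B \<Longrightarrow> R v w v0 = sA (c v) w" by metis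
    let ?x = "v0 - (\<Sum>v\<in>V. sA (c v) v)"
    have "T ?x = 0" if T: "T \<in> ops" for T
    proof -
      have "T v0 = (\<Sum>v\<in>V. R v (T v) v0)"
      proof (rule uniq[OF T ops_sum])
        show "\<forall>u\<in>V. T u = (\<Sum>v\<in>V. R v (T v) u)"
        proof
          fix u assume u: "u \<in> V"
          have "(\<Sum>v\<in>V. R v (T v) u) = (\<Sum>v\<in>V. if v = u then T u else 0)"
            using u R ops_in_B[OF T] by (intro sum.cong) auto
          then show "T u = (\<Sum>v\<in>V. R v (T v) u)" using u insert.hyps by simp
        qed
      qed (use R ops_in_B[OF T] in auto)
      also have "\<dots> = (\<Sum>v\<in>V. sA (c v) (T v))" using c ops_in_B[OF T] by (intro sum.cong) auto
      finally have eq: "T v0 = (\<Sum>v\<in>V. sA (c v) (T v))" .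
      have T0: "T 0 = 0" using ops_linear(2)[OF T, of 0 0] by simp
      have "T (\<Sum>v\<in>V. sA (c v) v) = (\<Sum>v\<in>V. sA (c v) (T v))"
        using insert.hyps(1) by (induction V rule: finite_induct) (auto simp: T0 ops_linear[OF T])
      moreover have "T v0 = T ?x + T (\<Sum>v\<in>V. sA (c v) v)"
        using ops_linear(1)[OF T, of ?x "\<Sum>v\<in>V. sA (c v) v"] by simp
      ultimately show ?thesis using eq by simp
    qed
    moreover have "?x \<in> B" using v0 VB by (intro B_diff B_sum B_scale) auto
    ultimately have "?x = 0" using ops_annihilated by blast
    then have "v0 = (\<Sum>v\<in>V. sA (c v) v)" by simp
    also have "\<dots> \<in> A.span V" by (intro A.span_sum A.span_scale A.span_base)
    finally show False using v0 by blast
  qed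
  then obtain T0 where T0: "T0 \<in> ops" "\<And>u. u \<in> V \<Longrightarrow> T0 u = 0" "T0 v0 \<noteq> 0" by blast
  have first: "\<exists>T\<in>ops. T v0 = w \<and> (\<forall>u\<in>V. T u = 0)" if w: "w \<in> B" for w
  proof -
    obtain S where S: "S \<in> ops" "S (T0 v0) = w"
      using ops_irreducible[OF ops_in_B[OF T0(1)] T0(3) w] .
    have "S 0 = 0" using ops_linear(2)[OF S(1), of 0 0] by simp
    then show ?thesis using ops_comp[OF S(1) T0(1)] S T0 by (intro bexI[of _ "\<lambda>x. S (T0 x)"]) auto
  qed
  show ?case
  proof (intro ballI)
    fix v w assume v: "v \<in> insert v0 V" and w: "w \<in> B"
    show "\<exists>T\<in>ops. T v = w \<and> (\<forall>u\<in>insert v0 V - {v}. T u = 0)"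
    proof (cases "v = v0")
      case True
      then show ?thesis using first[OF w] insert.hyps by auto
    next
      case False
      then have vV: "v \<in> V" using v by auto
      then obtain T where T: "T \<in> ops" "T v = w" "\<And>u. u \<in> V \<Longrightarrow> u \<noteq> v \<Longrightarrow> T u = 0"
        using IH[OF vV w] by blast
      obtain S where S: "S \<in> ops" "S v0 = T v0" "\<And>u. u \<in> V \<Longrightarrow> S u = 0"
        using first[OF ops_in_B[OF T(1)], of v0] by blast
      have "T u - S u = 0" if "u \<in> insert v0 V - {v}" for u
        using that T(3)[of u] S by auto
      then show ?thesis
        using ops_diff[OF T(1) S(1)] T S vV by (intro bexI[of _ "\<lambda>x. T x - S x"]) auto
    qed
  qed
qed simp

end

section \<open>The trace form and determinants\<close>

lemma det_mat:
  fixes X :: "nat \<Rightarrow> nat \<Rightarrow> 'f::comm_ring_1"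
  shows "det (mat m m (\<lambda>(i, j). X i j)) = (\<Sum>p | p permutes {0..<m}. signof p * (\<Prod>i=0..<m. X i (p i)))"
proof -
  have "(\<Prod>i=0..<m. mat m m (\<lambda>(i, j). X i j) $$ (i, p i)) = (\<Prod>i=0..<m. X i (p i))"
    if "p permutes {0..<m}" for p
    using permutes_in_image[OF that] by (intro prod.cong) auto
  then show ?thesis by (subst det_def'[of _ m]) (auto intro!: sum.cong)
qed

text \<open>Differentiating \<open>det X\<close> in the direction \<open>M X\<close> multiplies it by the trace of \<open>M\<close>.\<close>

lemma sum_det_mult_column:
  fixes X M :: "nat \<Rightarrow> nat \<Rightarrow> 'f::comm_ring_1"
  shows "(\<Sum>a=0..<m. det (mat m m (\<lambda>(i, j). if j = a then \<Sum>r=0..<m. M i r * X r j else X i j)))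
    = (\<Sum>a=0..<m. M a a) * det (mat m m (\<lambda>(i, j). X i j))"
proof -
  let ?D = "\<lambda>X. \<Sum>p | p permutes {0..<m}. signof p * (\<Prod>i=0..<m. X i (p i))"
  have replace: "?D (\<lambda>i j. X (if i = b then r else i) j) = (if r = b then ?D X else 0)"
    if "b < m" "r < m" for b r
  proof (cases "r = b")
    case True
    then have "(if i = b then r else i) = i" for i by auto
    then show ?thesis using True by (simp only: simp_thms if_True)
  next
    case False
    have "det (mat m m (\<lambda>(i, j). X (if i = b then r else i) j)) = 0"
      by (rule det_identical_rows[of _ m b r]) (use that False in \<open>auto intro!: eq_vecI\<close>)
    then show ?thesis using False by (simp only: det_mat if_False)
  qed
  have "(\<Sum>a=0..<m. \<Prod>i=0..<m. if p i = a then \<Sum>r=0..<m. M i r * X r (p i) else X i (p i))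
      = (\<Sum>b=0..<m. \<Sum>r=0..<m. M b r * (\<Prod>i=0..<m. X (if i = b then r else i) (p i)))"
    if p: "p permutes {0..<m}" for p
  proof -
    \<comment> \<open>After the substitution a = p b the summand changes exactly the factor with row
      index b. The derivative by columns thus becomes a derivative by rows, to which
      \<open>replace\<close> applies.\<close>
    have "(\<Sum>a=0..<m. \<Prod>i=0..<m. if p i = a then \<Sum>r=0..<m. M i r * X r (p i) else X i (p i))
        = (\<Sum>b=0..<m. \<Prod>i=0..<m. if p i = p b then \<Sum>r=0..<m. M i r * X r (p i) else X i (p i))"
      using sum.permute[OF p, of "\<lambda>a. \<Prod>i=0..<m. if p i = a then \<Sum>r=0..<m. M i r * X r (p i) else X i (p i)"]
      by (simp add: o_def)
    also have "\<dots> = (\<Sum>b=0..<m. \<Sum>r=0..<m. M b r * (\<Prod>i=0..<m. X (if i = b then r else i) (p i)))"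
    proof (rule sum.cong[OF refl])
      fix b assume b: "b \<in> {0..<m}"
      have inj: "p i = p b \<longleftrightarrow> i = b" for i using permutes_inj[OF p] by (auto dest: injD)
      have "(\<Prod>i=0..<m. if p i = p b then \<Sum>r=0..<m. M i r * X r (p i) else X i (p i))
         = (\<Sum>r=0..<m. M b r * X r (p b)) * (\<Prod>i\<in>{0..<m}-{b}. X i (p i))"
        using prod.remove[OF _ b, of "\<lambda>i. if p i = p b then \<Sum>r=0..<m. M i r * X r (p i) else X i (p i)"]
        by (simp add: inj)
      also have "\<dots> = (\<Sum>r=0..<m. M b r * (X r (p b) * (\<Prod>i\<in>{0..<m}-{b}. X i (p i))))"
        by (simp add: sum_distrib_right mult.assoc)
      also have "\<dots> = (\<Sum>r=0..<m. M b r * (\<Prod>i=0..<m. X (if i = b then r else i) (p i)))"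
      proof (rule sum.cong[OF refl])
        fix r
        have "(\<Prod>i=0..<m. X (if i = b then r else i) (p i))
            = X r (p b) * (\<Prod>i\<in>{0..<m}-{b}. X i (p i))"
          using prod.remove[OF _ b, of "\<lambda>i. X (if i = b then r else i) (p i)"] by simp
        then show "M b r * (X r (p b) * (\<Prod>i\<in>{0..<m}-{b}. X i (p i)))
            = M b r * (\<Prod>i=0..<m. X (if i = b then r else i) (p i))" by simp
      qed
      finally show "(\<Prod>i=0..<m. if p i = p b then \<Sum>r=0..<m. M i r * X r (p i) else X i (p i))
          = (\<Sum>r=0..<m. M b r * (\<Prod>i=0..<m. X (if i = b then r else i) (p i)))" .
    qed
    finally show ?thesis .
  qed
  then have "(\<Sum>p | p permutes {0..<m}. signof p
        * (\<Sum>a=0..<m. \<Prod>i=0..<m. if p i = a then \<Sum>r=0..<m. M i r * X r (p i) else X i (p i)))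
      = (\<Sum>p | p permutes {0..<m}. signof p
        * (\<Sum>b=0..<m. \<Sum>r=0..<m. M b r * (\<Prod>i=0..<m. X (if i = b then r else i) (p i))))"
    by (intro sum.cong) auto
  also have "\<dots> = (\<Sum>p | p permutes {0..<m}. \<Sum>b=0..<m. \<Sum>r=0..<m. M b r
        * (signof p * (\<Prod>i=0..<m. X (if i = b then r else i) (p i))))"
    by (simp only: sum_distrib_left mult.left_commute)
  also have "\<dots> = (\<Sum>b=0..<m. \<Sum>p | p permutes {0..<m}. \<Sum>r=0..<m. M b r
        * (signof p * (\<Prod>i=0..<m. X (if i = b then r else i) (p i))))"
    by (rule sum.swap)
  also have "\<dots> = (\<Sum>b=0..<m. \<Sum>r=0..<m. M b r * ?D (\<lambda>i j. X (if i = b then r else i) j))"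
    unfolding sum_distrib_left by (intro sum.cong refl sum.swap)
  also have "\<dots> = (\<Sum>b=0..<m. \<Sum>r=0..<m. M b r * (if r = b then ?D X else 0))"
    by (intro sum.cong refl arg_cong2[of _ _ _ _ "(*)"] replace) auto
  also have "\<dots> = (\<Sum>b=0..<m. M b b * ?D X)"
    by (intro sum.cong refl) (simp add: if_distrib cong: if_cong)
  also have "\<dots> = (\<Sum>b=0..<m. M b b) * ?D X" by (rule sum_distrib_right[symmetric])
  finally have eq: "(\<Sum>p | p permutes {0..<m}. signof p
        * (\<Sum>a=0..<m. \<Prod>i=0..<m. if p i = a then \<Sum>r=0..<m. M i r * X r (p i) else X i (p i)))
      = (\<Sum>b=0..<m. M b b) * ?D X" .
  have "(\<Sum>a=0..<m. \<Sum>p | p permutes {0..<m}. signof p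
        * (\<Prod>i=0..<m. if p i = a then \<Sum>r=0..<m. M i r * X r (p i) else X i (p i)))
      = (\<Sum>p | p permutes {0..<m}. \<Sum>a=0..<m. signof p
        * (\<Prod>i=0..<m. if p i = a then \<Sum>r=0..<m. M i r * X r (p i) else X i (p i)))"
    by (rule sum.swap)
  also have "\<dots> = (\<Sum>b=0..<m. M b b) * ?D X"
    unfolding sum_distrib_left[symmetric] by (rule eq)
  finally show ?thesis unfolding det_mat .
qed

lemma prod_list_map_upt: "prod_list (map f [0..<n]) = (\<Prod>i=0..<n. f i)"
  for f :: "nat \<Rightarrow> 'f::comm_monoid_mult"
  by (induction n) (auto simp: mult.commute)

context H_simple_block
begin

text \<open>Coordinate functions of the block. They are linear on \<open>B\<close> only: outside the
  span \<open>representation\<close> is 0 by convention.\<close>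

definition co :: "nat \<Rightarrow> 'a \<Rightarrow> 'f" where
  "co c x = A.representation (e ` {..<m}) x (e c)"

lemma e_in_B: "c < m \<Longrightarrow> e c \<in> B"
  using A.span_base[of "e c" "e ` {..<m}"] span_e by auto

lemma co_add: "x \<in> B \<Longrightarrow> y \<in> B \<Longrightarrow> co c (x + y) = co c x + co c y"
  unfolding co_def by (subst A.representation_add[OF indep_e]) (auto simp: span_e)

lemma co_scale: "x \<in> B \<Longrightarrow> co c (sA a x) = a * co c x"
  unfolding co_def by (subst A.representation_scale[OF indep_e]) (auto simp: span_e)

lemma co_0: "co c 0 = 0"
  by (simp add: co_def A.representation_zero)

lemma co_sum: "(\<And>i. i \<in> S \<Longrightarrow> f i \<in> B) \<Longrightarrow> co c (sum f S) = (\<Sum>i\<in>S. co c (f i))"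
  by (induction S rule: infinite_finite_induct) (auto simp: co_0 co_add B_sum)

lemma co_e: "c < m \<Longrightarrow> c' < m \<Longrightarrow> co c (e c') = (if c = c' then 1 else 0)"
  unfolding co_def using inj_e by (subst A.representation_basis[OF indep_e]) (auto simp: inj_on_def)

lemma sum_co: "x \<in> B \<Longrightarrow> (\<Sum>c=0..<m. sA (co c x) (e c)) = x"
proof -
  assume x: "x \<in> B"
  have "(\<Sum>b\<in>e ` {..<m}. sA (A.representation (e ` {..<m}) x b) b) = x"
    by (rule A.sum_representation_eq[OF indep_e]) (use x in \<open>auto simp: span_e\<close>)
  then show ?thesis
    by (subst (asm) sum.reindex[OF inj_e]) (simp add: co_def o_def atLeast0LessThan)
qed

text \<open>Computed in a basis \<open>F\<close> of xB instead of in \<open>e\<close>, the trace of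
  left multiplication by \<open>x\<close> is the number of elements of \<open>F\<close>, because
  \<open>x\<close> fixes xB pointwise; it is not 0 since the characteristic is 0. Interchanging the
  two sums is the identity tr(PQ) = tr(QP).\<close>

lemma trace_idempotent_nonzero:
  assumes x: "x \<in> B" "x * x = x" "x \<noteq> 0"
  shows "(\<Sum>c=0..<m. co c (x * e c)) \<noteq> 0"
proof -
  let ?S = "{x * b | b. b \<in> B}"
  obtain F where F: "F \<subseteq> ?S" "A.independent F" "?S \<subseteq> A.span F"
    using A.maximal_independent_subset[of ?S] by blast
  have fin: "finite F" by (rule A.fd_independent[OF F(2)])
  have "x \<in> A.span F" using x F(3) by force
  then have ne: "F \<noteq> {}" using x(3) by auto
  let ?q = "A.representation F"
  have FB: "f \<in> B" "x * f = f" if "f \<in> F" for f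
    using F(1) that x by (auto intro: B_mult simp: mult.assoc[symmetric])
  have "(\<Sum>c=0..<m. co c (x * e c)) = (\<Sum>c=0..<m. \<Sum>f\<in>F. ?q (x * e c) f * co c f)"
  proof (rule sum.cong[OF refl])
    fix c assume c: "c \<in> {0..<m}"
    have "x * e c = (\<Sum>f\<in>F. sA (?q (x * e c) f) f)"
      by (rule sym, rule A.sum_representation_eq[OF F(2)]) (use F(3) e_in_B c fin in auto)
    then have "co c (x * e c) = co c (\<Sum>f\<in>F. sA (?q (x * e c) f) f)" by simp
    also have "\<dots> = (\<Sum>f\<in>F. ?q (x * e c) f * co c f)"
      using FB by (subst co_sum) (auto simp: co_scale B_scale)
    finally show "co c (x * e c) = (\<Sum>f\<in>F. ?q (x * e c) f * co c f)" .
  qed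
  also have "\<dots> = (\<Sum>f\<in>F. \<Sum>c=0..<m. ?q (x * e c) f * co c f)" by (rule sum.swap)
  also have "\<dots> = (\<Sum>f\<in>F. 1)"
  proof (rule sum.cong[OF refl])
    fix f assume f: "f \<in> F"
    have xe: "x * e c \<in> A.span F" if "c \<in> {0..<m}" for c using F(3) e_in_B that by auto
    have "f = x * (\<Sum>c=0..<m. sA (co c f) (e c))" using FB[OF f] by (simp add: sum_co)
    also have "\<dots> = (\<Sum>c=0..<m. sA (co c f) (x * e c))"
      by (simp add: sum_distrib_left A.scale_mult_right)
    finally have "?q f f = ?q (\<Sum>c=0..<m. sA (co c f) (x * e c)) f" by simp
    also have "\<dots> = (\<Sum>c=0..<m. ?q (sA (co c f) (x * e c)) f)"
      by (subst A.representation_sum[OF F(2)]) (simp_all add: xe A.span_scale)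
    also have "\<dots> = (\<Sum>c=0..<m. ?q (x * e c) f * co c f)"
      by (intro sum.cong refl, subst A.representation_scale[OF F(2)]) (auto intro: xe simp: mult.commute)
    finally show "(\<Sum>c=0..<m. ?q (x * e c) f * co c f) = 1"
      using A.representation_basis[OF F(2) f] by simp
  qed
  finally show ?thesis using ne fin by simp
qed

text \<open>The trace of left multiplication by uv on the block. The arguments may lie anywhere in
  the algebra, also in other blocks; with the bracketing u (v e) every intermediate product is in
  \<open>B\<close>.\<close>

definition form :: "'a \<Rightarrow> 'a \<Rightarrow> 'f" where
  "form u v = (\<Sum>c=0..<m. co c (u * (v * e c)))"

lemma uve_in_B: "c < m \<Longrightarrow> u * (v * e c) \<in> B"
  by (intro B_mult e_in_B)

lemma form_eq_trace: "form x u = (\<Sum>c=0..<m. co c (x * u * e c))"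
  by (simp add: form_def mult.assoc)

lemma form_0_left: "form 0 u = 0" and form_0_right: "form u 0 = 0"
  by (simp_all add: form_def co_0)

lemma form_add_left: "form (x + y) u = form x u + form y u"
  and form_add_right: "form u (x + y) = form u x + form u y"
  unfolding form_def sum.distrib[symmetric]
  by (intro sum.cong refl; simp add: distrib_left distrib_right co_add uve_in_B)+

lemma form_scale_left: "form (sA a x) u = a * form x u"
  and form_scale_right: "form u (sA a x) = a * form u x"
  unfolding form_def sum_distrib_left
  by (intro sum.cong refl; simp add: A.scale_mult_left A.scale_mult_right co_scale uve_in_B)+

lemma form_sum_left: "form (sum f S) u = (\<Sum>i\<in>S. form (f i) u)"
  and form_sum_right: "form u (sum f S) = (\<Sum>i\<in>S. form u (f i))"
  by (induction S rule: infinite_finite_induct)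
    (auto simp: form_0_left form_0_right form_add_left form_add_right)

text \<open>If \<open>B\<close> is orthogonal to \<open>u\<close>, every idempotent of the left
  ideal Bu has trace 0 and is therefore 0, so Bu is nil and vanishes. The elements z of
  \<open>B\<close> with Bz = 0 form a left ideal whose elements have square zero, so it vanishes as
  well.\<close>

lemma form_nondegenerate:
  assumes u: "u \<in> B" and form: "\<And>x. x \<in> B \<Longrightarrow> form x u = 0"
  shows "u = 0"
proof -
  let ?I = "{x * u | x. x \<in> B}"
  have sub: "A.subspace ?I"
  proof (rule A.subspaceI)
    show "0 \<in> ?I" using B_0 by force
  next
    fix y z assume "y \<in> ?I" "z \<in> ?I"
    then obtain y' z' where "y = y' * u" "z = z' * u" "y' \<in> B" "z' \<in> B" by blast
    then have "y + z = (y' + z') * u" "y' + z' \<in> B" by (auto simp: distrib_right B_add)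
    then show "y + z \<in> ?I" by blast
  next
    fix c y assume "y \<in> ?I"
    then obtain y' where "y = y' * u" "y' \<in> B" by blast
    then have "sA c y = sA c y' * u" "sA c y' \<in> B" by (auto simp: A.scale_mult_left B_scale)
    then show "sA c y \<in> ?I" by blast
  qed
  have left: "a * y \<in> ?I" if "y \<in> ?I" for a y
  proof -
    from that obtain y' where "y = y' * u" "y' \<in> B" by blast
    then have "a * y = (a * y') * u" "a * y' \<in> B" by (auto simp: mult.assoc B_mult)
    then show ?thesis by blast
  qed
  have "?I \<subseteq> {0}"
  proof (rule semisimple)
    show "left_ideal ?I"
      unfolding left_ideal_def using left A.subspace_0[OF sub] A.subspace_diff[OF sub] by blast
    fix y assume y: "y \<in> ?I"
    show "\<exists>n. pw y n = 0"
    proof (rule ccontr)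
      assume "\<not> ?thesis"
      then obtain z where z: "z \<in> A.span (range (pw y))" "z * z = z" "z \<noteq> 0"
        using A.idempotent_of_non_nilpotent[of y] by blast
      have "pw y n \<in> ?I" for n by (induction n) (use y left in auto)
      then have "A.span (range (pw y)) \<subseteq> ?I" by (intro A.span_minimal sub) auto
      then obtain x where x: "x \<in> B" "z = x * u" using z(1) by blast
      then have "form x u \<noteq> 0"
        using trace_idempotent_nonzero[of z] z B_mult by (simp add: form_eq_trace)
      then show False using form x by blast
    qed
  qed
  then have xu: "x * u = 0" if "x \<in> B" for x using that by blast
  let ?K = "{z \<in> B. \<forall>x\<in>B. x * z = 0}"
  have "?K \<subseteq> {0}"
  proof (rule semisimple)
    show "left_ideal ?K"
      unfolding left_ideal_def
    proof (intro conjI ballI allI)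
      show "0 \<in> ?K" using B_0 by simp
      show "y - z \<in> ?K" if "y \<in> ?K" "z \<in> ?K" for y z
        using that by (simp add: B_diff right_diff_distrib)
      show "a * z \<in> ?K" if z: "z \<in> ?K" for a z
      proof -
        have "x * (a * z) = 0" if "x \<in> B" for x
          using z B_mult(2)[OF that, of a] by (simp add: mult.assoc[symmetric])
        then show ?thesis using z B_mult(1) by simp
      qed
    qed
    fix z assume "z \<in> ?K"
    then have "pw z 1 = 0" by auto
    then show "\<exists>n. pw z n = 0" by blast
  qed
  then show ?thesis using u xu by blast
qed

lemma det_form_nonzero: "det (mat m m (\<lambda>(c, c'). form (e c) (e c'))) \<noteq> 0"
proof
  let ?M = "mat m m (\<lambda>(c, c'). form (e c) (e c'))"
  assume "det ?M = 0"
  then obtain v where v: "v \<in> carrier_vec m" "v \<noteq> 0\<^sub>v m" "?M *\<^sub>v v = 0\<^sub>v m"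
    using det_0_iff_vec_prod_zero[of ?M m] by auto
  let ?u = "\<Sum>c=0..<m. sA (v $ c) (e c)"
  have uB: "?u \<in> B" by (intro B_sum B_scale e_in_B) auto
  have eu: "form (e a) ?u = 0" if a: "a < m" for a
  proof -
    have "form (e a) ?u = (\<Sum>c=0..<m. form (e a) (e c) * v $ c)"
      by (simp add: form_sum_right form_scale_right mult.commute)
    also have "\<dots> = (?M *\<^sub>v v) $ a"
      using v(1) a by (auto simp: scalar_prod_def)
    finally show ?thesis using v(3) a by simp
  qed
  have "form x ?u = 0" if "x \<in> B" for x
  proof -
    have "form x ?u = form (\<Sum>c=0..<m. sA (co c x) (e c)) ?u" using sum_co[OF that] by simp
    also have "\<dots> = (\<Sum>c=0..<m. co c x * form (e c) ?u)"
      by (simp only: form_sum_left form_scale_left)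
    also have "\<dots> = 0" using eu by (intro sum.neutral) auto
    finally show ?thesis .
  qed
  then have u0: "?u = 0" by (rule form_nondegenerate[OF uB])
  have "v $ c = 0" if c: "c < m" for c
  proof -
    have "co c ?u = (\<Sum>c'=0..<m. co c (sA (v $ c') (e c')))"
      by (intro co_sum B_scale e_in_B) auto
    also have "\<dots> = (\<Sum>c'=0..<m. if c' = c then v $ c' else 0)"
      using c by (intro sum.cong refl) (auto simp: co_scale e_in_B co_e)
    also have "\<dots> = v $ c" using c by simp
    finally show ?thesis using u0 by (simp add: co_0)
  qed
  then have "v = 0\<^sub>v m" using v(1) by (intro eq_vecI) auto
  then show False using v(2) by blast
qed

abbreviation det_co :: "(nat \<Rightarrow> 'a) \<Rightarrow> 'f" where
  "det_co x \<equiv> det (mat m m (\<lambda>(c, c'). co c (x c')))"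

lemma det_co_e: "det_co e = 1"
proof -
  have "mat m m (\<lambda>(c, c'). co c (e c')) = 1\<^sub>m m"
    by (intro eq_matI) (auto simp: co_e)
  then show ?thesis by simp
qed

text \<open>Replacing each column in turn by its image under left multiplication by uv is a
  derivative of the determinant and multiplies it by a trace. This is how values of the form arise
  from an alternating function.\<close>

lemma sum_det_co_derivation:
  assumes x: "\<And>c. c < m \<Longrightarrow> x c \<in> B"
  shows "(\<Sum>a=0..<m. det_co (x(a := u * (v * x a)))) = form u v * det_co x"
proof -
  have "co i (u * (v * x j)) = (\<Sum>r=0..<m. co i (u * (v * e r)) * co r (x j))" if "j < m" for i j
  proof -
    have "co i (u * (v * x j)) = co i (u * (v * (\<Sum>r=0..<m. sA (co r (x j)) (e r))))"
      using sum_co[OF x[OF that]] by simp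
    also have "\<dots> = co i (\<Sum>r=0..<m. sA (co r (x j)) (u * (v * e r)))"
      by (simp add: sum_distrib_left A.scale_mult_right)
    also have "\<dots> = (\<Sum>r=0..<m. co i (sA (co r (x j)) (u * (v * e r))))"
      by (intro co_sum B_scale uve_in_B) auto
    also have "\<dots> = (\<Sum>r=0..<m. co i (u * (v * e r)) * co r (x j))"
      by (intro sum.cong refl) (auto simp: co_scale uve_in_B)
    finally show ?thesis .
  qed
  then have "mat m m (\<lambda>(i, j). co i ((x(a := u * (v * x a))) j))
     = mat m m (\<lambda>(i, j). if j = a then \<Sum>r=0..<m. co i (u * (v * e r)) * co r (x j) else co i (x j))" for a
    by (intro eq_matI) auto
  then show ?thesis
    unfolding form_def by (simp only: sum_det_mult_column)
qed

end

lemma sum_mset_image_sum: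
  "(\<Sum>x\<in>#(\<Sum>i\<in>S. V i). T x) = (\<Sum>i\<in>S. \<Sum>x\<in>#V i. T x)"
  by (induction S rule: infinite_finite_induct) auto

lemma sum_mset_const_on: "(\<And>x. x \<in># V \<Longrightarrow> T x = {#x#}) \<Longrightarrow> (\<Sum>x\<in>#V. T x) = V"
  by (induction V) auto

lemma sum_list_map_upt: "sum_list (map f [0..<n]) = (\<Sum>i=0..<n. f i)"
  for f :: "nat \<Rightarrow> 'f::comm_monoid_add"
  by (induction n) (auto simp: add.commute)

section \<open>Functions whose values are products of determinants\<close>

context H_simple_block
begin

lemma exists_dual_op:
  assumes c: "c < m" and w: "w \<in> B"
  shows "\<exists>T\<in>ops. \<forall>x\<in>B. T x = sA (co c x) w"
proof -
  have "\<forall>v\<in>e ` {..<m}. \<forall>w\<in>B. \<exists>T\<in>ops. T v = w \<and> (\<forall>u\<in>e ` {..<m} - {v}. T u = 0)"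
    by (rule density) (use indep_e e_in_B in auto)
  then obtain T where T: "T \<in> ops" "T (e c) = w" "\<And>u. u \<in> e ` {..<m} - {e c} \<Longrightarrow> T u = 0"
    using c w by blast
  have Te: "T (e c') = (if c' = c then w else 0)" if "c' < m" for c'
    using T inj_e c that by (auto simp: inj_on_def)
  have T0: "T 0 = 0" using ops_linear(2)[OF T(1), of 0 0] by simp
  have Tsum: "T (sum f S) = (\<Sum>i\<in>S. T (f i))" for f and S :: "nat set"
    by (induction S rule: infinite_finite_induct) (auto simp: T0 ops_linear[OF T(1)])
  have "T x = sA (co c x) w" if x: "x \<in> B" for x
  proof -
    have "T x = T (\<Sum>c'=0..<m. sA (co c' x) (e c'))" using sum_co[OF x] by simp
    also have "\<dots> = (\<Sum>c'=0..<m. if c' = c then sA (co c x) w else 0)"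
      unfolding Tsum by (intro sum.cong refl) (auto simp: ops_linear[OF T(1)] Te)
    also have "\<dots> = sA (co c x) w" using c by simp
    finally show ?thesis .
  qed
  then show ?thesis using T(1) by blast
qed

lemma m_pos: "m > 0"
proof (rule ccontr)
  assume "\<not> m > 0"
  then have "B = {0}" using span_e by simp
  moreover obtain x y where "x \<in> B" "x * y \<noteq> 0" by (rule B_prod_nonzero)
  ultimately show False by auto
qed

text \<open>The variables \<open>(0, c)\<close> serve as a reservoir of \<open>m\<close> variables in which the function is
  alternating; the other variables \<open>(j + 1, c)\<close> form columns.\<close>

lemma exists_reservoir:
  "\<exists>N\<ge>1. \<exists>w\<in>B. w \<noteq> 0 \<and> (\<exists>f. hfun B (\<Sum>c=0..<m. {#(0::nat, c)#}) N f \<and>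
     (\<forall>\<psi>. (\<forall>c<m. \<psi> (0, c) \<in> B) \<longrightarrow> f \<psi> = sA (det_co (\<lambda>c. \<psi> (0, c))) w))"
proof -
  \<comment> \<open>One factor for each coordinate: the operator that extracts the coordinate
    \<open>c\<close> also delivers the factor \<open>ws ! c\<close>, so all terms are multiples of
    the same nonzero \<open>w\<close>.\<close>
  obtain ws where ws: "length ws = m" "set ws \<subseteq> B" "nonempty_prod ws \<noteq> 0"
    using exists_nonzero_prod[of "m - 1"] m_pos by auto
  define w where "w = nonempty_prod ws"
  have ws_map: "map ((!) ws) [0..<m] = ws" using ws(1) map_nth by blast
  have wB: "w \<in> B"
  proof -
    have "nonempty_prod us \<in> B" if "us \<noteq> []" "set us \<subseteq> B" for us
      using that
    proof (induction us)
      case (Cons u us)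
      then show ?case by (cases "us = []") (auto simp: nonempty_prod_Cons B_mult)
    qed simp
    then show ?thesis using ws m_pos unfolding w_def by fastforce
  qed
  have "\<forall>c<m. \<exists>T\<in>ops. \<forall>x\<in>B. T x = sA (co c x) (ws ! c)"
    using exists_dual_op ws nth_mem by blast
  then obtain T where T: "\<And>c. c < m \<Longrightarrow> T c \<in> ops"
    "\<And>c x. c < m \<Longrightarrow> x \<in> B \<Longrightarrow> T c x = sA (co c x) (ws ! c)" by metis
  have "\<forall>c<m. \<exists>N\<ge>1. hfun B {#()#} N (\<lambda>\<psi>. T c (\<psi> ()))" using T(1) by (auto simp: ops_def)
  then obtain N where N: "\<And>c. c < m \<Longrightarrow> N c \<ge> 1" "\<And>c. c < m \<Longrightarrow> hfun B {#()#} (N c) (\<lambda>\<psi>. T c (\<psi> ()))"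
    by metis
  define g where "g \<sigma> \<psi> = nonempty_prod (map (\<lambda>c. T c (\<psi> (0::nat, \<sigma> c))) [0..<m])"
    for \<sigma> :: "nat \<Rightarrow> nat" and \<psi> :: "nat \<times> nat \<Rightarrow> 'a"
  have g: "hfun B (\<Sum>c=0..<m. {#(0, c)#}) (\<Sum>c=0..<m. N c) (g \<sigma>)" if \<sigma>: "\<sigma> permutes {0..<m}" for \<sigma>
  proof -
    obtain m' where m': "m = Suc m'" using m_pos by (cases m) auto
    have "hfun B (\<Sum>c<m. {#(0::nat, \<sigma> c)#}) (\<Sum>c<m. N c)
        (\<lambda>\<psi>. nonempty_prod (map (\<lambda>c. T c (\<psi> (0, \<sigma> c))) [0..<m]))"
      unfolding m'
    proof (rule hfun_prod)
      fix c assume "c < Suc m'"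
      then show "hfun B {#(0, \<sigma> c)#} (N c) (\<lambda>\<psi>. T c (\<psi> (0, \<sigma> c)))"
        using hfun_rename[OF N(2)[of c], of "\<lambda>_. (0, \<sigma> c)"] m' by simp
    qed
    moreover have "(\<Sum>c<m. {#(0::nat, \<sigma> c)#}) = (\<Sum>c<m. {#(0, c)#})"
      using sum.permute[OF \<sigma>, of "\<lambda>c. {#(0::nat, c)#}"] by (simp add: o_def atLeast0LessThan)
    ultimately show ?thesis by (simp only: g_def[abs_def] atLeast0LessThan)
  qed
  \<comment> \<open>On arguments from \<open>B\<close> the functions \<open>g \<sigma>\<close> are
    the terms of the Leibniz formula up to sign, times \<open>w\<close>.\<close>
  define f where "f \<psi> = (\<Sum>\<sigma> | \<sigma> permutes {0..<m}. sA (signof \<sigma>) (g \<sigma> \<psi>))" for \<psi>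
  have "hfun B (\<Sum>c=0..<m. {#(0, c)#}) (\<Sum>c=0..<m. N c) f"
    unfolding f_def[abs_def] by (intro hfun_sum hfun_scale g) auto
  moreover have "f \<psi> = sA (det_co (\<lambda>c. \<psi> (0, c))) w" if \<psi>: "\<forall>c<m. \<psi> (0, c) \<in> B" for \<psi>
  proof -
    have "g \<sigma> \<psi> = sA (\<Prod>c=0..<m. co c (\<psi> (0, \<sigma> c))) w" if \<sigma>: "\<sigma> permutes {0..<m}" for \<sigma>
    proof -
      have "\<sigma> c < m" if "c < m" for c using permutes_in_image[OF \<sigma>, of c] that by simp
      then have "g \<sigma> \<psi> = nonempty_prod (map (\<lambda>c. sA (co c (\<psi> (0, \<sigma> c))) (ws ! c)) [0..<m])"
        unfolding g_def using \<psi> by (intro arg_cong[of _ _ nonempty_prod] map_cong refl T(2)) auto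
      also have "\<dots> = sA (\<Prod>c=0..<m. co c (\<psi> (0, \<sigma> c))) (nonempty_prod (map ((!) ws) [0..<m]))"
        using m_pos by (subst A.nonempty_prod_scale) (auto simp: prod_list_map_upt)
      finally show ?thesis by (simp add: ws_map w_def)
    qed
    then show ?thesis
      unfolding f_def det_mat A.scale_sum_left by (intro sum.cong) auto
  qed
  moreover have "w \<noteq> 0" using ws by (simp add: w_def)
  moreover have "(\<Sum>c=0..<m. N c) \<ge> 1"
  proof -
    have "N 0 \<le> (\<Sum>c=0..<m. N c)" using m_pos by (intro member_le_sum) auto
    then show ?thesis using N(1)[OF m_pos] by simp
  qed
  ultimately show ?thesis using wB by blast
qed

text \<open>Each summand is a substitution. Since \<open>(0, a)\<close> occurs exactly once, it adds
  \<open>u\<close> and \<open>v\<close> once to the variables and adds no constants.\<close>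

lemma hfun_derivation:
  fixes u v :: "nat \<times> nat"
  assumes g: "hfun B V N g" and V: "\<And>a. a < m \<Longrightarrow> count V (0, a) = 1"
  shows "hfun B (V + {#u, v#}) N (\<lambda>\<psi>. \<Sum>a=0..<m. g (\<psi>((0, a) := \<psi> u * (\<psi> v * \<psi> (0, a)))))"
proof (rule hfun_sum)
  fix a assume a: "a \<in> {0..<m}"
  let ?x = "(0, a)"
  have count: "count V ?x = 1" using V a by simp
  then have "?x \<in># V" by (simp flip: count_greater_zero_iff)
  then obtain V' where V'_eq: "V = add_mset ?x V'" by (blast dest: multi_member_split)
  then have V': "V = add_mset ?x V'" "?x \<notin># V'" using count by (simp_all add: not_in_iff)
  let ?T = "\<lambda>x. if x = ?x then {#u, v, ?x#} else {#x#}"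
  have "(\<Sum>x\<in>#V'. ?T x) = V'" by (rule sum_mset_const_on) (use V'(2) in auto)
  then have sum: "(\<Sum>x\<in>#V. ?T x) = V + {#u, v#}" using V' by simp
  have "hfun B ({#u#} + ({#v#} + {#?x#})) (0 + (0 + 0)) (\<lambda>\<psi>. \<psi> u * (\<psi> v * \<psi> ?x))"
    by (intro hfun_mult hfun_var)
  then have uvx: "hfun B {#u, v, ?x#} 0 (\<lambda>\<psi>. \<psi> u * (\<psi> v * \<psi> ?x))"
    by (simp add: add_mset_commute)
  have "hfun B (\<Sum>x\<in>#V. ?T x) (N + (\<Sum>x\<in>#V. 0))
      (\<lambda>\<psi>. g (\<lambda>x. (\<lambda>y \<psi>. if y = ?x then \<psi> u * (\<psi> v * \<psi> ?x) else \<psi> y) x \<psi>))"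
    by (rule hfun_subst[OF g]) (use uvx in \<open>auto intro: hfun_var\<close>)
  then show "hfun B (V + {#u, v#}) N (\<lambda>\<psi>. g (\<psi>(?x := \<psi> u * (\<psi> v * \<psi> ?x))))"
    unfolding sum by (simp add: fun_upd_def)
qed

text \<open>\<open>s\<close> is the scalar accumulated so far. It must not depend on the reservoir,
  because the derivation is to act on \<open>det_co\<close> alone. The determinant itself survives,
  so the step can be repeated for any list of pairs with the same number of constants.\<close>

lemma hfun_derivations:
  fixes V :: "(nat \<times> nat) multiset"
  assumes "hfun B V N g" and "\<And>a. a < m \<Longrightarrow> count V (0, a) = 1"
    and "\<And>\<psi>. \<forall>c<m. \<psi> (0, c) \<in> B \<Longrightarrow> g \<psi> = sA (s \<psi> * det_co (\<lambda>c. \<psi> (0, c))) w"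
    and "\<And>\<psi> a x. s (\<psi>((0, a) := x)) = s \<psi>"
    and "\<And>u v. (u, v) \<in> set prs \<Longrightarrow> fst u \<noteq> 0 \<and> fst v \<noteq> 0"
  shows "\<exists>g'. hfun B (V + (\<Sum>(u, v)\<leftarrow>prs. {#u, v#})) N g' \<and> (\<forall>\<psi>. (\<forall>c<m. \<psi> (0, c) \<in> B) \<longrightarrow>
     g' \<psi> = sA (s \<psi> * (\<Prod>(u, v)\<leftarrow>prs. form (\<psi> u) (\<psi> v)) * det_co (\<lambda>c. \<psi> (0, c))) w)"
  using assms
proof (induction prs arbitrary: V g s)
  case Nil
  then show ?case by (intro exI[of _ g]) simp
next
  case (Cons pr prs)
  obtain u v where pr: "pr = (u, v)" by (cases pr)
  have uv: "fst u \<noteq> 0" "fst v \<noteq> 0" using Cons.prems(5)[of u v] pr by auto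
  then have uv': "u \<noteq> (0, a)" "v \<noteq> (0, a)" for a by auto
  let ?D = "\<lambda>\<psi>. \<Sum>a=0..<m. g (\<psi>((0, a) := \<psi> u * (\<psi> v * \<psi> (0, a))))"
  let ?s = "\<lambda>\<psi>. s \<psi> * form (\<psi> u) (\<psi> v)"
  have "\<exists>g'. hfun B ((V + {#u, v#}) + (\<Sum>(u, v)\<leftarrow>prs. {#u, v#})) N g' \<and>
     (\<forall>\<psi>. (\<forall>c<m. \<psi> (0, c) \<in> B) \<longrightarrow>
     g' \<psi> = sA (?s \<psi> * (\<Prod>(u, v)\<leftarrow>prs. form (\<psi> u) (\<psi> v)) * det_co (\<lambda>c. \<psi> (0, c))) w)"
  proof (rule Cons.IH[of "V + {#u, v#}" ?D ?s])
    show "hfun B (V + {#u, v#}) N ?D" by (rule hfun_derivation) (use Cons.prems in auto)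
    show "count (V + {#u, v#}) (0, a) = 1" if "a < m" for a
      using Cons.prems(2)[OF that] uv' by simp
    show "?s (\<psi>((0, a) := x)) = ?s \<psi>" for \<psi> a x
      by (simp only: Cons.prems(4) fun_upd_other[OF uv'(1)] fun_upd_other[OF uv'(2)])
    show "fst u \<noteq> 0 \<and> fst v \<noteq> 0" if "(u, v) \<in> set prs" for u v
      using Cons.prems(5)[of u v] that by simp
    fix \<psi> :: "nat \<times> nat \<Rightarrow> 'a" assume \<psi>: "\<forall>c<m. \<psi> (0, c) \<in> B"
    let ?x = "\<lambda>c. \<psi> (0, c)"
    have "?D \<psi> = (\<Sum>a=0..<m. sA (s \<psi> * det_co (?x(a := \<psi> u * (\<psi> v * ?x a)))) w)"
    proof (rule sum.cong[OF refl])
      fix a assume a: "a \<in> {0..<m}"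
      let ?\<psi> = "\<psi>((0, a) := \<psi> u * (\<psi> v * \<psi> (0, a)))"
      have "g ?\<psi> = sA (s ?\<psi> * det_co (\<lambda>c. ?\<psi> (0, c))) w"
        by (rule Cons.prems(3)) (use \<psi> a in \<open>auto simp: B_mult\<close>)
      also have "(\<lambda>c. ?\<psi> (0, c)) = ?x(a := \<psi> u * (\<psi> v * ?x a))" by auto
      also have "s ?\<psi> = s \<psi>" by (rule Cons.prems(4))
      finally show "g ?\<psi> = sA (s \<psi> * det_co (?x(a := \<psi> u * (\<psi> v * ?x a)))) w" .
    qed
    also have "\<dots> = sA (s \<psi> * (\<Sum>a=0..<m. det_co (?x(a := \<psi> u * (\<psi> v * ?x a))))) w"
      by (simp only: sum_distrib_left A.scale_sum_left)
    also have "(\<Sum>a=0..<m. det_co (?x(a := \<psi> u * (\<psi> v * ?x a)))) = form (\<psi> u) (\<psi> v) * det_co ?x"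
      by (rule sum_det_co_derivation) (use \<psi> in auto)
    finally show "?D \<psi> = sA (?s \<psi> * det_co ?x) w" by (simp only: mult.assoc)
  qed
  then show ?case by (simp add: pr ac_simps)
qed

abbreviation det_form :: "(nat \<times> nat \<Rightarrow> 'a) \<Rightarrow> nat \<Rightarrow> nat \<Rightarrow> 'f" where
  "det_form \<psi> j j' \<equiv> det (mat m m (\<lambda>(c, c'). form (\<psi> (j, c)) (\<psi> (j', c'))))"

text \<open>The signed sum over all pairings of two new columns turns products of values of the form
  into its determinant. \<open>N\<close> and \<open>w\<close> come from the reservoir and are
  therefore fixed before \<open>s\<close>.\<close>

lemma exists_reservoir_columns:
  "\<exists>N\<ge>1. \<exists>w\<in>B. w \<noteq> 0 \<and> (\<forall>s. \<exists>f.
     hfun B ((\<Sum>c=0..<m. {#(0::nat, c)#}) + (\<Sum>j=0..<2*s. \<Sum>c=0..<m. {#(Suc j, c)#})) N f \<and>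
     (\<forall>\<psi>. (\<forall>c<m. \<psi> (0, c) \<in> B) \<longrightarrow>
       f \<psi> = sA ((\<Prod>j=0..<s. det_form \<psi> (Suc (2*j)) (Suc (2*j+1))) * det_co (\<lambda>c. \<psi> (0, c))) w))"
proof -
  obtain N w f0 where N: "N \<ge> 1" "w \<in> B" "w \<noteq> 0"
    and f0: "hfun B (\<Sum>c=0..<m. {#(0::nat, c)#}) N f0"
      "\<And>\<psi>. \<forall>c<m. \<psi> (0, c) \<in> B \<Longrightarrow> f0 \<psi> = sA (det_co (\<lambda>c. \<psi> (0, c))) w"
    using exists_reservoir by blast
  let ?V = "\<lambda>s. (\<Sum>c=0..<m. {#(0::nat, c)#}) + (\<Sum>j=0..<2*s. \<Sum>c=0..<m. {#(Suc j, c)#})"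
  let ?s = "\<lambda>s \<psi>. \<Prod>j=0..<s. det_form \<psi> (Suc (2*j)) (Suc (2*j+1))"
  have "\<exists>f. hfun B (?V s) N f \<and>
     (\<forall>\<psi>. (\<forall>c<m. \<psi> (0, c) \<in> B) \<longrightarrow> f \<psi> = sA (?s s \<psi> * det_co (\<lambda>c. \<psi> (0, c))) w)" for s
  proof (induction s)
    case 0
    then show ?case using f0 by (intro exI[of _ f0]) simp
  next
    case (Suc s)
    then obtain g where g: "hfun B (?V s) N g"
      "\<And>\<psi>. \<forall>c<m. \<psi> (0, c) \<in> B \<Longrightarrow> g \<psi> = sA (?s s \<psi> * det_co (\<lambda>c. \<psi> (0, c))) w" by blast
    have count: "count (?V s) (0, a) = 1" if "a < m" for a
    proof -
      have "count (\<Sum>c=0..<m. {#(0::nat, c)#}) (0, a) = (\<Sum>c=0..<m. if c = a then 1 else 0)"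
        unfolding count_sum by (intro sum.cong refl) auto
      moreover have "count (\<Sum>j=0..<2*s. \<Sum>c=0..<m. {#(Suc j, c)#}) (0, a) = 0"
        by (simp add: count_sum)
      moreover have "(\<Sum>c=0..<m. if c = a then 1 else 0 :: nat) = 1" using that by simp
      ultimately show ?thesis by (simp only: count_union)
    qed
    let ?prs = "\<lambda>\<sigma>. map (\<lambda>c. ((Suc (2*s), c), (Suc (2*s+1), \<sigma> c))) [0..<m]"
    have "\<exists>G. \<forall>\<sigma>. hfun B (?V s + (\<Sum>(u, v)\<leftarrow>?prs \<sigma>. {#u, v#})) N (G \<sigma>) \<and>
      (\<forall>\<psi>. (\<forall>c<m. \<psi> (0, c) \<in> B) \<longrightarrow> G \<sigma> \<psi>
        = sA (?s s \<psi> * (\<Prod>(u, v)\<leftarrow>?prs \<sigma>. form (\<psi> u) (\<psi> v)) * det_co (\<lambda>c. \<psi> (0, c))) w)"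
      by (rule choice, rule allI, rule hfun_derivations[OF g(1) count g(2)]) auto
    then obtain G where G: "\<And>\<sigma>. hfun B (?V s + (\<Sum>(u, v)\<leftarrow>?prs \<sigma>. {#u, v#})) N (G \<sigma>)"
      "\<And>\<sigma> \<psi>. \<forall>c<m. \<psi> (0, c) \<in> B \<Longrightarrow>
        G \<sigma> \<psi> = sA (?s s \<psi> * (\<Prod>(u, v)\<leftarrow>?prs \<sigma>. form (\<psi> u) (\<psi> v)) * det_co (\<lambda>c. \<psi> (0, c))) w"
      by blast
    have prs_V: "?V s + (\<Sum>(u, v)\<leftarrow>?prs \<sigma>. {#u, v#}) = ?V (Suc s)" if \<sigma>: "\<sigma> permutes {0..<m}" for \<sigma>
    proof -
      have union_two: "{#x, y#} = {#x#} + {#y#}" for x y :: "nat \<times> nat" by simp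
      have "(\<Sum>(u, v)\<leftarrow>?prs \<sigma>. {#u, v#}) = (\<Sum>c=0..<m. {#(Suc (2*s), c), (Suc (2*s+1), \<sigma> c)#})"
        by (simp only: map_map o_def prod.case sum_list_map_upt)
      also have "\<dots> = (\<Sum>c=0..<m. {#(Suc (2*s), c)#} + {#(Suc (2*s+1), \<sigma> c)#})"
by (intro sum.cong refl union_two)
      also have "\<dots> = (\<Sum>c=0..<m. {#(Suc (2*s), c)#}) + (\<Sum>c=0..<m. {#(Suc (2*s+1), \<sigma> c)#})"
        by (rule sum.distrib)
      also have "(\<Sum>c=0..<m. {#(Suc (2*s+1), \<sigma> c)#}) = (\<Sum>c=0..<m. {#(Suc (2*s+1), c)#})"
        using sum.permute[OF \<sigma>, of "\<lambda>c. {#(Suc (2*s+1), c)#}"] by (simp add: o_def)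
      finally show ?thesis by (simp add: add.assoc)
    qed
    let ?g = "\<lambda>\<psi>. \<Sum>\<sigma> | \<sigma> permutes {0..<m}. sA (signof \<sigma>) (G \<sigma> \<psi>)"
    have "hfun B (?V (Suc s)) N ?g"
    proof (intro hfun_sum hfun_scale)
      fix \<sigma> assume "\<sigma> \<in> {\<sigma>. \<sigma> permutes {0..<m}}"
      then show "hfun B (?V (Suc s)) N (G \<sigma>)" using G(1)[of \<sigma>] prs_V[of \<sigma>] by (simp only: mem_Collect_eq)
    qed
    moreover have "?g \<psi> = sA (?s (Suc s) \<psi> * det_co (\<lambda>c. \<psi> (0, c))) w"
      if \<psi>: "\<forall>c<m. \<psi> (0, c) \<in> B" for \<psi>
    proof -
      let ?P = "\<lambda>\<sigma>. \<Prod>c=0..<m. form (\<psi> (Suc (2*s), c)) (\<psi> (Suc (2*s+1), \<sigma> c))"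
      have "?g \<psi> = (\<Sum>\<sigma> | \<sigma> permutes {0..<m}. sA (?s s \<psi> * (signof \<sigma> * ?P \<sigma>) * det_co (\<lambda>c. \<psi> (0, c))) w)"
        using G(2)[OF \<psi>] by (simp add: o_def prod_list_map_upt mult_ac)
      also have "\<dots> = sA (?s s \<psi> * (\<Sum>\<sigma> | \<sigma> permutes {0..<m}. signof \<sigma> * ?P \<sigma>) * det_co (\<lambda>c. \<psi> (0, c))) w"
        by (simp only: A.scale_sum_left sum_distrib_left sum_distrib_right)
      also have "(\<Sum>\<sigma> | \<sigma> permutes {0..<m}. signof \<sigma> * ?P \<sigma>) = det_form \<psi> (Suc (2*s)) (Suc (2*s+1))"
        by (rule det_mat[symmetric])
      finally show ?thesis by simp
    qed
    ultimately show ?case by blast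
  qed
  then show ?thesis using N by blast
qed

text \<open>Filling the reservoir with the basis makes its determinant 1 at the price of
  \<open>m\<close> constants, and an operator with \<open>K\<close> constants carries
  \<open>w\<close> to \<open>b\<close>. Together with the \<open>N\<close> constants of the function
  with the reservoir these are \<open>K + (N + m)\<close>; larger numbers are reached by
  padding.\<close>

lemma exists_block_function:
  assumes b: "b \<in> B"
  shows "\<exists>N0. \<forall>N\<ge>N0. \<forall>s. \<exists>f. hfun B (\<Sum>j=0..<2*s. \<Sum>c=0..<m. {#(j, c)#}) N f \<and>
     (\<forall>\<psi>. f \<psi> = sA (\<Prod>j=0..<s. det_form \<psi> (2*j) (2*j+1)) b)"
proof -
  obtain N w where N: "N \<ge> 1" "w \<in> B" "w \<noteq> 0" and ex: "\<forall>s. \<exists>f.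
     hfun B ((\<Sum>c=0..<m. {#(0::nat, c)#}) + (\<Sum>j=0..<2*s. \<Sum>c=0..<m. {#(Suc j, c)#})) N f \<and>
     (\<forall>\<psi>. (\<forall>c<m. \<psi> (0, c) \<in> B) \<longrightarrow>
       f \<psi> = sA ((\<Prod>j=0..<s. det_form \<psi> (Suc (2*j)) (Suc (2*j+1))) * det_co (\<lambda>c. \<psi> (0, c))) w)"
    using exists_reservoir_columns by blast
  obtain T where T: "T \<in> ops" "T w = b" using ops_irreducible[OF N(2,3) b] .
  obtain K where K: "hfun B {#()#} K (\<lambda>\<psi>. T (\<psi> ()))" using T by (auto simp: ops_def)
  have "\<exists>f. hfun B (\<Sum>j=0..<2*s. \<Sum>c=0..<m. {#(j, c)#}) (K + (N + m)) f \<and>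
     (\<forall>\<psi>. f \<psi> = sA (\<Prod>j=0..<s. det_form \<psi> (2*j) (2*j+1)) b)" for s
  proof -
    let ?V = "(\<Sum>c=0..<m. {#(0::nat, c)#}) + (\<Sum>j=0..<2*s. \<Sum>c=0..<m. {#(Suc j, c)#})"
    obtain f where f: "hfun B ?V N f" "\<And>\<psi>. \<forall>c<m. \<psi> (0, c) \<in> B \<Longrightarrow>
       f \<psi> = sA ((\<Prod>j=0..<s. det_form \<psi> (Suc (2*j)) (Suc (2*j+1))) * det_co (\<lambda>c. \<psi> (0, c))) w"
      using ex by blast
    \<comment> \<open>The data of the substitution: \<open>(0, c)\<close> becomes the constant
      \<open>e c\<close>, and \<open>(Suc j, c)\<close> is renamed to \<open>(j, c)\<close>.\<close>
    define T' where "T' x = (case fst x of 0 \<Rightarrow> {#} | Suc j \<Rightarrow> {#(j, snd x)#})" for x :: "nat \<times> nat"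
    define M where "M x = (case fst x of 0 \<Rightarrow> Suc 0 | Suc j \<Rightarrow> 0)" for x :: "nat \<times> nat"
    define g where "g x \<psi> = (case fst x of 0 \<Rightarrow> e (snd x) | Suc j \<Rightarrow> \<psi> (j, snd x))"
      for x :: "nat \<times> nat" and \<psi> :: "nat \<times> nat \<Rightarrow> 'a"
    have "hfun B (\<Sum>x\<in>#?V. T' x) (N + (\<Sum>x\<in>#?V. M x)) (\<lambda>\<psi>. f (\<lambda>x. g x \<psi>))"
    proof (rule hfun_subst[OF f(1)])
      fix x assume x: "x \<in># ?V"
      show "hfun B (T' x) (M x) (g x)"
      proof (cases "fst x")
        case 0
        then have "snd x < m" using x by (auto simp: set_mset_sum)
        then show ?thesis
          using 0 hfun_const[OF e_in_B[of "snd x"]] by (simp add: T'_def M_def g_def[abs_def])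
      next
        case (Suc j)
        then show ?thesis
          using hfun_var[of B "(j, snd x)"] by (simp add: T'_def M_def g_def[abs_def])
      qed
    qed
    moreover have "(\<Sum>x\<in>#?V. T' x) = (\<Sum>j=0..<2*s. \<Sum>c=0..<m. {#(j, c)#})"
      by (simp add: sum_mset_image_sum T'_def)
    moreover have "(\<Sum>x\<in>#?V. M x) = m"
      by (simp add: sum_mset_image_sum M_def)
    ultimately have *: "hfun B (\<Sum>j=0..<2*s. \<Sum>c=0..<m. {#(j, c)#}) (N + m) (\<lambda>\<psi>. f (\<lambda>x. g x \<psi>))"
      by simp
    have "hfun B (\<Sum>j=0..<2*s. \<Sum>c=0..<m. {#(j, c)#}) (K + (N + m)) (\<lambda>\<psi>. T (f (\<lambda>x. g x \<psi>)))"
      using hfun_subst[OF K, of "\<lambda>_. \<Sum>j=0..<2*s. \<Sum>c=0..<m. {#(j, c)#}" "\<lambda>_. N + m"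
          "\<lambda>_ \<psi>. f (\<lambda>x. g x \<psi>)"] * by simp
    moreover have "T (f (\<lambda>x. g x \<psi>)) = sA (\<Prod>j=0..<s. det_form \<psi> (2*j) (2*j+1)) b" for \<psi>
    proof -
      have "f (\<lambda>x. g x \<psi>) = sA (\<Prod>j=0..<s. det_form \<psi> (2*j) (2*j+1)) w"
        using e_in_B det_co_e by (subst f(2)) (auto simp: g_def)
      then show ?thesis using ops_linear[OF T(1)] T(2) by simp
    qed
    ultimately show ?thesis by blast
  qed
  then have ex': "\<exists>f. hfun B (\<Sum>j=0..<2*s. \<Sum>c=0..<m. {#(j, c)#}) (K + (N + m)) f \<and>
     (\<forall>\<psi>. f \<psi> = sA (\<Prod>j=0..<s. det_form \<psi> (2*j) (2*j+1)) b)" for s .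
  show ?thesis
  proof (rule exI[of _ "K + (N + m)"], intro allI impI)
    fix N' s assume N': "K + (N + m) \<le> N'"
    obtain f where f: "hfun B (\<Sum>j=0..<2*s. \<Sum>c=0..<m. {#(j, c)#}) (K + (N + m)) f"
      "\<forall>\<psi>. f \<psi> = sA (\<Prod>j=0..<s. det_form \<psi> (2*j) (2*j+1)) b" using ex'[of s] by blast
    have "hfun B (\<Sum>j=0..<2*s. \<Sum>c=0..<m. {#(j, c)#}) N' f"
      by (rule hfun_pad_B[OF f(1) _ N']) (use N(1) in simp)
    then show "\<exists>f. hfun B (\<Sum>j=0..<2*s. \<Sum>c=0..<m. {#(j, c)#}) N' f \<and>
       (\<forall>\<psi>. f \<psi> = sA (\<Prod>j=0..<s. det_form \<psi> (2*j) (2*j+1)) b)" using f(2) by blast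
  qed
qed

text \<open>If the columns are filled with basis elements of several blocks, a nonzero determinant forces
  each column to contain every basis element of this block once.\<close>

lemma det_form_nonzero_imp:
  assumes "det_form \<psi> j j' \<noteq> 0"
  shows "inj_on (\<lambda>c. \<psi> (j, c)) {0..<m}" "inj_on (\<lambda>c. \<psi> (j', c)) {0..<m}"
    "\<And>c. c < m \<Longrightarrow> \<exists>u. form (\<psi> (j, c)) u \<noteq> 0" "\<And>c. c < m \<Longrightarrow> \<exists>u. form u (\<psi> (j', c)) \<noteq> 0"
proof -
  let ?M = "mat m m (\<lambda>(c, c'). form (\<psi> (j, c)) (\<psi> (j', c')))"
  show "inj_on (\<lambda>c. \<psi> (j, c)) {0..<m}"
  proof (rule inj_onI, rule ccontr)
    fix a b assume ab: "a \<in> {0..<m}" "b \<in> {0..<m}" "\<psi> (j, a) = \<psi> (j, b)" "a \<noteq> b"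
    have "det ?M = 0"
      by (rule det_identical_rows[of _ m a b]) (use ab in \<open>auto intro!: eq_vecI\<close>)
    then show False using assms by simp
  qed
  show "inj_on (\<lambda>c. \<psi> (j', c)) {0..<m}"
  proof (rule inj_onI, rule ccontr)
    fix a b assume ab: "a \<in> {0..<m}" "b \<in> {0..<m}" "\<psi> (j', a) = \<psi> (j', b)" "a \<noteq> b"
    have "det ?M = 0"
      by (rule det_identical_columns[of _ m a b]) (use ab in \<open>auto intro!: eq_vecI\<close>)
    then show False using assms by simp
  qed
  fix c assume c: "c < m"
  show "\<exists>u. form (\<psi> (j, c)) u \<noteq> 0"
  proof (rule ccontr)
    assume "\<not> ?thesis"
    then have "(\<Prod>i=0..<m. form (\<psi> (j, i)) (\<psi> (j', p i))) = 0" for p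
      using c by (intro prod_zero) auto
    then have "det ?M = 0" unfolding det_mat by (simp add: sum.neutral)
    then show False using assms by simp
  qed
  show "\<exists>u. form u (\<psi> (j', c)) \<noteq> 0"
  proof (rule ccontr)
    assume z: "\<not> ?thesis"
    have "(\<Prod>i=0..<m. form (\<psi> (j, i)) (\<psi> (j', p i))) = 0" if p: "p permutes {0..<m}" for p
    proof (rule prod_zero)
      have "c \<in> p ` {0..<m}" using permutes_image[OF p] c by simp
      then obtain i where "i \<in> {0..<m}" "p i = c" by auto
      then show "\<exists>i\<in>{0..<m}. form (\<psi> (j, i)) (\<psi> (j', p i)) = 0" using z by auto
    qed simp
    then have "det ?M = 0" unfolding det_mat by (simp add: sum.neutral)
    then show False using assms by simp
  qed
qed

end

section \<open>Normal form of multilinear $H$-functions\<close>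

lemma sum_fun_apply: "(sum f S) x = (\<Sum>i\<in>S. f i x)"
  for f :: "'i \<Rightarrow> 'x \<Rightarrow> 'a::comm_monoid_add"
  by (induction S rule: infinite_finite_induct) auto

lemma nonempty_prod_fun_apply:
  "fs \<noteq> [] \<Longrightarrow> (nonempty_prod fs) x = nonempty_prod (map (\<lambda>f. f x) fs)"
  for fs :: "('x \<Rightarrow> 'a::semigroup_mult) list"
proof (induction fs)
  case (Cons f fs)
  then show ?case by (cases "fs = []") (auto simp: nonempty_prod_Cons)
qed simp

lemma (in assoc_algebra) span_mult:
  assumes "x \<in> span S" "y \<in> span T"
  shows "x * y \<in> span {s * t | s t. s \<in> S \<and> t \<in> T}"
  using assms(1)
proof (induction rule: span_induct_alt)
  case (step c s z)
  have "s * y \<in> span {s * t | s t. s \<in> S \<and> t \<in> T}"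
    using assms(2)
  proof (induction rule: span_induct_alt)
    case (step d t w)
    then have "s * t \<in> span {s * t | s t. s \<in> S \<and> t \<in> T}"
      using \<open>s \<in> S\<close> by (intro span_base) blast
    then show ?case using step by (simp add: distrib_left scale_mult_right span_add span_scale)
  qed (simp add: span_zero)
  then show ?case using step by (simp add: distrib_right scale_mult_left span_add span_scale)
qed (simp add: span_zero)

context generalized_H_action
begin

text \<open>With pointwise operations the functions of \<psi> form an algebra of the same kind, so
  general facts on spans and on the action, applied to this algebra, become facts on
  functions.\<close>

lemma generalized_H_action_fun:
  "generalized_H_action (\<lambda>c (f :: 'x \<Rightarrow> 'a) x. sA c (f x)) sH (\<lambda>h f x. act h (f x))"
proof
  fix h
  obtain k and h1 h2 h3 h4 :: "nat \<Rightarrow> 'h" where k: "k \<ge> 1" and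
    eq: "\<And>a b. act h (a * b) = (\<Sum>i=1..k. act (h1 i) a * act (h2 i) b + act (h3 i) b * act (h4 i) a)"
    using act_product[of h] by blast
  have "(\<lambda>x. act h ((f * g) x)) = (\<Sum>i=1..k. (\<lambda>x. act (h1 i) (f x)) * (\<lambda>x. act (h2 i) (g x))
      + (\<lambda>x. act (h3 i) (g x)) * (\<lambda>x. act (h4 i) (f x)))" for f g :: "'x \<Rightarrow> 'a"
    by (rule ext) (simp add: sum_fun_apply eq)
  then show "\<exists>k\<ge>1. \<exists>h1 h2 h3 h4 :: nat \<Rightarrow> 'h. \<forall>f g :: 'x \<Rightarrow> 'a. (\<lambda>x. act h ((f * g) x))
      = (\<Sum>i=1..k. (\<lambda>x. act (h1 i) (f x)) * (\<lambda>x. act (h2 i) (g x))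
      + (\<lambda>x. act (h3 i) (g x)) * (\<lambda>x. act (h4 i) (f x)))"
    using k by (intro exI[of _ k] conjI exI[of _ h1] exI[of _ h2] exI[of _ h3] exI[of _ h4] allI)
qed (auto simp: fun_eq_iff A.scale_right_distrib A.scale_left_distrib A.scale_mult_left
    A.scale_mult_right act_add_right act_scale_right act_add_left act_scale_left act_mult act_one)

text \<open>Repeated use of the product rule moves the operator to the single letters. Since the
  rule may interchange factors, only the multiset of the letters is preserved.\<close>

lemma act_nonempty_prod_map:
  "ls \<noteq> [] \<Longrightarrow> act h (nonempty_prod (map g ls)) \<in>
     A.span {nonempty_prod (map (\<lambda>(h, l). act h (g l)) (zip hs ls')) | hs ls'.
       mset ls' = mset ls \<and> length hs = length ls}"
proof (induction ls arbitrary: h)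
  case (Cons l ls)
  let ?S = "\<lambda>ls. {nonempty_prod (map (\<lambda>(h, l). act h (g l)) (zip hs ls')) | hs ls'.
       mset ls' = mset ls \<and> length hs = length ls}"
  show ?case
  proof (cases "ls = []")
    case True
    then show ?thesis
      by (intro A.span_base) (auto intro!: exI[of _ "[h]"] exI[of _ "[l]"])
  next
    case False
    obtain k and h1 h2 h3 h4 :: "nat \<Rightarrow> 'h" where
      eq: "\<And>a b. act h (a * b) = (\<Sum>i=1..k. act (h1 i) a * act (h2 i) b + act (h3 i) b * act (h4 i) a)"
      using act_product[of h] by blast
    have base: "act h (g l) \<in> A.span {act h (g l) | h. True}" for h by (intro A.span_base) blast
    have left: "act h (g l) * y \<in> A.span (?S (l # ls))" if "y \<in> A.span (?S ls)" for h y
    proof -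
      have "act h (g l) * y \<in> A.span {s * t | s t. s \<in> {act h (g l) | h. True} \<and> t \<in> ?S ls}"
        by (rule A.span_mult[OF base that])
      also have "\<dots> \<subseteq> A.span (?S (l # ls))"
      proof (rule A.span_mono, clarify)
        fix h' and hs :: "'h list" and ls' assume *: "mset ls' = mset ls" "length hs = length ls"
        moreover have "length ls' = length ls" using *(1) by (rule mset_eq_length)
        moreover then have "map (\<lambda>(h, l). act h (g l)) (zip hs ls') \<noteq> []" using False *(2) by auto
        ultimately show "\<exists>hs' ls''. act h' (g l) * nonempty_prod (map (\<lambda>(h, l). act h (g l)) (zip hs ls'))
            = nonempty_prod (map (\<lambda>(h, l). act h (g l)) (zip hs' ls''))
            \<and> mset ls'' = mset (l # ls) \<and> length hs' = length (l # ls)"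
          by (intro exI[of _ "h' # hs"] exI[of _ "l # ls'"]) (auto simp: nonempty_prod_Cons)
      qed
      finally show ?thesis .
    qed
    have right: "y * act h (g l) \<in> A.span (?S (l # ls))" if "y \<in> A.span (?S ls)" for h y
    proof -
      have "y * act h (g l) \<in> A.span {s * t | s t. s \<in> ?S ls \<and> t \<in> {act h (g l) | h. True}}"
        by (rule A.span_mult[OF that base])
      also have "\<dots> \<subseteq> A.span (?S (l # ls))"
      proof (rule A.span_mono, clarify)
        fix h' and hs :: "'h list" and ls' assume *: "mset ls' = mset ls" "length hs = length ls"
        moreover have "length ls' = length ls" using *(1) by (rule mset_eq_length)
        moreover then have "map (\<lambda>(h, l). act h (g l)) (zip hs ls') \<noteq> []" using False *(2) by auto
        ultimately show "\<exists>hs' ls''. nonempty_prod (map (\<lambda>(h, l). act h (g l)) (zip hs ls')) * act h' (g l)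
            = nonempty_prod (map (\<lambda>(h, l). act h (g l)) (zip hs' ls''))
            \<and> mset ls'' = mset (l # ls) \<and> length hs' = length (l # ls)"
          by (intro exI[of _ "hs @ [h']"] exI[of _ "ls' @ [l]"]) (auto simp: nonempty_prod_append)
      qed
      finally show ?thesis .
    qed
    have "act h (g l * nonempty_prod (map g ls)) \<in> A.span (?S (l # ls))"
      unfolding eq by (intro A.span_sum A.span_add left right Cons.IH[OF False])
    then show ?thesis using False by (simp add: nonempty_prod_Cons)
  qed
qed simp

definition letter_val :: "('v \<Rightarrow> 'a) \<Rightarrow> ('v + 'a) \<times> 'h \<Rightarrow> 'a" where
  "letter_val \<psi> l = act (snd l) (case_sum \<psi> id (fst l))"

definition monomials :: "'a set \<Rightarrow> 'v multiset \<Rightarrow> nat \<Rightarrow> (('v \<Rightarrow> 'a) \<Rightarrow> 'a) set" where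
  "monomials Y V N = {\<lambda>\<psi>. nonempty_prod (map (letter_val \<psi>) ls) | ls. ls \<noteq> [] \<and>
     (\<exists>C. mset (map fst ls) = image_mset Inl V + image_mset Inr C \<and> size C = N \<and> set_mset C \<subseteq> Y)}"

text \<open>All operators are pushed down to the letters, where they compose with the operators
  already there; the reordering is harmless because \<open>monomials\<close> prescribes the letters
  only as a multiset.\<close>

lemma hfun_in_span_monomials:
  fixes f :: "('v \<Rightarrow> 'a) \<Rightarrow> 'a"
  assumes "hfun Y V N f"
  shows "f \<in> module.span (\<lambda>c f \<psi>. sA c (f \<psi>)) (monomials Y V N)"
proof -
  interpret F: generalized_H_action "\<lambda>c (f :: ('v \<Rightarrow> 'a) \<Rightarrow> 'a) x. sA c (f x)" sH "\<lambda>h f x. act h (f x)"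
    by (rule generalized_H_action_fun)
  have mon: "nonempty_prod (map (\<lambda>l \<psi>. letter_val \<psi> l) ls) = (\<lambda>\<psi>. nonempty_prod (map (letter_val \<psi>) ls))"
    if "ls \<noteq> []" for ls :: "(('v + 'a) \<times> 'h) list"
    using that by (auto simp: fun_eq_iff nonempty_prod_fun_apply o_def)
  show ?thesis
    using assms
  proof (induction rule: hfun.induct)
    case (hfun_var v)
    then show ?case
      by (intro F.A.span_base) (auto simp: monomials_def letter_val_def act_one
          intro!: exI[of _ "[(Inl v, 1)]"])
  next
    case (hfun_const a)
    then show ?case
      by (intro F.A.span_base) (auto simp: monomials_def letter_val_def act_one
          intro!: exI[of _ "[(Inr a, 1)]"] exI[of _ "{#a#}"])
  next
    case (hfun_act V N f h)
    show ?case
      using hfun_act.IH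
    proof (induction rule: F.A.span_induct_alt)
      case base
      have "(\<lambda>\<psi>. act h ((0 :: ('v \<Rightarrow> 'a) \<Rightarrow> 'a) \<psi>)) = 0" by (simp add: fun_eq_iff act_0)
      then show ?case using F.A.span_zero by simp
    next
      case (step c u z)
      then obtain ls C where ls: "u = (\<lambda>\<psi>. nonempty_prod (map (letter_val \<psi>) ls))" "ls \<noteq> []"
        and C: "mset (map fst ls) = image_mset Inl V + image_mset Inr C" "size C = N" "set_mset C \<subseteq> Y"
        by (auto simp: monomials_def)
      let ?g = "\<lambda>l (\<psi> :: 'v \<Rightarrow> 'a). letter_val \<psi> l"
      have "(\<lambda>\<psi>. act h (u \<psi>)) \<in> F.A.span {nonempty_prod (map (\<lambda>(h, l). (\<lambda>\<psi>. act h (?g l \<psi>))) (zip hs ls')) | hs ls'.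
         mset ls' = mset ls \<and> length hs = length ls}"
        using F.act_nonempty_prod_map[OF ls(2), of h ?g] unfolding mon[OF ls(2)] ls(1) .
      also have "\<dots> \<subseteq> F.A.span (monomials Y V N)"
      proof (rule F.A.span_mono, clarify)
        fix hs :: "'h list" and ls' assume *: "mset ls' = mset ls" "length hs = length ls"
        have len: "length ls' = length hs" using mset_eq_length[OF *(1)] *(2) by simp
        define ls'' where "ls'' = map (\<lambda>(h, l). (fst l, h * snd l)) (zip hs ls')"
        have "(\<lambda>(h, l). (\<lambda>\<psi>. act h (?g l \<psi>))) = ?g \<circ> (\<lambda>(h, l). (fst l, h * snd l))"
          by (auto simp: fun_eq_iff letter_val_def act_mult)
        then have "nonempty_prod (map (\<lambda>(h, l). (\<lambda>\<psi>. act h (?g l \<psi>))) (zip hs ls'))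
            = nonempty_prod (map ?g ls'')" by (simp add: ls''_def)
        moreover have ne: "ls'' \<noteq> []" using len *(2) ls(2) by (auto simp: ls''_def)
        moreover have "map fst ls'' = map fst ls'"
        proof -
          have "map fst ls'' = map fst (map snd (zip hs ls'))" by (auto simp: ls''_def)
          then show ?thesis using len by simp
        qed
        then have "mset (map fst ls'') = mset (map fst ls)" using *(1) by (metis mset_map)
        ultimately show "nonempty_prod (map (\<lambda>(h, l). (\<lambda>\<psi>. act h (?g l \<psi>))) (zip hs ls')) \<in> monomials Y V N"
          using C mon[OF ne] unfolding monomials_def by auto
      qed
      finally have 1: "(\<lambda>\<psi>. act h (u \<psi>)) \<in> F.A.span (monomials Y V N)" .
      have 2: "(\<lambda>\<psi>. act h (((\<lambda>\<psi>. sA c (u \<psi>)) + z) \<psi>)) = (\<lambda>\<psi>. sA c (act h (u \<psi>))) + (\<lambda>\<psi>. act h (z \<psi>))"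
        by (simp add: fun_eq_iff act_add_right act_scale_right)
      show ?case unfolding 2 using F.A.span_add[OF F.A.span_scale[OF 1, of c] step(2)] by simp
    qed
  next
    case (hfun_mult V N f V' N' f')
    have "f * f' \<in> F.A.span {s * t | s t. s \<in> monomials Y V N \<and> t \<in> monomials Y V' N'}"
      using hfun_mult by (intro F.A.span_mult)
    also have "\<dots> \<subseteq> F.A.span (monomials Y (V + V') (N + N'))"
    proof (rule F.A.span_mono, clarify)
      fix s t assume "s \<in> monomials Y V N" "t \<in> monomials Y V' N'"
      then obtain ls C ls' C' where
        ls: "s = (\<lambda>\<psi>. nonempty_prod (map (letter_val \<psi>) ls))" "ls \<noteq> []"
          "mset (map fst ls) = image_mset Inl V + image_mset Inr C" "size C = N" "set_mset C \<subseteq> Y"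
        and ls': "t = (\<lambda>\<psi>. nonempty_prod (map (letter_val \<psi>) ls'))" "ls' \<noteq> []"
          "mset (map fst ls') = image_mset Inl V' + image_mset Inr C'" "size C' = N'" "set_mset C' \<subseteq> Y"
        unfolding monomials_def by blast
      have "s * t = (\<lambda>\<psi>. nonempty_prod (map (letter_val \<psi>) (ls @ ls')))"
        using ls ls' by (simp add: fun_eq_iff nonempty_prod_append)
      moreover have "mset (map fst (ls @ ls')) = image_mset Inl (V + V') + image_mset Inr (C + C')"
        using ls(3) ls'(3) by (simp add: ac_simps)
      ultimately show "s * t \<in> monomials Y (V + V') (N + N')"
        unfolding monomials_def using ls ls'
        by (intro CollectI exI[of _ "ls @ ls'"] conjI exI[of _ "C + C'"]) auto
    qed
    finally show ?case by (simp add: times_fun_def)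
  next
    case (hfun_zero V N)
    then show ?case using F.A.span_zero by (simp add: zero_fun_def)
  next
    case (hfun_add V N f f')
    then show ?case using F.A.span_add[of f _ f'] by (simp add: plus_fun_def)
  next
    case (hfun_scale V N f c)
    show ?case by (rule F.A.span_scale[OF hfun_scale.IH])
  qed
qed

lemma hfun_const_span:
  assumes "Y' \<subseteq> A.span Y"
  shows "hfun Y' V N f \<Longrightarrow> hfun Y V N f"
proof (induction rule: hfun.induct)
  case (hfun_const a)
  then have "a \<in> A.span Y" using assms by blast
  then show ?case
  proof (induction rule: A.span_induct_alt)
    case (step c u z)
    show ?case by (rule hfun_add[OF hfun_scale[OF hfun.hfun_const[OF step(1)]] step(2)])
  qed (rule hfun_zero)
qed (auto intro: hfun.intros)

end

section \<open>Quotient dimensions\<close>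

context vector_space
begin

lemma exists_linear_relation:
  assumes T: "finite T" and S: "finite S" and card: "card S < card T" and g: "\<And>v. v \<in> T \<Longrightarrow> g v \<in> span S"
  shows "\<exists>c. (\<exists>v\<in>T. c v \<noteq> 0) \<and> (\<Sum>v\<in>T. scale (c v) (g v)) = 0"
proof (cases "inj_on g T")
  case True
  have "dependent (g ` T)"
  proof (rule ccontr)
    assume "independent (g ` T)"
    then have "card (g ` T) \<le> card S"
      using independent_span_bound[OF S, of "g ` T"] g by auto
    then show False using card card_image[OF True] by simp
  qed
  then obtain u v where "v \<in> g ` T" "u v \<noteq> 0" "(\<Sum>v\<in>g ` T. scale (u v) v) = 0"
    using dependent_finite[of "g ` T"] T by auto
  then show ?thesis
    by (intro exI[of _ "u \<circ> g"]) (auto simp: sum.reindex[OF True])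
next
  case False
  then obtain a b where ab: "a \<in> T" "b \<in> T" "a \<noteq> b" "g a = g b" by (auto simp: inj_on_def)
  let ?c = "\<lambda>v. if v = a then 1 else if v = b then - 1 else 0"
  have "(\<Sum>v\<in>T. scale (?c v) (g v)) = (\<Sum>v\<in>{a, b}. scale (?c v) (g v))"
    using T ab by (intro sum.mono_neutral_right) auto
  also have "\<dots> = 0" using ab by simp
  finally show ?thesis using ab by (intro exI[of _ ?c]) auto
qed

text \<open>More than \<open>card I\<close> vectors of test values are linearly dependent. As
  vectors on which all tests vanish lie in \<open>W\<close>, such a dependence is a relation modulo
  \<open>W\<close>.\<close>

lemma quotient_independent_card_le:
  assumes V: "subspace V" and S: "S \<subseteq> V"
    and ind: "\<And>T c. finite T \<Longrightarrow> T \<subseteq> S \<Longrightarrow> (\<Sum>v\<in>T. scale (c v) v) \<in> W \<Longrightarrow> \<forall>v\<in>T. c v = 0"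
    and I: "finite I" and t_add: "\<And>i x y. t i (x + y) = t i x + t i y"
    and t_scale: "\<And>i c x. t i (scale c x) = c * t i x"
    and tests: "\<And>v. v \<in> V \<Longrightarrow> \<forall>i\<in>I. t i v = (0::'a) \<Longrightarrow> v \<in> W"
  shows "finite S \<and> card S \<le> card I"
proof -
  interpret F: vector_space "\<lambda>c (f :: 'i \<Rightarrow> 'a) i. c * f i"
    by unfold_locales (auto simp: fun_eq_iff algebra_simps)
  let ?d = "\<lambda>i j. if i = j then 1 else 0 :: 'a"
  have t_sum: "t i (\<Sum>v\<in>T. scale (c v) v) = (\<Sum>v\<in>T. c v * t i v)" if "finite T" for T c i
  proof -
    have t_0: "t i 0 = 0" using t_scale[of i 0 0] by simp
    show ?thesis using that by (induction T rule: finite_induct) (auto simp: t_0 t_add t_scale)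
  qed
  have le: "card T \<le> card I" if T: "finite T" "T \<subseteq> S" for T
  proof (rule ccontr)
    assume "\<not> card T \<le> card I"
    moreover have "card (?d ` I) \<le> card I" by (rule card_image_le[OF I])
    ultimately have card: "card (?d ` I) < card T" by simp
    have span: "(\<lambda>i. if i \<in> I then t i v else 0) \<in> F.span (?d ` I)" for v
    proof -
      have "(\<lambda>i. t j v * ?d j i) \<in> F.span (?d ` I)" if "j \<in> I" for j
        using F.span_scale[OF F.span_base[of "?d j" "?d ` I"], of "t j v"] that by auto
      then have "(\<Sum>j\<in>I. (\<lambda>i. t j v * ?d j i)) \<in> F.span (?d ` I)" by (rule F.span_sum)
      moreover
      have "(\<lambda>i. if i \<in> I then t i v else 0) = (\<Sum>j\<in>I. (\<lambda>i. t j v * ?d j i))"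
        using I by (auto simp: fun_eq_iff sum_fun_apply if_distrib cong: if_cong)
      ultimately show ?thesis by simp
    qed
    have "\<exists>c. (\<exists>v\<in>T. c v \<noteq> 0) \<and> (\<Sum>v\<in>T. (\<lambda>i. c v * (if i \<in> I then t i v else 0))) = 0"
      by (rule F.exists_linear_relation[OF T(1) _ card span]) (simp add: I)
    then obtain c where c: "\<exists>v\<in>T. c v \<noteq> 0"
      "(\<Sum>v\<in>T. (\<lambda>i. c v * (if i \<in> I then t i v else 0))) = 0" by blast
    have "\<forall>i\<in>I. t i (\<Sum>v\<in>T. scale (c v) v) = 0"
    proof
      fix i assume "i \<in> I"
      then show "t i (\<Sum>v\<in>T. scale (c v) v) = 0"
        using fun_cong[OF c(2), of i] by (simp add: sum_fun_apply t_sum[OF T(1)])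
    qed
    moreover have "(\<Sum>v\<in>T. scale (c v) v) \<in> V"
      using T(2) S by (intro subspace_sum[OF V] subspace_scale[OF V]) auto
    ultimately have "(\<Sum>v\<in>T. scale (c v) v) \<in> W" using tests by blast
    then show False using ind[OF T] c(1) by blast
  qed
  have "finite S"
  proof (rule ccontr)
    assume "infinite S"
    then obtain T where "T \<subseteq> S" "finite T" "card T = Suc (card I)"
      using infinite_arbitrarily_large by blast
    then show False using le[of T] by simp
  qed
  then show ?thesis using le by blast
qed

text \<open>A set of greatest cardinality among those independent modulo \<open>W\<close>. The bound
  includes finiteness, without which \<open>card\<close> would say nothing.\<close>

lemma exists_quotient_basis:
  assumes V: "subspace V" and W: "subspace W"
    and bound: "\<And>S. S \<subseteq> V \<Longrightarrow> (\<And>T c. finite T \<Longrightarrow> T \<subseteq> S \<Longrightarrow> (\<Sum>v\<in>T. scale (c v) v) \<in> W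
       \<Longrightarrow> \<forall>v\<in>T. c v = 0) \<Longrightarrow> finite S \<and> card S \<le> b"
  shows "\<exists>S. quotient_basis scale V W S"
proof -
  let ?P = "\<lambda>S. S \<subseteq> V \<and> (\<forall>T c. finite T \<and> T \<subseteq> S \<and> (\<Sum>v\<in>T. scale (c v) v) \<in> W \<longrightarrow> (\<forall>v\<in>T. c v = 0))"
  have "?P {}" by auto
  moreover have "\<forall>S. ?P S \<longrightarrow> card S < Suc b"
    using bound by (meson less_Suc_eq_le)
  ultimately have "\<exists>S. ?P S \<and> (\<forall>S'. ?P S' \<longrightarrow> card S' \<le> card S)"
    by (rule ex_has_greatest_nat)
  then obtain S where S: "?P S" and max: "\<And>S'. ?P S' \<Longrightarrow> card S' \<le> card S" by (elim exE conjE) simp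
  have ind: "\<forall>v\<in>T. c v = 0" if "finite T" "T \<subseteq> S" "(\<Sum>v\<in>T. scale (c v) v) \<in> W" for T c
    using S that by simp
  have "finite S \<and> card S \<le> b" by (rule bound) (use S in auto)
  then have fin: "finite S" by blast
  have "\<exists>T c. finite T \<and> T \<subseteq> S \<and> v - (\<Sum>u\<in>T. scale (c u) u) \<in> W" if v: "v \<in> V" for v
  proof (cases "v \<in> S")
    case True
    then show ?thesis
      using subspace_0[OF W] by (intro exI[of _ "{v}"] exI[of _ "\<lambda>_. 1"]) auto
  next
    case False
    then have "\<not> ?P (insert v S)" using max[of "insert v S"] fin by auto
    then obtain T c where T: "finite T" "T \<subseteq> insert v S" "(\<Sum>u\<in>T. scale (c u) u) \<in> W" "\<exists>u\<in>T. c u \<noteq> 0"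
      using S v by auto
    have vT: "v \<in> T"
    proof (rule ccontr)
      assume "v \<notin> T"
      then have "T \<subseteq> S" using T by auto
      then show False using S T by blast
    qed
    have cv: "c v \<noteq> 0"
    proof
      assume "c v = 0"
      then have "(\<Sum>u\<in>T - {v}. scale (c u) u) \<in> W" "\<exists>u\<in>T - {v}. c u \<noteq> 0"
        using T vT by (auto simp: sum.remove)
      moreover have "T - {v} \<subseteq> S" using T(2) by auto
      ultimately show False using ind[of "T - {v}" c] T(1) by blast
    qed
    have "(\<Sum>u\<in>T. scale (c u) u) = scale (c v) v + (\<Sum>u\<in>T - {v}. scale (c u) u)"
      using T vT by (simp add: sum.remove)
    then have "scale (1 / c v) (scale (c v) v + (\<Sum>u\<in>T - {v}. scale (c u) u)) \<in> W"
      using T(3) subspace_scale[OF W] by simp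
    also have "scale (1 / c v) (scale (c v) v + (\<Sum>u\<in>T - {v}. scale (c u) u))
        = v - (\<Sum>u\<in>T - {v}. scale (- c u / c v) u)"
      using cv by (simp add: scale_right_distrib scale_sum_right sum_negf)
    finally show ?thesis using T
      by (intro exI[of _ "T - {v}"] exI[of _ "\<lambda>u. - c u / c v"]) auto
  qed
  then have spans: "\<forall>v\<in>V. \<exists>T c. finite T \<and> T \<subseteq> S \<and> v - (\<Sum>u\<in>T. scale (c u) u) \<in> W" by (rule ballI)
  show ?thesis
    unfolding quotient_basis_def
    by (rule exI[of _ S], intro conjI, rule conjunct1[OF S], rule conjunct2[OF S], rule spans)
qed

end

section \<open>$H$-polynomials as functions\<close>

lemma lookup_hpoly_scale: "Poly_Mapping.lookup (hpoly_scale c f) w = c * Poly_Mapping.lookup f w"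
  by (simp add: hpoly_scale_def Poly_Mapping.map.rep_eq when_def)

interpretation hpoly: vector_space hpoly_scale
  by unfold_locales
    (auto intro!: poly_mapping_eqI simp: lookup_hpoly_scale Poly_Mapping.lookup_add algebra_simps)

lemma keys_hpoly_scale: "Poly_Mapping.keys (hpoly_scale c f) \<subseteq> Poly_Mapping.keys f"
  by (auto simp: Poly_Mapping.in_keys_iff lookup_hpoly_scale)

context generalized_H_action
begin

definition word_val :: "(nat \<Rightarrow> 'a) \<Rightarrow> (nat \<times> 'h) free_word \<Rightarrow> 'a" where
  "word_val \<psi> w = nonempty_prod (map (\<lambda>(i, \<gamma>). act \<gamma> (\<psi> i)) (letters w))"

abbreviation ev :: "(nat \<Rightarrow> 'a) \<Rightarrow> ('h, 'f) hpoly \<Rightarrow> 'a" where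
  "ev \<equiv> hpoly_eval sA act"

lemma ev_superset:
  assumes "finite S" "Poly_Mapping.keys f \<subseteq> S"
  shows "ev \<psi> f = (\<Sum>w\<in>S. sA (Poly_Mapping.lookup f w) (word_val \<psi> w))"
  unfolding hpoly_eval_def word_val_def
  using assms by (intro sum.mono_neutral_left) (auto simp: Poly_Mapping.in_keys_iff)

lemma ev_add: "ev \<psi> (f + g) = ev \<psi> f + ev \<psi> g"
proof -
  let ?S = "Poly_Mapping.keys f \<union> Poly_Mapping.keys g"
  have S: "finite ?S" "Poly_Mapping.keys (f + g) \<subseteq> ?S" "Poly_Mapping.keys f \<subseteq> ?S" "Poly_Mapping.keys g \<subseteq> ?S"
    using Poly_Mapping.keys_add[of f g] by auto
  show ?thesis
    unfolding ev_superset[OF S(1,2)] ev_superset[OF S(1,3)] ev_superset[OF S(1,4)]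
    by (simp add: Poly_Mapping.lookup_add A.scale_left_distrib sum.distrib)
qed

lemma ev_scale: "ev \<psi> (hpoly_scale c f) = sA c (ev \<psi> f)"
  using keys_hpoly_scale[of c f]
  by (simp add: ev_superset[of "Poly_Mapping.keys f"] lookup_hpoly_scale A.scale_sum_right)

lemma ev_0: "ev \<psi> 0 = 0"
  by (simp add: hpoly_eval_def)

lemma ev_sum: "ev \<psi> (sum f S) = (\<Sum>i\<in>S. ev \<psi> (f i))"
  by (induction S rule: infinite_finite_induct) (auto simp: ev_0 ev_add)

lemma ev_single: "ev \<psi> (Poly_Mapping.single w c) = sA c (word_val \<psi> w)"
  by (subst ev_superset[of "{w}"]) auto

lemma hpoly_eq_sum_single: "f = (\<Sum>w\<in>Poly_Mapping.keys f. Poly_Mapping.single w (Poly_Mapping.lookup f w))"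
  by (rule poly_mapping_eqI)
    (auto simp: Poly_Mapping.lookup_sum Poly_Mapping.lookup_single when_def Poly_Mapping.in_keys_iff)

lemma word_val_add: "u \<noteq> 0 \<Longrightarrow> v \<noteq> 0 \<Longrightarrow> word_val \<psi> (u + v) = word_val \<psi> u * word_val \<psi> v"
  by (cases u; cases v) (auto simp: word_val_def plus_free_word_def zero_free_word_def nonempty_prod_append)

text \<open>The empty word is excluded because there is no unit to serve as its value.\<close>

lemma ev_mult:
  assumes "0 \<notin> Poly_Mapping.keys f" "0 \<notin> Poly_Mapping.keys g"
  shows "ev \<psi> (f * g) = ev \<psi> f * ev \<psi> g"
proof -
  let ?s = "\<lambda>f w. Poly_Mapping.single w (Poly_Mapping.lookup f w)"
  have "ev \<psi> (f * g) = ev \<psi> ((\<Sum>u\<in>Poly_Mapping.keys f. ?s f u) * (\<Sum>v\<in>Poly_Mapping.keys g. ?s g v))"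
    by (simp flip: hpoly_eq_sum_single)
  also have "\<dots> = (\<Sum>u\<in>Poly_Mapping.keys f. \<Sum>v\<in>Poly_Mapping.keys g. ev \<psi> (?s f u * ?s g v))"
    by (simp add: sum_product ev_sum)
  also have "\<dots> = (\<Sum>u\<in>Poly_Mapping.keys f. \<Sum>v\<in>Poly_Mapping.keys g. ev \<psi> (?s f u) * ev \<psi> (?s g v))"
  proof (intro sum.cong refl)
    fix u v assume "u \<in> Poly_Mapping.keys f" "v \<in> Poly_Mapping.keys g"
    then have "u \<noteq> 0" "v \<noteq> 0" using assms by auto
    then show "ev \<psi> (?s f u * ?s g v) = ev \<psi> (?s f u) * ev \<psi> (?s g v)"
      by (simp add: Poly_Mapping.mult_single ev_single word_val_add A.scale_mult_left A.scale_mult_right)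
  qed
  also have "\<dots> = ev \<psi> (\<Sum>u\<in>Poly_Mapping.keys f. ?s f u) * ev \<psi> (\<Sum>v\<in>Poly_Mapping.keys g. ?s g v)"
    by (simp add: sum_product ev_sum)
  finally show ?thesis by (simp flip: hpoly_eq_sum_single)
qed

end

locale H_basis = generalized_H_action sA sH act
  for sA :: "'f::field \<Rightarrow> 'a::ring \<Rightarrow> 'a" and sH :: "'f \<Rightarrow> 'h::ring_1 \<Rightarrow> 'h" and act +
  fixes \<Gamma> :: "'h set"
  assumes indep_\<Gamma>: "H.independent \<Gamma>" and span_\<Gamma>: "H.span \<Gamma> = UNIV"
begin

lemma ev_hvar: "ev \<psi> (hvar sH \<Gamma> i h) = act h (\<psi> i)"
proof -
  let ?r = "H.representation \<Gamma> h"
  have act_sum_left: "act (\<Sum>\<gamma>\<in>S. sH (c \<gamma>) \<gamma>) x = (\<Sum>\<gamma>\<in>S. sA (c \<gamma>) (act \<gamma> x))" for S c x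
  proof -
    have "act 0 x = 0" using act_scale_left[of 0 0 x] by simp
    then show ?thesis
      by (induction S rule: infinite_finite_induct) (auto simp: act_add_left act_scale_left)
  qed
  have "ev \<psi> (hvar sH \<Gamma> i h) = (\<Sum>\<gamma> | ?r \<gamma> \<noteq> 0. sA (?r \<gamma>) (act \<gamma> (\<psi> i)))"
    by (simp add: hvar_def ev_sum ev_scale ev_single word_val_def)
  also have "\<dots> = act (\<Sum>\<gamma> | ?r \<gamma> \<noteq> 0. sH (?r \<gamma>) \<gamma>) (\<psi> i)" by (simp add: act_sum_left)
  also have "(\<Sum>\<gamma> | ?r \<gamma> \<noteq> 0. sH (?r \<gamma>) \<gamma>) = h"
    using indep_\<Gamma> span_\<Gamma> by (intro H.sum_nonzero_representation_eq) auto
  finally show ?thesis .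
qed

lemma keys_hvar: "Poly_Mapping.keys (hvar sH \<Gamma> i h) \<subseteq> {Word [(i, \<gamma>)] | \<gamma>. \<gamma> \<in> \<Gamma>}"
proof -
  have "Poly_Mapping.keys (hvar sH \<Gamma> i h)
     \<subseteq> (\<Union>\<gamma>\<in>{\<gamma>. H.representation \<Gamma> h \<gamma> \<noteq> 0}. Poly_Mapping.keys
         (hpoly_scale (H.representation \<Gamma> h \<gamma>) (Poly_Mapping.single (Word [(i, \<gamma>)]) 1)))"
    unfolding hvar_def by (rule Poly_Mapping.keys_sum)
  also have "\<dots> \<subseteq> {Word [(i, \<gamma>)] | \<gamma>. \<gamma> \<in> \<Gamma>}"
    using keys_hpoly_scale H.representation_ne_zero by fastforce
  finally show ?thesis .
qed

lemma hpolys_mult: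
  fixes f g :: "('h, 'f) hpoly"
  assumes "f \<in> hpolys \<Gamma>" "g \<in> hpolys \<Gamma>"
  shows "f * g \<in> hpolys \<Gamma>"
proof -
  have "w \<noteq> 0 \<and> set (letters w) \<subseteq> {1..} \<times> \<Gamma>" if w: "w \<in> Poly_Mapping.keys (f * g)" for w
  proof -
    obtain u v where "w = u + v" "u \<in> Poly_Mapping.keys f" "v \<in> Poly_Mapping.keys g"
      using subsetD[OF Poly_Mapping.keys_mult w] by blast
    then show ?thesis using assms
      by (cases u; cases v) (fastforce simp: hpolys_def plus_free_word_def zero_free_word_def)
  qed
  then show ?thesis by (auto simp: hpolys_def)
qed

lemma prod_list_hvar:
  assumes "js \<noteq> []" "\<And>j. j \<in> set js \<Longrightarrow> \<sigma> j \<ge> 1"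
  shows "prod_list (map (\<lambda>j. hvar sH \<Gamma> (\<sigma> j) (h j)) js) \<in> hpolys \<Gamma>
    \<and> ev \<psi> (prod_list (map (\<lambda>j. hvar sH \<Gamma> (\<sigma> j) (h j)) js)) = nonempty_prod (map (\<lambda>j. act (h j) (\<psi> (\<sigma> j))) js)"
  using assms
proof (induction js)
  case (Cons j js)
  have v: "hvar sH \<Gamma> (\<sigma> j) (h j) \<in> hpolys \<Gamma>"
    using keys_hvar[of "\<sigma> j" "h j"] Cons.prems by (fastforce simp: hpolys_def zero_free_word_def)
  show ?case
  proof (cases "js = []")
    case True
    then show ?thesis using v by (simp add: ev_hvar)
  next
    case False
    then have IH: "prod_list (map (\<lambda>j. hvar sH \<Gamma> (\<sigma> j) (h j)) js) \<in> hpolys \<Gamma>"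
      "ev \<psi> (prod_list (map (\<lambda>j. hvar sH \<Gamma> (\<sigma> j) (h j)) js)) = nonempty_prod (map (\<lambda>j. act (h j) (\<psi> (\<sigma> j))) js)"
      using Cons by auto
    have "ev \<psi> (hvar sH \<Gamma> (\<sigma> j) (h j) * prod_list (map (\<lambda>j. hvar sH \<Gamma> (\<sigma> j) (h j)) js))
        = act (h j) (\<psi> (\<sigma> j)) * nonempty_prod (map (\<lambda>j. act (h j) (\<psi> (\<sigma> j))) js)"
      using v IH by (subst ev_mult) (auto simp: hpolys_def ev_hvar)
    then show ?thesis using False hpolys_mult[OF v IH(1)] by (simp add: nonempty_prod_Cons)
  qed
qed simp

abbreviation P :: "nat \<Rightarrow> ('h, 'f) hpoly set" where
  "P n \<equiv> multilinear_hpolys sH \<Gamma> n"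

lemma subspace_P: "hpoly.subspace (P n)"
  by (simp add: multilinear_hpolys_def)

lemma subspace_hpolys: "hpoly.subspace (hpolys \<Gamma> :: ('h, 'f) hpoly set)"
proof (rule hpoly.subspaceI)
  show "0 \<in> hpolys \<Gamma>" by (simp add: hpolys_def)
  show "f + g \<in> hpolys \<Gamma>" if "f \<in> hpolys \<Gamma>" "g \<in> hpolys \<Gamma>" for f g :: "('h, 'f) hpoly"
    using that Poly_Mapping.keys_add[of f g] by (fastforce simp: hpolys_def)
  show "hpoly_scale c f \<in> hpolys \<Gamma>" if "f \<in> hpolys \<Gamma>" for c and f :: "('h, 'f) hpoly"
    using that keys_hpoly_scale[of c f] by (fastforce simp: hpolys_def)
qed

lemma sigma_ge_1: "\<sigma> permutes {1..n} \<Longrightarrow> j \<in> set [1..<n+1] \<Longrightarrow> \<sigma> j \<ge> (1::nat)"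
  using permutes_in_image[of \<sigma> "{1..n}" j] by auto

lemma P_subset_hpolys:
  assumes "n \<ge> 1" shows "P n \<subseteq> hpolys \<Gamma>"
  unfolding multilinear_hpolys_def
proof (rule hpoly.span_minimal[OF _ subspace_hpolys], clarify)
  fix \<sigma> :: "nat \<Rightarrow> nat" and h :: "nat \<Rightarrow> 'h" assume "\<sigma> permutes {1..n}"
  then show "prod_list (map (\<lambda>j. hvar sH \<Gamma> (\<sigma> j) (h j)) [1..<n+1]) \<in> hpolys \<Gamma>"
    using prod_list_hvar[of "[1..<n+1]" \<sigma> h] sigma_ge_1 assms by simp
qed

lemma P_identities:
  assumes "n \<ge> 1" shows "P n \<inter> H_identities sA act \<Gamma> = {f \<in> P n. \<forall>\<psi>. ev \<psi> f = 0}"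
  using P_subset_hpolys[OF assms] by (auto simp: H_identities_def)

lemma hfun_ev:
  assumes n: "n \<ge> 1" and f: "f \<in> P n"
  shows "hfun {} (mset_set {1..n}) 0 (\<lambda>\<psi>. ev \<psi> f)"
  using f unfolding multilinear_hpolys_def
proof (induction rule: hpoly.span_induct_alt)
  case base
  show ?case by (simp add: ev_0 hfun_zero)
next
  case (step c u f)
  then obtain \<sigma> h where u: "u = prod_list (map (\<lambda>j. hvar sH \<Gamma> (\<sigma> j) (h j)) [1..<n+1])"
    and \<sigma>: "\<sigma> permutes {1..n}" by blast
  have ev_u: "ev \<psi> u = nonempty_prod (map (\<lambda>j. act (h (Suc j)) (\<psi> (\<sigma> (Suc j)))) [0..<Suc (n - 1)])" for \<psi>
  proof -
    have "ev \<psi> u = nonempty_prod (map (\<lambda>j. act (h j) (\<psi> (\<sigma> j))) [1..<n+1])"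
      unfolding u using prod_list_hvar[of "[1..<n+1]" \<sigma> h \<psi>] sigma_ge_1[OF \<sigma>] n by simp
    also have "[1..<n+1] = map Suc [0..<Suc (n - 1)]" using n by (simp add: map_Suc_upt)
    finally show ?thesis by (simp add: o_def)
  qed
  have "hfun {} (\<Sum>j<Suc (n - 1). {#\<sigma> (Suc j)#}) (\<Sum>j<Suc (n - 1). 0) (\<lambda>\<psi>. ev \<psi> u)"
    unfolding ev_u by (intro hfun_prod hfun_act hfun_var)
  moreover have "(\<Sum>j<Suc (n - 1). {#\<sigma> (Suc j)#}) = mset_set {1..n}"
  proof -
    have "(\<Sum>j<Suc (n - 1). {#\<sigma> (Suc j)#}) = (\<Sum>j\<in>{1..n}. {#\<sigma> j#})"
      by (rule sum.reindex_bij_witness[of _ "\<lambda>j. j - 1" Suc]) (use n in auto)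
    also have "\<dots> = (\<Sum>j\<in>{1..n}. {#j#})" using sum.permute[OF \<sigma>, of "\<lambda>j. {#j#}"] by (simp add: o_def)
    also have "\<dots> = mset_set {1..n}" by (induction "{1..n}" rule: infinite_finite_induct) (auto simp: sum_multiset_singleton)
    finally show ?thesis .
  qed
  ultimately have "hfun {} (mset_set {1..n}) 0 (\<lambda>\<psi>. ev \<psi> u)" by simp
  then have "hfun {} (mset_set {1..n}) 0 (\<lambda>\<psi>. sA c (ev \<psi> u) + ev \<psi> f)"
    using step by (intro hfun_add hfun_scale)
  then show ?case by (simp add: ev_add ev_scale)
qed

text \<open>Constants become additional variables.\<close>

lemma monomial_eq_ev:
  assumes F: "F \<in> monomials E (mset_set {1..k}) N" and n: "k + N \<ge> 1" and E: "E \<noteq> {}"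
  shows "\<exists>p\<in>P (k + N). \<exists>y\<in>{k+1..k+N} \<rightarrow>\<^sub>E E. \<forall>\<psi>. F \<psi> = ev (\<lambda>i. if i \<le> k then \<psi> i else y i) p"
proof -
  obtain ls C where F_eq: "F = (\<lambda>\<psi>. nonempty_prod (map (letter_val \<psi>) ls))" and ls: "ls \<noteq> []"
    and C: "mset (map fst ls) = image_mset Inl (mset_set {1..k}) + image_mset Inr C" "size C = N" "set_mset C \<subseteq> E"
    using F unfolding monomials_def by blast
  obtain cs where cs: "mset cs = C" using ex_mset by blast
  let ?n = "k + N"
  let ?L = "map Inl [1..<k+1] @ map Inr cs"
  have len_cs: "length cs = N" using cs C(2) by auto
  have "mset ?L = mset (map fst ls)"
    using C(1) cs by (simp add: atLeastLessThanSuc_atLeastAtMost del: upt_Suc)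
  then obtain \<pi> where \<pi>: "\<pi> permutes {..<length ?L}" "permute_list \<pi> ?L = map fst ls"
    using mset_eq_permutation[of "map fst ls" ?L] by metis
  have len: "length ls = ?n" using arg_cong[OF \<pi>(2), of length] len_cs by (simp del: upt_Suc)
  \<comment> \<open>Positions in lists start at 0, variables at 1. The variables up to
    \<open>k\<close> are the given ones, and those after \<open>k\<close> receive the constants
    \<open>cs\<close>.\<close>
  define \<sigma> where "\<sigma> j = (if j \<in> {1..?n} then Suc (\<pi> (j - 1)) else j)" for j
  define h where "h j = snd (ls ! (j - 1))" for j
  define y where "y = (\<lambda>i\<in>{k+1..k+N}. cs ! (i - k - 1))"
  have \<pi>': "\<pi> permutes {..<?n}" using \<pi>(1) len_cs by (simp del: upt_Suc)
  have \<sigma>: "\<sigma> permutes {1..?n}"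
  proof (rule bij_imp_permutes)
    show "bij_betw \<sigma> {1..?n} {1..?n}"
    proof (rule bij_betwI[where g = "\<lambda>j. Suc (inv_into UNIV \<pi> (j - 1))"])
      have inv: "inv_into UNIV \<pi> permutes {..<?n}" using \<pi>' by (rule permutes_inv)
      show "\<sigma> \<in> {1..?n} \<rightarrow> {1..?n}"
        using permutes_in_image[OF \<pi>'] by (fastforce simp: \<sigma>_def Suc_le_eq)
      show "(\<lambda>j. Suc (inv_into UNIV \<pi> (j - 1))) \<in> {1..?n} \<rightarrow> {1..?n}"
        using permutes_in_image[OF inv] by (fastforce simp: Suc_le_eq)
      fix j assume j: "j \<in> {1..?n}"
      then show "Suc (inv_into UNIV \<pi> (\<sigma> j - 1)) = j" using permutes_inverses(2)[OF \<pi>'] by (simp add: \<sigma>_def)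
      have "inv_into UNIV \<pi> (j - 1) < ?n" using permutes_in_image[OF inv, of "j - 1"] j by auto
      then show "\<sigma> (Suc (inv_into UNIV \<pi> (j - 1))) = j" using permutes_inverses(1)[OF \<pi>'] j by (simp add: \<sigma>_def Suc_le_eq)
    qed
  qed (auto simp: \<sigma>_def)
  let ?p = "prod_list (map (\<lambda>j. hvar sH \<Gamma> (\<sigma> j) (h j)) [1..<?n+1])"
  have "?p \<in> P ?n" unfolding multilinear_hpolys_def using \<sigma> by (intro hpoly.span_base) blast
  moreover have "y \<in> {k+1..k+N} \<rightarrow>\<^sub>E E"
  proof -
    have "set cs \<subseteq> E" using cs C(3) by auto
    then have "cs ! (i - k - 1) \<in> E" if "i \<in> {k+1..k+N}" for i
      using that len_cs nth_mem[of "i - k - 1" cs] by auto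
    then show ?thesis by (auto simp: y_def)
  qed
  moreover have "F \<psi> = ev (\<lambda>i. if i \<le> k then \<psi> i else y i) ?p" for \<psi>
  proof -
    let ?\<psi> = "\<lambda>i. if i \<le> k then \<psi> i else y i"
    have "ev ?\<psi> ?p = nonempty_prod (map (\<lambda>j. act (h j) (?\<psi> (\<sigma> j))) [1..<?n+1])"
      using prod_list_hvar[of "[1..<?n+1]" \<sigma> h ?\<psi>] sigma_ge_1[OF \<sigma>] n by simp
    also have "map (\<lambda>j. act (h j) (?\<psi> (\<sigma> j))) [1..<?n+1] = map (letter_val \<psi>) ls"
    proof (rule nth_equalityI)
      fix j assume j: "j < length (map (\<lambda>j. act (h j) (?\<psi> (\<sigma> j))) [1..<?n+1])"
      then have jn: "j < ?n" by (simp del: upt_Suc)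
      have \<pi>j: "\<pi> j < ?n" using permutes_in_image[OF \<pi>', of j] jn by simp
      have fst_j: "fst (ls ! j) = ?L ! \<pi> j"
      proof -
        have "fst (ls ! j) = permute_list \<pi> ?L ! j" using \<pi>(2) jn len by simp
        also have "\<dots> = ?L ! \<pi> j" using \<pi>(1) jn len_cs by (intro permute_list_nth) (auto simp del: upt_Suc)
        finally show ?thesis .
      qed
      have "case_sum \<psi> id (?L ! \<pi> j) = ?\<psi> (Suc (\<pi> j))"
      proof (cases "\<pi> j < k")
        case True
        then have "?L ! \<pi> j = Inl (Suc (\<pi> j))" by (simp add: nth_append del: upt_Suc)
        then show ?thesis using True by simp
      next
        case False
        then have "?L ! \<pi> j = Inr (cs ! (\<pi> j - k))" using \<pi>j len_cs by (simp add: nth_append del: upt_Suc)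
        moreover have "y (Suc (\<pi> j)) = cs ! (\<pi> j - k)" using False \<pi>j by (auto simp: y_def)
        ultimately show ?thesis using False by simp
      qed
      then show "map (\<lambda>j. act (h j) (?\<psi> (\<sigma> j))) [1..<?n+1] ! j = map (letter_val \<psi>) ls ! j"
        using jn len fst_j by (simp add: letter_val_def h_def \<sigma>_def del: upt_Suc)
    qed (simp add: len del: upt_Suc)
    finally show ?thesis unfolding F_eq by simp
  qed
  ultimately show ?thesis by blast
qed

end

context generalized_H_action
begin

text \<open>By linearity in each variable the arguments can be moved into \<open>S\<close> one at a
  time without losing the nonzero value.\<close>

lemma hfun_nonzero_on_generators:
  assumes F: "hfun Y (mset_set J) N F" and J: "finite J" and nz: "F \<psi> \<noteq> 0"
    and S: "\<And>j. j \<in> J \<Longrightarrow> \<psi> j \<in> A.span S"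
  shows "\<exists>\<psi>'. (\<forall>j\<in>J. \<psi>' j \<in> S) \<and> F \<psi>' \<noteq> 0"
proof -
  have "\<exists>\<psi>'. (\<forall>j\<in>K. \<psi>' j \<in> S) \<and> (\<forall>j\<in>J - K. \<psi>' j = \<psi> j) \<and> F \<psi>' \<noteq> 0" if "finite K" "K \<subseteq> J" for K
    using that
  proof (induction K rule: finite_induct)
    case empty
    then show ?case using nz by blast
  next
    case (insert j K)
    then obtain \<psi>' where \<psi>': "\<forall>j\<in>K. \<psi>' j \<in> S" "\<forall>j\<in>J - K. \<psi>' j = \<psi> j" "F \<psi>' \<noteq> 0" by blast
    have j: "j \<in> J" using insert by blast
    let ?g = "\<lambda>x. F (\<psi>'(j := x))"
    have count: "count (mset_set J) j = 1" using J j by simp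
    have lin: "?g (x + y) = ?g x + ?g y" "?g (sA c x) = sA c (?g x)" for x y c
      using hfun_linear[OF F count] by (simp_all del: fun_upd_apply)
    obtain s where s: "s \<in> S" "?g s \<noteq> 0"
    proof (rule A.span_nonzero[of ?g "\<psi>' j" S])
      show "\<psi>' j \<in> A.span S" using S[OF j] \<psi>'(2) insert j by auto
    qed (use lin \<psi>'(3) in auto)
    have "F (\<psi>'(j := s)) \<noteq> 0" by (rule s(2))
    moreover have "\<forall>i\<in>insert j K. (\<psi>'(j := s)) i \<in> S"
      "\<forall>i\<in>J - insert j K. (\<psi>'(j := s)) i = \<psi> i" using s(1) \<psi>' insert.hyps by auto
    ultimately show ?case by blast
  qed
  from this[OF J order_refl] show ?thesis by blast
qed

lemma hfun_nonzero_monomial: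
  assumes F: "hfun Y V N F" and nz: "F \<psi> \<noteq> 0"
  obtains M where "M \<in> monomials Y V N" "M \<psi> \<noteq> 0"
proof -
  interpret F: generalized_H_action "\<lambda>c (f :: ('v \<Rightarrow> 'a) \<Rightarrow> 'a) x. sA c (f x)" sH "\<lambda>h f x. act h (f x)"
    by (rule generalized_H_action_fun)
  show ?thesis
    by (rule F.A.span_nonzero[of "\<lambda>f. f \<psi>", OF _ _ hfun_in_span_monomials[OF F] nz]) (auto intro: that)
qed

end

section \<open>Codimensions in terms of functions\<close>

locale fd_H_basis = H_basis sA sH act \<Gamma> + fd_H_action sA sH act
  for sA :: "'f::field \<Rightarrow> 'a::ring \<Rightarrow> 'a" and sH :: "'f \<Rightarrow> 'h::ring_1 \<Rightarrow> 'h" and act \<Gamma>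
begin

text \<open>The tests are the coordinates in \<open>E\<close> of the values at the points of
  \<open>G\<close>.\<close>

lemma quotient_independent_P_card_le:
  assumes n: "n \<ge> 1" and G: "finite G"
    and tests: "\<And>F. hfun {} (mset_set {1..n}) 0 F \<Longrightarrow> \<forall>\<psi>\<in>G. F \<psi> = 0 \<Longrightarrow> \<forall>\<psi>. F \<psi> = 0"
    and E: "finite E" "A.independent E" "A.span E = UNIV"
    and S: "S \<subseteq> P n"
    and ind: "\<And>T c. finite T \<Longrightarrow> T \<subseteq> S \<Longrightarrow> (\<Sum>v\<in>T. hpoly_scale (c v) v) \<in> P n \<inter> H_identities sA act \<Gamma>
       \<Longrightarrow> \<forall>v\<in>T. c v = 0"
  shows "finite S \<and> card S \<le> card G * card E"
proof -
  have "finite S \<and> card S \<le> card (G \<times> E)"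
  proof (rule hpoly.quotient_independent_card_le[OF subspace_P S ind])
    let ?t = "\<lambda>(\<psi>, e) f. A.representation E (ev \<psi> f) e"
    show "finite (G \<times> E)" using G E by simp
    show "?t i (x + y) = ?t i x + ?t i y" for i x y
      using E by (auto simp: ev_add A.representation_add split: prod.split)
    show "?t i (hpoly_scale c x) = c * ?t i x" for i c x
      using E by (auto simp: ev_scale A.representation_scale split: prod.split)
    fix f assume f: "f \<in> P n" "\<forall>i\<in>G \<times> E. ?t i f = 0"
    have "ev \<psi> f = 0" if \<psi>: "\<psi> \<in> G" for \<psi>
    proof -
      have "ev \<psi> f = (\<Sum>e\<in>E. sA (A.representation E (ev \<psi> f) e) e)"
        using E by (intro A.sum_representation_eq[symmetric]) auto
      also have "\<dots> = 0" using f(2) \<psi> by (intro sum.neutral) auto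
      finally show ?thesis .
    qed
    then have "\<forall>\<psi>. ev \<psi> f = 0" by (intro tests[OF hfun_ev[OF n f(1)]]) blast
    then show "f \<in> P n \<inter> H_identities sA act \<Gamma>" using f(1) by (simp add: P_identities[OF n])
  qed
  then show ?thesis by (simp add: card_cartesian_product)
qed

text \<open>\<open>H_codim\<close> chooses a basis of the quotient by \<open>SOME\<close>, which is
  meaningful once a basis exists and is known to be finite. Tuples from a basis of A, with the value
  0 at all other variables, form a finite set of test points.\<close>

lemma H_codim_quotient_basis:
  assumes n: "n \<ge> 1"
  obtains S where "quotient_basis hpoly_scale (P n) (P n \<inter> H_identities sA act \<Gamma>) S"
    "finite S" "card S = H_codim sA sH act \<Gamma> n"
proof -
  let ?W = "P n \<inter> H_identities sA act \<Gamma>"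
  obtain E where E: "finite E" "A.independent E" "A.span E = UNIV" using A.fd_basis by blast
  define G where "G = (\<lambda>\<tau> j. if j \<in> {1..n} then \<tau> j else 0) ` ({1..n} \<rightarrow>\<^sub>E E)"
  have G: "finite G" unfolding G_def using E by (intro finite_imageI finite_PiE) auto
  have tests: "\<forall>\<psi>. F \<psi> = 0" if F: "hfun {} (mset_set {1..n}) 0 F" and z: "\<forall>\<psi>\<in>G. F \<psi> = 0" for F
  proof (rule ccontr)
    assume "\<not> ?thesis"
    then obtain \<psi> where "F \<psi> \<noteq> 0" by blast
    then obtain \<psi>' where \<psi>': "\<forall>j\<in>{1..n}. \<psi>' j \<in> E" "F \<psi>' \<noteq> 0"
      using hfun_nonzero_on_generators[OF F, of \<psi> E] E by auto
    let ?\<psi> = "\<lambda>j. if j \<in> {1..n} then restrict \<psi>' {1..n} j else 0"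
    have "?\<psi> \<in> G" unfolding G_def using \<psi>'(1) by (intro imageI) auto
    moreover have "F ?\<psi> = F \<psi>'" by (rule hfun_cong[OF F]) auto
    ultimately show False using z \<psi>'(2) by auto
  qed
  have "\<exists>S. quotient_basis hpoly_scale (P n) ?W S"
  proof (rule hpoly.exists_quotient_basis[OF subspace_P, where b = "card G * card E"])
    show "hpoly.subspace ?W"
      unfolding P_identities[OF n]
      using subspace_P[of n] by (auto simp: hpoly.subspace_def ev_0 ev_add ev_scale)
    show "finite S \<and> card S \<le> card G * card E" if "S \<subseteq> P n"
      "\<And>T c. finite T \<Longrightarrow> T \<subseteq> S \<Longrightarrow> (\<Sum>v\<in>T. hpoly_scale (c v) v) \<in> ?W \<Longrightarrow> \<forall>v\<in>T. c v = 0" for S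
      by (rule quotient_independent_P_card_le[OF n G tests E that])
  qed
  then have S: "quotient_basis hpoly_scale (P n) ?W (SOME S. quotient_basis hpoly_scale (P n) ?W S)"
    (is "quotient_basis _ _ _ ?S") by (rule someI_ex)
  have "finite ?S \<and> card ?S \<le> card G * card E"
    by (rule quotient_independent_P_card_le[OF n G tests E]) (use S in \<open>auto simp: quotient_basis_def\<close>)
  with S show ?thesis by (intro that[of ?S]) (auto simp: H_codim_def quotient_dim_def)
qed

lemma H_codim_le:
  assumes n: "n \<ge> 1" and G: "finite G"
    and tests: "\<And>F. hfun {} (mset_set {1..n}) 0 F \<Longrightarrow> \<forall>\<psi>\<in>G. F \<psi> = 0 \<Longrightarrow> \<forall>\<psi>. F \<psi> = 0"
    and E: "finite E" "A.independent E" "A.span E = UNIV"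
  shows "H_codim sA sH act \<Gamma> n \<le> card G * card E"
proof -
  obtain S where S: "quotient_basis hpoly_scale (P n) (P n \<inter> H_identities sA act \<Gamma>) S"
    "finite S" "card S = H_codim sA sH act \<Gamma> n" using H_codim_quotient_basis[OF n] .
  have "finite S \<and> card S \<le> card G * card E"
    by (rule quotient_independent_P_card_le[OF n G tests E]) (use S(1) in \<open>auto simp: quotient_basis_def\<close>)
  then show ?thesis using S(3) by simp
qed

text \<open>The \<open>N\<close> constants are expanded in \<open>E\<close> and then regarded as
  additional variables. Modulo identities the multilinear polynomials of degree k + N are
  combinations of \<open>H_codim\<close> many, so with \<open>card E ^ N\<close> choices for the
  additional variables all \<open>F w\<close> lie in the span of that many functions.\<close>

lemma hfun_family_card_le:
  assumes X: "finite X" and F: "\<And>w. w \<in> X \<Longrightarrow> hfun UNIV (mset_set {1..k}) N (F w)"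
    and n: "k + N \<ge> 1"
    and ind: "\<And>c. \<forall>\<psi>. (\<Sum>w\<in>X. sA (c w) (F w \<psi>)) = 0 \<Longrightarrow> \<forall>w\<in>X. c w = 0"
    and E: "finite E" "A.span E = UNIV" "E \<noteq> {}"
  shows "card X \<le> H_codim sA sH act \<Gamma> (k + N) * card E ^ N"
proof -
  interpret F: generalized_H_action "\<lambda>c (f :: (nat \<Rightarrow> 'a) \<Rightarrow> 'a) x. sA c (f x)" sH "\<lambda>h f x. act h (f x)"
    by (rule generalized_H_action_fun)
  let ?W = "P (k + N) \<inter> H_identities sA act \<Gamma>"
  obtain S where S: "quotient_basis hpoly_scale (P (k + N)) ?W S"
    "finite S" "card S = H_codim sA sH act \<Gamma> (k + N)" using H_codim_quotient_basis[OF n] .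
  note finS = S(2)
  let ?c = "\<lambda>\<psi> y i. if i \<le> k then \<psi> i else y i"
  let ?Y = "{k+1..k+N} \<rightarrow>\<^sub>E E"
  define Z where "Z = (\<lambda>(u, y) \<psi>. ev (?c \<psi> y) u) ` (S \<times> ?Y)"
  have finY: "finite ?Y" using E by (intro finite_PiE) auto
  have finZ: "finite Z" unfolding Z_def using finS finY by auto
  have "card Z \<le> card (S \<times> ?Y)" unfolding Z_def using finS finY by (intro card_image_le) auto
  also have "card (S \<times> ?Y) = card S * card E ^ N" by (simp add: card_cartesian_product card_PiE)
  finally have cardZ: "card Z \<le> card S * card E ^ N" .
  have F_span: "F w \<in> F.A.span Z" if w: "w \<in> X" for w
  proof -
    have "hfun E (mset_set {1..k}) N (F w)"
      by (rule hfun_const_span[OF _ F[OF w]]) (use E in auto)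
    then have "F w \<in> F.A.span (monomials E (mset_set {1..k}) N)" by (rule hfun_in_span_monomials)
    also have "\<dots> \<subseteq> F.A.span Z"
    proof (rule F.A.span_minimal)
      show "monomials E (mset_set {1..k}) N \<subseteq> F.A.span Z"
      proof
        fix M assume "M \<in> monomials E (mset_set {1..k}) N"
        then obtain p y where p: "p \<in> P (k + N)" "y \<in> ?Y" "\<And>\<psi>. M \<psi> = ev (?c \<psi> y) p"
          using monomial_eq_ev[OF _ n E(3)] by blast
        have "\<forall>v\<in>P (k + N). \<exists>T c. finite T \<and> T \<subseteq> S \<and> v - (\<Sum>u\<in>T. hpoly_scale (c u) u) \<in> ?W"
          using S(1) unfolding quotient_basis_def by (elim conjE)
        from bspec[OF this p(1)] obtain T c where
          T: "finite T" "T \<subseteq> S" "p - (\<Sum>u\<in>T. hpoly_scale (c u) u) \<in> ?W" by (elim exE conjE)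
        have "ev \<psi> p = (\<Sum>u\<in>T. sA (c u) (ev \<psi> u))" for \<psi>
        proof -
          have "ev \<psi> (p - (\<Sum>u\<in>T. hpoly_scale (c u) u)) = 0"
            using T(3) unfolding P_identities[OF n] by blast
          moreover have "ev \<psi> p = ev \<psi> (p - (\<Sum>u\<in>T. hpoly_scale (c u) u)) + ev \<psi> (\<Sum>u\<in>T. hpoly_scale (c u) u)"
            by (simp flip: ev_add)
          ultimately show ?thesis by (simp add: ev_sum ev_scale)
        qed
        then have "M = (\<Sum>u\<in>T. (\<lambda>\<psi>. sA (c u) (ev (?c \<psi> y) u)))"
          using p(3) by (simp add: fun_eq_iff sum_fun_apply)
        moreover have "(\<lambda>\<psi>. sA (c u) (ev (?c \<psi> y) u)) \<in> F.A.span Z" if "u \<in> T" for u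
        proof (rule F.A.span_scale, rule F.A.span_base)
          show "(\<lambda>\<psi>. ev (?c \<psi> y) u) \<in> Z"
            unfolding Z_def using that T(2) p(2) by (intro image_eqI[of _ _ "(u, y)"]) auto
        qed
        ultimately show "M \<in> F.A.span Z" by (simp add: F.A.span_sum)
      qed
    qed simp
    finally show ?thesis .
  qed
  have "card X \<le> card Z"
  proof (rule ccontr)
    assume "\<not> card X \<le> card Z"
    then have "\<exists>c. (\<exists>w\<in>X. c w \<noteq> 0) \<and> (\<Sum>w\<in>X. (\<lambda>\<psi>. sA (c w) (F w \<psi>))) = 0"
      by (intro F.A.exists_linear_relation[OF X finZ _ F_span]) auto
    then obtain c where c: "\<exists>w\<in>X. c w \<noteq> 0" "(\<Sum>w\<in>X. (\<lambda>\<psi>. sA (c w) (F w \<psi>))) = 0" by blast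
    have "(\<Sum>w\<in>X. sA (c w) (F w \<psi>)) = 0" for \<psi>
      using fun_cong[OF c(2), of \<psi>] by (simp add: sum_fun_apply)
    then show False using ind c(1) by blast
  qed
  then show ?thesis using cardZ S(3) by simp
qed

end

section \<open>Labelled products\<close>

locale wm_decomposition = fd_H_radical sA sH act + fd_H_basis sA sH act \<Gamma>
  for sA :: "'f::{alg_closed_field, field_char_0} \<Rightarrow> 'a::ring \<Rightarrow> 'a"
    and sH :: "'f \<Rightarrow> 'h::ring_1 \<Rightarrow> 'h" and act and \<Gamma> +
  fixes B :: "nat \<Rightarrow> 'a mod_jrad set" and \<kappa> :: "'a mod_jrad \<Rightarrow> 'a" and q :: nat
    and m :: "nat \<Rightarrow> nat" and e :: "nat \<Rightarrow> nat \<Rightarrow> 'a mod_jrad"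
  assumes B_ideal: "i \<in> {1..q} \<Longrightarrow> H_invariant_ideal (mod_jrad_scale sA) (mod_jrad_act act) UNIV (B i)"
    and B_simple: "i \<in> {1..q} \<Longrightarrow> H_simple (mod_jrad_scale sA) (mod_jrad_act act) (B i)"
    and B_sum: "direct_sum {1..q} B"
    and \<kappa>_hom: "algebra_hom (mod_jrad_scale sA) sA \<kappa>"
    and proj_\<kappa>: "jrad_proj (\<kappa> x) = x"
    and inj_e: "i \<in> {1..q} \<Longrightarrow> inj_on (e i) {..<m i}"
    and indep_e: "i \<in> {1..q} \<Longrightarrow> Q.A.independent (e i ` {..<m i})"
    and span_e: "i \<in> {1..q} \<Longrightarrow> Q.A.span (e i ` {..<m i}) = B i"
begin

lemma block:
  assumes i: "i \<in> {1..q}"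
  shows "H_simple_block (mod_jrad_scale sA) sH (mod_jrad_act act) (B i) (m i) (e i)"
proof unfold_locales
  show "I \<subseteq> {0}" if "left_ideal I" "\<And>x. x \<in> I \<Longrightarrow> \<exists>n. pw x n = 0" for I :: "'a mod_jrad set"
    using that by (rule nil_left_ideal_mod_jrad)
qed (fact B_ideal[OF i] B_simple[OF i] inj_e[OF i] indep_e[OF i] span_e[OF i])+

lemma \<kappa>_add: "\<kappa> (x + y) = \<kappa> x + \<kappa> y" and \<kappa>_mult: "\<kappa> (x * y) = \<kappa> x * \<kappa> y"
  and \<kappa>_scale: "\<kappa> (mod_jrad_scale sA c x) = sA c (\<kappa> x)"
  using \<kappa>_hom by (auto simp: algebra_hom_def)

lemma \<kappa>_0: "\<kappa> 0 = 0"
  using \<kappa>_add[of 0 0] by simp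

lemma \<kappa>_sum: "\<kappa> (sum f S) = (\<Sum>i\<in>S. \<kappa> (f i))"
  by (induction S rule: infinite_finite_induct) (auto simp: \<kappa>_0 \<kappa>_add)

lemma \<kappa>_span: "x \<in> Q.A.span S \<Longrightarrow> \<kappa> x \<in> A.span (\<kappa> ` S)"
proof (induction rule: Q.A.span_induct_alt)
  case (step c u z)
  then show ?case by (simp add: \<kappa>_add \<kappa>_scale A.span_add A.span_scale A.span_base)
qed (simp add: \<kappa>_0 A.span_zero)

lemma \<kappa>_nonempty_prod: "xs \<noteq> [] \<Longrightarrow> \<kappa> (nonempty_prod xs) = nonempty_prod (map \<kappa> xs)"
proof (induction xs)
  case (Cons x xs)
  then show ?case by (cases "xs = []") (auto simp: nonempty_prod_Cons \<kappa>_mult)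
qed simp

lemma B_0: "i \<in> {1..q} \<Longrightarrow> 0 \<in> B i" and B_uminus: "i \<in> {1..q} \<Longrightarrow> x \<in> B i \<Longrightarrow> - x \<in> B i"
  using B_ideal Q.A.subspace_0 Q.A.subspace_neg by (auto simp: H_invariant_ideal_def)

lemma B_decompose: obtains b where "\<And>i. i \<in> {1..q} \<Longrightarrow> b i \<in> B i" "x = (\<Sum>i\<in>{1..q}. b i)"
proof -
  have "\<exists>!b. b \<in> (\<Pi>\<^sub>E i\<in>{1..q}. B i) \<and> x = (\<Sum>i\<in>{1..q}. b i)"
    using B_sum unfolding direct_sum_def by blast
  then obtain b where b: "b \<in> (\<Pi>\<^sub>E i\<in>{1..q}. B i)" "x = (\<Sum>i\<in>{1..q}. b i)" by blast
  show ?thesis by (rule that[OF PiE_mem[OF b(1)] b(2)])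
qed

lemma B_mult_0:
  assumes "i \<in> {1..q}" "j \<in> {1..q}" "i \<noteq> j" "x \<in> B i" "y \<in> B j"
  shows "x * y = 0"
proof (rule direct_sum_Int[OF B_sum _ B_0 B_uminus assms(1-3)])
  show "x * y \<in> B i" "x * y \<in> B j"
    using B_ideal[OF assms(1)] B_ideal[OF assms(2)] assms by (auto simp: H_invariant_ideal_def)
qed auto

definition W :: "nat \<Rightarrow> 'a set" where
  "W i = H_span sA act (\<kappa> ` B i)"

lemma W_act: "w \<in> W i \<Longrightarrow> act h w \<in> W i"
  unfolding W_def H_span_def
proof (induction rule: A.span_induct_alt)
  case (step c u z)
  then obtain h' v where "u = act h' v" "v \<in> \<kappa> ` B i" by blast
  then have "act h u \<in> A.span {act h v | h v. v \<in> \<kappa> ` B i}"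
    by (intro A.span_base CollectI exI[of _ "h * h'"] exI[of _ v]) (simp add: act_mult)
  then show ?case using step by (simp add: act_add_right act_scale_right A.span_add A.span_scale)
qed (simp add: act_0 A.span_zero)

lemma \<kappa>_in_W: "b \<in> B i \<Longrightarrow> \<kappa> b \<in> W i"
  unfolding W_def H_span_def by (intro A.span_base CollectI exI[of _ 1] exI[of _ "\<kappa> b"]) (simp add: act_one)

lemma diff_\<kappa>_in_radical: "x - \<kappa> (jrad_proj x) \<in> jacobson_radical"
  by (simp add: jrad_proj_eq_iff[symmetric] proj_\<kappa>)

lemma proj_W: "w \<in> W i \<Longrightarrow> i \<in> {1..q} \<Longrightarrow> jrad_proj w \<in> B i"
  unfolding W_def H_span_def
proof (induction rule: A.span_induct_alt)
  case base
  then show ?case using B_0 by (simp add: jrad_proj_0)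
next
  case (step c u z)
  then obtain h b where "u = act h (\<kappa> b)" "b \<in> B i" by blast
  then have "jrad_proj u \<in> B i"
    using B_ideal[OF step.prems] by (simp add: jrad_proj_act proj_\<kappa> H_invariant_ideal_def)
  then show ?case
    using B_ideal[OF step.prems] step Q.A.subspace_add Q.A.subspace_scale
    by (simp add: jrad_proj_hom H_invariant_ideal_def)
qed

text \<open>A labelled list attaches to each factor the block it comes from, or \<open>0\<close> if it lies in the
  radical.\<close>

definition lab :: "nat \<Rightarrow> 'a set" where
  "lab i = (if i = 0 then jacobson_radical else \<kappa> ` B i)"

definition valid :: "(nat \<times> 'a) list \<Rightarrow> bool" where
  "valid zs \<longleftrightarrow> (\<forall>(i, x)\<in>set zs. i \<le> q \<and> x \<in> lab i)"

abbreviation prodl :: "(nat \<times> 'a) list \<Rightarrow> 'a" where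
  "prodl zs \<equiv> nonempty_prod (map snd zs)"

definition cnt :: "nat \<Rightarrow> (nat \<times> 'a) list \<Rightarrow> nat" where
  "cnt i zs = length (filter (\<lambda>z. fst z = i) zs)"

lemma cnt_simps [simp]: "cnt i [] = 0" "cnt i (z # zs) = (if fst z = i then 1 else 0) + cnt i zs"
  "cnt i (zs @ zs') = cnt i zs + cnt i zs'"
  by (auto simp: cnt_def)

lemma cnt_concat: "cnt i (concat zss) = (\<Sum>zs\<leftarrow>zss. cnt i zs)"
  by (induction zss) auto

lemma cnt_pos_iff: "cnt i zs > 0 \<longleftrightarrow> i \<in> fst ` set zs"
  by (induction zs) auto

lemma valid_simps [simp]: "valid []" "valid (z # zs) \<longleftrightarrow> fst z \<le> q \<and> snd z \<in> lab (fst z) \<and> valid zs"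
  "valid (zs @ zs') \<longleftrightarrow> valid zs \<and> valid zs'"
  by (auto simp: valid_def)

lemma valid_concat: "valid (concat zss) \<longleftrightarrow> (\<forall>zs\<in>set zss. valid zs)"
  by (induction zss) auto

lemma prodl_concat:
  "zss \<noteq> [] \<Longrightarrow> \<forall>zs\<in>set zss. zs \<noteq> [] \<Longrightarrow> prodl (concat zss) = nonempty_prod (map prodl zss)"
  using nonempty_prod_concat[of "map (map snd) zss"] by (simp add: map_concat o_def)

lemma W_decompose:
  assumes "i \<in> {1..q}" "w \<in> W i"
  shows "w = \<kappa> (jrad_proj w) + (w - \<kappa> (jrad_proj w))" "\<kappa> (jrad_proj w) \<in> lab i"
    "w - \<kappa> (jrad_proj w) \<in> lab 0"
  using assms proj_W diff_\<kappa>_in_radical by (auto simp: lab_def)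

definition nil_index :: nat where
  "nil_index = (SOME p. p \<ge> 1 \<and> (\<forall>ys :: 'a list.
     length (filter (\<lambda>y. y \<in> jacobson_radical) ys) \<ge> p \<longrightarrow> nonempty_prod ys = 0))"

lemma nil_index: "nil_index \<ge> 1"
  "length (filter (\<lambda>y. y \<in> jacobson_radical) ys) \<ge> nil_index \<Longrightarrow> nonempty_prod (ys :: 'a list) = 0"
proof -
  have "\<exists>p. p \<ge> 1 \<and> (\<forall>ys :: 'a list.
     length (filter (\<lambda>y. y \<in> jacobson_radical) ys) \<ge> p \<longrightarrow> nonempty_prod ys = 0)"
    using A.jacobson_radical_factors by metis
  from someI_ex[OF this] show "nil_index \<ge> 1"
    "length (filter (\<lambda>y. y \<in> jacobson_radical) ys) \<ge> nil_index \<Longrightarrow> nonempty_prod ys = 0"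
    unfolding nil_index_def by blast+
qed

lemma prodl_eq_0:
  assumes "\<And>x. (0, x) \<in> set zs \<Longrightarrow> x \<in> jacobson_radical" and "cnt 0 zs \<ge> nil_index"
  shows "prodl zs = 0"
proof (rule nil_index(2))
  have "cnt 0 zs \<le> length (filter (\<lambda>y. y \<in> jacobson_radical) (map snd zs))"
    using assms(1) by (induction zs) force+
  then show "nil_index \<le> length (filter (\<lambda>y. y \<in> jacobson_radical) (map snd zs))"
    using assms(2) by simp
qed

lemma valid_prodl_eq_0: "valid zs \<Longrightarrow> cnt 0 zs \<ge> nil_index \<Longrightarrow> prodl zs = 0"
  by (rule prodl_eq_0) (auto simp: valid_def lab_def)

section \<open>Chains of blocks\<close>

abbreviation chain :: "nat list \<Rightarrow> 'a set" where
  "chain is \<equiv> unitization_chain sA (map W is)"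

lemma chain_Cons_mult:
  assumes x: "x \<in> W i" and c: "c \<in> chain is" and ne: "is \<noteq> []"
  shows "x * c \<in> chain (i # is)" "x * a * c \<in> chain (i # is)"
proof -
  obtain j js where is_eq: "is = j # js" using ne by (cases "is") auto
  have "x = x * 0 + sA 1 x" "x * a = x * a + sA 0 x" by simp_all
  then have "x \<in> prod_unitization sA (W i)" "x * a \<in> prod_unitization sA (W i)"
    unfolding prod_unitization_def using x by (blast intro: A.span_base)+
  then show "x * c \<in> chain (i # is)" "x * a * c \<in> chain (i # is)"
    using c unfolding is_eq by (auto simp: subspace_prod_def intro!: A.span_base)
qed

text \<open>\<open>None\<close> stands for multiplication by the unit of
  \<open>A\<^sup>+\<close>.\<close>

definition mul_l :: "'a option \<Rightarrow> 'a \<Rightarrow> 'a" where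
  "mul_l a x = (case a of None \<Rightarrow> x | Some a \<Rightarrow> a * x)"

definition mul_r :: "'a \<Rightarrow> 'a option \<Rightarrow> 'a" where
  "mul_r x b = (case b of None \<Rightarrow> x | Some b \<Rightarrow> x * b)"

text \<open>\<open>remdups\<close> keeps the last occurrence of each block. From right to left, a
  factor with label 0, or one whose block occurs again further right, is absorbed into the left
  multiplier \<open>a\<close>; when a new block appears, \<open>a\<close> becomes the element
  between two members of the chain.\<close>

lemma prodl_in_chain:
  assumes "\<And>i x. (i, x) \<in> set ys \<Longrightarrow> i \<noteq> 0 \<Longrightarrow> x \<in> W i"
    and "filter (\<lambda>i. i \<noteq> 0) (map fst ys) \<noteq> []"
  shows "\<exists>c\<in>chain (remdups (filter (\<lambda>i. i \<noteq> 0) (map fst ys))). \<exists>a b. prodl ys = mul_l a (mul_r c b)"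
  using assms
proof (induction ys)
  case (Cons y ys)
  obtain i x where y: "y = (i, x)" by (cases y)
  let ?l = "filter (\<lambda>i. i \<noteq> 0) (map fst ys)"
  have mul: "z * mul_l a w = mul_l (Some (case a of None \<Rightarrow> z | Some a \<Rightarrow> z * a)) w" for z a w
    by (auto simp: mul_l_def mult.assoc split: option.split)
  show ?case
  proof (cases "ys = []")
    case True
    then have "i \<noteq> 0" "x \<in> W i" using Cons.prems y by (auto split: if_splits)
    then show ?thesis using True y
      by (intro bexI[of _ x] exI[of _ None]) (auto simp: mul_l_def mul_r_def)
  next
    case False
    have prod: "prodl (y # ys) = x * prodl ys" using False y by (simp add: nonempty_prod_Cons)
    show ?thesis
    proof (cases "?l = []")
      case True
      then have "i \<noteq> 0" "x \<in> W i" using Cons.prems y by (auto split: if_splits)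
      moreover have "remdups (filter (\<lambda>i. i \<noteq> 0) (map fst (y # ys))) = [i]"
        using True \<open>i \<noteq> 0\<close> y by simp
      moreover have "prodl (y # ys) = mul_l None (mul_r x (Some (prodl ys)))"
        using prod by (simp add: mul_l_def mul_r_def)
      ultimately show ?thesis by (intro bexI[of _ x]) auto
    next
      case l_ne: False
      have "\<exists>c\<in>chain (remdups ?l). \<exists>a b. prodl ys = mul_l a (mul_r c b)"
        by (rule Cons.IH[OF _ l_ne]) (use Cons.prems in auto)
      then obtain c a b where c: "c \<in> chain (remdups ?l)" "prodl ys = mul_l a (mul_r c b)" by blast
      show ?thesis
      proof (cases "i = 0 \<or> i \<in> set ?l")
        case True
        then have eq: "remdups (filter (\<lambda>i. i \<noteq> 0) (map fst (y # ys))) = remdups ?l"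
          using y by auto
        show ?thesis unfolding eq prod c(2) mul using c(1) by blast
      next
        case new: False
        then have eq: "remdups (filter (\<lambda>i. i \<noteq> 0) (map fst (y # ys))) = i # remdups ?l"
          using y by auto
        have x: "x \<in> W i" using Cons.prems(1)[of i x] y new by auto
        have ne: "remdups ?l \<noteq> []" using l_ne by (metis remdups_eq_nil_iff)
        let ?c = "(case a of None \<Rightarrow> x | Some a \<Rightarrow> x * a) * c"
        have "?c \<in> chain (i # remdups ?l)"
          using chain_Cons_mult[OF x c(1) ne] by (auto split: option.split)
        moreover have "x * mul_l a (mul_r c b) = mul_l None (mul_r ?c b)"
          by (auto simp: mul_l_def mul_r_def mult.assoc split: option.split)
        ultimately show ?thesis unfolding eq prod c(2) by blast
      qed
    qed
  qed
qed simp

lemma chain_nonzero: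
  assumes "\<And>i x. (i, x) \<in> set ys \<Longrightarrow> i \<noteq> 0 \<Longrightarrow> x \<in> W i"
    and "filter (\<lambda>i. i \<noteq> 0) (map fst ys) \<noteq> []" and "prodl ys \<noteq> 0"
  shows "chain (remdups (filter (\<lambda>i. i \<noteq> 0) (map fst ys))) \<noteq> {0}"
  using prodl_in_chain[OF assms(1,2)] assms(3)
  by (auto simp: mul_l_def mul_r_def split: option.splits)

lemma zero_in_chain: "is \<noteq> [] \<Longrightarrow> 0 \<in> chain is"
  by (cases "is" rule: list.exhaust; cases "tl is")
    (auto simp: W_def H_span_def subspace_prod_def A.span_zero)

text \<open>Label 0 carries no condition here: it marks the elements of A that stand between the
  blocks, radical or not.\<close>

lemma chain_subset_span:
  "is \<noteq> [] \<Longrightarrow> 0 \<notin> set is \<Longrightarrow> chain is \<subseteq> A.span {prodl ys | ys. ys \<noteq> []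
     \<and> (\<forall>(i, x)\<in>set ys. i \<in> insert 0 (set is) \<and> (i \<noteq> 0 \<longrightarrow> x \<in> W i)) \<and> set is \<subseteq> fst ` set ys}"
proof (induction "is")
  case (Cons i "is")
  let ?S = "\<lambda>is. {prodl ys | ys. ys \<noteq> []
     \<and> (\<forall>(i, x)\<in>set ys. i \<in> insert 0 (set is) \<and> (i \<noteq> 0 \<longrightarrow> x \<in> W i)) \<and> set is \<subseteq> fst ` set ys}"
  show ?case
  proof (cases "is")
    case Nil
    have "x \<in> ?S [i]" if "x \<in> W i" for x
      using that Cons.prems by (intro CollectI exI[of _ "[(i, x)]"]) auto
    then show ?thesis using Nil by (auto intro: A.span_base)
  next
    case (Cons j js)
    have v: "v \<in> A.span (?S [i])" if "v \<in> prod_unitization sA (W i)" for v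
    proof -
      have "u * a + sA c u \<in> A.span (?S [i])" if u: "u \<in> W i" for u a c
      proof -
        have "u \<in> ?S [i]" using u Cons.prems by (intro CollectI exI[of _ "[(i, u)]"]) auto
        moreover have "u * a \<in> ?S [i]"
          using u Cons.prems by (intro CollectI exI[of _ "[(i, u), (0, a)]"]) auto
        ultimately show ?thesis by (intro A.span_add A.span_scale A.span_base)
      qed
      then have "prod_unitization sA (W i) \<subseteq> A.span (?S [i])"
        unfolding prod_unitization_def by (intro A.span_minimal) auto
      then show ?thesis using that by blast
    qed
    have sub: "{s * t | s t. s \<in> ?S [i] \<and> t \<in> ?S is} \<subseteq> ?S (i # is)"
    proof clarify
      fix ys zs :: "(nat \<times> 'a) list"
      assume "ys \<noteq> []" "\<forall>(j, x)\<in>set ys. j \<in> insert 0 (set [i]) \<and> (j \<noteq> 0 \<longrightarrow> x \<in> W j)"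
        "set [i] \<subseteq> fst ` set ys"
        "zs \<noteq> []" "\<forall>(i, x)\<in>set zs. i \<in> insert 0 (set is) \<and> (i \<noteq> 0 \<longrightarrow> x \<in> W i)"
        "set is \<subseteq> fst ` set zs"
      then show "\<exists>ys'. prodl ys * prodl zs = prodl ys' \<and> ys' \<noteq> []
          \<and> (\<forall>(j, x)\<in>set ys'. j \<in> insert 0 (set (i # is)) \<and> (j \<noteq> 0 \<longrightarrow> x \<in> W j))
          \<and> set (i # is) \<subseteq> fst ` set ys'"
        by (intro exI[of _ "ys @ zs"]) (auto simp: nonempty_prod_append)
    qed
    have IH: "chain is \<subseteq> A.span (?S is)" using Cons.IH Cons.prems Cons by simp
    have "v * w \<in> A.span (?S (i # is))" if "v \<in> prod_unitization sA (W i)" "w \<in> chain is" for v w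
      using A.span_mult[OF v[OF that(1)] subsetD[OF IH that(2)]] A.span_mono[OF sub] by blast
    then have "subspace_prod sA (prod_unitization sA (W i)) (chain is) \<subseteq> A.span (?S (i # is))"
      unfolding subspace_prod_def by (intro A.span_minimal) auto
    then show ?thesis using Cons by simp
  qed
qed simp

end

section \<open>The upper bound\<close>

context wm_decomposition
begin

lemma A_decompose: "x \<in> A.span (\<Union>i\<in>{0..q}. lab i)"
proof -
  obtain b where b: "\<And>i. i \<in> {1..q} \<Longrightarrow> b i \<in> B i" "jrad_proj x = (\<Sum>i\<in>{1..q}. b i)"
    using B_decompose[of "jrad_proj x"] by blast
  have "\<kappa> (b i) \<in> (\<Union>i\<in>{0..q}. lab i)" if "i \<in> {1..q}" for i
    using that b(1) by (intro UN_I[of i]) (auto simp: lab_def)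
  then have "\<kappa> (jrad_proj x) \<in> A.span (\<Union>i\<in>{0..q}. lab i)"
    unfolding b(2) \<kappa>_sum by (intro A.span_sum A.span_base)
  moreover have "x - \<kappa> (jrad_proj x) \<in> A.span (\<Union>i\<in>{0..q}. lab i)"
    using diff_\<kappa>_in_radical by (intro A.span_base UN_I[of 0]) (auto simp: lab_def)
  ultimately have "\<kappa> (jrad_proj x) + (x - \<kappa> (jrad_proj x)) \<in> A.span (\<Union>i\<in>{0..q}. lab i)"
    by (rule A.span_add)
  then show ?thesis by simp
qed

lemma card_small_subsets:
  "card {K. K \<subseteq> {1..n} \<and> card K < p} \<le> (n + 1) ^ p" for n p :: nat
proof -
  let ?L = "{xs. set xs \<subseteq> {0..n} \<and> length xs = p}"
  have "{K. K \<subseteq> {1..n} \<and> card K < p} \<subseteq> (\<lambda>xs. set xs - {0}) ` ?L"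
  proof clarify
    fix K assume K: "K \<subseteq> {1..n}" "card K < p"
    then have fin: "finite K" using finite_subset by blast
    let ?xs = "sorted_list_of_set K @ replicate (p - card K) 0"
    have "K = set ?xs - {0}" using K fin by auto
    moreover have "?xs \<in> ?L" using K fin by auto
    ultimately show "K \<in> (\<lambda>xs. set xs - {0}) ` ?L" by blast
  qed
  then have "card {K. K \<subseteq> {1..n} \<and> card K < p} \<le> card ((\<lambda>xs. set xs - {0}) ` ?L)"
    by (intro card_mono finite_imageI finite_lists_length_eq) auto
  also have "\<dots> \<le> card ?L" by (intro card_image_le finite_lists_length_eq) auto
  also have "\<dots> = (n + 1) ^ p" by (subst card_lists_length_eq) auto
  finally show ?thesis .
qed

text \<open>On a tuple of basis elements a monomial can be nonzero only if fewer than \<open>nil_index\<close> of them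
  lie in the radical and the blocks of the others can be ordered into a nonzero chain.\<close>

lemma H_codim_upper_bound:
  assumes d: "d \<ge> 1"
    and dmax: "\<And>is. is \<noteq> [] \<Longrightarrow> distinct is \<Longrightarrow> set is \<subseteq> {1..q} \<Longrightarrow> chain is \<noteq> {0} \<Longrightarrow> (\<Sum>i\<in>set is. m i) \<le> d"
  shows "\<exists>C. \<forall>n\<ge>1. H_codim sA sH act \<Gamma> n \<le> C * (n + 1) ^ nil_index * d ^ n"
proof -
  obtain E where E: "finite E" "A.independent E" "A.span E = UNIV" using A.fd_basis by blast
  obtain E0 where E0: "E0 \<subseteq> jacobson_radical" "A.independent E0" "jacobson_radical \<subseteq> A.span E0"
    using A.maximal_independent_subset[of jacobson_radical] by blast
  have finE0: "finite E0" by (rule A.fd_independent[OF E0(2)])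
  define D where "D i = (if i = 0 then E0 else \<kappa> ` e i ` {..<m i})" for i
  have D_lab: "D i \<subseteq> lab i" if "i \<le> q" for i
  proof (cases "i = 0")
    case False
    then have "e i ` {..<m i} \<subseteq> B i" using span_e[of i] that Q.A.span_superset[of "e i ` {..<m i}"] by auto
    then show ?thesis using False by (auto simp: D_def lab_def)
  qed (use E0 in \<open>auto simp: D_def lab_def\<close>)
  have lab_D: "lab i \<subseteq> A.span (D i)" if "i \<le> q" for i
  proof (cases "i = 0")
    case False
    then show ?thesis using span_e[of i] that \<kappa>_span by (auto simp: D_def lab_def)
  qed (use E0 in \<open>auto simp: D_def lab_def\<close>)
  have finD: "finite (D i)" for i using finE0 by (simp add: D_def)
  have cardD: "card (D i) \<le> m i" if "i \<noteq> 0" for i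
    using that card_image_le[of "e i ` {..<m i}" \<kappa>] card_image_le[of "{..<m i}" "e i"] by (auto simp: D_def)
  let ?Lab = "Sigma {0..q} D"
  have span_D: "A.span (snd ` ?Lab) = UNIV"
  proof -
    have "D i \<subseteq> snd ` ?Lab" if "i \<in> {0..q}" for i using that by force
    then have "lab i \<subseteq> A.span (snd ` ?Lab)" if "i \<in> {0..q}" for i
      using that lab_D[of i] A.span_mono[of "D i" "snd ` ?Lab"] by fastforce
    then have "(\<Union>i\<in>{0..q}. lab i) \<subseteq> A.span (snd ` ?Lab)" by blast
    then have "A.span (\<Union>i\<in>{0..q}. lab i) \<subseteq> A.span (snd ` ?Lab)"
      by (intro A.span_minimal) auto
    then show ?thesis using A_decompose by blast
  qed
  let ?p = nil_index
  \<comment> \<open>\<open>2 ^ q\<close> accounts for the set of blocks that occur,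
    \<open>(card E0 + 1) ^ ?p\<close> for the radical entries and \<open>card E\<close> for the
    coordinates of the value. The positions of the radical entries give the power of n + 1.\<close>
  define C where "C = 2 ^ q * (card E0 + 1) ^ ?p * card E"
  have "H_codim sA sH act \<Gamma> n \<le> C * (n + 1) ^ ?p * d ^ n" if n: "n \<ge> 1" for n
  proof -
    define zero_pos where "zero_pos \<tau> = {j \<in> {1..n}. fst (\<tau> j) = 0}" for \<tau> :: "nat \<Rightarrow> nat \<times> 'a"
    define blocks where "blocks \<tau> = (\<lambda>j. fst (\<tau> j)) ` {1..n} - {0}" for \<tau> :: "nat \<Rightarrow> nat \<times> 'a"
    define T where "T = {\<tau> \<in> {1..n} \<rightarrow>\<^sub>E ?Lab. card (zero_pos \<tau>) < ?p \<and> (\<Sum>i\<in>blocks \<tau>. m i) \<le> d}"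
    define G where "G = (\<lambda>\<tau> j. if j \<in> {1..n} then snd (\<tau> j) else 0) ` T"
    have "finite ({1..n} \<rightarrow>\<^sub>E ?Lab)" using finD by (intro finite_PiE) auto
    then have finT: "finite T" by (simp add: T_def)
    have tests: "\<forall>\<psi>. F \<psi> = 0" if F: "hfun {} (mset_set {1..n}) 0 F" and z: "\<forall>\<psi>\<in>G. F \<psi> = 0" for F
    proof (rule ccontr)
      assume "\<not> ?thesis"
      then obtain \<psi>0 where "F \<psi>0 \<noteq> 0" by blast
      then obtain \<psi> where \<psi>: "\<forall>j\<in>{1..n}. \<psi> j \<in> snd ` ?Lab" "F \<psi> \<noteq> 0"
        using hfun_nonzero_on_generators[OF F, of \<psi>0 "snd ` ?Lab"] span_D by auto
      then have "\<forall>j\<in>{1..n}. \<exists>l\<in>?Lab. snd l = \<psi> j" by force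
      then obtain \<tau> where \<tau>: "\<And>j. j \<in> {1..n} \<Longrightarrow> \<tau> j \<in> ?Lab \<and> snd (\<tau> j) = \<psi> j" by metis
      obtain M where M: "M \<in> monomials {} (mset_set {1..n}) 0" "M \<psi> \<noteq> 0"
        using hfun_nonzero_monomial[OF F \<psi>(2)] .
      then obtain ls where ls: "ls \<noteq> []" "mset (map fst ls) = image_mset Inl (mset_set {1..n})"
        "M = (\<lambda>\<psi>. nonempty_prod (map (letter_val \<psi>) ls))"
        by (auto simp: monomials_def)
      \<comment> \<open>The factors of the monomial, each labelled by the block of the basis element
        in its variable. The operators keep radical elements in the radical and move elements of
        \<kappa>(B i) into \<open>W i\<close>.\<close>
      define ys where "ys = map (\<lambda>l. (fst (\<tau> (projl (fst l))), letter_val \<psi> l)) ls"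
      have prod: "prodl ys \<noteq> 0" using M(2) ls(3) by (simp add: ys_def o_def)
      have labels: "mset (map fst ys) = image_mset (\<lambda>j. fst (\<tau> j)) (mset_set {1..n})"
      proof -
        have "mset (map fst ys) = image_mset (\<lambda>s. fst (\<tau> (projl s))) (mset (map fst ls))"
          by (simp add: ys_def image_mset.compositionality o_def)
        then show ?thesis unfolding ls(2) by (simp add: image_mset.compositionality o_def)
      qed
      have mem: "i \<le> q \<and> (if i = 0 then x \<in> jacobson_radical else x \<in> W i)" if "(i, x) \<in> set ys" for i x
      proof -
        from that obtain l where l: "l \<in> set ls" "i = fst (\<tau> (projl (fst l)))" "x = letter_val \<psi> l"
          by (auto simp: ys_def)
        have "fst l \<in># mset (map fst ls)" using l(1) by simp
        then obtain v where v: "fst l = Inl v" "v \<in> {1..n}" unfolding ls(2) by auto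
        have x: "x = act (snd l) (\<psi> v)" using l(3) v by (simp add: letter_val_def)
        have "\<tau> v \<in> ?Lab" "snd (\<tau> v) = \<psi> v" using \<tau>[OF v(2)] by auto
        then have "i \<le> q" "\<psi> v \<in> D i" using l(2) v by (cases "\<tau> v"; auto)+
        then show ?thesis
          using D_lab[of i] x radical_inv W_act \<kappa>_in_W by (auto simp: lab_def split: if_splits)
      qed
      have "cnt 0 ys < ?p"
      proof (rule ccontr)
        assume "\<not> ?thesis"
        then have "prodl ys = 0" using mem by (intro prodl_eq_0) force+
        then show False using prod by blast
      qed
      moreover have "cnt 0 ys = card (zero_pos \<tau>)"
      proof -
        have "cnt 0 ys = count (mset (map fst ys)) 0"
          by (induction ys) auto
        also have "\<dots> = card ((\<lambda>j. fst (\<tau> j)) -` {0} \<inter> {1..n})"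
          unfolding labels by (simp add: count_image_mset)
        also have "(\<lambda>j. fst (\<tau> j)) -` {0} \<inter> {1..n} = zero_pos \<tau>" by (auto simp: zero_pos_def)
        finally show ?thesis .
      qed
      moreover have "(\<Sum>i\<in>blocks \<tau>. m i) \<le> d"
      proof (cases "filter (\<lambda>i. i \<noteq> 0) (map fst ys) = []")
        case True
        have "blocks \<tau> = set (filter (\<lambda>i. i \<noteq> 0) (map fst ys))"
          using arg_cong[OF labels, of set_mset] by (auto simp: blocks_def)
        then have "blocks \<tau> = {}" unfolding True by simp
        then show ?thesis by simp
      next
        case False
        let ?is = "remdups (filter (\<lambda>i. i \<noteq> 0) (map fst ys))"
        have blocks: "blocks \<tau> = set ?is"
          using arg_cong[OF labels, of set_mset] by (auto simp: blocks_def)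
        have "chain ?is \<noteq> {0}" by (rule chain_nonzero[OF _ False prod]) (use mem in force)
        moreover have "set ?is \<subseteq> {1..q}" using mem by (force simp: Suc_le_eq)
        moreover have "?is \<noteq> []" using False by (metis remdups_eq_nil_iff)
        ultimately show ?thesis unfolding blocks by (intro dmax) auto
      qed
      ultimately have "restrict \<tau> {1..n} \<in> T"
        using \<tau> by (auto simp: T_def zero_pos_def blocks_def cong: conj_cong)
      then have "(\<lambda>j. if j \<in> {1..n} then snd (restrict \<tau> {1..n} j) else 0) \<in> G"
        unfolding G_def by (rule imageI)
      moreover have "F (\<lambda>j. if j \<in> {1..n} then snd (restrict \<tau> {1..n} j) else 0) = F \<psi>"
        by (rule hfun_cong[OF F]) (use \<tau> in auto)
      ultimately show False using z \<psi>(2) by auto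
    qed
    have "H_codim sA sH act \<Gamma> n \<le> card G * card E"
      by (rule H_codim_le[OF n _ tests E]) (use finT G_def in auto)
    also have "card G \<le> card T" unfolding G_def by (rule card_image_le[OF finT])
    also have "card T \<le> 2 ^ q * (n + 1) ^ ?p * ((card E0 + 1) ^ ?p * d ^ n)"
    proof -
      let ?II = "{I. I \<subseteq> {1..q} \<and> (\<Sum>i\<in>I. m i) \<le> d}"
      let ?KK = "{K. K \<subseteq> {1..n} \<and> card K < ?p}"
      let ?X = "\<lambda>(I, K). PiE {1..n} (\<lambda>j. if j \<in> K then {0} \<times> E0 else Sigma I D)"
      have finII: "finite ?II" by (rule finite_subset[of _ "Pow {1..q}"]) auto
      have finKK: "finite ?KK" by (rule finite_subset[of _ "Pow {1..n}"]) auto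
      have finI: "finite I" if "I \<in> ?II" for I using that finite_subset[of I "{1..q}"] by auto
      have "T \<subseteq> (\<Union>IK\<in>?II \<times> ?KK. ?X IK)"
      proof
        fix \<tau> assume \<tau>: "\<tau> \<in> T"
        then have PiE: "\<tau> \<in> {1..n} \<rightarrow>\<^sub>E ?Lab" by (simp add: T_def)
        have lab: "\<tau> j \<in> ?Lab" if "j \<in> {1..n}" for j by (rule PiE_mem[OF PiE that])
        have "\<tau> \<in> ?X (blocks \<tau>, zero_pos \<tau>)"
          unfolding prod.case
        proof (rule PiE_I)
          fix j assume j: "j \<in> {1..n}"
          show "\<tau> j \<in> (if j \<in> zero_pos \<tau> then {0} \<times> E0 else Sigma (blocks \<tau>) D)"
            using lab[OF j] j by (cases "\<tau> j") (force simp: zero_pos_def blocks_def D_def)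
        qed (rule PiE_arb[OF PiE])
        moreover have "blocks \<tau> \<subseteq> {1..q}"
          using lab by (fastforce simp: blocks_def Suc_le_eq)
        then have "(blocks \<tau>, zero_pos \<tau>) \<in> ?II \<times> ?KK"
          using \<tau> by (simp add: T_def) (auto simp: zero_pos_def)
        ultimately show "\<tau> \<in> (\<Union>IK\<in>?II \<times> ?KK. ?X IK)" by (rule UN_I[rotated])
      qed
      then have "card T \<le> card (\<Union>IK\<in>?II \<times> ?KK. ?X IK)"
      proof (rule card_mono[rotated])
        have "finite (?X IK)" if "IK \<in> ?II \<times> ?KK" for IK
        proof -
          obtain I K where IK: "IK = (I, K)" "I \<in> ?II" using \<open>IK \<in> ?II \<times> ?KK\<close> by blast
          have "finite (Sigma I D)" by (rule finite_SigmaI[OF finI[OF IK(2)] finD])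
          then show ?thesis unfolding IK(1) prod.case using finE0 by (intro finite_PiE) simp_all
        qed
        then show "finite (\<Union>IK\<in>?II \<times> ?KK. ?X IK)"
          by (rule finite_UN_I[OF finite_cartesian_product[OF finII finKK]])
      qed
      also have "\<dots> \<le> (\<Sum>IK\<in>?II \<times> ?KK. card (?X IK))"
        using finII finKK by (intro card_UN_le) auto
      also have "\<dots> \<le> (\<Sum>IK\<in>?II \<times> ?KK. (card E0 + 1) ^ ?p * d ^ n)"
      proof (rule sum_mono)
        fix IK assume "IK \<in> ?II \<times> ?KK"
        then obtain I K where IK: "IK = (I, K)" "I \<in> ?II" "K \<in> ?KK" by blast
        have "card (?X IK) = (\<Prod>j\<in>{1..n}. card (if j \<in> K then {0} \<times> E0 else Sigma I D))"
          unfolding IK(1) by (simp add: card_PiE)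
        \<comment> \<open>A radical position is charged \<open>(card E0 + 1) * d\<close> rather than
          \<open>card E0\<close>, so that every position contributes a factor \<open>d\<close>. The
          additional 1 makes the base at least 1, so that the exponent may be raised to
          \<open>?p\<close>.\<close>
        also have "\<dots> \<le> (\<Prod>j\<in>{1..n}. (if j \<in> K then card E0 + 1 else 1) * d)"
        proof (rule prod_mono, safe)
          fix j
          have "card (Sigma I D) \<le> d"
          proof -
            have "card (Sigma I D) = (\<Sum>i\<in>I. card (D i))" using finI[OF IK(2)] finD by (simp add: card_SigmaI)
            also have "\<dots> \<le> (\<Sum>i\<in>I. m i)" using IK(2) by (intro sum_mono cardD) auto
            finally show ?thesis using IK(2) by simp
          qed
          moreover have "card E0 \<le> (card E0 + 1) * d" using d by (simp add: trans_le_add2)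
          ultimately show "card (if j \<in> K then {0} \<times> E0 else Sigma I D) \<le> (if j \<in> K then card E0 + 1 else 1) * d"
            by (auto simp: card_cartesian_product)
        qed
        also have "\<dots> = (\<Prod>j\<in>{1..n}. if j \<in> K then card E0 + 1 else 1) * d ^ n"
          by (simp add: prod.distrib)
        also have "(\<Prod>j\<in>{1..n}. if j \<in> K then card E0 + 1 else 1) = (card E0 + 1) ^ card K"
        proof -
          have "(\<Prod>j\<in>{1..n}. if j \<in> K then card E0 + 1 else 1) = (\<Prod>j\<in>{1..n} \<inter> K. card E0 + 1)"
            by (rule prod.inter_restrict[symmetric]) simp
          also have "{1..n} \<inter> K = K" using IK(3) by auto
          finally show ?thesis by simp
        qed
        also have "(card E0 + 1) ^ card K \<le> (card E0 + 1) ^ ?p"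
          using IK(3) by (intro power_increasing) auto
        finally show "card (?X IK) \<le> (card E0 + 1) ^ ?p * d ^ n" by simp
      qed
      also have "\<dots> = card ?II * card ?KK * ((card E0 + 1) ^ ?p * d ^ n)"
        by (simp add: card_cartesian_product)
      also have "\<dots> \<le> (2 ^ q * (n + 1) ^ ?p) * ((card E0 + 1) ^ ?p * d ^ n)"
      proof (intro mult_right_mono mult_mono)
        have "card ?II \<le> card (Pow {1..q})" by (rule card_mono) auto
        then show "card ?II \<le> 2 ^ q" by (simp add: card_Pow)
        show "card ?KK \<le> (n + 1) ^ ?p" by (rule card_small_subsets)
      qed auto
      finally show ?thesis .
    qed
    finally show ?thesis by (simp add: C_def mult_ac)
  qed
  then show ?thesis by blast
qed

end

section \<open>Replacing block factors by multilinear functions\<close>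

lemma nonempty_prod_diff:
  fixes u v :: "'a::ring"
  shows "nonempty_prod (us @ u # ws) - nonempty_prod (us @ v # ws) = nonempty_prod (us @ (u - v) # ws)"
  by (cases "us = []"; cases "ws = []")
    (auto simp: nonempty_prod_append nonempty_prod_Cons left_diff_distrib right_diff_distrib)

text \<open>The factors are exchanged one at a time from the left; the hypothesis says that no
  exchange changes the product.\<close>

lemma nonempty_prod_telescope:
  fixes x x' :: "nat \<Rightarrow> 'a::ring"
  assumes "\<And>k. k < L \<Longrightarrow>
    nonempty_prod (map (\<lambda>l. if l < k then x' l else if l = k then x k - x' k else x l) [0..<L]) = 0"
  shows "nonempty_prod (map x [0..<L]) = nonempty_prod (map x' [0..<L])"
proof -
  have "nonempty_prod (map x [0..<L]) = nonempty_prod (map (\<lambda>l. if l < k then x' l else x l) [0..<L])"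
    if "k \<le> L" for k
    using that
  proof (induction k)
    case (Suc k)
    then have upt: "[0..<L] = [0..<k] @ k # [Suc k..<L]"
      using upt_conv_Cons[of k L] upt_add_eq_append[of 0 k "L - k"] by simp
    have maps: "map (\<lambda>l. if l < k then x' l else x l) [0..<k] = map x' [0..<k]"
      "map (\<lambda>l. if l < k then x' l else x l) [Suc k..<L] = map x [Suc k..<L]"
      "map (\<lambda>l. if l < Suc k then x' l else x l) [0..<k] = map x' [0..<k]"
      "map (\<lambda>l. if l < Suc k then x' l else x l) [Suc k..<L] = map x [Suc k..<L]"
      "map (\<lambda>l. if l < k then x' l else if l = k then x k - x' k else x l) [0..<k] = map x' [0..<k]"
      "map (\<lambda>l. if l < k then x' l else if l = k then x k - x' k else x l) [Suc k..<L] = map x [Suc k..<L]"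
      by (auto intro!: map_cong)
    have "nonempty_prod (map (\<lambda>l. if l < k then x' l else x l) [0..<L])
       - nonempty_prod (map (\<lambda>l. if l < Suc k then x' l else x l) [0..<L])
       = nonempty_prod (map x' [0..<k] @ (x k - x' k) # map x [Suc k..<L])"
      unfolding nonempty_prod_diff[symmetric] upt map_append list.map maps by simp
    also have "\<dots> = nonempty_prod (map (\<lambda>l. if l < k then x' l else if l = k then x k - x' k else x l) [0..<L])"
      unfolding upt map_append list.map maps by simp
    also have "\<dots> = 0" using assms Suc by simp
    finally show ?case using Suc by simp
  qed simp
  moreover have "map (\<lambda>l. if l < L then x' l else x l) [0..<L] = map x' [0..<L]"
    by (auto intro!: map_cong)
  ultimately show ?thesis by (metis order_refl)
qed

section \<open>Expansions into labelled products\<close>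

context wm_decomposition
begin

text \<open>Each factor splits into its \<kappa>-part and a radical part, and expanding the product
  preserves the number of factors.\<close>

lemma prod_in_span_valid:
  "zs \<noteq> [] \<Longrightarrow> set zs \<subseteq> W i \<Longrightarrow> i \<in> {1..q} \<Longrightarrow>
     nonempty_prod zs \<in> A.span {prodl us | us. length us = length zs \<and> valid us \<and> fst ` set us \<subseteq> {0, i}}"
proof (induction zs)
  case (Cons z zs)
  let ?S = "\<lambda>n. {prodl us | us. length us = n \<and> valid us \<and> fst ` set us \<subseteq> {0, i}}"
  have z: "z \<in> W i" using Cons.prems by simp
  have "\<kappa> (jrad_proj z) \<in> ?S 1"
    using W_decompose(2)[OF Cons.prems(3) z] Cons.prems(3)
    by (intro CollectI exI[of _ "[(i, \<kappa> (jrad_proj z))]"]) simp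
  moreover have "z - \<kappa> (jrad_proj z) \<in> ?S 1"
    using W_decompose(3)[OF Cons.prems(3) z]
    by (intro CollectI exI[of _ "[(0, z - \<kappa> (jrad_proj z))]"]) simp
  ultimately have "\<kappa> (jrad_proj z) + (z - \<kappa> (jrad_proj z)) \<in> A.span (?S 1)"
    by (intro A.span_add A.span_base)
  then have z1: "z \<in> A.span (?S 1)" by simp
  show ?case
  proof (cases "zs = []")
    case True
    then show ?thesis using z1 by simp
  next
    case False
    then have "nonempty_prod zs \<in> A.span (?S (length zs))" using Cons by simp
    then have "z * nonempty_prod zs \<in> A.span {s * t | s t. s \<in> ?S 1 \<and> t \<in> ?S (length zs)}"
      by (rule A.span_mult[OF z1])
    also have "\<dots> \<subseteq> A.span (?S (length (z # zs)))"
    proof (rule A.span_mono, clarify)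
      fix us vs :: "(nat \<times> 'a) list"
      assume *: "length us = 1" "valid us" "fst ` set us \<subseteq> {0, i}"
        "length vs = length zs" "valid vs" "fst ` set vs \<subseteq> {0, i}"
      then have "us \<noteq> []" "vs \<noteq> []" using False by auto
      then show "\<exists>ws. prodl us * prodl vs = prodl ws \<and> length ws = length (z # zs) \<and> valid ws
          \<and> fst ` set ws \<subseteq> {0, i}"
        using * by (intro exI[of _ "us @ vs"]) (auto simp: nonempty_prod_append)
    qed
    finally show ?thesis using False by (simp add: nonempty_prod_Cons)
  qed
qed simp

text \<open>Since \<open>B i\<close> is spanned by products of \<open>nil_index\<close> elements, so is \<open>W i\<close>, and some factor of
  a nonzero product lies in \<open>\<kappa> (B i)\<close>.\<close>

lemma W_in_span_valid:
  assumes i: "i \<in> {1..q}" and w: "w \<in> W i"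
  shows "w \<in> A.span {prodl zs | zs. zs \<noteq> [] \<and> valid zs \<and> cnt i zs \<ge> 1}"
proof -
  let ?R = "A.span {prodl zs | zs. zs \<noteq> [] \<and> valid zs \<and> cnt i zs \<ge> 1}"
  obtain n where n: "nil_index = Suc n" using nil_index(1) by (cases nil_index) auto
  interpret S: H_simple_block "mod_jrad_scale sA" sH "mod_jrad_act act" "B i" "m i" "e i"
    by (rule block[OF i])
  have prod_R: "nonempty_prod zs \<in> ?R" if zs: "length zs = Suc n" "set zs \<subseteq> W i" for zs
  proof -
    have "nonempty_prod zs \<in> A.span {prodl us | us. length us = length zs \<and> valid us \<and> fst ` set us \<subseteq> {0, i}}"
      by (rule prod_in_span_valid[OF _ zs(2) i]) (use zs in auto)
    also have "\<dots> \<subseteq> ?R"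
    proof (rule A.span_minimal)
      show "{prodl us | us. length us = length zs \<and> valid us \<and> fst ` set us \<subseteq> {0, i}} \<subseteq> ?R"
      proof clarify
        fix us :: "(nat \<times> 'a) list"
        assume us: "length us = length zs" "valid us" "fst ` set us \<subseteq> {0, i}"
        show "prodl us \<in> ?R"
        proof (cases "cnt i us \<ge> 1")
          case True
          then show ?thesis using us by (intro A.span_base) auto
        next
          case False
          then have notin: "i \<notin> fst ` set us" using cnt_pos_iff[of i us] by simp
          have "fst ` set us \<subseteq> {0}"
          proof
            fix j assume j: "j \<in> fst ` set us"
            then have "j \<noteq> i" using notin by metis
            then show "j \<in> {0}" using subsetD[OF us(3) j] by simp
          qed
          then have "cnt 0 us = length us" by (induction us) auto
          then have "prodl us = 0" using us zs n by (intro valid_prodl_eq_0) auto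
          then show ?thesis by (simp add: A.span_zero)
        qed
      qed
    qed simp
    finally show ?thesis .
  qed
  have act_R: "act h v \<in> ?R" if v: "v \<in> \<kappa> ` B i" for h v
  proof -
    obtain b where b: "v = \<kappa> b" "b \<in> B i" using v by blast
    have "b \<in> Q.A.span {nonempty_prod ws | ws. length ws = Suc n \<and> set ws \<subseteq> B i}"
      by (rule Q.A.subset_span_prods[OF S.B_subset_span_products b(2)])
    then have "\<kappa> b \<in> A.span (\<kappa> ` {nonempty_prod ws | ws. length ws = Suc n \<and> set ws \<subseteq> B i})"
      by (rule \<kappa>_span)
    then have "act h (\<kappa> b) \<in> ?R"
    proof (induction rule: A.span_induct_alt)
      case base
      then show ?case by (simp add: act_0 A.span_zero)
    next
      case (step c u z)
      then obtain ws where ws: "u = \<kappa> (nonempty_prod ws)" "length ws = Suc n" "set ws \<subseteq> B i" by blast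
      have u: "u = nonempty_prod (map \<kappa> ws)" using ws by (subst ws(1), intro \<kappa>_nonempty_prod) auto
      have "act h u \<in> A.span {nonempty_prod zs | zs. length zs = length (map \<kappa> ws) \<and> set zs \<subseteq> W i}"
        unfolding u by (rule act_prod_span) (use ws W_act \<kappa>_in_W in auto)
      also have "\<dots> \<subseteq> ?R"
        using prod_R ws(2) by (intro A.span_minimal) auto
      finally show ?case using step by (simp add: act_add_right act_scale_right A.span_add A.span_scale)
    qed
    then show ?thesis using b by simp
  qed
  have "{act h v | h v. v \<in> \<kappa> ` B i} \<subseteq> ?R"
    by (rule subsetI, elim CollectE exE conjE, simp only: act_R)
  then have "A.span {act h v | h v. v \<in> \<kappa> ` B i} \<subseteq> ?R" by (intro A.span_minimal) auto
  then show ?thesis using w unfolding W_def H_span_def by blast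
qed

lemma A_in_span_valid: "x \<in> A.span {prodl zs | zs. zs \<noteq> [] \<and> valid zs}"
proof -
  have "(\<Union>i\<in>{0..q}. lab i) \<subseteq> {prodl zs | zs. zs \<noteq> [] \<and> valid zs}"
  proof
    fix y assume "y \<in> (\<Union>i\<in>{0..q}. lab i)"
    then obtain i where "i \<le> q" "y \<in> lab i" by auto
    then show "y \<in> {prodl zs | zs. zs \<noteq> [] \<and> valid zs}"
      by (intro CollectI exI[of _ "[(i, y)]"]) auto
  qed
  then show ?thesis by (rule subsetD[OF A.span_mono A_decompose])
qed

text \<open>\<open>R l\<close> records what is to be remembered about the expansion of the factor in
  position \<open>l\<close>; the numbers of labels can then be added over the positions.\<close>

lemma exists_valid_expansion:
  assumes L: "L > 0" and xs: "\<And>l. l < L \<Longrightarrow> x l \<in> A.span {prodl zs | zs. zs \<noteq> [] \<and> valid zs \<and> R l zs}"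
    and nz: "nonempty_prod (map x [0..<L]) \<noteq> 0"
  obtains f where "\<And>l. l < L \<Longrightarrow> f l \<noteq> [] \<and> valid (f l) \<and> R l (f l)"
    "prodl (concat (map f [0..<L])) \<noteq> 0"
proof -
  let ?S = "\<lambda>l. {prodl zs | zs. zs \<noteq> [] \<and> valid zs \<and> R l zs}"
  have "list_all2 (\<lambda>y S. y \<in> A.span S) (map x [0..<L]) (map ?S [0..<L])"
    using xs by (auto simp: list_all2_conv_all_nth)
  then obtain zs where zs: "list_all2 (\<in>) zs (map ?S [0..<L])" "nonempty_prod zs \<noteq> 0"
    using A.exists_nonzero_expansion[of _ _ "[]"] nz by auto
  have len: "length zs = L" using zs(1) by (auto dest: list_all2_lengthD)
  have "\<forall>l. \<exists>us. l < L \<longrightarrow> zs ! l = prodl us \<and> us \<noteq> [] \<and> valid us \<and> R l us"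
  proof
    fix l
    show "\<exists>us. l < L \<longrightarrow> zs ! l = prodl us \<and> us \<noteq> [] \<and> valid us \<and> R l us"
    proof (cases "l < L")
      case True
      then have "zs ! l \<in> ?S l" using list_all2_nthD[OF zs(1), of l] len by simp
      then show ?thesis by blast
    qed simp
  qed
  then obtain f where f: "\<And>l. l < L \<Longrightarrow> zs ! l = prodl (f l) \<and> f l \<noteq> [] \<and> valid (f l) \<and> R l (f l)"
    by (metis (no_types))
  have "zs = map (\<lambda>l. prodl (f l)) [0..<L]" by (rule nth_equalityI) (use len f in auto)
  moreover have "prodl (concat (map f [0..<L])) = nonempty_prod (map prodl (map f [0..<L]))"
    by (rule prodl_concat) (use L f in auto)
  ultimately have "prodl (concat (map f [0..<L])) \<noteq> 0" using zs(2) by (simp add: o_def)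
  then show ?thesis using f by (intro that) auto
qed

lemma cnt_concat_map: "cnt i (concat (map f [0..<L])) = (\<Sum>l<L. cnt i (f l))"
  by (simp add: cnt_concat o_def sum_list_map_upt atLeast0LessThan)

lemma cnt_eq_sum: "cnt i ys = (\<Sum>l<length ys. if fst (ys ! l) = i then 1 else 0)"
proof -
  have "cnt i ys = (\<Sum>y\<leftarrow>ys. if fst y = i then 1 else 0)" by (induction ys) auto
  then show ?thesis by (simp add: sum_list_sum_nth atLeast0LessThan)
qed

lemma valid_concat_map: "(\<And>l. l < L \<Longrightarrow> valid (f l)) \<Longrightarrow> valid (concat (map f [0..<L]))"
  by (simp add: valid_concat)

text \<open>Elements of A between the blocks expand into arbitrary labelled products, whereas a
  factor from \<open>W i\<close> is expanded so that the label \<open>i\<close> is kept. Thus the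
  nonvanishing of a chain of spaces \<open>W i\<close> yields a nonzero product with factors from
  the \<kappa>(B i) themselves.\<close>

lemma exists_valid_list:
  assumes js: "is \<noteq> []" "set is \<subseteq> {1..q}" and ch: "chain is \<noteq> {0}"
  shows "\<exists>ys. valid ys \<and> ys \<noteq> [] \<and> set is \<subseteq> fst ` set ys \<and> prodl ys \<noteq> 0"
proof -
  obtain x where x: "x \<in> chain is" "x \<noteq> 0" using ch zero_in_chain[OF js(1)] by blast
  obtain s where s: "s \<in> {prodl ys | ys. ys \<noteq> []
     \<and> (\<forall>(i, x)\<in>set ys. i \<in> insert 0 (set is) \<and> (i \<noteq> 0 \<longrightarrow> x \<in> W i)) \<and> set is \<subseteq> fst ` set ys}" "s \<noteq> 0"
  proof (rule A.span_nonzero[of "\<lambda>x. x" x])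
    show "x \<in> A.span {prodl ys | ys. ys \<noteq> []
     \<and> (\<forall>(i, x)\<in>set ys. i \<in> insert 0 (set is) \<and> (i \<noteq> 0 \<longrightarrow> x \<in> W i)) \<and> set is \<subseteq> fst ` set ys}"
      by (rule subsetD[OF chain_subset_span[OF js(1)] x(1)]) (use js(2) in auto)
  qed (use x in auto)
  from s(1) obtain ys where ys': "s = prodl ys" "ys \<noteq> []" "set is \<subseteq> fst ` set ys"
    "\<forall>(i, x)\<in>set ys. i \<in> insert 0 (set is) \<and> (i \<noteq> 0 \<longrightarrow> x \<in> W i)"
    by (elim CollectE exE conjE)
  have ys: "s = prodl ys" "ys \<noteq> []" "set is \<subseteq> fst ` set ys"
    "\<And>i x. (i, x) \<in> set ys \<Longrightarrow> i \<in> insert 0 (set is) \<and> (i \<noteq> 0 \<longrightarrow> x \<in> W i)"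
    using ys' by (auto split: prod.splits)
  let ?L = "length ys"
  let ?R = "\<lambda>l zs. fst (ys ! l) \<noteq> 0 \<longrightarrow> cnt (fst (ys ! l)) zs \<ge> 1"
  have "map (\<lambda>l. snd (ys ! l)) [0..<?L] = map snd ys" by (rule nth_equalityI) auto
  then have nz: "nonempty_prod (map (\<lambda>l. snd (ys ! l)) [0..<?L]) \<noteq> 0" using ys(1) s(2) by simp
  have span: "snd (ys ! l) \<in> A.span {prodl zs | zs. zs \<noteq> [] \<and> valid zs \<and> ?R l zs}" if l: "l < ?L" for l
  proof (cases "fst (ys ! l) = 0")
    case True
    then show ?thesis using A_in_span_valid by simp
  next
    case False
    have "(fst (ys ! l), snd (ys ! l)) \<in> set ys" using l by simp
    from ys(4)[OF this] have "fst (ys ! l) \<in> {1..q}" "snd (ys ! l) \<in> W (fst (ys ! l))"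
      using False js(2) by auto
    then show ?thesis using W_in_span_valid False by simp
  qed
  obtain f where f: "\<And>l. l < ?L \<Longrightarrow> f l \<noteq> [] \<and> valid (f l) \<and> ?R l (f l)"
    "prodl (concat (map f [0..<?L])) \<noteq> 0"
    using exists_valid_expansion[of ?L "\<lambda>l. snd (ys ! l)" ?R, OF _ span nz] ys(2) by auto
  have "i \<in> fst ` set (concat (map f [0..<?L]))" if i: "i \<in> set is" for i
  proof -
    have "i \<in> fst ` set ys" using i ys(3) by blast
    then obtain l where l: "l < ?L" "fst (ys ! l) = i" by (auto simp: in_set_conv_nth)
    then have "cnt i (f l) \<ge> 1" using f(1)[OF l(1)] i js(2) by auto
    then have "i \<in> fst ` set (f l)" using cnt_pos_iff[of i "f l"] by simp
    then obtain z where "z \<in> set (f l)" "i = fst z" by blast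
    then show ?thesis using l(1) by (intro image_eqI[of _ _ z]) auto
  qed
  moreover have "concat (map f [0..<?L]) \<noteq> []" using f(1)[of 0] ys(2) by auto
  moreover have "valid (concat (map f [0..<?L]))" by (rule valid_concat_map) (use f in blast)
  ultimately show ?thesis using f(2) by blast
qed

text \<open>Products with \<open>nil_index\<close> radical factors vanish, so the number of radical
  factors is bounded and a maximum is attained.\<close>

lemma exists_maximal_list:
  assumes "is \<noteq> []" "set is \<subseteq> {1..q}" "chain is \<noteq> {0}"
  obtains ys where "valid ys" "ys \<noteq> []" "set is \<subseteq> fst ` set ys" "prodl ys \<noteq> 0"
    "\<And>zs. valid zs \<Longrightarrow> set is \<subseteq> fst ` set zs \<Longrightarrow> prodl zs \<noteq> 0 \<Longrightarrow> cnt 0 zs \<le> cnt 0 ys"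
proof -
  let ?P = "\<lambda>ys. valid ys \<and> ys \<noteq> [] \<and> set is \<subseteq> fst ` set ys \<and> prodl ys \<noteq> 0"
  obtain ys0 where "?P ys0" using exists_valid_list[OF assms] by blast
  moreover have "\<forall>zs. ?P zs \<longrightarrow> cnt 0 zs < nil_index"
    using valid_prodl_eq_0 by (meson not_le)
  ultimately have "\<exists>ys. ?P ys \<and> (\<forall>zs. ?P zs \<longrightarrow> cnt 0 zs \<le> cnt 0 ys)"
    by (rule ex_has_greatest_nat)
  then obtain ys where ys: "?P ys" and max: "\<And>zs. ?P zs \<Longrightarrow> cnt 0 zs \<le> cnt 0 ys" by blast
  have "cnt 0 zs \<le> cnt 0 ys" if "valid zs" "set is \<subseteq> fst ` set zs" "prodl zs \<noteq> 0" for zs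
    using that assms(1) by (intro max) (cases "is", auto)
  then show ?thesis using ys that by blast
qed

text \<open>Counting the labels \<open>i\<close> and 0 together makes the bound \<open>n\<close>
  stable when a factor from \<open>W i\<close> is split and its radical part is taken.\<close>

definition spanned :: "nat \<Rightarrow> nat \<Rightarrow> 'a set" where
  "spanned i n = A.span {prodl zs | zs. zs \<noteq> [] \<and> valid zs \<and> n \<le> cnt i zs + cnt 0 zs}"

definition spanned_rad :: "nat \<Rightarrow> nat \<Rightarrow> 'a set" where
  "spanned_rad i n = A.span {prodl zs | zs. zs \<noteq> [] \<and> valid zs \<and> n \<le> cnt i zs + cnt 0 zs \<and> 1 \<le> cnt 0 zs}"

lemma spanned_mult:
  "x \<in> spanned i a \<Longrightarrow> y \<in> spanned i b \<Longrightarrow> x * y \<in> spanned i (a + b)"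
  "x \<in> spanned_rad i a \<Longrightarrow> y \<in> spanned i b \<Longrightarrow> x * y \<in> spanned_rad i (a + b)"
  "x \<in> spanned i a \<Longrightarrow> y \<in> spanned_rad i b \<Longrightarrow> x * y \<in> spanned_rad i (a + b)"
proof -
  have mult: "x * y \<in> A.span {prodl zs | zs. zs \<noteq> [] \<and> valid zs \<and> R'' zs}"
    if "x \<in> A.span {prodl zs | zs. zs \<noteq> [] \<and> valid zs \<and> R zs}" "y \<in> A.span {prodl zs | zs. zs \<noteq> [] \<and> valid zs \<and> R' zs}"
      "\<And>zs zs'. R zs \<Longrightarrow> R' zs' \<Longrightarrow> R'' (zs @ zs')" for x y R R' R''
  proof -
    have "{s * t | s t. s \<in> {prodl zs | zs. zs \<noteq> [] \<and> valid zs \<and> R zs} \<and> t \<in> {prodl zs | zs. zs \<noteq> [] \<and> valid zs \<and> R' zs}}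
       \<subseteq> {prodl zs | zs. zs \<noteq> [] \<and> valid zs \<and> R'' zs}"
    proof clarify
      fix zs zs' :: "(nat \<times> 'a) list"
      assume "zs \<noteq> []" "valid zs" "R zs" "zs' \<noteq> []" "valid zs'" "R' zs'"
      then show "\<exists>us. prodl zs * prodl zs' = prodl us \<and> us \<noteq> [] \<and> valid us \<and> R'' us"
        using that(3) by (intro exI[of _ "zs @ zs'"]) (auto simp: nonempty_prod_append)
    qed
    then show ?thesis using A.span_mult[OF that(1,2)] A.span_mono by blast
  qed
  show "x \<in> spanned i a \<Longrightarrow> y \<in> spanned i b \<Longrightarrow> x * y \<in> spanned i (a + b)"
    "x \<in> spanned_rad i a \<Longrightarrow> y \<in> spanned i b \<Longrightarrow> x * y \<in> spanned_rad i (a + b)"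
    "x \<in> spanned i a \<Longrightarrow> y \<in> spanned_rad i b \<Longrightarrow> x * y \<in> spanned_rad i (a + b)"
    unfolding spanned_def spanned_rad_def by (erule (1) mult; simp)+
qed

text \<open>Writing k for \<kappa> composed with the projection, xP - k(x)k(P) = (x - k(x)) P + k(x)
  (P - k(P)). So every term of the error contains a radical factor, and no term loses any of the
  labels \<open>i\<close> and 0 counted together.\<close>

lemma W_list_spanned:
  "us \<noteq> [] \<Longrightarrow> (\<And>l x. (l, x) \<in> set us \<Longrightarrow> l \<in> {1..q} \<and> x \<in> W l) \<Longrightarrow>
    prodl us \<in> spanned i (cnt i us) \<and> \<kappa> (jrad_proj (prodl us)) \<in> spanned i (cnt i us)
    \<and> prodl us - \<kappa> (jrad_proj (prodl us)) \<in> spanned_rad i (cnt i us)"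
proof (induction us)
  case (Cons u us)
  obtain l x where u: "u = (l, x)" by (cases u)
  have lx: "l \<in> {1..q}" "x \<in> W l" using Cons.prems(2)[of l x] u by auto
  let ?c = "if l = i then 1 else 0 :: nat"
  let ?k = "\<kappa> (jrad_proj x)"
  have k: "?k \<in> spanned i ?c"
    unfolding spanned_def using W_decompose(2)[OF lx] lx(1)
    by (intro A.span_base CollectI exI[of _ "[(l, ?k)]"]) auto
  have j: "x - ?k \<in> spanned_rad i ?c"
    unfolding spanned_rad_def using W_decompose(3)[OF lx]
    by (intro A.span_base CollectI exI[of _ "[(0, x - ?k)]"]) auto
  have "x - ?k \<in> spanned i ?c"
    unfolding spanned_def using W_decompose(3)[OF lx]
    by (intro A.span_base CollectI exI[of _ "[(0, x - ?k)]"]) auto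
  then have "?k + (x - ?k) \<in> spanned i ?c" using k unfolding spanned_def by (intro A.span_add)
  then have x: "x \<in> spanned i ?c" by simp
  show ?case
  proof (cases "us = []")
    case True
    then show ?thesis using x k j u by simp
  next
    case False
    let ?P = "prodl us"
    have IH: "?P \<in> spanned i (cnt i us)" "\<kappa> (jrad_proj ?P) \<in> spanned i (cnt i us)"
      "?P - \<kappa> (jrad_proj ?P) \<in> spanned_rad i (cnt i us)"
      using Cons.IH[OF False] Cons.prems(2) by auto
    have prod: "prodl (u # us) = x * ?P" using False u by (simp add: nonempty_prod_Cons)
    have "x * ?P - ?k * \<kappa> (jrad_proj ?P) = (x - ?k) * ?P + ?k * (?P - \<kappa> (jrad_proj ?P))"
      by (simp add: algebra_simps)
    moreover have "(x - ?k) * ?P + ?k * (?P - \<kappa> (jrad_proj ?P)) \<in> spanned_rad i (?c + cnt i us)"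
      using spanned_mult(2)[OF j IH(1)] spanned_mult(3)[OF k IH(3)]
      unfolding spanned_rad_def by (rule A.span_add)
    ultimately show ?thesis
      unfolding prod using spanned_mult(1)[OF x IH(1)] spanned_mult(1)[OF k IH(2)] u
      by (simp add: jrad_proj_mult \<kappa>_mult)
  qed
qed simp

lemma spanned_mono: "n \<le> n' \<Longrightarrow> spanned i n' \<subseteq> spanned i n"
  "n \<le> n' \<Longrightarrow> spanned_rad i n' \<subseteq> spanned_rad i n"
  unfolding spanned_def spanned_rad_def by (rule A.span_mono; auto)+

text \<open>At arguments from \<kappa>(B l) the letters of a monomial lie in the spaces
  \<open>W l\<close>, and each of the \<open>N\<close> constants contributes a label
  \<open>i\<close> or 0 to every term. The \<kappa>-part of the value therefore differs from it by
  terms that have a radical factor and still carry \<open>N\<close> such labels.\<close>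

lemma hfun_spanned:
  fixes f :: "('v \<Rightarrow> 'a) \<Rightarrow> 'a"
  assumes f: "hfun (W i) V N f" and i: "i \<in> {1..q}" and \<psi>: "\<And>v. \<exists>l\<in>{1..q}. \<psi> v \<in> \<kappa> ` B l"
  shows "f \<psi> \<in> spanned i N \<and> \<kappa> (jrad_proj (f \<psi>)) \<in> spanned i N
    \<and> f \<psi> - \<kappa> (jrad_proj (f \<psi>)) \<in> spanned_rad i N"
proof -
  interpret F: generalized_H_action "\<lambda>c (f :: ('v \<Rightarrow> 'a) \<Rightarrow> 'a) x. sA c (f x)" sH "\<lambda>h f x. act h (f x)"
    by (rule generalized_H_action_fun)
  obtain lb where lb: "\<And>v. lb v \<in> {1..q} \<and> \<psi> v \<in> \<kappa> ` B (lb v)" using \<psi> by metis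
  have mon: "M \<psi> \<in> spanned i N \<and> \<kappa> (jrad_proj (M \<psi>)) \<in> spanned i N
    \<and> M \<psi> - \<kappa> (jrad_proj (M \<psi>)) \<in> spanned_rad i N" if "M \<in> monomials (W i) V N" for M
  proof -
    from that obtain ls C where ls: "ls \<noteq> []" "M = (\<lambda>\<psi>. nonempty_prod (map (letter_val \<psi>) ls))"
      and C: "mset (map fst ls) = image_mset Inl V + image_mset Inr C" "size C = N" "set_mset C \<subseteq> W i"
      unfolding monomials_def by blast
    have \<psi>_W: "\<psi> v \<in> W (lb v)" for v using lb[of v] \<kappa>_in_W by auto
    define label where "label s = (case s of Inl v \<Rightarrow> lb v | Inr _ \<Rightarrow> i)" for s :: "'v + 'a"
    define us where "us = map (\<lambda>l. (label (fst l), letter_val \<psi> l)) ls"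
    have mem: "l \<in> {1..q} \<and> x \<in> W l" if "(l, x) \<in> set us" for l x
    proof -
      from that obtain y where y: "y \<in> set ls" "l = label (fst y)" "x = letter_val \<psi> y"
        by (auto simp: us_def)
      have "fst y \<in># mset (map fst ls)" using y(1) by simp
      then have "fst y \<in> Inl ` set_mset V \<union> Inr ` set_mset C" unfolding C(1) by simp
      then show ?thesis
        using y i lb C(3) W_act \<psi>_W by (auto simp: label_def letter_val_def)
    qed
    have "N \<le> cnt i us"
    proof -
      have "cnt i us = length (filter (\<lambda>s. label s = i) (map fst ls))"
        unfolding us_def by (induction ls) auto
      also have "\<dots> = size (filter_mset (\<lambda>s. label s = i) (mset (map fst ls)))"
        by (simp only: mset_filter[symmetric] size_mset)
      also have "\<dots> \<ge> size (filter_mset (\<lambda>s. label s = i) (image_mset Inr C))"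
        unfolding C(1) by (simp add: filter_union_mset)
      also have "filter_mset (\<lambda>s. label s = i) (image_mset Inr C) = image_mset Inr C"
        by (simp add: filter_mset_image_mset label_def)
      finally show ?thesis using C(2) by simp
    qed
    moreover have "prodl us = M \<psi>" by (simp add: us_def ls(2) o_def)
    moreover have "us \<noteq> []" using ls(1) by (simp add: us_def)
    ultimately show ?thesis
      using W_list_spanned[of us i] mem spanned_mono[of N "cnt i us" i] by auto
  qed
  have "f \<in> F.A.span (monomials (W i) V N)" by (rule hfun_in_span_monomials[OF f])
  then show ?thesis
  proof (induction rule: F.A.span_induct_alt)
    case base
    then show ?case
      by (simp add: jrad_proj_0 \<kappa>_0 spanned_def spanned_rad_def A.span_zero)
  next
    case (step c M g)
    have "sA c (M \<psi>) + g \<psi> - \<kappa> (jrad_proj (sA c (M \<psi>) + g \<psi>))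
        = sA c (M \<psi> - \<kappa> (jrad_proj (M \<psi>))) + (g \<psi> - \<kappa> (jrad_proj (g \<psi>)))"
      by (simp add: jrad_proj_hom \<kappa>_add \<kappa>_scale A.scale_right_diff_distrib)
    moreover have "sA c (M \<psi> - \<kappa> (jrad_proj (M \<psi>))) + (g \<psi> - \<kappa> (jrad_proj (g \<psi>))) \<in> spanned_rad i N"
      using mon[OF step(1)] step(2) unfolding spanned_rad_def by (intro A.span_add A.span_scale) blast+
    moreover have "sA c (M \<psi>) + g \<psi> \<in> spanned i N \<and> \<kappa> (jrad_proj (sA c (M \<psi>) + g \<psi>)) \<in> spanned i N"
      using mon[OF step(1)] step(2)
      by (simp add: jrad_proj_hom \<kappa>_add \<kappa>_scale spanned_def A.span_add A.span_scale)
    ultimately show ?case by (simp only: plus_fun_apply simp_thms)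
  qed
qed

text \<open>Every term of the difference of both sides contains one radical factor more than \<open>ys\<close>, and
  still a factor from each block, since it has at least \<open>nil_index\<close> factors which come from that
  block or lie in the radical.\<close>

lemma collapse:
  assumes ys: "valid ys" "ys \<noteq> []"
    and max: "\<And>zs. valid zs \<Longrightarrow> I \<subseteq> fst ` set zs \<Longrightarrow> prodl zs \<noteq> 0 \<Longrightarrow> cnt 0 zs \<le> cnt 0 ys"
    and I: "I \<subseteq> {1..q}" and pos: "\<And>i. i \<in> I \<Longrightarrow> pos i < length ys \<and> fst (ys ! pos i) = i"
    and u: "\<And>i. i \<in> I \<Longrightarrow> u i \<in> spanned i nil_index \<and> u' i \<in> spanned i nil_index
      \<and> u i - u' i \<in> spanned_rad i nil_index"
  defines "slot v l \<equiv> (let i = fst (ys ! l) in if i \<in> I \<and> l = pos i then v i else snd (ys ! l))"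
  shows "nonempty_prod (map (slot u) [0..<length ys]) = nonempty_prod (map (slot u') [0..<length ys])"
proof (rule nonempty_prod_telescope)
  let ?L = "length ys"
  fix k assume k: "k < ?L"
  define sel where "sel l \<longleftrightarrow> fst (ys ! l) \<in> I \<and> l = pos (fst (ys ! l))" for l
  let ?x = "\<lambda>l. if l < k then slot u' l else if l = k then slot u k - slot u' k else slot u l"
  show "nonempty_prod (map ?x [0..<?L]) = 0"
  proof (cases "sel k")
    case False
    then have "slot u k = slot u' k" unfolding sel_def slot_def Let_def by auto
    then have "0 = ?x k" by simp
    also have "?x k \<in> set (map ?x [0..<?L])" using k by (intro image_eqI[of _ _ k] | simp)+
    finally show ?thesis by (rule nonempty_prod_0)
  next
    case True
    show ?thesis
    proof (rule ccontr)
      assume nz: "nonempty_prod (map ?x [0..<?L]) \<noteq> 0"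
      define R where "R l zs \<longleftrightarrow> (if sel l then nil_index \<le> cnt (fst (ys ! l)) zs + cnt 0 zs
          \<and> (l = k \<longrightarrow> 1 \<le> cnt 0 zs) else zs = [ys ! l])" for l zs
      have span: "?x l \<in> A.span {prodl zs | zs. zs \<noteq> [] \<and> valid zs \<and> R l zs}" if l: "l < ?L" for l
      proof (cases "sel l")
        case True
        let ?i = "fst (ys ! l)"
        have i: "?i \<in> I" "slot u l = u ?i" "slot u' l = u' ?i"
          using True by (auto simp: sel_def slot_def Let_def)
        show ?thesis using u[OF i(1)] True i unfolding R_def spanned_def spanned_rad_def by auto
      next
        case False
        then have "?x l = snd (ys ! l)" using \<open>sel k\<close> by (auto simp: sel_def slot_def Let_def)
        moreover have "valid [ys ! l]" using ys(1) l by (auto simp: valid_def)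
        ultimately show ?thesis
          using False unfolding R_def by (intro A.span_base CollectI exI[of _ "[ys ! l]"]) auto
      qed
      obtain f where f: "\<And>l. l < ?L \<Longrightarrow> f l \<noteq> [] \<and> valid (f l) \<and> R l (f l)"
        "prodl (concat (map f [0..<?L])) \<noteq> 0"
        using exists_valid_expansion[of ?L ?x R, OF _ span nz] ys(2) by blast
      let ?zs = "concat (map f [0..<?L])"
      have valid: "valid ?zs" by (rule valid_concat_map) (use f in blast)
      have "cnt 0 ys + 1 = (\<Sum>l<?L. (if fst (ys ! l) = 0 then 1 else 0) + (if l = k then 1 else 0))"
        using k by (simp add: cnt_eq_sum sum.distrib)
      also have "\<dots> \<le> (\<Sum>l<?L. cnt 0 (f l))"
      proof (rule sum_mono)
        fix l assume "l \<in> {..<?L}"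
        then have R: "R l (f l)" using f by blast
        show "(if fst (ys ! l) = 0 then 1 else 0) + (if l = k then 1 else 0) \<le> cnt 0 (f l)"
        proof (cases "sel l")
          case True
          then have "fst (ys ! l) \<noteq> 0" using I by (auto simp: sel_def)
          then show ?thesis using R True by (auto simp: R_def)
        next
          case False
          then show ?thesis using R \<open>sel k\<close> by (auto simp: R_def)
        qed
      qed
      also have "\<dots> = cnt 0 ?zs" by (simp only: cnt_concat_map)
      finally have more: "cnt 0 ys + 1 \<le> cnt 0 ?zs" .
      \<comment> \<open>Being nonzero, the product has fewer than \<open>nil_index\<close> radical
        factors; in the slot of \<open>i\<close> they cannot account for all
        \<open>nil_index\<close> labels.\<close>
      have less: "cnt 0 ?zs < nil_index" using valid_prodl_eq_0[OF valid] f(2) by (meson not_le)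
      have "i \<in> fst ` set ?zs" if i: "i \<in> I" for i
      proof -
        have l: "pos i < ?L" "fst (ys ! pos i) = i" using pos[OF i] by auto
        then have "sel (pos i)" using i by (simp add: sel_def)
        then have "nil_index \<le> cnt i (f (pos i)) + cnt 0 (f (pos i))"
          using f(1)[OF l(1)] l(2) by (simp add: R_def)
        moreover have "cnt j (f (pos i)) \<le> cnt j ?zs" for j
          unfolding cnt_concat_map using l(1) by (intro member_le_sum) auto
        ultimately have "cnt i ?zs > 0" using less by (metis add_mono le_trans linorder_not_less neq0_conv add_0 less_le_trans)
        then show ?thesis by (simp only: cnt_pos_iff)
      qed
      then have "cnt 0 ?zs \<le> cnt 0 ys" using max[OF valid _ f(2)] by blast
      then show False using more by simp
    qed
  qed
qed

end

section \<open>Inserting block functions into a maximal product\<close>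

lemma image_mset_sum: "image_mset f (\<Sum>i\<in>S. V i) = (\<Sum>i\<in>S. image_mset f (V i))"
  by (induction S rule: infinite_finite_induct) auto

context wm_decomposition
begin

text \<open>Constants are lifted by \<kappa>, and operators pass through because the projection is
  \<open>H\<close>-linear. Only the value modulo the radical is controlled.\<close>

lemma hfun_lift:
  assumes "Q.hfun (B i) V N f"
  shows "\<exists>g. hfun (W i) V N g \<and> (\<forall>\<psi>. jrad_proj (g \<psi>) = f (\<lambda>v. jrad_proj (\<psi> v)))"
  using assms
proof (induction rule: Q.hfun.induct)
  case (hfun_var v)
  show ?case by (rule exI[of _ "\<lambda>\<psi>. \<psi> v"]) (auto intro: hfun.hfun_var)
next
  case (hfun_const a)
  then show ?case
    by (intro exI[of _ "\<lambda>\<psi>. \<kappa> a"]) (auto intro: hfun.hfun_const \<kappa>_in_W simp: proj_\<kappa>)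
next
  case (hfun_act V N f h)
  then obtain g where "hfun (W i) V N g" "\<forall>\<psi>. jrad_proj (g \<psi>) = f (\<lambda>v. jrad_proj (\<psi> v))" by blast
  then show ?case
    by (intro exI[of _ "\<lambda>\<psi>. act h (g \<psi>)"]) (auto intro: hfun.hfun_act simp: jrad_proj_act)
next
  case (hfun_mult V N f V' N' f')
  then obtain g g' where "hfun (W i) V N g" "\<forall>\<psi>. jrad_proj (g \<psi>) = f (\<lambda>v. jrad_proj (\<psi> v))"
    "hfun (W i) V' N' g'" "\<forall>\<psi>. jrad_proj (g' \<psi>) = f' (\<lambda>v. jrad_proj (\<psi> v))" by blast
  then show ?case
    by (intro exI[of _ "\<lambda>\<psi>. g \<psi> * g' \<psi>"]) (auto intro: hfun.hfun_mult simp: jrad_proj_mult)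
next
  case (hfun_zero V N)
  show ?case by (rule exI[of _ "\<lambda>\<psi>. 0"]) (auto intro: hfun.hfun_zero simp: jrad_proj_0)
next
  case (hfun_add V N f f')
  then obtain g g' where "hfun (W i) V N g" "\<forall>\<psi>. jrad_proj (g \<psi>) = f (\<lambda>v. jrad_proj (\<psi> v))"
    "hfun (W i) V N g'" "\<forall>\<psi>. jrad_proj (g' \<psi>) = f' (\<lambda>v. jrad_proj (\<psi> v))" by blast
  then show ?case
    by (intro exI[of _ "\<lambda>\<psi>. g \<psi> + g' \<psi>"]) (auto intro: hfun.hfun_add simp: jrad_proj_add)
next
  case (hfun_scale V N f c)
  then obtain g where "hfun (W i) V N g" "\<forall>\<psi>. jrad_proj (g \<psi>) = f (\<lambda>v. jrad_proj (\<psi> v))" by blast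
  then show ?case
    by (intro exI[of _ "\<lambda>\<psi>. sA c (g \<psi>)"]) (auto intro: hfun.hfun_scale simp: A.jrad_proj_scale)
qed

abbreviation form_of :: "nat \<Rightarrow> 'a mod_jrad \<Rightarrow> 'a mod_jrad \<Rightarrow> 'f" where
  "form_of i \<equiv> H_simple_block.form (mod_jrad_scale sA) (m i) (e i)"

abbreviation det_of :: "nat \<Rightarrow> (nat \<times> nat \<Rightarrow> 'a mod_jrad) \<Rightarrow> nat \<Rightarrow> nat \<Rightarrow> 'f" where
  "det_of i \<chi> j j' \<equiv> det (mat (m i) (m i) (\<lambda>(c, c'). form_of i (\<chi> (j, c)) (\<chi> (j', c'))))"

text \<open>In the maximal product one factor \<kappa>(b i) per block is replaced by a lifted block
  function. By \<open>collapse\<close> its value may be replaced by the \<kappa>-part, which is a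
  scalar multiple of \<kappa>(b i). So \<open>a\<close> is the maximal product itself.\<close>

lemma exists_main_function:
  assumes js: "is \<noteq> []" "set is \<subseteq> {1..q}" and ch: "chain is \<noteq> {0}"
  shows "\<exists>N0 a. a \<noteq> 0 \<and> (\<forall>N\<ge>N0. \<forall>s. \<exists>F.
    hfun UNIV (\<Sum>i\<in>set is. \<Sum>j=0..<2*s. \<Sum>c=0..<m i. {#(i, j, c)#}) N F \<and>
    (\<forall>\<chi>. (\<forall>x. \<exists>l\<in>{1..q}. \<chi> x \<in> B l) \<longrightarrow> F (\<lambda>x. \<kappa> (\<chi> x))
      = sA (\<Prod>i\<in>set is. \<Prod>j=0..<s. det_of i (\<lambda>x. \<chi> (i, x)) (2*j) (2*j+1)) a))"
proof -
  let ?I = "set is"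
  obtain ys where ys: "valid ys" "ys \<noteq> []" "?I \<subseteq> fst ` set ys" "prodl ys \<noteq> 0"
    and max: "\<And>zs. valid zs \<Longrightarrow> ?I \<subseteq> fst ` set zs \<Longrightarrow> prodl zs \<noteq> 0 \<Longrightarrow> cnt 0 zs \<le> cnt 0 ys"
    using exists_maximal_list[OF js ch] by metis
  let ?L = "length ys"
  have "\<exists>l<?L. fst (ys ! l) = i" if "i \<in> ?I" for i
  proof -
    have "i \<in> fst ` set ys" using that ys(3) by blast
    then obtain z where "z \<in> set ys" "fst z = i" by blast
    then show ?thesis by (metis in_set_conv_nth)
  qed
  then obtain pos where pos: "\<And>i. i \<in> ?I \<Longrightarrow> pos i < ?L \<and> fst (ys ! pos i) = i" by metis
  have "\<exists>b\<in>B i. \<kappa> b = snd (ys ! pos i)" if i: "i \<in> ?I" for i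
  proof -
    have "(fst (ys ! pos i), snd (ys ! pos i)) \<in> set ys"
      unfolding prod.collapse using pos[OF i] by simp
    then have "snd (ys ! pos i) \<in> lab i" using ys(1) pos[OF i] by (fastforce simp: valid_def)
    moreover have "i \<noteq> 0" using i js(2) by auto
    ultimately show ?thesis by (auto simp: lab_def)
  qed
  then obtain b where b: "\<And>i. i \<in> ?I \<Longrightarrow> b i \<in> B i \<and> \<kappa> (b i) = snd (ys ! pos i)" by metis
  have "\<forall>i\<in>?I. \<exists>N0. \<forall>N\<ge>N0. \<forall>s.
     \<exists>f. Q.hfun (B i) (\<Sum>j=0..<2*s. \<Sum>c=0..<m i. {#(j, c)#}) N f \<and>
     (\<forall>\<psi>. f \<psi> = mod_jrad_scale sA (\<Prod>j=0..<s. det_of i \<psi> (2*j) (2*j+1)) (b i))"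
  proof
    fix i assume i: "i \<in> ?I"
    then have "i \<in> {1..q}" using js(2) by blast
    then interpret S: H_simple_block "mod_jrad_scale sA" sH "mod_jrad_act act" "B i" "m i" "e i"
      by (rule block)
    have "b i \<in> B i" using b[OF i] by blast
    then show "\<exists>N0. \<forall>N\<ge>N0. \<forall>s.
     \<exists>f. Q.hfun (B i) (\<Sum>j=0..<2*s. \<Sum>c=0..<m i. {#(j, c)#}) N f \<and>
     (\<forall>\<psi>. f \<psi> = mod_jrad_scale sA (\<Prod>j=0..<s. det_of i \<psi> (2*j) (2*j+1)) (b i))"
      by (rule S.exists_block_function)
  qed
  from bchoice[OF this] obtain N0 where N0_all: "\<forall>i\<in>?I. \<forall>N\<ge>N0 i. \<forall>s.
     \<exists>f. Q.hfun (B i) (\<Sum>j=0..<2*s. \<Sum>c=0..<m i. {#(j, c)#}) N f \<and>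
     (\<forall>\<psi>. f \<psi> = mod_jrad_scale sA (\<Prod>j=0..<s. det_of i \<psi> (2*j) (2*j+1)) (b i))"
    by (rule exE)
  have N0: "\<exists>f. Q.hfun (B i) (\<Sum>j=0..<2*s. \<Sum>c=0..<m i. {#(j, c)#}) N f \<and>
     (\<forall>\<psi>. f \<psi> = mod_jrad_scale sA (\<Prod>j=0..<s. det_of i \<psi> (2*j) (2*j+1)) (b i))"
    if "i \<in> ?I" "N0 i \<le> N" for i N s
    by (rule N0_all[rule_format, OF that])
  define sel where "sel l \<longleftrightarrow> fst (ys ! l) \<in> ?I \<and> l = pos (fst (ys ! l))" for l
  have pos_inj: "inj_on pos ?I" by (rule inj_onI) (metis pos)
  have pos_image: "{l \<in> {..<?L}. sel l} = pos ` ?I"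
    using pos by (auto simp: sel_def image_iff)
  have sum_sel: "(\<Sum>l<?L. if sel l then h (fst (ys ! l)) else 0) = (\<Sum>i\<in>?I. h i)"
    for h :: "nat \<Rightarrow> 'x::comm_monoid_add"
  proof -
    have "(\<Sum>l<?L. if sel l then h (fst (ys ! l)) else 0) = (\<Sum>l\<in>pos ` ?I. h (fst (ys ! l)))"
      unfolding pos_image[symmetric] by (rule sum.inter_filter[symmetric]) simp
    also have "\<dots> = (\<Sum>i\<in>?I. h i)"
      unfolding sum.reindex[OF pos_inj] by (intro sum.cong) (auto simp: pos)
    finally show ?thesis .
  qed
  have prod_sel: "(\<Prod>l<?L. if sel l then h (fst (ys ! l)) else 1) = (\<Prod>i\<in>?I. h i)" for h :: "nat \<Rightarrow> 'f"
  proof -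
    have "(\<Prod>l<?L. if sel l then h (fst (ys ! l)) else 1) = (\<Prod>l\<in>pos ` ?I. h (fst (ys ! l)))"
      unfolding pos_image[symmetric] by (rule prod.inter_filter[symmetric]) simp
    also have "\<dots> = (\<Prod>i\<in>?I. h i)"
      unfolding prod.reindex[OF pos_inj] by (intro prod.cong) (auto simp: pos)
    finally show ?thesis .
  qed
  \<comment> \<open>At least \<open>nil_index\<close> constants per block are what
    \<open>collapse\<close> requires. Each factor of \<open>ys\<close> that is not replaced counts
    as one constant, which gives \<open>N1\<close>.\<close>
  define M where "M i = max (N0 i) nil_index" for i
  define N1 where "N1 = (\<Sum>l<?L. if sel l then M (fst (ys ! l)) else 1)"
  have "\<exists>F. hfun UNIV (\<Sum>i\<in>?I. \<Sum>j=0..<2*s. \<Sum>c=0..<m i. {#(i, j, c)#}) N F \<and>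
    (\<forall>\<chi>. (\<forall>x. \<exists>l\<in>{1..q}. \<chi> x \<in> B l) \<longrightarrow> F (\<lambda>x. \<kappa> (\<chi> x))
      = sA (\<Prod>i\<in>?I. \<Prod>j=0..<s. det_of i (\<lambda>x. \<chi> (i, x)) (2*j) (2*j+1)) (prodl ys))"
    if N: "N \<ge> N1" for N s
  proof -
    \<comment> \<open>The surplus is put into one block, so that the total number of constants is
      exactly \<open>N\<close>.\<close>
    define M' where "M' i = M i + (if i = hd is then N - N1 else 0)" for i
    have M': "N0 i \<le> M' i" "nil_index \<le> M' i" for i by (auto simp: M'_def M_def)
    let ?V = "\<lambda>i. \<Sum>j=0..<2*s. \<Sum>c=0..<m i. {#(j, c)#}"
    have "\<forall>i\<in>?I. \<exists>g. hfun (W i) (?V i) (M' i) g \<and> (\<forall>\<psi>. jrad_proj (g \<psi>)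
       = mod_jrad_scale sA (\<Prod>j=0..<s. det_of i (\<lambda>x. jrad_proj (\<psi> x)) (2*j) (2*j+1)) (b i))"
    proof
      fix i assume i: "i \<in> ?I"
      obtain f where f: "Q.hfun (B i) (?V i) (M' i) f"
        "\<forall>\<psi>. f \<psi> = mod_jrad_scale sA (\<Prod>j=0..<s. det_of i \<psi> (2*j) (2*j+1)) (b i)"
        using N0[OF i M'(1)] by blast
      obtain g where g: "hfun (W i) (?V i) (M' i) g" "\<And>\<psi>. jrad_proj (g \<psi>) = f (\<lambda>x. jrad_proj (\<psi> x))"
        using hfun_lift[OF f(1)] by blast
      then show "\<exists>g. hfun (W i) (?V i) (M' i) g \<and> (\<forall>\<psi>. jrad_proj (g \<psi>)
         = mod_jrad_scale sA (\<Prod>j=0..<s. det_of i (\<lambda>x. jrad_proj (\<psi> x)) (2*j) (2*j+1)) (b i))"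
        using f(2) by (intro exI[of _ g]) simp
    qed
    from bchoice[OF this] obtain g where g_all: "\<forall>i\<in>?I. hfun (W i) (?V i) (M' i) (g i) \<and>
       (\<forall>\<psi>. jrad_proj (g i \<psi>)
       = mod_jrad_scale sA (\<Prod>j=0..<s. det_of i (\<lambda>x. jrad_proj (\<psi> x)) (2*j) (2*j+1)) (b i))"
      by (rule exE)
    then have g: "\<And>i. i \<in> ?I \<Longrightarrow> hfun (W i) (?V i) (M' i) (g i)"
      "\<And>i \<psi>. i \<in> ?I \<Longrightarrow> jrad_proj (g i \<psi>)
       = mod_jrad_scale sA (\<Prod>j=0..<s. det_of i (\<lambda>x. jrad_proj (\<psi> x)) (2*j) (2*j+1)) (b i)"
      by auto
    let ?V' = "\<lambda>i. \<Sum>j=0..<2*s. \<Sum>c=0..<m i. {#(i, j, c)#}"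
    define G where "G l \<psi> = (if sel l then g (fst (ys ! l)) (\<lambda>x. \<psi> (fst (ys ! l), x)) else snd (ys ! l))"
      for l and \<psi> :: "nat \<times> nat \<times> nat \<Rightarrow> 'a"
    define F where "F \<psi> = nonempty_prod (map (\<lambda>l. G l \<psi>) [0..<?L])" for \<psi>
    obtain L' where L': "?L = Suc L'" using ys(2) by (cases ys) auto
    have "hfun UNIV (\<Sum>l<?L. if sel l then ?V' (fst (ys ! l)) else {#})
        (\<Sum>l<?L. if sel l then M' (fst (ys ! l)) else 1) F"
      unfolding F_def[abs_def] L'
    proof (rule hfun_prod)
      fix l assume "l < Suc L'"
      show "hfun UNIV (if sel l then ?V' (fst (ys ! l)) else {#})
          (if sel l then M' (fst (ys ! l)) else 1) (G l)"
      proof (cases "sel l")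
        case True
        let ?i = "fst (ys ! l)"
        have i: "?i \<in> ?I" using True by (simp add: sel_def)
        have "hfun UNIV (image_mset (Pair ?i) (?V ?i)) (M' ?i) (\<lambda>\<psi>. g ?i (\<lambda>x. \<psi> (?i, x)))"
          by (rule hfun_rename[OF hfun_mono[OF g(1)[OF i]]]) simp
        then show ?thesis using True by (simp add: G_def[abs_def] image_mset_sum)
      next
        case False
        then show ?thesis using hfun_const[of "snd (ys ! l)" UNIV] by (simp add: G_def[abs_def])
      qed
    qed
    moreover have "(\<Sum>l<?L. if sel l then ?V' (fst (ys ! l)) else {#}) = (\<Sum>i\<in>?I. ?V' i)"
      by (rule sum_sel)
    moreover have "(\<Sum>l<?L. if sel l then M' (fst (ys ! l)) else 1) = N"
    proof -
      have "(\<Sum>l<?L. if sel l then M' (fst (ys ! l)) else 1)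
          = (\<Sum>l<?L. (if sel l then M (fst (ys ! l)) else 1)
              + (if sel l then (if fst (ys ! l) = hd is then N - N1 else 0) else 0))"
        by (intro sum.cong) (auto simp: M'_def)
      also have "\<dots> = N1 + (\<Sum>i\<in>?I. if i = hd is then N - N1 else 0)"
        unfolding sum.distrib N1_def sum_sel[of "\<lambda>i. if i = hd is then N - _ else 0"] ..
      also have "\<dots> = N" using N js(1) by simp
      finally show ?thesis .
    qed
    ultimately have hF: "hfun UNIV (\<Sum>i\<in>?I. ?V' i) N F" by simp
    have "F (\<lambda>x. \<kappa> (\<chi> x)) = sA (\<Prod>i\<in>?I. \<Prod>j=0..<s. det_of i (\<lambda>x. \<chi> (i, x)) (2*j) (2*j+1)) (prodl ys)"
      if \<chi>: "\<forall>x. \<exists>l\<in>{1..q}. \<chi> x \<in> B l" for \<chi>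
    proof -
      define D where "D i = (\<Prod>j=0..<s. det_of i (\<lambda>x. \<chi> (i, x)) (2*j) (2*j+1))" for i
      define u where "u i = g i (\<lambda>x. \<kappa> (\<chi> (i, x)))" for i
      define u' where "u' i = \<kappa> (jrad_proj (u i))" for i
      have u: "u i \<in> spanned i nil_index \<and> u' i \<in> spanned i nil_index \<and> u i - u' i \<in> spanned_rad i nil_index"
        if i: "i \<in> ?I" for i
      proof -
        have "i \<in> {1..q}" using i js(2) by blast
        from hfun_spanned[OF g(1)[OF i] this, of "\<lambda>x. \<kappa> (\<chi> (i, x))"] \<chi>
        show ?thesis using spanned_mono[OF M'(2)[of i], of i] unfolding u'_def u_def by blast
      qed
      have u'_eq: "u' i = sA (D i) (snd (ys ! pos i))" if i: "i \<in> ?I" for i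
        using b[OF i] unfolding u'_def u_def g(2)[OF i] D_def by (simp add: proj_\<kappa> \<kappa>_scale)
      define slot where "slot v l = (let i = fst (ys ! l) in if i \<in> ?I \<and> l = pos i then v i else snd (ys ! l))"
        for v and l
      have slot_sel: "slot v l = (if sel l then v (fst (ys ! l)) else snd (ys ! l))" for v l
        by (simp add: slot_def Let_def sel_def)
      have "F (\<lambda>x. \<kappa> (\<chi> x)) = nonempty_prod (map (slot u) [0..<?L])"
        unfolding F_def by (intro arg_cong[of _ _ nonempty_prod] map_cong refl) (auto simp: G_def u_def slot_sel)
      also have "\<dots> = nonempty_prod (map (slot u') [0..<?L])"
        unfolding slot_def by (rule collapse[OF ys(1,2) max js(2) pos u])
      also have "\<dots> = nonempty_prod (map (\<lambda>l. sA (if sel l then D (fst (ys ! l)) else 1) (snd (ys ! l))) [0..<?L])"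
      proof (intro arg_cong[of _ _ nonempty_prod] map_cong refl)
        fix l
        show "slot u' l = sA (if sel l then D (fst (ys ! l)) else 1) (snd (ys ! l))"
        proof (cases "sel l")
          case True
          then have "fst (ys ! l) \<in> ?I" "pos (fst (ys ! l)) = l" by (auto simp: sel_def)
          then show ?thesis using True u'_eq by (simp add: slot_sel)
        qed (simp add: slot_sel)
      qed
      also have "\<dots> = sA (\<Prod>l=0..<?L. if sel l then D (fst (ys ! l)) else 1) (nonempty_prod (map (\<lambda>l. snd (ys ! l)) [0..<?L]))"
        using ys(2) by (subst A.nonempty_prod_scale) (auto simp: prod_list_map_upt)
      also have "(\<Prod>l=0..<?L. if sel l then D (fst (ys ! l)) else 1) = (\<Prod>i\<in>?I. D i)"
        using prod_sel[of D] by (simp add: atLeast0LessThan)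
      also have "map (\<lambda>l. snd (ys ! l)) [0..<?L] = map snd ys" by (rule nth_equalityI) auto
      finally show ?thesis by (simp only: D_def)
    qed
    then show ?thesis using hF by blast
  qed
  then show ?thesis using ys(4) by blast
qed

end

section \<open>Counting ballot words\<close>

text \<open>Lattice words, with the condition imposed on the final segments. For weakly decreasing
  \<open>l\<close>, those with \<open>l c\<close> letters c correspond to the standard Young
  tableaux with row lengths \<open>l\<close>.\<close>

fun ballot :: "nat list \<Rightarrow> bool" where
  "ballot [] \<longleftrightarrow> True"
| "ballot (c # ws) \<longleftrightarrow> ballot ws \<and> (c = 0 \<or> count_list ws c < count_list ws (c - 1))"

definition ballot_words :: "nat \<Rightarrow> (nat \<Rightarrow> nat) \<Rightarrow> nat list set" where
  "ballot_words d l = {ws. ballot ws \<and> set ws \<subseteq> {..<d} \<and> (\<forall>c<d. count_list ws c = l c)}"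

lemma ballot_count_Suc: "ballot ws \<Longrightarrow> count_list ws (Suc b) \<le> count_list ws b"
  by (induction ws arbitrary: b) (auto intro: le_SucI)

lemma ballot_count: "ballot ws \<Longrightarrow> c \<le> c' \<Longrightarrow> count_list ws c' \<le> count_list ws c"
  by (rule lift_Suc_antimono_le) (auto intro: ballot_count_Suc)

lemma length_eq_sum_count: "set ws \<subseteq> {..<d} \<Longrightarrow> length ws = (\<Sum>c<d. count_list ws c)" for d :: nat
  by (metis finite_lessThan sum_count_set)

lemma finite_ballot_words: "finite (ballot_words d l)"
proof (rule finite_subset)
  show "ballot_words d l \<subseteq> {ws. set ws \<subseteq> {..<d} \<and> length ws = (\<Sum>c<d. l c)}"
    by (auto simp: ballot_words_def length_eq_sum_count)
qed (rule finite_lists_length_eq, simp)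

lemma ballot_words_rec:
  assumes dec: "\<And>c. Suc c < d \<Longrightarrow> l (Suc c) \<le> l c" and n: "(\<Sum>c<d. l c) > 0"
  shows "ballot_words d l = (\<Union>c\<in>{c. c < d \<and> l c > 0}. (#) c ` ballot_words d (l(c := l c - 1)))"
proof (intro equalityI subsetI)
  fix ws assume ws: "ws \<in> ballot_words d l"
  then have "ws \<noteq> []" using n by (auto simp: ballot_words_def)
  then obtain c ws' where c: "ws = c # ws'" by (cases ws) auto
  then have "c < d" "l c > 0" "ws' \<in> ballot_words d (l(c := l c - 1))"
    using ws by (auto simp: ballot_words_def)
  then show "ws \<in> (\<Union>c\<in>{c. c < d \<and> l c > 0}. (#) c ` ballot_words d (l(c := l c - 1)))"
    using c by blast
next
  fix ws assume "ws \<in> (\<Union>c\<in>{c. c < d \<and> l c > 0}. (#) c ` ballot_words d (l(c := l c - 1)))"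
  then obtain c ws' where c: "ws = c # ws'" "c < d" "l c > 0"
    "ws' \<in> ballot_words d (l(c := l c - 1))" by blast
  have "c = 0 \<or> count_list ws' c < count_list ws' (c - 1)"
  proof (cases c)
    case (Suc b)
    then show ?thesis using c dec[of b] by (auto simp: ballot_words_def)
  qed simp
  then show "ws \<in> ballot_words d l"
    using c by (auto simp: ballot_words_def)
qed

lemma card_ballot_words_rec:
  assumes "\<And>c. Suc c < d \<Longrightarrow> l (Suc c) \<le> l c" and "(\<Sum>c<d. l c) > 0"
  shows "card (ballot_words d l)
    = (\<Sum>c\<in>{c. c < d \<and> l c > 0}. card (ballot_words d (l(c := l c - 1))))"
proof -
  have "ballot_words d l = (\<Union>c\<in>{c. c < d \<and> l c > 0}. (#) c ` ballot_words d (l(c := l c - 1)))"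
    by (rule ballot_words_rec) (use assms in auto)
  then have "card (ballot_words d l)
      = card (\<Union>c\<in>{c. c < d \<and> l c > 0}. (#) c ` ballot_words d (l(c := l c - 1)))" by (rule arg_cong)
  also have "\<dots> = (\<Sum>c\<in>{c. c < d \<and> l c > 0}. card ((#) c ` ballot_words d (l(c := l c - 1))))"
    by (rule card_UN_disjoint) (auto simp: finite_ballot_words)
  finally show ?thesis by (simp add: card_image)
qed

text \<open>The value 0 at negative integers, as for the reciprocal of the Gamma function, makes the
  relation \<open>inv_fact_pred\<close> hold for all integers.\<close>

definition inv_fact :: "int \<Rightarrow> real" where
  "inv_fact z = (if z < 0 then 0 else 1 / fact (nat z))"

lemma inv_fact_pred: "inv_fact (z - 1) = of_int z * inv_fact z"
proof (cases "z > 0")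
  case True
  then have "nat z = Suc (nat (z - 1))" by simp
  then show ?thesis using True by (simp add: inv_fact_def field_simps)
qed (auto simp: inv_fact_def)

text \<open>The matrix of the determinantal formula n! det(1/(l_i - i + j)!) for the number of
  standard tableaux. Integer row lengths admit the value -1, which arises in the recursion at an
  empty row.\<close>

definition ballot_mat :: "nat \<Rightarrow> (nat \<Rightarrow> int) \<Rightarrow> real mat" where
  "ballot_mat d l = mat d d (\<lambda>(i, j). inv_fact (l i - int i + int j))"

lemma det_ballot_mat:
  "det (ballot_mat d l) = (\<Sum>p | p permutes {0..<d}. signof p * (\<Prod>i=0..<d. inv_fact (l i - int i + int (p i))))"
proof -
  have "(\<Prod>i=0..<d. ballot_mat d l $$ (i, p i)) = (\<Prod>i=0..<d. inv_fact (l i - int i + int (p i)))"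
    if "p permutes {0..<d}" for p
    using permutes_in_image[OF that] by (intro prod.cong) (auto simp: ballot_mat_def)
  then show ?thesis
    by (subst det_def') (auto simp: ballot_mat_def intro!: sum.cong)
qed

text \<open>Lowering \<open>l c\<close> multiplies the Leibniz term of \<open>p\<close> by l c - c +
  p c, and the contributions - c + p c of a permutation add up to 0.\<close>

lemma sum_det_ballot_mat:
  "(\<Sum>c=0..<d. det (ballot_mat d (l(c := l c - 1)))) = of_int (\<Sum>c=0..<d. l c) * det (ballot_mat d l)"
proof -
  have "(\<Sum>c=0..<d. \<Prod>i=0..<d. inv_fact ((l(c := l c - 1)) i - int i + int (p i)))
      = of_int (\<Sum>c=0..<d. l c) * (\<Prod>i=0..<d. inv_fact (l i - int i + int (p i)))"
    if p: "p permutes {0..<d}" for p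
  proof -
    let ?z = "\<lambda>i. l i - int i + int (p i)"
    have "(\<Prod>i=0..<d. inv_fact ((l(c := l c - 1)) i - int i + int (p i)))
       = of_int (?z c) * (\<Prod>i=0..<d. inv_fact (?z i))" if c: "c \<in> {0..<d}" for c
    proof -
      have "(\<Prod>i=0..<d. inv_fact ((l(c := l c - 1)) i - int i + int (p i)))
         = inv_fact (?z c - 1) * (\<Prod>i\<in>{0..<d}-{c}. inv_fact (?z i))"
        by (subst prod.remove[OF _ c]) (auto intro!: arg_cong2[of _ _ _ _ "(*)"] prod.cong simp: algebra_simps)
      also have "\<dots> = of_int (?z c) * (inv_fact (?z c) * (\<Prod>i\<in>{0..<d}-{c}. inv_fact (?z i)))"
        by (simp add: inv_fact_pred)
      also have "inv_fact (?z c) * (\<Prod>i\<in>{0..<d}-{c}. inv_fact (?z i)) = (\<Prod>i=0..<d. inv_fact (?z i))"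
        using prod.remove[OF _ c, of "\<lambda>i. inv_fact (?z i)"] by simp
      finally show ?thesis .
    qed
    then have "(\<Sum>c=0..<d. \<Prod>i=0..<d. inv_fact ((l(c := l c - 1)) i - int i + int (p i)))
       = of_int (\<Sum>c=0..<d. ?z c) * (\<Prod>i=0..<d. inv_fact (?z i))"
      by (simp add: sum_distrib_right)
    also have "(\<Sum>c=0..<d. ?z c) = (\<Sum>c=0..<d. l c) + ((\<Sum>c=0..<d. int (p c)) - (\<Sum>c=0..<d. int c))"
      by (simp add: sum.distrib sum_subtractf)
    also have "(\<Sum>c=0..<d. int (p c)) = (\<Sum>c=0..<d. int c)"
      using sum.permute[OF p, of int] by (simp add: o_def)
    finally show ?thesis by simp
  qed
  then show ?thesis
    unfolding det_ballot_mat
    by (subst sum.swap) (simp add: sum_distrib_left[symmetric] sum_distrib_left mult.left_commute)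
qed

text \<open>Removing a box that must not be removed makes two neighbouring rows of the matrix equal
  or, at an empty last row, makes this row of the matrix zero. So the forbidden terms drop out of
  the recursion for the determinants.\<close>

lemma det_ballot_mat_wall:
  assumes dec: "\<And>c. Suc c < d \<Longrightarrow> l (Suc c) \<le> l c" and c: "c < d"
    and wall: "l c = 0 \<or> Suc c < d \<and> l (Suc c) = l c"
  shows "det (ballot_mat d ((int \<circ> l)(c := int (l c) - 1))) = 0"
proof (cases "Suc c < d")
  case True
  then have eq: "l (Suc c) = l c" using wall dec[of c] by auto
  show ?thesis
    by (rule det_identical_rows[of _ d c "Suc c"])
      (use True eq in \<open>auto simp: ballot_mat_def algebra_simps\<close>)
next
  case False
  then have c': "l c = 0" "Suc c = d" using wall c by auto
  have "(\<Prod>i=0..<d. inv_fact (((int \<circ> l)(c := int (l c) - 1)) i - int i + int (p i))) = 0"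
    if p: "p permutes {0..<d}" for p
  proof (rule prod_zero)
    have "p c < d" using permutes_in_image[OF p, of c] c by auto
    then show "\<exists>i\<in>{0..<d}. inv_fact (((int \<circ> l)(c := int (l c) - 1)) i - int i + int (p i)) = 0"
      using c c' by (intro bexI[of _ c]) (auto simp: inv_fact_def)
  qed simp
  then show ?thesis unfolding det_ballot_mat by (simp add: sum.neutral)
qed

text \<open>Both sides satisfy the same recursion, in which one box is removed from the
  shape.\<close>

lemma card_ballot_words:
  assumes "\<And>c. Suc c < d \<Longrightarrow> l (Suc c) \<le> l c"
  shows "real (card (ballot_words d l)) = fact (\<Sum>c<d. l c) * det (ballot_mat d (int \<circ> l))"
  using assms
proof (induction "\<Sum>c<d. l c" arbitrary: l)
  case 0
  then have l0: "\<And>c. c < d \<Longrightarrow> l c = 0" by auto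
  have "ws = []" if ws: "ws \<in> ballot_words d l" for ws
  proof -
    have "length ws = 0"
      using ws 0(1) l0 by (subst length_eq_sum_count[of _ d]) (auto simp: ballot_words_def)
    then show ?thesis by simp
  qed
  then have "ballot_words d l = {[]}" using l0 by (auto simp: ballot_words_def)
  moreover have "det (ballot_mat d (int \<circ> l)) = 1"
  proof -
    have "det (ballot_mat d (int \<circ> l)) = prod_list (diag_mat (ballot_mat d (int \<circ> l)))"
      by (rule det_upper_triangular[of _ d])
        (auto simp: ballot_mat_def upper_triangular_def l0 inv_fact_def)
    also have "diag_mat (ballot_mat d (int \<circ> l)) = replicate d 1"
      by (rule nth_equalityI) (auto simp: diag_mat_def ballot_mat_def l0 inv_fact_def)
    finally show ?thesis by (simp only: prod_list_replicate power_one)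
  qed
  ultimately show ?case using 0 by (simp add: o_def)
next
  case (Suc n)
  note dec = Suc.prems
  have pos: "(\<Sum>c<d. l c) > 0" using Suc(2) by simp
  have term_c: "(if l c > 0 then real (card (ballot_words d (l(c := l c - 1)))) else 0)
      = fact n * det (ballot_mat d ((int \<circ> l)(c := int (l c) - 1)))" if c: "c < d" for c
  proof (cases "l c > 0 \<and> (Suc c < d \<longrightarrow> l (Suc c) < l c)")
    case True
    have upd: "(int \<circ> l)(c := int (l c) - 1) = int \<circ> l(c := l c - 1)"
      using True by (auto simp: fun_eq_iff of_nat_diff)
    have "(\<Sum>b<d. l b) = l c + (\<Sum>b\<in>{..<d}-{c}. l b)"
      using c by (intro sum.remove) auto
    moreover have "(\<Sum>b<d. (l(c := l c - 1)) b) = (l c - 1) + (\<Sum>b\<in>{..<d}-{c}. l b)"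
      using c by (subst sum.remove[of _ c]) (auto intro!: sum.cong)
    ultimately have n: "n = (\<Sum>b<d. (l(c := l c - 1)) b)"
      using Suc(2) True by simp
    have "(l(c := l c - 1)) (Suc b) \<le> (l(c := l c - 1)) b" if "Suc b < d" for b
      using dec[OF that] True that by auto
    from Suc(1)[OF n this] have "real (card (ballot_words d (l(c := l c - 1))))
        = fact n * det (ballot_mat d (int \<circ> l(c := l c - 1)))" by (simp only: n[symmetric])
    then show ?thesis using True by (simp only: upd if_True)
  next
    case False
    then have wall: "l c = 0 \<or> Suc c < d \<and> l (Suc c) = l c"
      using dec[of c] by auto
    have "ballot_words d (l(c := l c - 1)) = {}" if "l c > 0"
    proof -
      have eq: "Suc c < d" "l (Suc c) = l c" using wall that by auto
      have "False" if ws: "ws \<in> ballot_words d (l(c := l c - 1))" for ws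
      proof -
        have "count_list ws (Suc c) = l c" "count_list ws c = l c - 1" "ballot ws"
          using ws eq c by (auto simp: ballot_words_def)
        then show False using ballot_count_Suc[of ws c] \<open>l c > 0\<close> by simp
      qed
      then show ?thesis by blast
    qed
    then show ?thesis using det_ballot_mat_wall[of d l c, OF dec c wall] by simp
  qed
  have "real (card (ballot_words d l))
     = (\<Sum>c\<in>{c. c < d \<and> l c > 0}. real (card (ballot_words d (l(c := l c - 1)))))"
    by (subst card_ballot_words_rec[OF dec pos]) auto
  also have "\<dots> = (\<Sum>c=0..<d. if l c > 0 then real (card (ballot_words d (l(c := l c - 1)))) else 0)"
    by (rule sum.mono_neutral_cong_left) auto
  also have "\<dots> = fact n * (\<Sum>c=0..<d. det (ballot_mat d ((int \<circ> l)(c := int (l c) - 1))))"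
    by (simp add: term_c sum_distrib_left)
  also have "(\<Sum>c=0..<d. det (ballot_mat d ((int \<circ> l)(c := int (l c) - 1))))
     = of_int (\<Sum>c=0..<d. int (l c)) * det (ballot_mat d (int \<circ> l))"
    using sum_det_ballot_mat[of d "int \<circ> l"] by simp
  also have "(\<Sum>c=0..<d. int (l c)) = int (Suc n)"
    using Suc(2) by (simp add: atLeast0LessThan flip: of_nat_sum)
  finally show ?case unfolding Suc(2)[symmetric] by (simp add: algebra_simps o_def)
qed

lemma ballot_words_nonempty:
  assumes "\<And>c. Suc c < d \<Longrightarrow> l (Suc c) \<le> l c"
  shows "ballot_words d l \<noteq> {}"
  using assms
proof (induction "\<Sum>c<d. l c" arbitrary: l)
  case 0
  then have "[] \<in> ballot_words d l" by (auto simp: ballot_words_def)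
  then show ?case by blast
next
  case (Suc n)
  note dec = Suc.prems
  let ?S = "{c. c < d \<and> l c > 0}"
  \<comment> \<open>The last nonempty row can be shortened without destroying monotonicity.\<close>
  define c where "c = Max ?S"
  have "?S \<noteq> {}" using Suc(2) by (metis (no_types, lifting) Collect_empty_eq gr0I lessThan_iff nat.distinct(1) sum.neutral)
  then have "c \<in> ?S" unfolding c_def by (intro Max_in) auto
  then have c: "c < d" "l c > 0" by auto
  have max: "b \<le> c" if "b \<in> ?S" for b unfolding c_def using that by (intro Max_ge) auto
  have "(\<Sum>b<d. l b) = l c + (\<Sum>b\<in>{..<d}-{c}. l b)"
    using c by (intro sum.remove) auto
  moreover have "(\<Sum>b<d. (l(c := l c - 1)) b) = (l c - 1) + (\<Sum>b\<in>{..<d}-{c}. l b)"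
    using c by (subst sum.remove[of _ c]) (auto intro!: sum.cong)
  ultimately have n: "n = (\<Sum>b<d. (l(c := l c - 1)) b)"
    using Suc(2) c by simp
  have "(l(c := l c - 1)) (Suc b) \<le> (l(c := l c - 1)) b" if "Suc b < d" for b
  proof (cases "b = c")
    case True
    then have "l (Suc b) = 0" using max[of "Suc b"] that by (cases "l (Suc b)") auto
    then show ?thesis using True by simp
  qed (use dec[OF that] in auto)
  from Suc(1)[OF n this] obtain ws where ws: "ws \<in> ballot_words d (l(c := l c - 1))" by blast
  have "ballot_words d l = (\<Union>c\<in>{c. c < d \<and> l c > 0}. (#) c ` ballot_words d (l(c := l c - 1)))"
    by (rule ballot_words_rec) (use dec Suc(2) in auto)
  then have "c # ws \<in> ballot_words d l" using ws c by auto
  then show ?case by blast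
qed

section \<open>Estimates for rectangular shapes\<close>

lemma fact_div_fact_int: "b \<le> a \<Longrightarrow> fact a / fact b \<in> (\<int> :: real set)"
  using fact_dvd[of b a, where 'a = int]
  by (metis Ints_of_int of_int_divide_in_Ints of_int_fact)

text \<open>The determinant formula makes \<open>N * (\<Prod>i<d. (k + d - 1 - i)!) / (d k)!\<close> an integer, where
  \<open>N\<close> is the number of ballot words; being positive, it is at least \<open>1\<close>.\<close>

lemma card_rect_ballot_words_ge_fact:
  "fact (d * k) \<le> card (ballot_words d (\<lambda>_. k)) * (\<Prod>i=0..<d. fact (k + d - 1 - i) :: nat)"
proof -
  let ?N = "real (card (ballot_words d (\<lambda>_. k)))"
  let ?P = "\<Prod>i=0..<d. fact (k + d - 1 - i) :: real"
  have N: "?N = fact (d * k) * det (ballot_mat d (\<lambda>_. int k))"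
    using card_ballot_words[of d "\<lambda>_. k"] by (simp add: o_def)
  have "?N > 0"
    using ballot_words_nonempty[of d "\<lambda>_. k"] finite_ballot_words by (auto simp: card_gt_0_iff)
  then have pos: "det (ballot_mat d (\<lambda>_. int k)) > 0"
    unfolding N by (simp add: zero_less_mult_iff)
  \<comment> \<open>For j < d the argument of \<open>inv_fact\<close> is at most k + d - 1 - i, so
    this is 0 or an integral quotient of factorials.\<close>
  have "(fact (k + d - 1 - i) :: real) * inv_fact (int k - int i + int j) \<in> \<int>" if "i < d" "j < d" for i j
  proof (cases "int k - int i + int j < 0")
    case False
    then have "nat (int k - int i + int j) \<le> k + d - 1 - i" using that by auto
    then show ?thesis using fact_div_fact_int False by (simp add: inv_fact_def)
  qed (simp add: inv_fact_def)
  then have "(\<Prod>i=0..<d. (fact (k + d - 1 - i) :: real) * inv_fact (int k - int i + int (p i))) \<in> \<int>"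
    if p: "p permutes {0..<d}" for p
    using permutes_in_image[OF p] by (intro Ints_prod) auto
  then have "signof p * (\<Prod>i=0..<d. (fact (k + d - 1 - i) :: real) * inv_fact (int k - int i + int (p i))) \<in> \<int>"
    if p: "p permutes {0..<d}" for p
    using that by (intro Ints_mult) (auto simp: sign_def)
  then have "?P * det (ballot_mat d (\<lambda>_. int k)) \<in> \<int>"
    unfolding det_ballot_mat sum_distrib_left
    by (intro Ints_sum) (auto simp: prod.distrib mult.left_commute)
  moreover have "?P * det (ballot_mat d (\<lambda>_. int k)) > 0"
    using pos by (intro mult_pos_pos prod_pos) auto
  ultimately have "?P * det (ballot_mat d (\<lambda>_. int k)) \<ge> 1"
    by (metis Ints_cases int_one_le_iff_zero_less of_int_0_less_iff of_int_1_le_iff)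
  then have "fact (d * k) * 1 \<le> fact (d * k) * (?P * det (ballot_mat d (\<lambda>_. int k)))"
    by (intro mult_left_mono) auto
  then have "fact (d * k) \<le> ?N * ?P" unfolding N by (simp add: mult_ac)
  also have "\<dots> = real (card (ballot_words d (\<lambda>_. k)) * (\<Prod>i=0..<d. fact (k + d - 1 - i)))"
    by simp
  finally show ?thesis by (metis of_nat_fact of_nat_le_iff)
qed

lemma fact_add_le: "fact (k + m) \<le> fact k * (k + m) ^ m" for k m :: nat
proof (induction m)
  case (Suc m)
  have "fact (k + Suc m) = (k + Suc m) * fact (k + m)" by simp
  also have "\<dots> \<le> (k + Suc m) * (fact k * (k + m) ^ m)" using Suc by (intro mult_left_mono) auto
  also have "\<dots> \<le> (k + Suc m) * (fact k * (k + Suc m) ^ m)"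
    by (intro mult_left_mono power_mono) auto
  finally show ?case by (simp add: algebra_simps)
qed simp

text \<open>A weak form of Stirling's estimate for the multinomial coefficient (dk)!/(k!)^d. From k
  to k + 1 the left side gains exactly ((k + 1) d)^d and the factorial of dk at least (dk)^d; the
  factor \<open>(k * d) ^ d\<close> makes up for the difference.\<close>

lemma fact_mult_ge: "k \<ge> 1 \<Longrightarrow> fact k ^ d * d ^ (d * k) \<le> fact (d * k) * (k * d) ^ d" for k d :: nat
proof (induction k rule: dec_induct)
  case base
  show ?case by (simp add: fact_ge_1)
next
  case (step k)
  have ge: "fact n * n ^ m \<le> fact (n + m)" for n m :: nat
  proof (induction m)
    case (Suc m)
    have "fact n * n ^ Suc m \<le> n * fact (n + m)" using Suc by (simp add: mult_ac)
    also have "\<dots> \<le> (n + Suc m) * fact (n + m)" by (intro mult_right_mono) auto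
    finally show ?case by simp
  qed simp
  have "fact (Suc k) ^ d = Suc k ^ d * fact k ^ d" "d ^ (d * Suc k) = d ^ d * d ^ (d * k)"
    by (simp_all only: fact_Suc power_mult_distrib of_nat_id mult_Suc_right power_add)
  then have "fact (Suc k) ^ d * d ^ (d * Suc k) = (Suc k * d) ^ d * (fact k ^ d * d ^ (d * k))"
    by (simp only: power_mult_distrib mult_ac)
  also have "\<dots> \<le> (Suc k * d) ^ d * (fact (d * k) * (k * d) ^ d)"
    using step by (intro mult_left_mono) auto
  also have "\<dots> = (fact (d * k) * (d * k) ^ d) * (Suc k * d) ^ d" by (simp add: mult_ac)
  also have "\<dots> \<le> fact (d * k + d) * (Suc k * d) ^ d"
    using ge by (intro mult_right_mono) auto
  also have "d * k + d = d * Suc k" by simp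
  finally show ?case .
qed

lemma card_rect_ballot_words_ge:
  assumes "k \<ge> 1"
  shows "d ^ (d * k) \<le> card (ballot_words d (\<lambda>_. k)) * (k + d) ^ (d * d) * (k * d) ^ d"
proof -
  let ?N = "card (ballot_words d (\<lambda>_. k))"
  have "(\<Prod>i=0..<d. fact (k + d - 1 - i) :: nat) \<le> (\<Prod>i=0..<d. fact k * (k + d) ^ d)"
  proof (rule prod_mono, safe)
    fix i assume "i \<in> {0..<d}"
    then have i: "k + d - 1 - i = k + (d - 1 - i)" by auto
    have "fact (k + (d - 1 - i)) \<le> fact k * (k + (d - 1 - i)) ^ (d - 1 - i)"
      by (rule fact_add_le)
    also have "\<dots> \<le> fact k * (k + d) ^ (d - 1 - i)" by (intro mult_left_mono power_mono) auto
    also have "\<dots> \<le> fact k * (k + d) ^ d"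
      using assms by (intro mult_left_mono power_increasing) auto
    finally show "(fact (k + d - 1 - i) :: nat) \<le> fact k * (k + d) ^ d" using i by simp
  qed
  also have "\<dots> = fact k ^ d * (k + d) ^ (d * d)" by (simp add: power_mult_distrib power_mult)
  finally have P: "(\<Prod>i=0..<d. fact (k + d - 1 - i) :: nat) \<le> fact k ^ d * (k + d) ^ (d * d)" .
  have "fact k ^ d * d ^ (d * k) \<le> fact (d * k) * (k * d) ^ d" by (rule fact_mult_ge[OF assms])
  also have "\<dots> \<le> (?N * (fact k ^ d * (k + d) ^ (d * d))) * (k * d) ^ d"
    using card_rect_ballot_words_ge_fact[of d k] mult_left_mono[OF P, of ?N]
    by (intro mult_right_mono) (auto intro: order_trans)
  also have "\<dots> = fact k ^ d * (?N * (k + d) ^ (d * d) * (k * d) ^ d)" by (simp add: mult_ac)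
  finally show ?thesis by simp
qed

section \<open>Columns of ballot words\<close>

text \<open>Equal letters are numbered from the end, beginning with 0. In the tableau of a ballot
  word this is the column of the box that belongs to position \<open>a\<close>.\<close>

definition column :: "nat list \<Rightarrow> nat \<Rightarrow> nat" where
  "column ws a = count_list (drop (Suc a) ws) (ws ! a)"

text \<open>The word as a number in base \<open>d\<close> whose first letter is the least
  significant digit, so that words are compared from the end.\<close>

fun word_value :: "nat \<Rightarrow> nat list \<Rightarrow> nat" where
  "word_value d [] = 0"
| "word_value d (x # xs) = x + d * word_value d xs"

lemma exists_position:
  "j < count_list ws c \<Longrightarrow> \<exists>a<length ws. ws ! a = c \<and> column ws a = j"
proof (induction ws)
  case (Cons x ws)
  show ?case
  proof (cases "j < count_list ws c")
    case True
    then obtain a where "a < length ws" "ws ! a = c" "column ws a = j" using Cons.IH by blast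
    then show ?thesis by (intro exI[of _ "Suc a"]) (auto simp: column_def)
  next
    case False
    then have "x = c" "j = count_list ws c" using Cons.prems by (auto split: if_splits)
    then show ?thesis by (intro exI[of _ 0]) (auto simp: column_def)
  qed
qed simp

lemma column_less: "a < length ws \<Longrightarrow> column ws a < count_list ws (ws ! a)"
proof (induction ws arbitrary: a)
  case (Cons x ws)
  show ?case
  proof (cases a)
    case (Suc b)
    then have "column ws b < count_list ws (ws ! b)" using Cons by auto
    then show ?thesis using Suc by (auto simp: column_def)
  qed (simp add: column_def)
qed simp

lemma column_inj:
  assumes "a < length ws" "b < length ws" "ws ! a = ws ! b" "column ws a = column ws b"
  shows "a = b"
  using assms
proof (induction ws arbitrary: a b)
  case (Cons x ws)
  show ?case
  proof (cases a; cases b)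
    fix b' assume "a = 0" "b = Suc b'"
    then show ?thesis
      using Cons.prems column_less[of b' ws] by (auto simp: column_def)
  next
    fix a' assume "a = Suc a'" "b = 0"
    then show ?thesis
      using Cons.prems column_less[of a' ws] by (auto simp: column_def)
  next
    fix a' b' assume "a = Suc a'" "b = Suc b'"
    then show ?thesis using Cons by (auto simp: column_def)
  qed simp
qed simp

text \<open>Read from the end, a ballot word has its letters in increasing order in each column, so it is
  the smallest of the words obtained by permuting letters within columns.\<close>

lemma ballot_triangular:
  assumes "ballot ws" "set ws \<subseteq> {..<d}" "length us = length ws"
    and "\<And>a b. a < length ws \<Longrightarrow> b < length ws \<Longrightarrow> a \<noteq> b \<Longrightarrow> column ws a = column ws b
           \<Longrightarrow> us ! a \<noteq> us ! b"
  shows "us = ws \<or> word_value d ws < word_value d us"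
  using assms
proof (induction ws arbitrary: us)
  case (Cons c ws)
  then obtain u us' where us: "us = u # us'" "length us' = length ws"
    by (cases us) auto
  have inj: "us ! a \<noteq> us ! b"
    if "a < Suc (length ws)" "b < Suc (length ws)" "a \<noteq> b" "column (c # ws) a = column (c # ws) b" for a b
    using Cons.prems(4)[of a b] that by simp
  have "us' = ws \<or> word_value d ws < word_value d us'"
  proof (rule Cons.IH)
    fix a b assume "a < length ws" "b < length ws" "a \<noteq> b" "column ws a = column ws b"
    then show "us' ! a \<noteq> us' ! b" using inj[of "Suc a" "Suc b"] us by (auto simp: column_def)
  qed (use Cons.prems us in auto)
  then show ?case
  proof
    assume eq: "us' = ws"
    \<comment> \<open>If u < c, the ballot condition has already placed the letter \<open>u\<close>
      in this column further right, where the two words agree; the column would contain it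
      twice.\<close>
    have "\<not> u < c"
    proof
      assume "u < c"
      let ?j = "count_list ws c"
      have "?j < count_list ws (c - 1)" using Cons.prems(1) \<open>u < c\<close> by auto
      also have "\<dots> \<le> count_list ws u" using Cons.prems(1) \<open>u < c\<close> by (intro ballot_count) auto
      finally obtain b where b: "b < length ws" "ws ! b = u" "column ws b = ?j"
        using exists_position by blast
      then have "us ! 0 \<noteq> us ! Suc b" by (intro inj) (auto simp: column_def)
      then show False using b us eq by simp
    qed
    then show ?thesis using us eq by auto
  next
    assume less: "word_value d ws < word_value d us'"
    have "c + d * word_value d ws < d + d * word_value d ws" using Cons.prems by simp
    also have "\<dots> \<le> d * word_value d us'" using less by (metis Suc_leI mult_Suc_right mult_le_mono2)
    finally show ?thesis using us by simp
  qed
qed simp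

section \<open>The lower bound\<close>

context wm_decomposition
begin

text \<open>Different blocks annihilate each other, so left multiplications by xu and by ux are zero
  on \<open>B i\<close>.\<close>

lemma form_of_other_block:
  assumes i: "i \<in> {1..q}" and l: "l \<in> {1..q}" "l \<noteq> i" and x: "x \<in> B l"
  shows "form_of i x u = 0" "form_of i u x = 0"
proof -
  interpret S: H_simple_block "mod_jrad_scale sA" sH "mod_jrad_act act" "B i" "m i" "e i"
    by (rule block[OF i])
  have "x * (u * e i c) = 0" "u * (x * e i c) = 0" if "c < m i" for c
    using B_mult_0[OF l(1) i l(2) x] S.e_in_B[OF that] S.B_mult(1)[OF S.e_in_B[OF that]] by simp_all
  then show "form_of i x u = 0" "form_of i u x = 0"
    unfolding S.form_def by (simp_all add: S.co_0)
qed

text \<open>Letters code pairs (i, c), that is, the basis elements of the selected blocks. A word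
  \<open>w\<close> puts the variable of position p into \<open>column w p\<close>, in the slot given
  by its letter; a word \<open>u\<close> also serves as the point that gives each variable a basis
  element. If \<open>FF w\<close> does not vanish at \<open>u\<close>, the letters of
  \<open>u\<close> within each column of \<open>w\<close> are distinct, and
  \<open>ballot_triangular\<close> applies.\<close>

lemma card_ballot_words_le:
  assumes js: "is \<noteq> []" "set is \<subseteq> {1..q}" and ch: "chain is \<noteq> {0}"
    and E: "finite E" "A.span E = UNIV" "E \<noteq> {}"
  defines "d \<equiv> \<Sum>i\<in>set is. m i"
  shows "\<exists>N0. \<forall>N\<ge>N0. \<forall>s\<ge>1.
    card (ballot_words d (\<lambda>_. 2*s)) \<le> H_codim sA sH act \<Gamma> (d * (2*s) + N) * card E ^ N"
proof -
  let ?I = "set is"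
  obtain N0 a where a: "a \<noteq> 0" and ex: "\<And>N s. N \<ge> N0 \<Longrightarrow> \<exists>F.
    hfun UNIV (\<Sum>i\<in>?I. \<Sum>j=0..<2*s. \<Sum>c=0..<m i. {#(i, j, c)#}) N F \<and>
    (\<forall>\<chi>. (\<forall>x. \<exists>l\<in>{1..q}. \<chi> x \<in> B l) \<longrightarrow> F (\<lambda>x. \<kappa> (\<chi> x))
      = sA (\<Prod>i\<in>?I. \<Prod>j=0..<s. det_of i (\<lambda>x. \<chi> (i, x)) (2*j) (2*j+1)) a)"
    using exists_main_function[OF js ch] by blast
  let ?Lt = "SIGMA i:?I. {0..<m i}"
  have "card ?Lt = d" by (simp add: d_def card_SigmaI)
  then obtain letter where letter: "bij_betw letter {0..<d} ?Lt"
    using ex_bij_betw_nat_finite[of ?Lt] by auto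
  define code where "code = the_inv_into {0..<d} letter"
  have code: "code x < d" "letter (code x) = x" if "x \<in> ?Lt" for x
    using letter that unfolding code_def bij_betw_def
    by (auto simp: f_the_inv_into_f dest: the_inv_into_into[of letter "{0..<d}" x "{0..<d}"])
  have code_letter: "code (letter l) = l" if "l < d" for l
    using letter that unfolding code_def bij_betw_def by (simp add: the_inv_into_f_f)
  have letter_in: "letter l \<in> ?Lt" if "l < d" for l
    using bij_betwE[OF letter] that by simp
  \<comment> \<open>The value 0 outside the letters keeps every argument inside a block, as the
    formula for \<open>F\<close> requires.\<close>
  define bas where "bas l = (if l < d then e (fst (letter l)) (snd (letter l)) else 0)" for l
  have i0: "hd is \<in> {1..q}" using js by (cases "is") auto
  have e_in: "e i c \<in> B i" if "i \<in> {1..q}" "c < m i" for i c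
    using H_simple_block.e_in_B[OF block[OF that(1)] that(2)] .
  have bas_block: "bas l \<in> B (fst (letter l))" "fst (letter l) \<in> {1..q}" if "l < d" for l
    using letter_in[OF that] that js(2) e_in[of "fst (letter l)" "snd (letter l)"]
    by (auto simp: bas_def mem_Times_iff split: prod.splits)
  have bas_any: "\<exists>i\<in>{1..q}. bas l \<in> B i" for l
    using bas_block[of l] B_0[OF i0] i0 by (cases "l < d") (auto simp: bas_def)
  have "card (ballot_words d (\<lambda>_. 2*s)) \<le> H_codim sA sH act \<Gamma> (d * (2*s) + N) * card E ^ N"
    if N: "N \<ge> N0" and s: "s \<ge> 1" for N s
  proof -
    let ?k = "2 * s" and ?n = "d * (2 * s)"
    let ?X = "ballot_words d (\<lambda>_. ?k)"
    obtain F where hF: "hfun UNIV (\<Sum>i\<in>?I. \<Sum>j=0..<?k. \<Sum>c=0..<m i. {#(i, j, c)#}) N F"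
      and F: "\<And>\<chi>. (\<forall>x. \<exists>l\<in>{1..q}. \<chi> x \<in> B l) \<Longrightarrow> F (\<lambda>x. \<kappa> (\<chi> x))
        = sA (\<Prod>i\<in>?I. \<Prod>j=0..<s. det_of i (\<lambda>x. \<chi> (i, x)) (2*j) (2*j+1)) a"
      using ex[OF N] by blast
    have X: "length w = ?n" "set w \<subseteq> {..<d}" "ballot w" "\<And>c. c < d \<Longrightarrow> count_list w c = ?k"
      if "w \<in> ?X" for w
      using that length_eq_sum_count[of w d] by (auto simp: ballot_words_def)
    define pos where "pos w j c = (SOME p. p < length w \<and> w ! p = c \<and> column w p = j)" for w j c
    have pos: "pos w j c < ?n" "w ! pos w j c = c" "column w (pos w j c) = j"
      if "w \<in> ?X" "j < ?k" "c < d" for w j c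
    proof -
      have "\<exists>p<length w. w ! p = c \<and> column w p = j"
        using exists_position[of j w c] X[OF that(1)] that by simp
      from someI_ex[OF this] show "pos w j c < ?n" "w ! pos w j c = c" "column w (pos w j c) = j"
        unfolding pos_def using X(1)[OF that(1)] by auto
    qed
    \<comment> \<open>Variables are numbered from 1, positions from 0.\<close>
    define place where "place w x = (case x of (i, j, c) \<Rightarrow> Suc (pos w j (code (i, c))))" for w x
    define FF where "FF w \<psi> = F (\<lambda>x. \<psi> (place w x))" for w and \<psi> :: "nat \<Rightarrow> 'a"
    let ?D = "SIGMA i:?I. SIGMA j:{0..<?k}. {0..<m i}"
    have V: "(\<Sum>i\<in>?I. \<Sum>j=0..<?k. \<Sum>c=0..<m i. {#(i, j, c)#}) = mset_set ?D"
    proof -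
      have "(\<Sum>i\<in>?I. \<Sum>j=0..<?k. \<Sum>c=0..<m i. {#(i, j, c)#})
          = (\<Sum>i\<in>?I. \<Sum>(j, c)\<in>(SIGMA j:{0..<?k}. {0..<m i}). {#(i, j, c)#})"
        by (intro sum.cong refl sum.Sigma) auto
      also have "\<dots> = (\<Sum>(i, jc)\<in>?D. {#(i, jc)#})"
        by (subst sum.Sigma) (auto intro!: sum.cong)
      also have "\<dots> = (\<Sum>x\<in>?D. {#x#})" by (intro sum.cong) auto
      also have "\<dots> = mset_set ?D" by (rule sum_multiset_singleton)
      finally show ?thesis .
    qed
    have place_inj: "inj_on (place w) ?D" if w: "w \<in> ?X" for w
    proof (rule inj_onI)
      fix x x' assume x: "x \<in> ?D" "x' \<in> ?D" "place w x = place w x'"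
      obtain i j c where x1: "x = (i, j, c)" by (rule prod_cases3)
      obtain i' j' c' where x2: "x' = (i', j', c')" by (rule prod_cases3)
      have *: "i \<in> ?I" "j \<in> {0..<?k}" "c \<in> {0..<m i}" "i' \<in> ?I" "j' \<in> {0..<?k}"
        "c' \<in> {0..<m i'}" "place w (i, j, c) = place w (i', j', c')"
        using x unfolding x1 x2 by auto
      then have lt: "code (i, c) < d" "code (i', c') < d"
        "letter (code (i, c)) = (i, c)" "letter (code (i', c')) = (i', c')"
        using code[of "(i, c)"] code[of "(i', c')"] by auto
      have "pos w j (code (i, c)) = pos w j' (code (i', c'))" using *(7) by (simp add: place_def)
      then have eq: "code (i, c) = code (i', c')" "j = j'"
        using pos(2,3)[OF w _ lt(1), of j] pos(2,3)[OF w _ lt(2), of j'] *(2,5) by simp_all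
      have "letter (code (i, c)) = letter (code (i', c'))" using eq(1) by (rule arg_cong)
      then have "(i, c) = (i', c')" unfolding lt(3,4) .
      then show "x = x'" using eq(2) by (simp add: x1 x2)
    qed
    have place_image: "place w ` ?D = {1..?n}" if w: "w \<in> ?X" for w
    proof (rule card_subset_eq)
      show "place w ` ?D \<subseteq> {1..?n}"
      proof clarify
        fix i j c assume *: "i \<in> ?I" "j \<in> {0..<?k}" "c \<in> {0..<m i}"
        then have "code (i, c) < d" using code(1)[of "(i, c)"] by auto
        then show "place w (i, j, c) \<in> {1..?n}"
          using pos(1)[OF w, of j "code (i, c)"] *(2) by (simp add: place_def Suc_le_eq)
      qed
      have "card (place w ` ?D) = card ?D" by (rule card_image[OF place_inj[OF w]])
      also have "\<dots> = (\<Sum>i\<in>?I. ?k * m i)" by (simp add: card_SigmaI)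
      also have "\<dots> = ?n" by (simp add: d_def sum_distrib_left sum_distrib_right mult_ac)
      finally show "card (place w ` ?D) = card {1..?n}" by simp
    qed simp
    have hFF: "hfun UNIV (mset_set {1..?n}) N (FF w)" if w: "w \<in> ?X" for w
    proof -
      have "hfun UNIV (image_mset (place w) (mset_set ?D)) N (FF w)"
        unfolding FF_def[abs_def] using hfun_rename[OF hF] unfolding V .
      then show ?thesis using place_image[OF w] image_mset_mset_set[OF place_inj[OF w]] by simp
    qed
    define pt where "pt u v = \<kappa> (bas (u ! (v - 1)))" for u v
    define \<chi> where "\<chi> w u x = bas (u ! (place w x - 1))" for w u x
    have FF_pt: "FF w (pt u) = sA (\<Prod>i\<in>?I. \<Prod>j=0..<s. det_of i (\<lambda>x. \<chi> w u (i, x)) (2*j) (2*j+1)) a" for w u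
    proof -
      have "FF w (pt u) = F (\<lambda>x. \<kappa> (\<chi> w u x))" by (simp add: FF_def pt_def \<chi>_def)
      also have "\<dots> = sA (\<Prod>i\<in>?I. \<Prod>j=0..<s. det_of i (\<lambda>x. \<chi> w u (i, x)) (2*j) (2*j+1)) a"
        by (rule F) (use bas_any in \<open>auto simp: \<chi>_def\<close>)
      finally show ?thesis .
    qed
    have \<chi>_eq: "\<chi> w u (i, j, c) = bas (u ! pos w j (code (i, c)))" for w u i j c
      by (simp add: \<chi>_def place_def)
    have diag: "FF w (pt w) \<noteq> 0" if w: "w \<in> ?X" for w
    proof -
      have "det_of i (\<lambda>x. \<chi> w w (i, x)) (2*j) (2*j+1) \<noteq> 0" if i: "i \<in> ?I" and j: "j \<in> {0..<s}" for i j
      proof -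
        have iq: "i \<in> {1..q}" using i js(2) by blast
        have "\<chi> w w (i, j', c) = e i c" if "c < m i" "j' < ?k" for j' c
        proof -
          have "code (i, c) < d" "letter (code (i, c)) = (i, c)" using code[of "(i, c)"] i that by auto
          then show ?thesis using pos(2)[OF w that(2)] by (simp add: \<chi>_eq bas_def)
        qed
        then have "mat (m i) (m i) (\<lambda>(c, c'). form_of i (\<chi> w w (i, 2*j, c)) (\<chi> w w (i, 2*j+1, c')))
            = mat (m i) (m i) (\<lambda>(c, c'). form_of i (e i c) (e i c'))"
          using j by (intro eq_matI) auto
        then show ?thesis using H_simple_block.det_form_nonzero[OF block[OF iq]] by simp
      qed
      then show ?thesis unfolding FF_pt using a by (simp add: A.scale_eq_0_iff prod_zero_iff)
    qed
    have tri: "u = w \<or> word_value d w < word_value d u"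
      if w: "w \<in> ?X" and u: "u \<in> ?X" and nz: "FF w (pt u) \<noteq> 0" for w u
    proof (rule ballot_triangular[OF X(3)[OF w] X(2)[OF w]])
      show "length u = length w" using X(1)[OF w] X(1)[OF u] by simp
      fix p p' assume p: "p < length w" "p' < length w" "p \<noteq> p'" "column w p = column w p'"
      show "u ! p \<noteq> u ! p'"
      proof
        assume eq: "u ! p = u ! p'"
        let ?j = "column w p"
        have wd: "w ! p < d" "w ! p' < d" "u ! p < d"
          using X(1,2)[OF w] X(1,2)[OF u] p(1,2) nth_mem by (metis lessThan_iff subsetD)+
        have ne: "w ! p \<noteq> w ! p'" using column_inj[OF p(1,2) _ p(4)] p(3) by blast
        have jk: "?j < ?k" using column_less[OF p(1)] X(4)[OF w wd(1)] by simp
        have pos_p: "pos w ?j (w ! p) = p" "pos w ?j (w ! p') = p'"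
          using column_inj[of _ w] pos[OF w jk wd(1)] pos[OF w jk wd(2)] p X(1)[OF w] by metis+
        obtain i c where ic: "letter (w ! p) = (i, c)" "i \<in> ?I" "c < m i"
          using letter_in[OF wd(1)] by (cases "letter (w ! p)") auto
        obtain i' c' where ic': "letter (w ! p') = (i', c')" "i' \<in> ?I" "c' < m i'"
          using letter_in[OF wd(2)] by (cases "letter (w ! p')") auto
        have \<chi>p: "\<chi> w u (i, ?j, c) = bas (u ! p)" "\<chi> w u (i', ?j, c') = bas (u ! p)"
          using code_letter[OF wd(1)] code_letter[OF wd(2)] ic(1) ic'(1) pos_p eq by (simp_all add: \<chi>_eq)
        have dets: "inj_on (\<lambda>c. \<chi> w u (i, ?j, c)) {0..<m i}"
          "\<And>c. c < m i \<Longrightarrow> (\<exists>v. form_of i (\<chi> w u (i, ?j, c)) v \<noteq> 0) \<or> (\<exists>v. form_of i v (\<chi> w u (i, ?j, c)) \<noteq> 0)"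
          if i: "i \<in> ?I" for i
        proof -
          have iq: "i \<in> {1..q}" using i js(2) by blast
          interpret S: H_simple_block "mod_jrad_scale sA" sH "mod_jrad_act act" "B i" "m i" "e i"
            by (rule block[OF iq])
          \<comment> \<open>The columns 2j and 2j + 1 share a determinant, so \<open>?j\<close>
            belongs to the one with index \<open>?j div 2\<close>.\<close>
          have "det_of i (\<lambda>x. \<chi> w u (i, x)) (2*(?j div 2)) (2*(?j div 2)+1) \<noteq> 0"
          proof
            assume z: "det_of i (\<lambda>x. \<chi> w u (i, x)) (2*(?j div 2)) (2*(?j div 2)+1) = 0"
            have "?j div 2 \<in> {0..<s}" using jk by auto
            then have "(\<Prod>j=0..<s. det_of i (\<lambda>x. \<chi> w u (i, x)) (2*j) (2*j+1)) = 0"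
              using z by (intro prod_zero) auto
            then have "(\<Prod>i\<in>?I. \<Prod>j=0..<s. det_of i (\<lambda>x. \<chi> w u (i, x)) (2*j) (2*j+1)) = 0"
              using i by (intro prod_zero) auto
            then show False using nz unfolding FF_pt by simp
          qed
          note det = S.det_form_nonzero_imp[OF this]
          have "?j = 2*(?j div 2) \<or> ?j = 2*(?j div 2)+1" by presburger
          then show "inj_on (\<lambda>c. \<chi> w u (i, ?j, c)) {0..<m i}"
            "\<And>c. c < m i \<Longrightarrow> (\<exists>v. form_of i (\<chi> w u (i, ?j, c)) v \<noteq> 0) \<or> (\<exists>v. form_of i v (\<chi> w u (i, ?j, c)) \<noteq> 0)"
            using det by metis+
        qed
        \<comment> \<open>A basis element of another block is orthogonal to everything, so the
          repeated element determines the block; within one block the column is injective.\<close>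
        have block_eq: "i = fst (letter (u ! p))" if i: "i \<in> ?I" "c < m i" "\<chi> w u (i, ?j, c) = bas (u ! p)" for i c
        proof (rule ccontr)
          assume "i \<noteq> fst (letter (u ! p))"
          moreover have "i \<in> {1..q}" using i(1) js(2) by blast
          ultimately show False
            using dets(2)[OF i(1,2)] i(3) form_of_other_block[of i "fst (letter (u ! p))" "bas (u ! p)"]
              bas_block[OF wd(3)] by auto
        qed
        have "i = i'" using block_eq[OF ic(2,3) \<chi>p(1)] block_eq[OF ic'(2,3) \<chi>p(2)] by simp
        then have "c = c'"
          using inj_onD[OF dets(1)[OF ic(2)], of c c'] \<chi>p ic(3) ic'(3) by simp
        then have "letter (w ! p) = letter (w ! p')" using \<open>i = i'\<close> ic(1) ic'(1) by simp
        then show False using ne code_letter[OF wd(1)] code_letter[OF wd(2)] by metis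
      qed
    qed
    show ?thesis
    proof (rule hfun_family_card_le[OF finite_ballot_words hFF _ _ E])
      have "d \<ge> 1"
      proof -
        have "m (hd is) \<le> d" unfolding d_def using js(1) by (intro member_le_sum) auto
        moreover have "m (hd is) > 0" by (rule H_simple_block.m_pos[OF block[OF i0]])
        ultimately show ?thesis by simp
      qed
      then show "1 \<le> ?n + N" using s by (simp add: Suc_le_eq)
      fix x assume x: "\<forall>\<psi>. (\<Sum>w\<in>?X. sA (x w) (FF w \<psi>)) = 0"
      show "\<forall>w\<in>?X. x w = 0"
      proof (rule ccontr)
        assume "\<not> ?thesis"
        then have "\<exists>w. w \<in> ?X \<and> x w \<noteq> 0" by blast
        \<comment> \<open>At the point given by a word of least value among those with nonzero
          coefficient, all other terms of the relation vanish.\<close>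
        then obtain w where w: "w \<in> ?X" "x w \<noteq> 0"
          and min: "\<And>w'. w' \<in> ?X \<and> x w' \<noteq> 0 \<Longrightarrow> word_value d w \<le> word_value d w'"
          using ex_has_least_nat[of "\<lambda>w. w \<in> ?X \<and> x w \<noteq> 0" _ "word_value d"] by blast
        have "(\<Sum>w'\<in>?X. sA (x w') (FF w' (pt w))) = (\<Sum>w'\<in>{w}. sA (x w') (FF w' (pt w)))"
        proof (rule sum.mono_neutral_right[OF finite_ballot_words])
          show "\<forall>w'\<in>?X - {w}. sA (x w') (FF w' (pt w)) = 0"
          proof
            fix w' assume w': "w' \<in> ?X - {w}"
            show "sA (x w') (FF w' (pt w)) = 0"
            proof (rule ccontr)
              assume "\<not> ?thesis"
              then have "x w' \<noteq> 0" "FF w' (pt w) \<noteq> 0" by auto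
              then have "word_value d w' < word_value d w" using tri[of w' w] w' w(1) by auto
              then show False using min[of w'] w' \<open>x w' \<noteq> 0\<close> by auto
            qed
          qed
        qed (use w in auto)
        then have "sA (x w) (FF w (pt w)) = 0" using x by simp
        then show False using w(2) diag[OF w(1)] by (simp add: A.scale_eq_0_iff)
      qed
    qed
  qed
  then show ?thesis by blast
qed

text \<open>Covers the small degrees, about which the main construction says nothing: one nonzero
  product shows that a multilinear function without constants is nonzero.\<close>

lemma H_codim_pos:
  assumes "\<not> nilpotent_ring TYPE('a)" and n: "n \<ge> 1"
  shows "H_codim sA sH act \<Gamma> n \<ge> 1"
proof -
  obtain xs :: "'a list" where xs: "length xs = n" "nonempty_prod xs \<noteq> 0"
    using assms unfolding nilpotent_ring_def by blast
  obtain n' where n': "n = Suc n'" using n by (cases n) auto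
  let ?F = "\<lambda>\<psi>. nonempty_prod (map (\<lambda>j. \<psi> (Suc j)) [0..<n])"
  have "hfun UNIV (\<Sum>j<n. {#Suc j#}) (\<Sum>j<n. 0) ?F"
    unfolding n' by (intro hfun_prod hfun_var)
  moreover have "(\<Sum>j<n. {#Suc j#}) = mset_set {1..n}"
  proof -
    have "(\<Sum>j<n. {#Suc j#}) = (\<Sum>j\<in>{1..n}. {#j#})"
      by (rule sum.reindex_bij_witness[of _ "\<lambda>j. j - 1" Suc]) auto
    then show ?thesis by (simp add: sum_multiset_singleton)
  qed
  ultimately have F: "hfun UNIV (mset_set {1..n}) 0 ?F" by simp
  obtain E where E: "finite E" "A.span E = UNIV" using fin_dim by blast
  have "?F (\<lambda>j. xs ! (j - 1)) = nonempty_prod xs"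
    using xs(1) by (intro arg_cong[of _ _ nonempty_prod] nth_equalityI) auto
  then have nz: "?F (\<lambda>j. xs ! (j - 1)) \<noteq> 0" using xs(2) by simp
  have "card {()} \<le> H_codim sA sH act \<Gamma> (n + 0) * card (insert 0 E) ^ 0"
  proof (rule hfun_family_card_le[where F = "\<lambda>_. ?F"])
    show "A.span (insert 0 E) = UNIV" using E(2) A.span_mono[of E "insert 0 E"] by auto
    show "\<forall>w\<in>{()}. c w = 0" if "\<forall>\<psi>. (\<Sum>w\<in>{()}. sA (c w) (?F \<psi>)) = 0" for c
    proof -
      have "sA (c ()) (?F (\<lambda>j. xs ! (j - 1))) = 0" using that[rule_format, of "\<lambda>j. xs ! (j - 1)"] by simp
      then show ?thesis using nz A.scale_eq_0_iff by blast
    qed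
  qed (use F n E in auto)
  then show ?thesis by simp
qed

end

text \<open>From \<open>R\<close> on, n = d (2s) + N with N0 \<le> N \<le> R: multiples of 2d are
  filled by pairs of columns, and the remainder is absorbed by constants, whose number may be chosen
  freely from \<open>N0\<close> on. So only a bounded power of \<open>K\<close> is lost. For smaller
  n the constant \<open>d ^ R\<close> suffices.\<close>

lemma lower_bound_arithmetic:
  fixes c :: "nat \<Rightarrow> nat"
  assumes d: "d \<ge> 1" and K: "K \<ge> 1" and pos: "\<And>n. n \<ge> 1 \<Longrightarrow> c n \<ge> 1"
    and rect: "\<And>N s. N \<ge> N0 \<Longrightarrow> s \<ge> 1 \<Longrightarrow>
      d ^ (d * (2*s)) \<le> c (d * (2*s) + N) * K ^ N * (2*s + d) ^ (d * d) * (2*s*d) ^ d"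
  shows "\<exists>Q\<ge>1. \<forall>n\<ge>1. d ^ n \<le> c n * Q * n ^ (d * d + d)"
proof -
  define R where "R = N0 + 2 * d"
  define Q where "Q = K ^ R * (1 + d) ^ (d * d) * d ^ R"
  have Q1: "Q \<ge> d ^ R" "Q \<ge> 1" unfolding Q_def using d K by (simp_all add: Suc_le_eq)
  have "d ^ n \<le> c n * Q * n ^ (d * d + d)" if n: "n \<ge> 1" for n
  proof (cases "n < R")
    case True
    have "d ^ n \<le> 1 * d ^ R * 1" using True d by (simp add: power_increasing)
    also have "\<dots> \<le> c n * Q * n ^ (d * d + d)"
      using pos[OF n] Q1(1) n by (intro mult_mono) auto
    finally show ?thesis .
  next
    case False
    define s where "s = (n - N0) div (2 * d)"
    define N where "N = N0 + (n - N0) mod (2 * d)"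
    have nN: "n = d * (2 * s) + N"
      using div_mult_mod_eq[of "n - N0" "2 * d"] False
      unfolding s_def N_def R_def by (simp add: mult_ac)
    have N: "N \<ge> N0" "N \<le> R" using d by (simp_all add: N_def R_def less_imp_le)
    have "2 * d \<le> n - N0" using False by (simp add: R_def)
    then have s: "s \<ge> 1" unfolding s_def using d by (simp add: Suc_le_eq div_greater_zero_iff)
    have le: "2 * s * d \<le> n" "2 * s + d \<le> n * (1 + d)"
    proof -
      show sd: "2 * s * d \<le> n" using nN by (simp add: mult_ac)
      have "2 * s \<le> 2 * s * d" using d by simp
      then have "2 * s \<le> n" using sd by linarith
      moreover have "d \<le> n * d" using n by (cases n) auto
      ultimately show "2 * s + d \<le> n * (1 + d)" unfolding add_mult_distrib2 by linarith
    qed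
    have "d ^ n = d ^ (d * (2 * s)) * d ^ N" by (simp add: nN power_add)
    also have "\<dots> \<le> (c n * K ^ N * (2*s + d) ^ (d * d) * (2*s*d) ^ d) * d ^ N"
      using rect[OF N(1) s] unfolding nN[symmetric] by (rule mult_right_mono) simp
    also have "\<dots> \<le> (c n * K ^ R * (n * (1 + d)) ^ (d * d) * n ^ d) * d ^ R"
      using N(2) K d by (intro mult_mono power_mono le power_increasing order_refl) auto
    also have "\<dots> = c n * Q * n ^ (d * d + d)"
      by (simp only: Q_def power_add power_mult_distrib mult.assoc mult.commute mult.left_commute)
    finally show ?thesis .
  qed
  then show ?thesis using Q1(2) by blast
qed

section \<open>The two bounds combined\<close>

context wm_decomposition
begin

lemma dim_sum_blocks:
  assumes S: "S \<subseteq> {1..q}"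
  shows "Q.A.dim (Q.A.span (\<Union>i\<in>S. B i)) = (\<Sum>i\<in>S. m i)"
proof -
  let ?E = "\<lambda>i. e i ` {..<m i}"
  have fin: "finite S" using S finite_subset by blast
  have sub: "Q.A.subspace (B i)" if "i \<in> {1..q}" for i
    using B_ideal[OF that] by (simp add: H_invariant_ideal_def)
  note ind = Q.A.direct_sum_independent[OF B_sum _ sub, of ?E]
  have dis: "disjoint_family_on ?E {1..q}" and indep: "Q.A.independent (\<Union>i\<in>{1..q}. ?E i)"
    by (rule ind; simp add: indep_e span_e)+
  have "Q.A.span (\<Union>i\<in>S. B i) = Q.A.span (\<Union>i\<in>S. ?E i)"
  proof (rule subset_antisym; rule Q.A.span_minimal[OF _ Q.A.subspace_span])
    show "(\<Union>i\<in>S. B i) \<subseteq> Q.A.span (\<Union>i\<in>S. ?E i)"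
    proof
      fix x assume "x \<in> (\<Union>i\<in>S. B i)"
      then obtain i where i: "i \<in> S" "x \<in> B i" by blast
      then have "x \<in> Q.A.span (?E i)" using span_e S by blast
      moreover have "?E i \<subseteq> (\<Union>i\<in>S. ?E i)" using i(1) by blast
      ultimately show "x \<in> Q.A.span (\<Union>i\<in>S. ?E i)" using Q.A.span_mono by blast
    qed
    show "(\<Union>i\<in>S. ?E i) \<subseteq> Q.A.span (\<Union>i\<in>S. B i)"
    proof
      fix x assume "x \<in> (\<Union>i\<in>S. ?E i)"
      then obtain i where i: "i \<in> S" "x \<in> ?E i" by blast
      then have "x \<in> B i" using span_e[of i] Q.A.span_base[OF i(2)] S by blast
      then show "x \<in> Q.A.span (\<Union>i\<in>S. B i)" using i(1) by (intro Q.A.span_base) blast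
    qed
  qed
  moreover have "Q.A.independent (\<Union>i\<in>S. ?E i)"
    by (rule Q.A.independent_mono[OF indep]) (use S in blast)
  ultimately have "Q.A.dim (Q.A.span (\<Union>i\<in>S. B i)) = card (\<Union>i\<in>S. ?E i)"
    by (simp add: Q.A.dim_eq_card_independent)
  also have "\<dots> = (\<Sum>i\<in>S. card (?E i))"
    using dis S by (intro card_UN_disjoint[OF fin]) (auto simp: disjoint_family_on_def subset_iff)
  also have "\<dots> = (\<Sum>i\<in>S. m i)"
    using inj_e S by (intro sum.cong) (auto simp: card_image)
  finally show ?thesis .
qed

lemma W_nonzero:
  assumes i: "i \<in> {1..q}"
  shows "W i \<noteq> {0}"
proof
  assume W: "W i = {0}"
  interpret S: H_simple_block "mod_jrad_scale sA" sH "mod_jrad_act act" "B i" "m i" "e i"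
    by (rule block[OF i])
  have e0: "e i 0 \<in> B i" by (rule S.e_in_B[OF S.m_pos])
  have "act 1 (\<kappa> (e i 0)) \<in> W i" unfolding W_def H_span_def using e0 by (intro A.span_base) blast
  then have "\<kappa> (e i 0) = 0" using W by (simp add: act_one)
  then have "e i 0 = 0" using proj_\<kappa>[of "e i 0"] by (simp add: jrad_proj_0)
  moreover have "e i 0 \<in> e i ` {..<m i}" using S.m_pos by blast
  ultimately show False using indep_e[OF i] Q.A.dependent_zero by metis
qed

text \<open>Without blocks A would coincide with its radical and hence be nilpotent.\<close>

lemma q_pos:
  assumes "\<not> nilpotent_ring TYPE('a)"
  shows "q \<ge> 1"
proof (rule ccontr)
  assume "\<not> q \<ge> 1"
  then have q: "{1..q} = {}" by simp
  have J: "x \<in> jacobson_radical" for x :: 'a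
  proof -
    obtain b where "jrad_proj x = (\<Sum>i\<in>{1..q}. b i)" by (rule B_decompose)
    then have "jrad_proj x = jrad_proj 0" unfolding q by (simp add: jrad_proj_0)
    then show ?thesis unfolding jrad_proj_eq_iff by simp
  qed
  obtain p where "p \<ge> 1"
    "\<forall>xs :: 'a list. length xs = p \<longrightarrow> set xs \<subseteq> jacobson_radical \<longrightarrow> nonempty_prod xs = 0"
    using A.jacobson_radical_nilpotent by blast
  then have "nilpotent_ring TYPE('a)" unfolding nilpotent_ring_def using J by blast
  then show False using assms by simp
qed

theorem H_codim_bounds:
  assumes nn: "\<not> nilpotent_ring TYPE('a)"
    and d: "d = Max {Q.A.dim (Q.A.span (\<Union>i\<in>set is. B i)) | is.
                  is \<noteq> [] \<and> distinct is \<and> set is \<subseteq> {1..q} \<and> chain is \<noteq> {0}}"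
  shows "\<exists>C1 C2 r1 r2 :: real. C1 > 0 \<and> C2 > 0 \<and>
           (\<forall>n\<ge>1. C1 * real n powr r1 * real d ^ n \<le> real (H_codim sA sH act \<Gamma> n)
                 \<and> real (H_codim sA sH act \<Gamma> n) \<le> C2 * real n powr r2 * real d ^ n)"
proof -
  let ?ok = "\<lambda>is. is \<noteq> [] \<and> distinct is \<and> set is \<subseteq> {1..q} \<and> chain is \<noteq> {0}"
  let ?dim = "\<lambda>is. Q.A.dim (Q.A.span (\<Union>i\<in>set is. B i))"
  have dim: "?dim xs = (\<Sum>i\<in>set xs. m i)" if "?ok xs" for xs
    using that dim_sum_blocks by blast
  define M where "M = {?dim xs | xs. ?ok xs}"
  have dM: "d = Max M" unfolding d M_def ..
  have fin: "finite M"
  proof (rule finite_subset)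
    show "M \<subseteq> (\<lambda>S. Q.A.dim (Q.A.span (\<Union>i\<in>S. B i))) ` Pow {1..q}" unfolding M_def by blast
  qed simp
  \<comment> \<open>The chain of length 1 makes the set of dimensions nonempty, so that
    \<open>Max\<close> is attained, and gives d \<ge> 1.\<close>
  have q: "1 \<in> {1..q}" using q_pos[OF nn] by simp
  then have ok1: "?ok [1]" using W_nonzero by auto
  then have "?dim [1] \<in> M" unfolding M_def by blast
  then have d1: "?dim [1] \<le> d" and "M \<noteq> {}" using fin dM by auto
  then obtain js where js: "?ok js" "d = ?dim js" using Max_in[OF fin] dM unfolding M_def by auto
  have d_sum: "d = (\<Sum>i\<in>set js. m i)" using js dim by simp
  have d_pos: "d \<ge> 1"
    using d1 dim[OF ok1] H_simple_block.m_pos[OF block[OF q]] by simp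
  have max: "(\<Sum>i\<in>set xs. m i) \<le> d" if "?ok xs" for xs
  proof -
    have "?dim xs \<in> M" unfolding M_def using that by blast
    then show ?thesis using dim[OF that] fin dM by simp
  qed
  let ?c = "H_codim sA sH act \<Gamma>"
  obtain C where C: "\<And>n. n \<ge> 1 \<Longrightarrow> ?c n \<le> C * (n + 1) ^ nil_index * d ^ n"
    using H_codim_upper_bound[OF d_pos] max by blast
  obtain E where E: "finite E" "A.span E = UNIV" using fin_dim by blast
  define E' where "E' = insert 0 E"
  have E': "finite E'" "A.span E' = UNIV" "E' \<noteq> {}"
    using E A.span_mono[of E E'] by (auto simp: E'_def)
  have js2: "js \<noteq> []" "set js \<subseteq> {1..q}" "chain js \<noteq> {0}" using js(1) by auto
  obtain N0 where N0: "\<forall>N\<ge>N0. \<forall>s\<ge>1.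
    card (ballot_words d (\<lambda>_. 2*s)) \<le> ?c (d * (2*s) + N) * card E' ^ N"
    using card_ballot_words_le[OF js2 E'] unfolding d_sum[symmetric] by (rule exE)
  have "\<exists>Q\<ge>1. \<forall>n\<ge>1. d ^ n \<le> ?c n * Q * n ^ (d * d + d)"
  proof (rule lower_bound_arithmetic[OF d_pos])
    show "card E' \<ge> 1" using E' by (simp add: Suc_le_eq card_gt_0_iff)
    show "?c n \<ge> 1" if "n \<ge> 1" for n by (rule H_codim_pos[OF nn that])
    fix N s :: nat assume "N \<ge> N0" "s \<ge> 1"
    then have "card (ballot_words d (\<lambda>_. 2*s)) \<le> ?c (d * (2*s) + N) * card E' ^ N" using N0 by blast
    moreover have "d ^ (d * (2*s)) \<le> card (ballot_words d (\<lambda>_. 2*s)) * (2*s + d) ^ (d * d) * (2*s*d) ^ d"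
      using \<open>s \<ge> 1\<close> by (intro card_rect_ballot_words_ge) simp
    ultimately show "d ^ (d * (2*s)) \<le> ?c (d * (2*s) + N) * card E' ^ N * (2*s + d) ^ (d * d) * (2*s*d) ^ d"
      by (meson mult_le_mono1 order_trans)
  qed
  then obtain Q where Q: "Q \<ge> 1" "\<And>n. n \<ge> 1 \<Longrightarrow> d ^ n \<le> ?c n * Q * n ^ (d * d + d)" by blast
  let ?t = "d * d + d"
  have lower: "1 / real Q * real n powr (- real ?t) * real d ^ n \<le> real (?c n)" if n: "n \<ge> 1" for n
  proof -
    have "real d ^ n \<le> real (?c n) * real Q * real n ^ ?t"
      using Q(2)[OF n] by (simp only: of_nat_mult[symmetric] of_nat_power[symmetric] of_nat_le_iff)
    moreover have "real n powr (- real ?t) = 1 / real n ^ ?t"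
      using n by (simp add: powr_minus_divide powr_realpow del: of_nat_add of_nat_mult)
    moreover have "real n ^ ?t > 0" "real Q > 0" using n Q(1) by simp_all
    ultimately show ?thesis by (simp only: times_divide_eq_left times_divide_eq_right
      divide_divide_eq_left mult_1_left pos_divide_le_eq mult_pos_pos mult.assoc mult.commute mult.left_commute)
  qed
  \<comment> \<open>The power of 2 comes from n + 1 \<le> 2 n, and \<open>Suc C\<close> is positive
    even if \<open>C\<close> is 0.\<close>
  let ?C = "real (Suc C * 2 ^ nil_index)"
  have upper: "real (?c n) \<le> ?C * real n powr real nil_index * real d ^ n" if n: "n \<ge> 1" for n
  proof -
    have "?c n \<le> C * (n + 1) ^ nil_index * d ^ n" by (rule C[OF n])
    also have "\<dots> \<le> Suc C * (2 * n) ^ nil_index * d ^ n"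
      using n by (intro mult_mono power_mono) auto
    also have "\<dots> = Suc C * 2 ^ nil_index * n ^ nil_index * d ^ n" by (simp only: power_mult_distrib mult.assoc)
    finally have "real (?c n) \<le> real (Suc C * 2 ^ nil_index * n ^ nil_index * d ^ n)"
      by (simp only: of_nat_le_iff)
    also have "\<dots> = ?C * real n powr real nil_index * real d ^ n"
      using n by (simp add: powr_realpow)
    finally show ?thesis .
  qed
  show ?thesis
  proof (intro exI conjI allI impI)
    show "1 / real Q > 0" using Q(1) by simp
    show "?C > 0" unfolding of_nat_0_less_iff by simp
  qed (fact lower upper)+
qed

end

theorem theorem1:
  fixes sA :: "'f::{alg_closed_field, field_char_0} \<Rightarrow> 'a::ring \<Rightarrow> 'a"
    and sH :: "'f \<Rightarrow> 'h::ring_1 \<Rightarrow> 'h"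
    and act :: "'h \<Rightarrow> 'a \<Rightarrow> 'a"
    and \<Gamma> :: "'h set"
    and B :: "nat \<Rightarrow> 'a mod_jrad set"
    and \<kappa> :: "'a mod_jrad \<Rightarrow> 'a"
    and q d :: nat
  assumes "generalized_H_action sA sH act"
    and "\<exists>S. finite S \<and> module.span sA S = UNIV"
    and "\<not> nilpotent_ring TYPE('a)"
    and "\<forall>h. \<forall>x\<in>jacobson_radical. act h x \<in> jacobson_radical"
    and "\<forall>i\<in>{1..q}. H_invariant_ideal (mod_jrad_scale sA) (mod_jrad_act act) UNIV (B i)"
    and "\<forall>i\<in>{1..q}. H_simple (mod_jrad_scale sA) (mod_jrad_act act) (B i)"
    and "direct_sum {1..q} B"
    and "algebra_hom (mod_jrad_scale sA) sA \<kappa>"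
    and "\<forall>x. jrad_proj (\<kappa> x) = x"
    and "d = Max {vector_space.dim (mod_jrad_scale sA)
                    (module.span (mod_jrad_scale sA) (\<Union>i\<in>set is. B i)) | is.
                  is \<noteq> [] \<and> distinct is \<and> set is \<subseteq> {1..q}
                  \<and> unitization_chain sA (map (\<lambda>i. H_span sA act (\<kappa> ` B i)) is) \<noteq> {0}}"
    and "\<not> module.dependent sH \<Gamma>" and "module.span sH \<Gamma> = UNIV"
  shows "\<exists>C1 C2 r1 r2 :: real. C1 > 0 \<and> C2 > 0 \<and>
           (\<forall>n\<ge>1. C1 * real n powr r1 * real d ^ n \<le> real (H_codim sA sH act \<Gamma> n)
                 \<and> real (H_codim sA sH act \<Gamma> n) \<le> C2 * real n powr r2 * real d ^ n)"
proof -
  interpret gen: generalized_H_action sA sH act by fact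
  interpret R: fd_H_radical sA sH act
    using assms(2,4) by unfold_locales auto
  \<comment> \<open>The bases of the blocks are auxiliary data of the argument, chosen here; the
    role of \<open>m i\<close> is taken by \<open>card (E i)\<close>.\<close>
  have "\<forall>i\<in>{1..q}. \<exists>E. finite E \<and> R.Q.A.independent E \<and> R.Q.A.span E = B i"
  proof
    fix i assume "i \<in> {1..q}"
    then have sub: "R.Q.A.subspace (B i)" using assms(5) by (simp add: H_invariant_ideal_def)
    obtain E where E: "E \<subseteq> B i" "R.Q.A.independent E" "B i \<subseteq> R.Q.A.span E"
      using R.Q.A.maximal_independent_subset[of "B i"] by blast
    then show "\<exists>E. finite E \<and> R.Q.A.independent E \<and> R.Q.A.span E = B i"
      using R.Q.A.fd_independent[OF E(2)] R.Q.A.span_minimal[OF E(1) sub] by blast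
  qed
  from bchoice[OF this] obtain E where E: "\<forall>i\<in>{1..q}. finite (E i) \<and> R.Q.A.independent (E i) \<and> R.Q.A.span (E i) = B i"
    by (rule exE)
  have "\<forall>i\<in>{1..q}. \<exists>e. bij_betw e {0..<card (E i)} (E i)"
    using E ex_bij_betw_nat_finite by blast
  from bchoice[OF this] obtain e where e: "\<forall>i\<in>{1..q}. bij_betw (e i) {0..<card (E i)} (E i)"
    by (rule exE)
  have e': "inj_on (e i) {..<card (E i)}" "e i ` {..<card (E i)} = E i" if "i \<in> {1..q}" for i
    using e that by (auto simp: bij_betw_def atLeast0LessThan)
  interpret wm_decomposition sA sH act \<Gamma> B \<kappa> q "\<lambda>i. card (E i)" e
  proof unfold_locales
    show "gen.H.independent \<Gamma>" "gen.H.span \<Gamma> = UNIV" by fact+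
    show "inj_on (e i) {..<card (E i)}" if "i \<in> {1..q}" for i by (rule e'(1)[OF that])
    show "R.Q.A.independent (e i ` {..<card (E i)})" "R.Q.A.span (e i ` {..<card (E i)}) = B i"
      if "i \<in> {1..q}" for i
      using e'(2)[OF that] E that by simp_all
  qed (use assms in auto)
  have "map (\<lambda>i. H_span sA act (\<kappa> ` B i)) xs = map W xs" for xs
    by (simp add: W_def)
  with assms(10) have "d = Max {R.Q.A.dim (R.Q.A.span (\<Union>i\<in>set is. B i)) | is.
                  is \<noteq> [] \<and> distinct is \<and> set is \<subseteq> {1..q} \<and> chain is \<noteq> {0}}"
    by simp
  then show ?thesis by (rule H_codim_bounds[OF assms(3)])
qed

end
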